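(* Let $K$ be a finite abelian extension of $k$. Let $n,m\in\mathbb{N}$ and $N\in R_T$ be such that $K\subseteq {}_nk(\Lambda_N)_m$ and such that $m$ is minimum with this property (for the given $n$ and $N$). Then $m$ is independent of $n$ and $N$. Let $t=f_\infty(K/k)$ be the degree of the infinite primes of $K$, let $M=L_nk_m$, $E=KM\cap k(\Lambda_N)$, $F=K\cap {}_nk(\Lambda_N)$ and $d=f_\infty(EK/K)=f_\infty(E_{\mathfrak{ge}}K/K_{\mathfrak{ge}})$. Then $${}_nk(\Lambda_N)\,K={}_nk(\Lambda_N)_m$$ and $$m=[K:F]=t\,e_\infty(K/F)=t\,d\,p^s=f_\infty(EK/k)\,p^s$$ for some integer $s\ge 0$. In particular $$e_\infty(K/F)=d\,p^s=f_\infty(K_m/K).$$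
   Context: $k=\mathbb{F}_q(T)$ is a global rational function field of characteristic $p$, $R_T=\mathbb{F}_q[T]$, and $P_\infty$ (the infinite prime) is the pole of $T$ in $k$. For nonzero $N\in R_T$, $k(\Lambda_N)$ is the $N$-th Carlitz cyclotomic function field. $L_n$ denotes the subfield of degree $q^n$ over $k$ of $k(\Lambda_{1/T^{n+1}})$, the cyclotomic function field of modulus $(1/T)^{n+1}$ constructed with $\mathbb{F}_q[1/T]$ in place of $\mathbb{F}_q[T]$ (so $L_n$ is the fixed field of $\mathbb{F}_q^*$). $k_m:=\mathbb{F}_{q^m}(T)$, ${}_nk(\Lambda_N):=L_n\,k(\Lambda_N)$, ${}_nk(\Lambda_N)_m:=L_n\,k(\Lambda_N)\,\mathbb{F}_{q^m}$, and $K_m:=K\,\mathbb{F}_{q^m}$. By the Kronecker--Weber theorem every finite abelian extension of $k$ is contained in some ${}_nk(\Lambda_N)_m$. The minimum $m$ is called the conductor of constants of $K/k$. For finite abelian extensions, $e_\infty(A/B)$ and $f_\infty(A/B)$ are the ramification index and inertia degree in $A/B$ of the primes of $B$ above $P_\infty$. The genus field $F_{\mathfrak{ge}}$ of a finite abelian extension $F/k$ is the maximal extension of $F$ that is abelian over $k$ and contained in the Hilbert class field of $F$, the latter being (Rosen) the maximal abelian extension of $F$ that is unramified at every prime and in which every prime of $F$ above $P_\infty$ decomposes fully. *)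

theory Defs
  imports
    "HOL-Algebra.Algebraic_Closure_Type"
    "HOL-Algebra.Generated_Fields"
    "HOL-Algebra.Embedded_Algebras"
    "HOL-Algebra.QuotRing"
    "HOL-Library.Cardinality"
begin

section \<open>Subfields of a fixed algebraic closure of the rational function field\<close>

text \<open>
  The finite field \<open>\<bbbF>\<^sub>q\<close> is a type \<open>'a\<close> of sort \<open>{finite,field}\<close>, so \<open>q = CARD('a)\<close> and
  \<open>p = CHAR('a)\<close>; \<open>\<bbbF>\<^sub>q[T]\<close> is \<open>'a poly\<close> and \<open>\<bbbF>\<^sub>q(T)\<close> is \<open>'a poly fract\<close>. All extension fields
  are subsets of one algebraic closure of \<open>\<bbbF>\<^sub>q(T)\<close>.
\<close>

type_synonym 'a rat_closure = "'a poly fract alg_closure"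

abbreviation Om :: "'a::{finite,field} rat_closure ring" (\<open>\<Omega>\<close>)
  where "\<Omega> \<equiv> ring_of_type_algebra"

definition ratfun_field :: "'a::{finite,field} rat_closure set" (\<open>\<kk>\<close>)
  where "\<kk> = range to_ac"

definition const_emb :: "'a::{finite,field} \<Rightarrow> 'a rat_closure"
  where "const_emb a = to_ac (to_fract [:a:])"

definition ratfun_T :: "'a::{finite,field} rat_closure"
  where "ratfun_T = to_ac (to_fract [:0, 1:])"

definition composite :: "'a::{finite,field} rat_closure set \<Rightarrow> 'a rat_closure set \<Rightarrow> 'a rat_closure set"
    (infixl \<open>\<squnion>\<^sub>F\<close> 65)
  where "A \<squnion>\<^sub>F B = generate_field \<Omega> (A \<union> B)"

definition ext_degree :: "'a::{finite,field} rat_closure set \<Rightarrow> 'a rat_closure set \<Rightarrow> nat"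
  where "ext_degree A B = ring.dim \<Omega> B A"  \<comment> \<open>\<open>[A : B]\<close>\<close>

text \<open>Automorphisms are functions on all of \<open>\<Omega>\<close> of which only the values on \<open>A\<close> matter.\<close>

definition field_auts :: "'a::{finite,field} rat_closure set \<Rightarrow> 'a rat_closure set \<Rightarrow>
    ('a rat_closure \<Rightarrow> 'a rat_closure) set"
  where "field_auts A B =
    {\<sigma> \<in> ring_iso (\<Omega>\<lparr>carrier := A\<rparr>) (\<Omega>\<lparr>carrier := A\<rparr>). \<forall>x\<in>B. \<sigma> x = x}"

definition finite_abelian_ext :: "'a::{finite,field} rat_closure set \<Rightarrow> 'a rat_closure set \<Rightarrow> bool"
  where "finite_abelian_ext A B \<longleftrightarrow>
    subfield A \<Omega> \<and> subfield B \<Omega> \<and> B \<subseteq> A \<and> ring.finite_dimension \<Omega> B A \<and>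
    {x \<in> A. \<forall>\<sigma>\<in>field_auts A B. \<sigma> x = x} = B \<and>
    (\<forall>\<sigma>\<in>field_auts A B. \<forall>\<tau>\<in>field_auts A B. \<forall>x\<in>A. \<sigma> (\<tau> x) = \<tau> (\<sigma> x))"

section \<open>Carlitz cyclotomic function fields and constant extensions\<close>

text \<open>
  The Carlitz module over \<open>\<bbbF>\<^sub>q[\<theta>]\<close>, where \<open>\<theta>\<close> is \<open>T\<close> or \<open>1/T\<close>: the polynomial
  \<open>N = \<Sum>\<^sub>i a\<^sub>i \<theta>\<^sup>i\<close> acts as \<open>\<Sum>\<^sub>i a\<^sub>i \<phi>\<^sup>i\<close>, where \<open>\<phi>(u) = u\<^sup>q + \<theta> u\<close>.
  The argument \<open>N :: 'a poly\<close> is thus always read as a polynomial in \<open>\<theta>\<close>.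
\<close>

definition carlitz_act :: "'a::{finite,field} rat_closure \<Rightarrow> 'a poly \<Rightarrow> 'a rat_closure \<Rightarrow> 'a rat_closure"
  where "carlitz_act \<theta> N u =
    (\<Sum>i\<le>Polynomial.degree N. const_emb (Polynomial.coeff N i) *
       ((\<lambda>v. v ^ CARD('a) + \<theta> * v) ^^ i) u)"

definition carlitz_torsion :: "'a::{finite,field} rat_closure \<Rightarrow> 'a poly \<Rightarrow> 'a rat_closure set"
  where "carlitz_torsion \<theta> N = {u. carlitz_act \<theta> N u = 0}"

definition cyclotomic_field :: "'a::{finite,field} rat_closure \<Rightarrow> 'a poly \<Rightarrow> 'a rat_closure set"
  where "cyclotomic_field \<theta> N = generate_field \<Omega> (\<kk> \<union> carlitz_torsion \<theta> N)"

abbreviation cyc :: "'a::{finite,field} poly \<Rightarrow> 'a rat_closure set"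
  where "cyc N \<equiv> cyclotomic_field ratfun_T N"

text \<open>
  \<open>L\<^sub>n\<close>: the subfield of \<open>k(\<Lambda>)\<close>, \<open>\<Lambda>\<close> the torsion of \<open>(1/T)\<^bsup>n+1\<^esup>\<close>, fixed by \<open>\<bbbF>\<^sub>q\<^sup>*\<close>; here \<open>a \<in> \<bbbF>\<^sub>q\<^sup>*\<close>
  is the automorphism with \<open>\<lambda> \<mapsto> a \<lambda>\<close> on \<open>\<Lambda>\<close>.
\<close>

definition wild_field :: "nat \<Rightarrow> 'a::{finite,field} rat_closure set" (\<open>\<L>\<close>)
  where "\<L> n =
    (let \<theta> = inverse ratfun_T; N = Polynomial.monom 1 (n + 1) in
      {x \<in> cyclotomic_field \<theta> N.
        \<forall>\<sigma>\<in>field_auts (cyclotomic_field \<theta> N) \<kk>.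
          (\<exists>a. a \<noteq> 0 \<and> (\<forall>u\<in>carlitz_torsion \<theta> N. \<sigma> u = const_emb a * u)) \<longrightarrow> \<sigma> x = x})"

text \<open>
  \<open>A\<^sub>m = A \<bbbF>\<^bsub>q^m\<^esub>\<close>, where \<open>\<bbbF>\<^bsub>q^m\<^esub>\<close> is the set of roots of \<open>x\<^bsup>q^m\<^esup> - x\<close>.
  Meaningful for \<open>m \<ge> 1\<close> only.
\<close>

definition const_ext :: "'a::{finite,field} rat_closure set \<Rightarrow> nat \<Rightarrow> 'a rat_closure set"
  where "const_ext A m = A \<squnion>\<^sub>F {x. x ^ (CARD('a) ^ m) = x}"

definition ncyc :: "nat \<Rightarrow> 'a::{finite,field} poly \<Rightarrow> 'a rat_closure set"
  where "ncyc n N = \<L> n \<squnion>\<^sub>F cyc N"  \<comment> \<open>\<open>\<^sub>nk(\<Lambda>\<^sub>N)\<close>\<close>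

definition min_const_degree :: "'a::{finite,field} rat_closure set \<Rightarrow> nat \<Rightarrow> 'a poly \<Rightarrow> nat \<Rightarrow> bool"
  where "min_const_degree K n N m \<longleftrightarrow>
    m \<ge> 1 \<and> K \<subseteq> const_ext (ncyc n N) m \<and>
    (\<forall>j\<ge>1. K \<subseteq> const_ext (ncyc n N) j \<longrightarrow> m \<le> j)"

section \<open>Primes, ramification and inertia\<close>

text \<open>A prime of a function field \<open>A\<close> is represented by its valuation ring \<open>V\<close>.\<close>

definition field_prime :: "'a::{finite,field} rat_closure set \<Rightarrow> 'a rat_closure set \<Rightarrow> bool"
  where "field_prime A V \<longleftrightarrow>
    subring V \<Omega> \<and> range const_emb \<subseteq> V \<and> V \<subset> A \<and> (\<forall>x\<in>A. x \<in> V \<or> inverse x \<in> V)"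

definition prime_ideal_of :: "'a::{finite,field} rat_closure set \<Rightarrow> 'a rat_closure set"
  where "prime_ideal_of V = {x \<in> V. x = 0 \<or> inverse x \<notin> V}"

definition uniformizer :: "'a::{finite,field} rat_closure set \<Rightarrow> 'a rat_closure \<Rightarrow> bool"
  where "uniformizer V \<pi> \<longleftrightarrow> prime_ideal_of V = {\<pi> * y | y. y \<in> V}"

definition prime_val :: "'a::{finite,field} rat_closure set \<Rightarrow> 'a rat_closure \<Rightarrow> int"
  where "prime_val V x =
    (THE i. \<exists>\<pi> u. uniformizer V \<pi> \<and> u \<in> V \<and> u \<notin> prime_ideal_of V \<and> x = \<pi> powi i * u)"

text \<open>
  In the next two definitions \<open>V\<close> is a prime of an extension of \<open>B\<close>; the prime of \<open>B\<close> below it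
  is \<open>V \<inter> B\<close>.
\<close>

definition ram_index :: "'a::{finite,field} rat_closure set \<Rightarrow> 'a rat_closure set \<Rightarrow> nat"
  where "ram_index B V =
    (THE e. \<forall>x\<in>B - {0}. prime_val V x = int e * prime_val (V \<inter> B) x)"

definition inertia_degree :: "'a::{finite,field} rat_closure set \<Rightarrow> 'a rat_closure set \<Rightarrow> nat"
  where "inertia_degree B V =
    (let R = \<Omega>\<lparr>carrier := V\<rparr>; P = prime_ideal_of V in
      ring.dim (R Quot P) ((\<lambda>x. P +>\<^bsub>R\<^esub> x) ` (V \<inter> B)) (carrier (R Quot P)))"

text \<open>The valuation ring of \<open>P\<^sub>\<infinity>\<close>, and the infinite primes of \<open>A\<close>.\<close>

definition inf_ring :: "'a::{finite,field} rat_closure set"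
  where "inf_ring =
    {to_ac (Fract a b) | a b. b \<noteq> 0 \<and> Polynomial.degree a \<le> Polynomial.degree b}"

definition inf_prime :: "'a::{finite,field} rat_closure set \<Rightarrow> 'a rat_closure set \<Rightarrow> bool"
  where "inf_prime A V \<longleftrightarrow> field_prime A V \<and> V \<inter> \<kk> = inf_ring"

text \<open>
  \<open>e\<^sub>\<infinity>(A/B)\<close> and \<open>f\<^sub>\<infinity>(A/B)\<close>: the common values over all infinite primes of \<open>A\<close>, which exist when
  \<open>A\<close> and \<open>B\<close> are Galois over \<open>k\<close>.
\<close>

definition e_inf :: "'a::{finite,field} rat_closure set \<Rightarrow> 'a rat_closure set \<Rightarrow> nat"
  where "e_inf A B = (THE e. \<forall>V. inf_prime A V \<longrightarrow> ram_index B V = e)"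

definition f_inf :: "'a::{finite,field} rat_closure set \<Rightarrow> 'a rat_closure set \<Rightarrow> nat"
  where "f_inf A B = (THE f. \<forall>V. inf_prime A V \<longrightarrow> inertia_degree B V = f)"

section \<open>Hilbert class field and genus field\<close>

text \<open>Residue fields are perfect, so a prime is unramified iff its ramification index is \<open>1\<close>.\<close>

definition unramified_ext :: "'a::{finite,field} rat_closure set \<Rightarrow> 'a rat_closure set \<Rightarrow> bool"
  where "unramified_ext A B \<longleftrightarrow> (\<forall>V. field_prime A V \<longrightarrow> ram_index B V = 1)"

definition inf_splits :: "'a::{finite,field} rat_closure set \<Rightarrow> 'a rat_closure set \<Rightarrow> bool"
  where "inf_splits A B \<longleftrightarrow>
    (\<forall>W. inf_prime B W \<longrightarrow> card {V. field_prime A V \<and> V \<inter> B = W} = ext_degree A B)"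

text \<open>
  Being abelian, unramified and split at the infinite primes passes to composites and to
  subextensions, so the maximal extension with these properties is the composite of all finite
  ones; likewise for the extensions of \<open>B\<close> that are abelian over \<open>k\<close> and contained in the
  Hilbert class field.
\<close>

definition hilbert_class_field :: "'a::{finite,field} rat_closure set \<Rightarrow> 'a rat_closure set"
  where "hilbert_class_field B = generate_field \<Omega>
    (\<Union>{A. finite_abelian_ext A B \<and> unramified_ext A B \<and> inf_splits A B})"

definition genus_field :: "'a::{finite,field} rat_closure set \<Rightarrow> 'a rat_closure set"
  where "genus_field B = generate_field \<Omega>
    (\<Union>{A. B \<subseteq> A \<and> A \<subseteq> hilbert_class_field B \<and> finite_abelian_ext A \<kk>})"

end

(*
  Fix a valuation ring O of the algebraic closure above the infinite prime. The torsion points of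
  the Carlitz modules over F_q[T] and F_q[1/T] have explicit values at O, and counting ramification
  and residue degrees shows that the decomposition group of the infinite prime in
  A = L_n k(Lambda_N) F_{q^m} restricts onto the product of the Galois groups of L_n and of F_{q^m},
  even by elements trivial on k(Lambda_N), and that the residue field of A is F_{q^m}.
  So every automorphism fixing L_n k(Lambda_N) preserves O on K. By natural irrationalities K/F is
  isomorphic in Galois group to the constant extension of degree m; hence the infinite primes of F
  do not split in K, and m = [K:F] = e f with f = t, as the residue field of F is F_q.
  Minimality of m puts F_{q^m} into EK L_n. Since [L_n : k] is a power of p, the constants of
  degree m are reached from the residue field of EK by a p-power step: this is p^s.
  For the genus fields only residues matter: places that split completely add no new ones.
*)
theory Submission
  imports Defs Complex_Main
begin

section \<open>Subfields of an algebraically closed field\<close>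

text \<open>No completions are taken. \<open>\<O>\<close> lives on the whole closure, Galois groups
  are sets of restrictions of its automorphisms, and local degrees become sizes of restricted
  decomposition groups D. Only e f \<le> |D| is proved directly: products of elements with distinct
  values and elements with independent residues are independent over the decomposition field, which
  is immediate over the base, and Artin's theorem bounds their number. The opposite bound is special
  to A: D acts on k(Lambda_N) through at most q - 1 elements, on L_n through at most q^n and on the
  constants through at most m. As q - 1 and q^n are coprime, tame and wild ramification both survive
  in A, and the product of the three bounds is attained. For K and F equality follows because the
  inequalities along a tower multiply to the equality on top. Residue fields are handled through
  constants, which serve as their own residue representatives: congruent constants are
  equal.\<close>

definition subfld :: "'w::field set \<Rightarrow> bool" where
  "subfld B \<longleftrightarrow> 0 \<in> B \<and> 1 \<in> B \<and> (\<forall>x\<in>B. \<forall>y\<in>B. x - y \<in> B \<and> x * y \<in> B) \<and> (\<forall>x\<in>B. inverse x \<in> B)"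

lemma subfld_0: "subfld B ==> 0 \<in> B"
  and subfld_1: "subfld B ==> 1 \<in> B"
  and subfld_diff: "subfld B ==> x \<in> B ==> y \<in> B ==> x - y \<in> B"
  and subfld_mult: "subfld B ==> x \<in> B ==> y \<in> B ==> x * y \<in> B"
  and subfld_inverse: "subfld B ==> x \<in> B ==> inverse x \<in> B"
  by (auto simp: subfld_def)

lemma subfld_uminus: "subfld B ==> x \<in> B ==> - x \<in> B"
  using subfld_diff[of B 0 x] subfld_0 by auto

lemma subfld_add: "subfld B ==> x \<in> B ==> y \<in> B ==> x + y \<in> B"
  using subfld_diff[of B x "- y"] subfld_uminus by auto

lemma subfld_divide: "subfld B ==> x \<in> B ==> y \<in> B ==> x / y \<in> B"
  by (simp add: field_class.field_divide_inverse subfld_inverse subfld_mult)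

lemma subfld_sum: "subfld B ==> (\<And>i. i \<in> I ==> f i \<in> B) ==> sum f I \<in> B"
  by (induction I rule: infinite_finite_induct) (auto simp: subfld_0 subfld_add)

lemma subfld_prod: "subfld B ==> (\<And>i. i \<in> I ==> f i \<in> B) ==> prod f I \<in> B"
  by (induction I rule: infinite_finite_induct) (auto simp: subfld_1 subfld_mult)

lemma subfld_power: "subfld B ==> x \<in> B ==> x ^ n \<in> B"
  by (induction n) (auto simp: subfld_1 subfld_mult)

lemma subfld_powi: "subfld B ==> x \<in> B ==> x powi i \<in> B"
  by (cases "i \<ge> 0") (auto simp: power_int_def subfld_power subfld_inverse)

lemmas subfld_closed = subfld_0 subfld_1 subfld_diff subfld_mult subfld_inverse subfld_uminus
  subfld_add subfld_divide subfld_sum subfld_prod subfld_power subfld_powi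

lemma subfld_Inter: "(\<And>B. B \<in> \<B> ==> subfld B) ==> subfld (\<Inter>\<B>)"
  by (auto simp: subfld_def)

lemma subfld_Int: "subfld A ==> subfld B ==> subfld (A \<inter> B)"
  by (auto simp: subfld_def)

lemma subfld_UNIV: "subfld UNIV"
  by (auto simp: subfld_def)

text \<open>The impredicative closure suits inclusions and images under automorphisms;
  \<open>generate_field_eq_gen\<close> identifies it with the notion used in the
  definitions.\<close>

definition gen :: "'w::field set \<Rightarrow> 'w set" where
  "gen S = \<Inter>{B. subfld B \<and> S \<subseteq> B}"

lemma subfld_gen: "subfld (gen S)"
  unfolding gen_def by (rule subfld_Inter) auto

lemma gen_incl: "S \<subseteq> gen S"
  by (auto simp: gen_def)

lemma gen_least: "subfld B ==> S \<subseteq> B ==> gen S \<subseteq> B"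
  by (auto simp: gen_def)

lemma gen_mono: "S \<subseteq> T ==> gen S \<subseteq> gen T"
  by (auto simp: gen_def)

lemma gen_subfld: "subfld B ==> gen B = B"
  using gen_least[of B B] gen_incl[of B] by auto

lemma gen_Un_gen: "gen (gen S \<union> T) = gen (S \<union> T)"
proof (rule antisym)
  show "gen (gen S \<union> T) \<subseteq> gen (S \<union> T)"
    by (rule gen_least[OF subfld_gen]) (use gen_mono[of S "S \<union> T"] gen_incl[of "S \<union> T"] in auto)
  show "gen (S \<union> T) \<subseteq> gen (gen S \<union> T)"
    by (rule gen_mono) (use gen_incl[of S] in auto)
qed

lemma gen_Un_gen': "gen (T \<union> gen S) = gen (T \<union> S)"
  using gen_Un_gen[of S T] by (simp add: Un_commute)

lemma gen_induct [consumes 1, case_names incl zero one diff mult inverse]: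
  assumes "x \<in> gen S"
    and "\<And>x. x \<in> S ==> P x" and "P 0" and "P 1"
    and "\<And>x y. x \<in> gen S ==> y \<in> gen S ==> P x ==> P y ==> P (x - y)"
    and "\<And>x y. x \<in> gen S ==> y \<in> gen S ==> P x ==> P y ==> P (x * y)"
    and "\<And>x. x \<in> gen S ==> P x ==> P (inverse x)"
  shows "P x"
proof -
  have "subfld {x \<in> gen S. P x}"
    using assms subfld_gen[of S] by (auto simp: subfld_def)
  hence "gen S \<subseteq> {x \<in> gen S. P x}"
    by (rule gen_least) (use assms gen_incl[of S] in auto)
  thus ?thesis using assms(1) by auto
qed

text \<open>Membership in a composite of infinitely many fields is a finite condition. This reduces
  separable closures and Hilbert class fields, which are generated by infinite families, to finite
  extensions.\<close>

lemma gen_finite_subset: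
  assumes "x \<in> gen S" obtains T where "finite T" "T \<subseteq> S" "x \<in> gen T"
proof -
  have "\<exists>T. finite T \<and> T \<subseteq> S \<and> x \<in> gen T" using assms
  proof (induction rule: gen_induct)
    case (incl x) thus ?case using gen_incl by (intro exI[of _ "{x}"]) auto
  next
    case zero thus ?case using subfld_0[OF subfld_gen] by blast
  next
    case one thus ?case using subfld_1[OF subfld_gen] by blast
  next
    case (diff x y)
    then obtain T T' where "finite T" "T \<subseteq> S" "x \<in> gen T" "finite T'" "T' \<subseteq> S" "y \<in> gen T'" by blast
    thus ?case using gen_mono[of T "T \<union> T'"] gen_mono[of T' "T \<union> T'"]
      by (intro exI[of _ "T \<union> T'"]) (auto intro!: subfld_diff[OF subfld_gen])
  next
    case (mult x y)
    then obtain T T' where "finite T" "T \<subseteq> S" "x \<in> gen T" "finite T'" "T' \<subseteq> S" "y \<in> gen T'" by blast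
    thus ?case using gen_mono[of T "T \<union> T'"] gen_mono[of T' "T \<union> T'"]
      by (intro exI[of _ "T \<union> T'"]) (auto intro!: subfld_mult[OF subfld_gen])
  next
    case (inverse x) thus ?case using subfld_inverse[OF subfld_gen] by blast
  qed
  thus ?thesis using that by blast
qed

section \<open>Polynomials with coefficients in a subfield\<close>

text \<open>Polynomials keep the coefficient type of the ambient field; subfields enter only as a
  condition on coefficients, so that evaluation and roots need no change of type.\<close>

definition pover :: "'w::field set \<Rightarrow> 'w poly \<Rightarrow> bool" where
  "pover B p \<longleftrightarrow> (\<forall>i. coeff p i \<in> B)"

lemma pover_mono: "pover B p ==> B \<subseteq> C ==> pover C p"
  by (auto simp: pover_def)

context
  fixes B :: "'w::field set"
  assumes B: "subfld B"
begin

lemma pover_0: "pover B 0" and pover_1: "pover B 1"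
  using B by (auto simp: pover_def subfld_closed)

lemma pover_diff: "pover B p ==> pover B q ==> pover B (p - q)"
  using B by (auto simp: pover_def subfld_closed)

lemma pover_add: "pover B p ==> pover B q ==> pover B (p + q)"
  using B by (auto simp: pover_def subfld_closed)

lemma pover_mult: "pover B p ==> pover B q ==> pover B (p * q)"
  using B by (auto simp: pover_def coeff_mult intro!: subfld_closed)

lemma pover_smult: "c \<in> B ==> pover B p ==> pover B (smult c p)"
  using B by (auto simp: pover_def intro!: subfld_closed)

lemma pover_monom: "c \<in> B ==> pover B (monom c n)"
  using B by (auto simp: pover_def intro!: subfld_closed)

lemma pover_pCons: "pover B (pCons c p) \<longleftrightarrow> c \<in> B \<and> pover B p"
proof
  assume *: "pover B (pCons c p)"
  show "c \<in> B \<and> pover B p"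
    using *[unfolded pover_def, rule_format, of 0] *[unfolded pover_def, rule_format, of "Suc i" for i]
    by (auto simp: pover_def)
qed (auto simp: pover_def coeff_pCons split: nat.split)

lemma pover_poly: "pover B p ==> x \<in> B ==> poly p x \<in> B"
  using B by (induction p) (auto simp: pover_pCons intro!: subfld_closed)

lemma pover_pcompose: "pover B p ==> pover B q ==> pover B (pcompose p q)"
  by (induction p) (auto simp: pover_pCons pcompose_pCons pover_0 intro!: pover_add pover_mult)

text \<open>Cancelling the leading term by a monomial multiple of the monic \<open>p\<close>
  requires no division, so quotient and remainder stay over \<open>B\<close>.\<close>

lemma pover_divmod_monic:
  assumes "pover B f" "pover B p" "lead_coeff p = 1"
  shows "\<exists>h r. pover B h \<and> pover B r \<and> f = p * h + r \<and> (r = 0 \<or> degree r < degree p)"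
  using assms(1)
proof (induction "degree f" arbitrary: f rule: less_induct)
  case less
  show ?case
  proof (cases "f = 0 \<or> degree f < degree p")
    case True
    thus ?thesis using less.prems by (intro exI[of _ 0] exI[of _ f]) (auto simp: pover_0)
  next
    case False
    define n where "n = degree f - degree p"
    define g where "g = monom (lead_coeff f) n"
    have p0: "p \<noteq> 0" using assms(3) by auto
    have g0: "g \<noteq> 0" using False by (auto simp: g_def monom_eq_0_iff)
    have og: "pover B g" unfolding g_def by (rule pover_monom) (use less.prems in \<open>auto simp: pover_def\<close>)
    have dg: "degree (p * g) = degree f"
      using p0 g0 False by (subst degree_mult_eq) (auto simp: g_def n_def degree_monom_eq)
    have lg: "lead_coeff (p * g) = lead_coeff f"
      unfolding lead_coeff_mult assms(3) using False by (simp add: g_def degree_monom_eq)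
    show ?thesis
    proof (cases "f - p * g = 0")
      case True thus ?thesis using og by (intro exI[of _ g] exI[of _ 0]) (auto simp: pover_0)
    next
      case f0: False
      have "degree (f - p * g) < degree f"
      proof -
        have "degree (f - p * g) \<le> degree f" using dg by (metis degree_diff_le le_refl)
        moreover have "coeff (f - p * g) (degree f) = 0"
          using lg dg by simp
        ultimately show ?thesis using f0
          by (metis le_neq_implies_less leading_coeff_0_iff)
      qed
      from less.hyps[OF this] obtain h r where hr: "pover B h" "pover B r" "f - p * g = p * h + r"
        "r = 0 \<or> degree r < degree p"
        using pover_diff[OF less.prems pover_mult[OF assms(2) og]] by blast
      have "f = p * (g + h) + r" using hr(3) by (simp add: algebra_simps)
      thus ?thesis using hr pover_add[OF og hr(1)] by blast
    qed
  qed
qed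

end

text \<open>The name refers to the ambient field: it is algebraic over \<open>B\<close>, hence an
  algebraic closure of \<open>B\<close> when it is algebraically closed.\<close>

definition algcl :: "'w::field set \<Rightarrow> bool" where
  "algcl B \<longleftrightarrow> subfld B \<and> (\<forall>x. \<exists>p. pover B p \<and> p \<noteq> 0 \<and> poly p x = 0)"

lemma algcl_mono: "algcl B ==> subfld C ==> B \<subseteq> C ==> algcl C"
  by (meson algcl_def pover_mono)

lemma algcl_subfld: "algcl B ==> subfld B"
  by (simp add: algcl_def)

text \<open>Stated as a monic generator of the ideal of polynomials over \<open>B\<close> vanishing
  at \<open>x\<close>, the form in which the well-definedness of an embedding of B(x) uses
  it.\<close>

definition minpol :: "'w::field set \<Rightarrow> 'w \<Rightarrow> 'w poly \<Rightarrow> bool" where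
  "minpol B x p \<longleftrightarrow> pover B p \<and> lead_coeff p = 1 \<and> poly p x = 0 \<and>
    (\<forall>f. pover B f \<longrightarrow> poly f x = 0 \<longrightarrow> (\<exists>h. pover B h \<and> f = p * h))"

lemma minpol_exists:
  assumes "algcl B" obtains p where "minpol B x p"
proof -
  have B: "subfld B" using assms by (rule algcl_subfld)
  define P where "P = (\<lambda>p. pover B p \<and> p \<noteq> 0 \<and> poly p x = 0)"
  obtain p0 where "P p0" using assms by (auto simp: P_def algcl_def)
  then obtain p1 where p1: "P p1" and min: "\<And>q. P q ==> degree p1 \<le> degree q"
    using exists_least_iff[of "\<lambda>n. \<exists>p. P p \<and> degree p = n"]
    by (metis not_le_imp_less)
  define p where "p = smult (inverse (lead_coeff p1)) p1"
  have lc: "lead_coeff p1 \<noteq> 0" using p1 by (auto simp: P_def)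
  have p: "pover B p" "lead_coeff p = 1" "poly p x = 0" "degree p = degree p1"
    using p1 lc B by (auto simp: p_def P_def pover_def intro!: subfld_closed)
  have "\<exists>h. pover B h \<and> f = p * h" if f: "pover B f" "poly f x = 0" for f
  proof -
    obtain h r where hr: "pover B h" "pover B r" "f = p * h + r" "r = 0 \<or> degree r < degree p"
      using pover_divmod_monic[OF B f(1) p(1,2)] by blast
    have "poly r x = 0" using hr(3) f(2) p(3) by simp
    hence "r = 0" using hr(2,4) min[of r] p(4) by (metis P_def not_less)
    thus ?thesis using hr by auto
  qed
  thus ?thesis using that[of p] p by (auto simp: minpol_def)
qed

lemma minpol_degree_pos: 
  assumes "minpol B x p" shows "degree p > 0"
proof (rule ccontr)
  assume "\<not> ?thesis"
  then obtain c where c: "p = [:c:]" by (auto elim: degree_eq_zeroE)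
  thus False using assms by (auto simp: minpol_def)
qed

text \<open>Write the minimal polynomial as a + X p'. Then z p'(z) = - a, and a is nonzero because
  p' would otherwise vanish at z in smaller degree. So B[z] is already a field.\<close>

lemma inverse_eq_poly:
  assumes "algcl B" "z \<noteq> 0" obtains h where "pover B h" "poly h z = inverse z"
proof -
  have B: "subfld B" using assms(1) by (rule algcl_subfld)
  obtain p where p: "minpol B z p" using minpol_exists[OF assms(1)] .
  obtain a p' where pa: "p = pCons a p'" by (cases p)
  have o: "a \<in> B" "pover B p'" using p B by (auto simp: minpol_def pa pover_pCons)
  have e: "a + z * poly p' z = 0" using p by (auto simp: minpol_def pa)
  have p0: "p \<noteq> 0" "p' \<noteq> 0" using minpol_degree_pos[OF p] pa by (auto split: if_splits)
  have "a \<noteq> 0"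
  proof
    assume "a = 0"
    hence "poly p' z = 0" using e assms(2) by simp
    then obtain h where h: "p' = p * h" using p o(2) unfolding minpol_def by blast
    hence "h \<noteq> 0" using p0 by auto
    hence "degree p' \<ge> degree p" using h p0 by (simp add: degree_mult_eq)
    thus False using p0 pa by simp
  qed
  have "pover B (smult (- (inverse a)) p')"
    using o B by (intro pover_smult subfld_closed) auto
  moreover have "poly (smult (- (inverse a)) p') z = inverse z"
  proof -
    have "z * poly p' z = - a" using e by (simp add: eq_neg_iff_add_eq_0 add.commute)
    thus ?thesis using assms(2) \<open>a \<noteq> 0\<close> by (simp add: nonzero_eq_divide_eq field_simps)
  qed
  ultimately show ?thesis using that by blast
qed

section \<open>Extension of embeddings\<close>

text \<open>Partial embeddings are represented by their graphs, so that unions of chains are immediate.\<close>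

definition emb_graph :: "('w::field \<times> 'w) set \<Rightarrow> bool" where
  "emb_graph g \<longleftrightarrow> (1, 1) \<in> g \<and> (\<forall>x y x' y'. (x, y) \<in> g \<longrightarrow> (x', y') \<in> g \<longrightarrow>
     (x - x', y - y') \<in> g \<and> (x * x', y * y') \<in> g) \<and>
     (\<forall>x y. (x, y) \<in> g \<longrightarrow> (inverse x, inverse y) \<in> g) \<and> (\<forall>y. (0, y) \<in> g \<longrightarrow> y = 0)"

definition fhom :: "'w::field set \<Rightarrow> ('w \<Rightarrow> 'w) \<Rightarrow> bool" where
  "fhom B \<sigma> \<longleftrightarrow> \<sigma> 1 = 1 \<and> (\<forall>x\<in>B. \<forall>y\<in>B. \<sigma> (x - y) = \<sigma> x - \<sigma> y \<and> \<sigma> (x * y) = \<sigma> x * \<sigma> y)"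

context
  fixes B :: "'w::field set" and \<sigma>
  assumes B: "subfld B" and \<sigma>: "fhom B \<sigma>"
begin

lemma fhom_0: "\<sigma> 0 = 0"
  using \<sigma> B subfld_0[OF B] unfolding fhom_def by (metis diff_self)

lemma fhom_diff: "x \<in> B ==> y \<in> B ==> \<sigma> (x - y) = \<sigma> x - \<sigma> y"
  and fhom_mult: "x \<in> B ==> y \<in> B ==> \<sigma> (x * y) = \<sigma> x * \<sigma> y"
  and fhom_1: "\<sigma> 1 = 1"
  using \<sigma> by (auto simp: fhom_def)

lemma fhom_uminus: "x \<in> B ==> \<sigma> (- x) = - \<sigma> x"
  using fhom_diff[of 0 x] subfld_0[OF B] fhom_0 by simp

lemma fhom_add: "x \<in> B ==> y \<in> B ==> \<sigma> (x + y) = \<sigma> x + \<sigma> y"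
  using fhom_diff[of x "- y"] fhom_uminus subfld_uminus[OF B] by simp

lemma fhom_inverse: "x \<in> B ==> \<sigma> (inverse x) = inverse (\<sigma> x)"
proof (cases "x = 0")
  case False
  assume x: "x \<in> B"
  have "\<sigma> (inverse x) * \<sigma> x = 1"
    using fhom_mult[of "inverse x" x] x False fhom_1 subfld_inverse[OF B x] by simp
  thus ?thesis by (metis inverse_unique mult.commute)
qed (simp add: fhom_0)

lemma fhom_nonzero: "x \<in> B ==> x \<noteq> 0 ==> \<sigma> x \<noteq> 0"
  using fhom_mult[of x "inverse x"] fhom_1 subfld_inverse[OF B] by fastforce

lemma fhom_sum: "(\<And>i. i \<in> I ==> f i \<in> B) ==> \<sigma> (sum f I) = (\<Sum>i\<in>I. \<sigma> (f i))"
  by (induction I rule: infinite_finite_induct) (auto simp: fhom_0 fhom_add subfld_sum[OF B])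

lemma fhom_prod: "(\<And>i. i \<in> I ==> f i \<in> B) ==> \<sigma> (prod f I) = (\<Prod>i\<in>I. \<sigma> (f i))"
  by (induction I rule: infinite_finite_induct) (auto simp: fhom_1 fhom_mult subfld_prod[OF B])

lemma fhom_power: "x \<in> B ==> \<sigma> (x ^ n) = \<sigma> x ^ n"
  by (induction n) (auto simp: fhom_1 fhom_mult subfld_power[OF B])

lemma fhom_powi: "x \<in> B ==> \<sigma> (x powi i) = \<sigma> x powi i"
  by (cases "i \<ge> 0") (auto simp: power_int_def fhom_power fhom_inverse subfld_power[OF B] subfld_inverse[OF B])

lemma fhom_map_diff: "pover B p ==> pover B q ==> map_poly \<sigma> (p - q) = map_poly \<sigma> p - map_poly \<sigma> q"
  by (rule poly_eqI) (auto simp: coeff_map_poly fhom_0 fhom_diff pover_def)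

lemma fhom_map_mult: "pover B p ==> pover B q ==> map_poly \<sigma> (p * q) = map_poly \<sigma> p * map_poly \<sigma> q"
  by (rule poly_eqI)
    (auto simp: coeff_map_poly fhom_0 fhom_mult fhom_sum pover_def coeff_mult subfld_mult[OF B])

lemma fhom_map_prod: "(\<And>i. i \<in> I ==> pover B (f i)) ==> map_poly \<sigma> (prod f I) = (\<Prod>i\<in>I. map_poly \<sigma> (f i))"
proof (induction I rule: infinite_finite_induct)
  case (insert i I)
  have "pover B (prod f I)" if "finite I" using that insert.prems
    by (induction I) (auto simp: pover_1[OF B] intro!: pover_mult[OF B])
  thus ?case using insert by (auto simp: fhom_map_mult)
qed (auto simp: fhom_1 map_poly_1')

lemma fhom_poly: "pover B p ==> x \<in> B ==> \<sigma> (poly p x) = poly (map_poly \<sigma> p) (\<sigma> x)"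
proof (induction p)
  case (pCons a p)
  thus ?case using pover_pCons[OF B, of a p] B
    by (cases "p = 0 \<and> a = 0") (auto simp: map_poly_pCons fhom_0 fhom_add fhom_mult pover_poly[OF B] subfld_mult[OF B])
qed (simp add: fhom_0)

lemma fhom_map_id: "pover B p ==> (\<And>x. x \<in> B ==> \<sigma> x = x) ==> map_poly \<sigma> p = p"
  by (rule poly_eqI) (auto simp: coeff_map_poly fhom_0 pover_def)

end

lemmas hom_0 = fhom_0[OF subfld_UNIV]
  and hom_1 = fhom_1[OF subfld_UNIV]
  and hom_add = fhom_add[OF subfld_UNIV]
  and hom_diff = fhom_diff[OF subfld_UNIV]
  and hom_inverse = fhom_inverse[OF subfld_UNIV]
  and hom_map_prod = fhom_map_prod[OF subfld_UNIV]
  and hom_mult = fhom_mult[OF subfld_UNIV]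
  and hom_nonzero = fhom_nonzero[OF subfld_UNIV]
  and hom_poly = fhom_poly[OF subfld_UNIV]
  and hom_power = fhom_power[OF subfld_UNIV]
  and hom_powi = fhom_powi[OF subfld_UNIV]
  and hom_prod = fhom_prod[OF subfld_UNIV]
  and hom_sum = fhom_sum[OF subfld_UNIV]
  and hom_uminus = fhom_uminus[OF subfld_UNIV]

lemma emb_graph_fhom:
  assumes g: "emb_graph g" and s: "\<sigma> = (\<lambda>x. THE y. (x, y) \<in> g)"
  shows "(x, y) \<in> g \<longleftrightarrow> x \<in> Domain g \<and> y = \<sigma> x" "subfld (Domain g)" "fhom (Domain g) \<sigma>"
proof -
  have u: "y = y'" if "(x, y) \<in> g" "(x, y') \<in> g" for x y y'
  proof -
    have "(x - x, y - y') \<in> g" using g that unfolding emb_graph_def by blast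
    thus ?thesis using g unfolding emb_graph_def by auto
  qed
  have sg: "\<sigma> x = y" if "(x, y) \<in> g" for x y
    unfolding s by (rule the_equality) (use that u in auto)
  show mem: "(x, y) \<in> g \<longleftrightarrow> x \<in> Domain g \<and> y = \<sigma> x" for x y using sg by auto
  have "(0, 0) \<in> g" using g unfolding emb_graph_def by (metis diff_self)
  thus "subfld (Domain g)" using g unfolding subfld_def emb_graph_def by (blast intro: DomainI)
  show "fhom (Domain g) \<sigma>"
    unfolding fhom_def
  proof (intro conjI ballI)
    show "\<sigma> 1 = 1" using g sg by (auto simp: emb_graph_def)
    fix x y assume "x \<in> Domain g" "y \<in> Domain g"
    hence "(x, \<sigma> x) \<in> g" "(y, \<sigma> y) \<in> g" using sg by auto
    hence "(x - y, \<sigma> x - \<sigma> y) \<in> g" "(x * y, \<sigma> x * \<sigma> y) \<in> g" using g unfolding emb_graph_def by blast+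
    thus "\<sigma> (x - y) = \<sigma> x - \<sigma> y" "\<sigma> (x * y) = \<sigma> x * \<sigma> y" using sg by auto
  qed
qed

text \<open>The relation is single-valued because every f vanishing at \<open>x\<close> is a
  multiple of \<open>p\<close>; it is closed under inverses because an inverse is a polynomial in
  the element itself.\<close>

lemma emb_graph_adjoin:
  assumes B: "algcl B" and \<sigma>: "fhom B \<sigma>" and p: "minpol B x p" and y: "poly (map_poly \<sigma> p) y = 0"
  shows "emb_graph {(poly f x, poly (map_poly \<sigma> f) y) | f. pover B f}" (is "emb_graph ?g")
proof -
  have sB: "subfld B" using B by (rule algcl_subfld)
  note [simp] = fhom_0[OF sB \<sigma>] fhom_1[OF sB \<sigma>]
  have z: "poly (map_poly \<sigma> f) y = 0" if "pover B f" "poly f x = 0" for f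
  proof -
    obtain h where "pover B h" "f = p * h" using p \<open>pover B f\<close> \<open>poly f x = 0\<close> unfolding minpol_def by blast
    thus ?thesis using y p fhom_map_mult[OF sB \<sigma>, of p h] by (simp add: minpol_def)
  qed
  show ?thesis unfolding emb_graph_def
  proof (intro conjI allI impI)
    show "(1, 1) \<in> ?g" by (auto intro!: exI[of _ 1] pover_1[OF sB] simp: map_poly_1')
  next
    fix a b a' b' assume "(a, b) \<in> ?g" "(a', b') \<in> ?g"
    then obtain f f' where f: "pover B f" "pover B f'" "a = poly f x" "b = poly (map_poly \<sigma> f) y"
      "a' = poly f' x" "b' = poly (map_poly \<sigma> f') y" by auto
    show "(a - a', b - b') \<in> ?g" 
      using f pover_diff[OF sB f(1,2)] fhom_map_diff[OF sB \<sigma> f(1,2)] by (auto intro!: exI[of _ "f - f'"])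
    show "(a * a', b * b') \<in> ?g" 
      using f pover_mult[OF sB f(1,2)] fhom_map_mult[OF sB \<sigma> f(1,2)] by (auto intro!: exI[of _ "f * f'"])
  next
    fix b assume "(0, b) \<in> ?g" thus "b = 0" using z by auto
  next
    fix a b assume "(a, b) \<in> ?g"
    then obtain f where f: "pover B f" "a = poly f x" "b = poly (map_poly \<sigma> f) y" by auto
    show "(inverse a, inverse b) \<in> ?g"
    proof (cases "a = 0")
      case True
      thus ?thesis using z[OF f(1)] f by (auto intro!: exI[of _ 0] pover_0[OF sB])
    next
      case False
      obtain h where h: "pover B h" "poly h a = inverse a" using inverse_eq_poly[OF B False] .
      define G where "G = pcompose h f"
      have G: "pover B G" "poly G x = inverse a" unfolding G_def
        using pover_pcompose[OF sB h(1) f(1)] h f by (auto simp: poly_pcompose)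
      have o: "pover B (f * G)" "pover B 1" using pover_mult[OF sB f(1) G(1)] pover_1[OF sB] .
      have "poly (map_poly \<sigma> (f * G - 1)) y = 0"
        by (rule z) (use pover_diff[OF sB o] G f False in auto)
      hence "b * poly (map_poly \<sigma> G) y = 1"
        using fhom_map_diff[OF sB \<sigma> o] fhom_map_mult[OF sB \<sigma> f(1) G(1)] f by (simp add: map_poly_1')
      hence "inverse b = poly (map_poly \<sigma> G) y" by (rule inverse_unique)
      thus ?thesis using G by (auto intro!: exI[of _ G])
    qed
  qed
qed

text \<open>Automorphisms of the entire ambient field: the Galois group of an extension appears as a
  set of restrictions, and groups of different extensions can be compared directly.\<close>

definition Aut :: "'w::field set \<Rightarrow> ('w \<Rightarrow> 'w) set" where
  "Aut B = {\<sigma>. fhom UNIV \<sigma> \<and> bij \<sigma> \<and> (\<forall>x\<in>B. \<sigma> x = x)}"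

text \<open>Zorn's lemma gives a maximal embedding; sending a further element to a root of its
  transported minimal polynomial shows that it is defined everywhere. It is onto because it permutes
  the finitely many roots of each polynomial over \<open>k\<close>.\<close>

lemma emb_graph_extends:
  fixes g :: "('w::alg_closed_field \<times> 'w) set"
  assumes k: "algcl k" and g: "emb_graph g" and id: "\<And>x. x \<in> k ==> (x, x) \<in> g"
  obtains \<tau> where "\<tau> \<in> Aut k" "\<And>x y. (x, y) \<in> g ==> \<tau> x = y"
proof -
  define \<A> where "\<A> = {h. emb_graph h \<and> g \<subseteq> h}"
  have "\<exists>M\<in>\<A>. \<forall>Z\<in>\<A>. M \<subseteq> Z \<longrightarrow> Z = M"
  proof (rule subset_Zorn_nonempty)
    show "\<A> \<noteq> {}" using g by (auto simp: \<A>_def)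
    fix \<C> assume C: "\<C> \<noteq> {}" "subset.chain \<A> \<C>"
    have ch: "\<exists>Z\<in>\<C>. Z1 \<subseteq> Z \<and> Y \<subseteq> Z" if "Z1 \<in> \<C>" "Y \<in> \<C>" for Z1 Y
      using subset_chain_def C(2) that by (metis (no_types, lifting) order_refl subset_chain_def)
    have em: "emb_graph Z1" "g \<subseteq> Z1" if "Z1 \<in> \<C>" for Z1 using C(2) that unfolding subset.chain_def \<A>_def by auto
    have "emb_graph (\<Union>\<C>)" unfolding emb_graph_def
    proof (intro conjI allI impI)
      show "(1, 1) \<in> \<Union>\<C>" using C(1) em by (auto simp: emb_graph_def)
    next
      fix x y x' y' assume "(x, y) \<in> \<Union>\<C>" "(x', y') \<in> \<Union>\<C>"
      then obtain Z1 Z2 where "Z1 \<in> \<C>" "(x, y) \<in> Z1" "Z2 \<in> \<C>" "(x', y') \<in> Z2" by auto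
      then obtain Z where Z: "Z \<in> \<C>" "(x, y) \<in> Z" "(x', y') \<in> Z" using ch[of Z1 Z2] by auto
      hence "(x - x', y - y') \<in> Z \<and> (x * x', y * y') \<in> Z" using em(1)[OF Z(1)] by (simp add: emb_graph_def)
      thus "(x - x', y - y') \<in> \<Union>\<C>" "(x * x', y * y') \<in> \<Union>\<C>" using Z(1) by auto
    next
      fix x y assume "(x, y) \<in> \<Union>\<C>" 
      then obtain Z where Z: "Z \<in> \<C>" "(x, y) \<in> Z" by auto
      hence "(inverse x, inverse y) \<in> Z" using em(1)[OF Z(1)] by (simp add: emb_graph_def)
      thus "(inverse x, inverse y) \<in> \<Union>\<C>" using Z(1) by auto
    next
      fix y assume "(0, y) \<in> \<Union>\<C>" 
      then obtain Z where Z: "Z \<in> \<C>" "(0, y) \<in> Z" by auto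
      thus "y = 0" using em(1)[OF Z(1)] by (simp add: emb_graph_def)
    qed
    thus "\<Union>\<C> \<in> \<A>" using C(1) em by (auto simp: \<A>_def)
  qed
  then obtain M where M': "M \<in> \<A>" "\<forall>Z\<in>\<A>. M \<subseteq> Z \<longrightarrow> Z = M" by blast
  hence M: "emb_graph M" "g \<subseteq> M" by (auto simp: \<A>_def)
  have max: "Z = M" if "emb_graph Z" "M \<subseteq> Z" for Z
  proof -
    have "Z \<in> \<A>" using that M(2) by (auto simp: \<A>_def)
    thus ?thesis using M'(2) that(2) by blast
  qed
  define \<sigma> where "\<sigma> = (\<lambda>x. THE y. (x, y) \<in> M)"
  note ms = emb_graph_fhom[OF M(1) \<sigma>_def]
  have kD: "k \<subseteq> Domain M" using id M(2) by blast
  have aD: "algcl (Domain M)" using algcl_mono[OF k ms(2) kD] .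
  have "x \<in> Domain M" for x
  proof -
    obtain p where p: "minpol (Domain M) x p" using minpol_exists[OF aD] .
    note [simp] = fhom_0[OF ms(2,3)] fhom_1[OF ms(2,3)]
    have "coeff (map_poly \<sigma> p) (degree p) \<noteq> 0"
      using p by (simp add: coeff_map_poly minpol_def)
    hence "degree (map_poly \<sigma> p) > 0"
      using minpol_degree_pos[OF p] le_degree by (metis leD not_gr_zero le0 order_less_le_trans)
    then obtain y where y: "poly (map_poly \<sigma> p) y = 0" using alg_closed_imp_poly_has_root by blast
    define h where "h = {(poly f x, poly (map_poly \<sigma> f) y) | f. pover (Domain M) f}"
    have "emb_graph h" unfolding h_def by (rule emb_graph_adjoin[OF aD ms(3) p y])
    moreover have "M \<subseteq> h"
    proof
      fix z assume "z \<in> M"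
      then obtain a where "a \<in> Domain M" "z = (a, \<sigma> a)" using ms(1) by (metis surj_pair)
      thus "z \<in> h" unfolding h_def
        by (auto intro!: exI[of _ "[:a:]"] simp: map_poly_pCons pover_pCons[OF ms(2)] pover_0[OF ms(2)])
    qed
    ultimately have "h = M" by (rule max)
    moreover have "(x, y) \<in> h" unfolding h_def
      by (auto intro!: exI[of _ "[:0, 1:]"] simp: map_poly_pCons pover_pCons[OF ms(2)] pover_0[OF ms(2)] subfld_0[OF ms(2)] subfld_1[OF ms(2)])
    ultimately show ?thesis by auto
  qed
  hence U: "Domain M = UNIV" by auto
  have hom: "fhom UNIV \<sigma>" using ms(3) U by simp
  have gs: "\<sigma> x = y" if "(x, y) \<in> g" for x y using that M(2) ms(1)[of x y] by auto
  have ks: "\<sigma> x = x" if "x \<in> k" for x using gs id that by blast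
  have inj: "inj \<sigma>"
  proof (rule injI)
    fix x y assume "\<sigma> x = \<sigma> y"
    hence "\<sigma> (x - y) = 0" using hom_diff[OF hom] by simp
    thus "x = y" using hom_nonzero[OF hom, of "x - y"] by auto
  qed
  have "surj \<sigma>"
  proof (unfold surj_def, rule allI)
    fix z
    obtain p where p: "pover k p" "p \<noteq> 0" "poly p z = 0" using k by (auto simp: algcl_def)
    define S where "S = {w. poly p w = 0}"
    have fin: "finite S" unfolding S_def using p(2) by (rule poly_roots_finite)
    have oU: "pover UNIV p" by (simp add: pover_def)
    have mp: "map_poly \<sigma> p = p"
      by (rule poly_eqI) (use p(1) ks hom_0[OF hom] in \<open>auto simp: coeff_map_poly pover_def\<close>)
    have "\<sigma> ` S \<subseteq> S"
    proof (rule image_subsetI)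
      fix w assume "w \<in> S"
      hence "\<sigma> (poly p w) = 0" using hom_0[OF hom] by (simp add: S_def)
      thus "\<sigma> w \<in> S" using hom_poly[OF hom oU, of w] mp by (simp add: S_def)
    qed
    hence "\<sigma> ` S = S" using fin inj by (meson endo_inj_surj inj_on_subset subset_UNIV)
    thus "\<exists>x. z = \<sigma> x" using p(3) by (auto simp: S_def)
  qed
  hence "\<sigma> \<in> Aut k" using hom inj ks by (auto simp: Aut_def bij_def)
  thus ?thesis using gs that by blast
qed

section \<open>Automorphisms and separable elements\<close>

lemma Aut_fhom: "\<sigma> \<in> Aut B ==> fhom UNIV \<sigma>"
  and Aut_bij: "\<sigma> \<in> Aut B ==> bij \<sigma>"
  and Aut_fix: "\<sigma> \<in> Aut B ==> x \<in> B ==> \<sigma> x = x"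
  by (auto simp: Aut_def)

lemma Aut_mono: "B \<subseteq> C ==> Aut C \<subseteq> Aut B"
  by (auto simp: Aut_def)

abbreviation finv :: "('w \<Rightarrow> 'w) \<Rightarrow> 'w \<Rightarrow> 'w" where
  "finv \<equiv> inv_into UNIV"

text \<open>Covers both \<open>Aut B\<close> and the decomposition groups \<open>Dec B V\<close>, so
  that Artin's theorem applies to either.\<close>

definition autgrp :: "('w::field \<Rightarrow> 'w) set \<Rightarrow> bool" where
  "autgrp H \<longleftrightarrow> (\<forall>\<sigma>\<in>H. fhom UNIV \<sigma> \<and> bij \<sigma> \<and> finv \<sigma> \<in> H) \<and> id \<in> H \<and> (\<forall>\<sigma>\<in>H. \<forall>\<tau>\<in>H. \<sigma> \<circ> \<tau> \<in> H)"

lemma fhom_inv: 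
  assumes "fhom UNIV \<sigma>" "bij \<sigma>" shows "fhom UNIV (finv \<sigma>)"
proof -
  have s: "\<sigma> (finv \<sigma> x) = x" for x using assms(2) by (simp add: bij_is_surj surj_f_inv_f)
  have i: "finv \<sigma> (\<sigma> x) = x" for x using assms(2) by (simp add: bij_is_inj)
  have "finv \<sigma> 1 = 1" using i[of 1] hom_1[OF assms(1)] by simp
  moreover have "finv \<sigma> (x - y) = finv \<sigma> x - finv \<sigma> y" for x y
    using i[of "finv \<sigma> x - finv \<sigma> y"] hom_diff[OF assms(1)] s by simp
  moreover have "finv \<sigma> (x * y) = finv \<sigma> x * finv \<sigma> y" for x y
    using i[of "finv \<sigma> x * finv \<sigma> y"] hom_mult[OF assms(1)] s by simp
  ultimately show ?thesis by (simp add: fhom_def)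
qed

lemma autgrp_Aut: "autgrp (Aut B)"
  unfolding autgrp_def
proof (intro conjI ballI)
  fix \<sigma> assume s: "\<sigma> \<in> Aut B"
  show "fhom UNIV \<sigma>" "bij \<sigma>" using s by (auto simp: Aut_def)
  have "finv \<sigma> x = x" if "x \<in> B" for x
    using s that by (metis Aut_bij Aut_fix bij_is_inj inv_f_f)
  thus "finv \<sigma> \<in> Aut B" using s fhom_inv by (auto simp: Aut_def bij_imp_bij_inv)
next
  show "id \<in> Aut B" by (auto simp: Aut_def fhom_def)
next
  fix \<sigma> \<tau> assume "\<sigma> \<in> Aut B" "\<tau> \<in> Aut B"
  thus "\<sigma> \<circ> \<tau> \<in> Aut B" by (auto simp: Aut_def fhom_def bij_comp)
qed

lemma autgrpD:
  assumes "autgrp H"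
  shows "\<sigma> \<in> H ==> fhom UNIV \<sigma>" "\<sigma> \<in> H ==> bij \<sigma>" "\<sigma> \<in> H ==> finv \<sigma> \<in> H" "id \<in> H"
    "\<sigma> \<in> H ==> \<tau> \<in> H ==> \<sigma> \<circ> \<tau> \<in> H"
  using assms by (auto simp: autgrp_def)

lemma bij_inv_simps: "bij \<sigma> ==> \<sigma> (finv \<sigma> x) = x" "bij \<sigma> ==> finv \<sigma> (\<sigma> x) = x"
  by (auto simp: bij_is_surj surj_f_inv_f bij_is_inj)

lemma image_gen:
  assumes "fhom UNIV \<sigma>" "bij \<sigma>" shows "\<sigma> ` gen S = gen (\<sigma> ` S)"
proof -
  have sub: "subfld (\<sigma> ` C)" if C: "subfld C" and s: "fhom UNIV \<sigma>" for C \<sigma>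
  proof -
    note h = hom_0[OF s] hom_1[OF s] hom_diff[OF s, symmetric]
        hom_mult[OF s, symmetric] hom_inverse[OF s, symmetric]
    show ?thesis unfolding subfld_def
      using C by (auto simp: h subfld_closed intro!: imageI image_eqI[of 0 \<sigma> 0] image_eqI[of 1 \<sigma> 1])
  qed
  have le: "gen (\<sigma> ` S) \<subseteq> \<sigma> ` gen S" if "fhom UNIV \<sigma>" for \<sigma> S
    by (rule gen_least[OF sub[OF subfld_gen that]]) (use gen_incl[of S] in auto)
  have "gen (finv \<sigma> ` \<sigma> ` S) \<subseteq> finv \<sigma> ` gen (\<sigma> ` S)" by (rule le[OF fhom_inv[OF assms]])
  hence "gen S \<subseteq> finv \<sigma> ` gen (\<sigma> ` S)" using assms(2) by (simp add: image_comp bij_is_inj)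
  hence "\<sigma> ` gen S \<subseteq> \<sigma> ` finv \<sigma> ` gen (\<sigma> ` S)" by (rule image_mono)
  hence "\<sigma> ` gen S \<subseteq> gen (\<sigma> ` S)" using assms(2) by (simp add: image_comp bij_inv_simps)
  thus ?thesis using le[OF assms(1)] by blast
qed

lemma fhom_subset: "fhom A \<sigma> ==> B \<subseteq> A ==> fhom B \<sigma>"
  by (auto simp: fhom_def)

lemma aut_agree_gen:
  assumes h: "fhom UNIV \<sigma>" "fhom UNIV \<tau>" and "\<And>x. x \<in> S ==> \<sigma> x = \<tau> x" "x \<in> gen S"
  shows "\<sigma> x = \<tau> x"
proof -
  have "subfld {x. \<sigma> x = \<tau> x}" unfolding subfld_def
    by (simp add: hom_0[OF h(1)] hom_0[OF h(2)] hom_1[OF h(1)] hom_1[OF h(2)] hom_diff[OF h(1)] hom_diff[OF h(2)]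
        hom_mult[OF h(1)] hom_mult[OF h(2)] hom_inverse[OF h(1)] hom_inverse[OF h(2)])
  from gen_least[OF this, of S] show ?thesis using assms by auto
qed

lemma Aut_extends:
  fixes A :: "'w::alg_closed_field set"
  assumes k: "algcl k" and A: "subfld A" "k \<subseteq> A" and \<sigma>: "fhom A \<sigma>" "\<And>x. x \<in> k ==> \<sigma> x = x"
  obtains \<tau> where "\<tau> \<in> Aut k" "\<And>x. x \<in> A ==> \<tau> x = \<sigma> x"
proof -
  define g where "g = {(x, \<sigma> x) | x. x \<in> A}"
  have "emb_graph g" unfolding emb_graph_def g_def
    using A by (auto simp: subfld_closed fhom_0[OF A(1) \<sigma>(1)] fhom_1[OF A(1) \<sigma>(1)]
      fhom_diff[OF A(1) \<sigma>(1)] fhom_mult[OF A(1) \<sigma>(1)] fhom_inverse[OF A(1) \<sigma>(1)])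
  then obtain \<tau> where "\<tau> \<in> Aut k" "\<And>x y. (x, y) \<in> g ==> \<tau> x = y"
    using emb_graph_extends[OF k, of g] A(2) \<sigma>(2) by (auto simp: g_def)
  thus ?thesis using that by (auto simp: g_def)
qed

lemma fhom_id: "fhom B id"
  by (auto simp: fhom_def)

lemma Aut_conj:
  fixes B :: "'w::alg_closed_field set"
  assumes B: "algcl B" and p: "minpol B x p" "poly p y = 0"
  obtains \<tau> where "\<tau> \<in> Aut B" "\<tau> x = y"
proof -
  have sB: "subfld B" using B by (rule algcl_subfld)
  define g where "g = {(poly f x, poly (map_poly id f) y) | f. pover B f}"
  have "emb_graph g" unfolding g_def by (rule emb_graph_adjoin[OF B fhom_id p(1)]) (use p in simp)
  moreover have "(c, c) \<in> g" if "c \<in> B" for c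
    using that by (auto simp: g_def pover_pCons[OF sB] pover_0[OF sB] intro!: exI[of _ "[:c:]"])
  ultimately obtain \<tau> where t: "\<tau> \<in> Aut B" "\<And>x y. (x, y) \<in> g ==> \<tau> x = y"
    using emb_graph_extends[OF B] by blast
  have "(x, y) \<in> g" using subfld_0[OF sB] subfld_1[OF sB]
    by (auto simp: g_def pover_pCons[OF sB] pover_0[OF sB] intro!: exI[of _ "[:0, 1:]"])
  thus ?thesis using t that by blast
qed

text \<open>For the identity embedding, the graph of \<open>emb_graph_adjoin\<close> has as domain a
  subfield that contains \<open>x\<close> and \<open>B\<close> and consists of polynomial values at
  \<open>x\<close>.\<close>

lemma adjoin_eq_polys:
  assumes "algcl B" "y \<in> gen (insert x B)" obtains f where "pover B f" "y = poly f x"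
proof -
  have sB: "subfld B" using assms(1) by (rule algcl_subfld)
  obtain p where p: "minpol B x p" using minpol_exists[OF assms(1)] .
  define g where "g = {(poly f x, poly (map_poly id f) x) | f. pover B f}"
  have g: "emb_graph g" unfolding g_def
    by (rule emb_graph_adjoin[OF assms(1) fhom_id p]) (use p in \<open>simp add: minpol_def\<close>)
  have "gen (insert x B) \<subseteq> Domain g"
  proof (rule gen_least[OF emb_graph_fhom(2)[OF g refl]])
    show "insert x B \<subseteq> Domain g"
    proof
      fix z assume "z \<in> insert x B"
      hence "pover B [:0, 1:]" "z = x \<or> pover B [:z:]" using subfld_0[OF sB] subfld_1[OF sB]
        by (auto simp: pover_pCons[OF sB] pover_0[OF sB])
      moreover have "z = x ==> poly [:0, 1:] x = z" "poly [:z:] x = z" by simp_all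
      ultimately obtain f where "pover B f" "poly f x = z" by blast
      hence "(z, poly (map_poly id f) x) \<in> g" by (auto simp: g_def)
      thus "z \<in> Domain g" by (rule DomainI)
    qed
  qed
  thus ?thesis using assms(2) that by (auto simp: g_def Domain_iff)
qed

section \<open>Products of distinct linear factors, separable elements and Galois subfields\<close>

abbreviation root_poly :: "'w::field set \<Rightarrow> 'w poly" where
  "root_poly R \<equiv> (\<Prod>r\<in>R. [:- r, 1:])"

lemma monic_root_poly: "lead_coeff (root_poly R) = 1"
  by (simp add: lead_coeff_prod)

lemma degree_root_poly: "finite R ==> degree (root_poly R) = card R"
  by (subst degree_prod_eq_sum_degree) auto

lemma poly_root_poly: "finite R ==> poly (root_poly R) x = 0 \<longleftrightarrow> x \<in> R"
  by (auto simp: poly_prod)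

text \<open>Each r in \<open>R\<close> is a root of \<open>p\<close> or of the cofactor
  \<open>h\<close> and is split off from that factor; what remains divides the smaller
  product.\<close>

lemma factor_root_poly:
  assumes "finite R" "p * h = root_poly R" "lead_coeff p = 1"
  shows "\<exists>R'\<subseteq>R. p = root_poly R'"
  using assms
proof (induction R arbitrary: p h rule: finite_induct)
  case empty
  hence ph: "p * h = 1" by simp
  hence "p \<noteq> 0" "h \<noteq> 0" by auto
  hence "degree p + degree h = 0" using ph by (metis degree_1 degree_mult_eq)
  then obtain c where "p = [:c:]" by (auto elim: degree_eq_zeroE)
  thus ?case using empty.prems by (auto simp: one_pCons)
next
  case (insert r R)
  have "poly (p * h) r = 0" using insert.prems(1) insert.hyps by (simp add: poly_root_poly)
  hence "poly p r = 0 \<or> poly h r = 0" by simp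
  thus ?case
  proof
    assume "poly p r = 0"
    then obtain p' where p': "p = [:- r, 1:] * p'" by (auto simp: poly_eq_0_iff_dvd)
    have "[:- r, 1:] * (p' * h) = [:- r, 1:] * root_poly R"
      using insert.prems(1) prod.insert[OF insert.hyps, of "\<lambda>r. [:- r, 1:]"] p' by (simp only: mult.assoc)
    hence "p' * h = root_poly R" by (subst (asm) mult_cancel_left) auto
    moreover have "lead_coeff p' = 1" using insert.prems(2) p' lead_coeff_mult[of "[:-r,1:]" p'] by simp
    ultimately obtain R' where R': "R' \<subseteq> R" "p' = root_poly R'" using insert.IH by blast
    have "r \<notin> R'" "finite R'" using R'(1) insert.hyps finite_subset by auto
    thus ?thesis using R' p' by (intro exI[of _ "insert r R'"]) auto
  next
    assume "poly h r = 0"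
    then obtain h' where h': "h = [:- r, 1:] * h'" by (auto simp: poly_eq_0_iff_dvd)
    have "[:- r, 1:] * (p * h') = [:- r, 1:] * root_poly R"
      using insert.prems(1) prod.insert[OF insert.hyps, of "\<lambda>r. [:- r, 1:]"] h' by (simp only: mult.left_commute)
    hence "p * h' = root_poly R" by (subst (asm) mult_cancel_left) auto
    thus ?thesis using insert.IH insert.prems(2) by blast
  qed
qed

text \<open>Separability without derivatives: the witness is a product of distinct linear factors,
  so orbit polynomials provide it directly.\<close>

definition Sep :: "'w::field set \<Rightarrow> 'w set" where
  "Sep B = {x. \<exists>R. finite R \<and> x \<in> R \<and> pover B (root_poly R)}"

lemma Sep_mono: "B \<subseteq> C ==> Sep B \<subseteq> Sep C"
  unfolding Sep_def using pover_mono by blast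

lemma Sep_base: "subfld B ==> B \<subseteq> Sep B"
  by (auto simp: Sep_def pover_pCons pover_0 subfld_1 subfld_uminus intro!: exI[of _ "{x}" for x])

lemma minpol_Sep:
  assumes "minpol B x p" "x \<in> Sep B"
  obtains R where "finite R" "p = root_poly R"
proof -
  obtain R0 where R0: "finite R0" "x \<in> R0" "pover B (root_poly R0)" using assms(2) by (auto simp: Sep_def)
  then obtain h where "root_poly R0 = p * h" using assms(1) unfolding minpol_def by (metis poly_root_poly)
  then obtain R where "R \<subseteq> R0" "p = root_poly R"
    using factor_root_poly[OF R0(1), of p h] assms(1) by (auto simp: minpol_def)
  thus ?thesis using that R0(1) finite_subset by blast
qed

text \<open>Induction on the generators: over B(s) the element is fixed by a smaller group, so it
  equals g(s) with deg g below the degree of s. Every conjugate r of s satisfies g(r) = x, so g - x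
  has more roots than its degree allows unless g is constant.\<close>

lemma fixed_gen_finite_Sep:
  fixes B :: "'w::alg_closed_field set"
  assumes "finite S" "algcl B" "S \<subseteq> Sep B" "x \<in> gen (B \<union> S)" "\<And>\<sigma>. \<sigma> \<in> Aut B ==> \<sigma> x = x"
  shows "x \<in> B"
  using assms
proof (induction S arbitrary: B rule: finite_induct)
  case empty thus ?case using gen_subfld[of B] by (simp add: algcl_def)
next
  case (insert s S)
  define B1 where "B1 = gen (insert s B)"
  have sB: "subfld B" using insert.prems(1) by (rule algcl_subfld)
  have BB1: "B \<subseteq> B1" unfolding B1_def using gen_incl[of "insert s B"] by auto
  have a1: "algcl B1" using algcl_mono[OF insert.prems(1) _ BB1] by (simp add: B1_def subfld_gen)
  have "gen (B1 \<union> S) = gen (B \<union> insert s S)" by (simp add: B1_def gen_Un_gen)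
  hence "x \<in> B1"
    using insert.IH[OF a1] insert.prems Sep_mono[OF BB1] Aut_mono[OF BB1] by blast
  then obtain f where f: "pover B f" "x = poly f s"
    using adjoin_eq_polys[OF insert.prems(1)] by (auto simp: B1_def)
  obtain p where p: "minpol B s p" using minpol_exists[OF insert.prems(1)] .
  obtain R where R: "finite R" "p = root_poly R" using minpol_Sep[OF p] insert.prems(2) by auto
  obtain h g where hg: "pover B h" "pover B g" "f = p * h + g" 
    "g = 0 \<or> degree g < degree p"
    using pover_divmod_monic[OF sB f(1), of p] p unfolding minpol_def by blast
  have xg: "x = poly g s" using f hg p by (simp add: minpol_def)
  have "poly (g - [:x:]) r = 0" if "r \<in> R" for r
  proof -
    obtain \<sigma> where s: "\<sigma> \<in> Aut B" "\<sigma> s = r" 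
      using Aut_conj[OF insert.prems(1) p, of r] poly_root_poly[OF R(1), of r] R(2) \<open>r \<in> R\<close> by metis
    have "map_poly \<sigma> g = g" 
      by (rule fhom_map_id[OF sB fhom_subset[OF Aut_fhom[OF s(1)]] hg(2)]) (use Aut_fix[OF s(1)] in auto)
    hence "\<sigma> x = poly g r" using hom_poly[OF Aut_fhom[OF s(1)], of g s] xg s(2) 
      by (simp add: pover_def)
    thus ?thesis using insert.prems(4)[OF s(1)] by simp
  qed
  hence sub: "R \<subseteq> {r. poly (g - [:x:]) r = 0}" by auto
  have "g - [:x:] = 0"
  proof (rule ccontr)
    assume nz: "g - [:x:] \<noteq> 0"
    have "card R \<le> card {r. poly (g - [:x:]) r = 0}" by (rule card_mono[OF poly_roots_finite[OF nz] sub])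
    also have "\<dots> \<le> degree (g - [:x:])" by (rule card_poly_roots_bound[OF nz])
    also have "\<dots> \<le> degree g" using degree_diff_le_max[of g "[:x:]"] by simp
    finally have "degree p \<le> degree g" using R by (simp add: degree_root_poly)
    thus False using hg(4) minpol_degree_pos[OF p] by (auto simp: degree_root_poly)
  qed
  hence "g = [:x:]" by simp
  thus "x \<in> B" using hg(2) pover_pCons[OF sB] by auto
qed

lemma fixed_gen_Sep:
  fixes B :: "'w::alg_closed_field set"
  assumes "algcl B" "x \<in> gen (B \<union> Sep B)" "\<And>\<sigma>. \<sigma> \<in> Aut B ==> \<sigma> x = x"
  shows "x \<in> B"
proof -
  obtain T where T: "finite T" "T \<subseteq> B \<union> Sep B" "x \<in> gen T" using gen_finite_subset[OF assms(2)] .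
  have "x \<in> gen (B \<union> (T - B))" using T(3) gen_mono[of T "B \<union> (T - B)"] by auto
  thus ?thesis using fixed_gen_finite_Sep[of "T - B" B x] T assms by auto
qed

lemma root_poly_fixed:
  assumes "fhom UNIV \<tau>" "bij \<tau>" "finite R" "\<tau> ` R = R"
  shows "\<tau> (coeff (root_poly R) i) = coeff (root_poly R) i"
proof -
  have "map_poly \<tau> (root_poly R) = (\<Prod>r\<in>R. map_poly \<tau> [:- r, 1:])"
    by (rule hom_map_prod[OF assms(1)]) (auto simp: pover_def)
  also have "\<dots> = (\<Prod>r\<in>R. [:- \<tau> r, 1:])"
    by (simp add: map_poly_pCons hom_0[OF assms(1)] hom_1[OF assms(1)] 
        hom_uminus[OF assms(1)])
  also have "\<dots> = (\<Prod>r\<in>\<tau> ` R. [:- r, 1:])"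
    by (subst prod.reindex) (use assms(2) in \<open>auto intro: inj_on_subset bij_is_inj\<close>)
  finally have "map_poly \<tau> (root_poly R) = root_poly R" using assms(4) by simp
  thus ?thesis by (metis coeff_map_poly hom_0[OF assms(1)])
qed

lemma self_orbit: "autgrp H ==> f id = y ==> y \<in> f ` H"
  using autgrpD(4) by blast

lemma autgrp_orbit:
  assumes "autgrp H" "\<tau> \<in> H" shows "\<tau> ` (\<lambda>\<sigma>. \<sigma> x) ` H = (\<lambda>\<sigma>. \<sigma> x) ` H"
proof
  show "\<tau> ` (\<lambda>\<sigma>. \<sigma> x) ` H \<subseteq> (\<lambda>\<sigma>. \<sigma> x) ` H"
  proof (intro image_subsetI, clarify)
    fix \<sigma> assume s: "\<sigma> \<in> H"
    show "\<tau> (\<sigma> x) \<in> (\<lambda>\<sigma>. \<sigma> x) ` H" using autgrpD(5)[OF assms s] by (auto intro!: rev_image_eqI)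
  qed
  show "(\<lambda>\<sigma>. \<sigma> x) ` H \<subseteq> \<tau> ` (\<lambda>\<sigma>. \<sigma> x) ` H"
  proof (rule image_subsetI)
    fix \<sigma> assume s: "\<sigma> \<in> H"
    have "finv \<tau> \<circ> \<sigma> \<in> H" using autgrpD(3,5)[OF assms(1)] assms(2) s by blast
    moreover have "\<sigma> x = \<tau> ((finv \<tau> \<circ> \<sigma>) x)" using autgrpD(2)[OF assms] by (simp add: bij_inv_simps)
    ultimately show "\<sigma> x \<in> \<tau> ` (\<lambda>\<sigma>. \<sigma> x) ` H" by (rule_tac image_eqI) (auto intro: rev_image_eqI)
  qed
qed

lemma pover_coeff: "subfld B ==> R \<subseteq> B ==> pover B (root_poly R)"
proof (induction R rule: infinite_finite_induct)
  case (insert r R)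
  thus ?case using pover_mult[OF insert.prems(1), of "[:- r, 1:]" "root_poly R"] 
    by (simp del: mult_pCons_left add: pover_pCons pover_0 subfld_1 subfld_uminus)
qed (auto simp: pover_1)

lemma finite_orbit:
  assumes B: "algcl B" shows "finite ((\<lambda>\<sigma>. \<sigma> x) ` Aut B)"
proof -
  obtain p where p: "pover B p" "p \<noteq> 0" "poly p x = 0" using B by (auto simp: algcl_def)
  have "(\<lambda>\<sigma>. \<sigma> x) ` Aut B \<subseteq> {y. poly p y = 0}"
  proof (rule image_subsetI)
    fix \<sigma> assume s: "\<sigma> \<in> Aut B"
    have "map_poly \<sigma> p = p" 
      by (rule fhom_map_id[OF algcl_subfld[OF B] fhom_subset[OF Aut_fhom[OF s]] p(1)]) (use Aut_fix[OF s] in auto)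
    hence "\<sigma> (poly p x) = poly p (\<sigma> x)" using hom_poly[OF Aut_fhom[OF s], of p x] by (simp add: pover_def)
    thus "\<sigma> x \<in> {y. poly p y = 0}" using p(3) hom_0[OF Aut_fhom[OF s]] by simp
  qed
  thus ?thesis using poly_roots_finite[OF p(2)] finite_subset by blast
qed

lemma orbit_poly:
  assumes B: "algcl B" and H: "autgrp H" "H \<subseteq> Aut B"
  shows "finite ((\<lambda>\<sigma>. \<sigma> x) ` H)" "x \<in> (\<lambda>\<sigma>. \<sigma> x) ` H"
    "\<tau> \<in> H ==> \<tau> (coeff (root_poly ((\<lambda>\<sigma>. \<sigma> x) ` H)) i) = coeff (root_poly ((\<lambda>\<sigma>. \<sigma> x) ` H)) i"
proof -
  show fin: "finite ((\<lambda>\<sigma>. \<sigma> x) ` H)" using finite_orbit[OF B] H(2) by (meson finite_subset image_mono)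
  show "x \<in> (\<lambda>\<sigma>. \<sigma> x) ` H" by (rule self_orbit[OF H(1)]) simp
  show "\<tau> (coeff (root_poly ((\<lambda>\<sigma>. \<sigma> x) ` H)) i) = coeff (root_poly ((\<lambda>\<sigma>. \<sigma> x) ` H)) i" if t: "\<tau> \<in> H"
    by (rule root_poly_fixed[OF autgrpD(1,2)[OF H(1) t] fin autgrp_orbit[OF H(1) t]])
qed

lemma Sep_stable:
  assumes B: "subfld B" and s: "\<sigma> \<in> Aut B" and x: "x \<in> Sep B" shows "\<sigma> x \<in> Sep B"
proof -
  obtain R where R: "finite R" "x \<in> R" "pover B (root_poly R)" using x by (auto simp: Sep_def)
  have "map_poly \<sigma> (root_poly R) = root_poly R" 
    by (rule fhom_map_id[OF B fhom_subset[OF Aut_fhom[OF s]] R(3)]) (use Aut_fix[OF s] in auto)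
  hence "\<sigma> (poly (root_poly R) x) = poly (root_poly R) (\<sigma> x)" 
    using hom_poly[OF Aut_fhom[OF s], of "root_poly R" x] by (simp add: pover_def)
  moreover have "poly (root_poly R) x = 0" using R poly_root_poly by blast
  ultimately have "\<sigma> x \<in> R" using poly_root_poly[OF R(1)] hom_0[OF Aut_fhom[OF s]] by metis
  thus ?thesis using R by (auto simp: Sep_def)
qed

text \<open>An element of the field generated by separable elements has an orbit polynomial with
  coefficients in that field and fixed by \<open>Aut B\<close>, hence over \<open>B\<close>. Its
  roots are distinct, so the element is separable: \<open>Sep B\<close> is a subfield.\<close>

lemma gen_Sep:
  fixes B :: "'w::alg_closed_field set"
  assumes B: "algcl B" shows "gen (B \<union> Sep B) = Sep B"
proof
  show "gen (B \<union> Sep B) \<subseteq> Sep B"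
  proof
    fix x assume x: "x \<in> gen (B \<union> Sep B)"
    define R where "R = (\<lambda>\<sigma>. \<sigma> x) ` Aut B"
    have st: "\<sigma> ` gen (B \<union> Sep B) \<subseteq> gen (B \<union> Sep B)" if s: "\<sigma> \<in> Aut B" for \<sigma>
      using Sep_stable[OF algcl_subfld[OF B] s] Aut_fix[OF s]
      by (subst image_gen[OF Aut_fhom[OF s] Aut_bij[OF s]]) (auto intro!: gen_mono)
    hence RS: "R \<subseteq> gen (B \<union> Sep B)" using x unfolding R_def by blast
    note orb = orbit_poly[OF B autgrp_Aut order.refl, where x = x, folded R_def]
    have "pover B (root_poly R)" unfolding pover_def
    proof (intro allI fixed_gen_Sep[OF B])
      fix i
      show "coeff (root_poly R) i \<in> gen (B \<union> Sep B)"
        using pover_coeff[OF subfld_gen RS] by (simp add: pover_def)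
    qed (rule orb(3))
    thus "x \<in> Sep B" using orb by (auto simp: Sep_def)
  qed
  show "Sep B \<subseteq> gen (B \<union> Sep B)" using gen_incl[of "B \<union> Sep B"] by auto
qed

lemma subfld_Sep: "algcl (B :: 'w::alg_closed_field set) ==> subfld (Sep B)"
  using gen_Sep subfld_gen by metis

lemma Sep_fixed:
  fixes B :: "'w::alg_closed_field set"
  assumes "algcl B" "x \<in> Sep B" "\<And>\<sigma>. \<sigma> \<in> Aut B ==> \<sigma> x = x" shows "x \<in> B"
  using fixed_gen_Sep[OF assms(1)] assms(2,3) gen_Sep[OF assms(1)] by simp

text \<open>Galois of possibly infinite degree. Finiteness is the separate condition that
  \<open>Rst (Aut B) A\<close> is finite.\<close>

definition Gal :: "'w::field set \<Rightarrow> 'w set \<Rightarrow> bool" where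
  "Gal B A \<longleftrightarrow> subfld A \<and> B \<subseteq> A \<and> A \<subseteq> Sep B \<and> (\<forall>\<sigma>\<in>Aut B. \<sigma> ` A \<subseteq> A)"

lemma stable_image:
  assumes "autgrp H" "\<And>\<sigma>. \<sigma> \<in> H ==> \<sigma> ` A \<subseteq> A" "\<sigma> \<in> H" shows "\<sigma> ` A = A"
proof
  show "\<sigma> ` A \<subseteq> A" using assms by blast
  show "A \<subseteq> \<sigma> ` A"
  proof
    fix x assume "x \<in> A"
    hence "finv \<sigma> x \<in> A" using assms(2)[OF autgrpD(3)[OF assms(1,3)]] by auto
    thus "x \<in> \<sigma> ` A" using autgrpD(2)[OF assms(1,3)] by (metis bij_inv_simps(1) imageI)
  qed
qed

lemma Gal_image: "Gal B A ==> \<sigma> \<in> Aut B ==> \<sigma> ` A = A"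
  by (rule stable_image[OF autgrp_Aut]) (auto simp: Gal_def)

lemma Gal_mem: "Gal B A ==> \<sigma> \<in> Aut B ==> x \<in> A ==> \<sigma> x \<in> A"
  unfolding Gal_def by blast

lemma Gal_D: "Gal B A ==> subfld A" "Gal B A ==> B \<subseteq> A" "Gal B A ==> A \<subseteq> Sep B"
  by (auto simp: Gal_def)

lemma Gal_gen:
  fixes B :: "'w::alg_closed_field set"
  assumes "algcl B" "S \<subseteq> Sep B" "\<And>\<sigma> x. \<sigma> \<in> Aut B ==> x \<in> S ==> \<sigma> x \<in> gen (B \<union> S)"
  shows "Gal B (gen (B \<union> S))"
  unfolding Gal_def
proof (intro conjI ballI)
  show "subfld (gen (B \<union> S))" by (rule subfld_gen)
  show "B \<subseteq> gen (B \<union> S)" using gen_incl[of "B \<union> S"] by auto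
  show "gen (B \<union> S) \<subseteq> Sep B"
    by (rule gen_least[OF subfld_Sep[OF assms(1)]]) (use assms(2) Sep_base[OF algcl_subfld[OF assms(1)]] in auto)
  fix \<sigma> assume s: "\<sigma> \<in> Aut B"
  have "\<sigma> ` (B \<union> S) \<subseteq> gen (B \<union> S)" using assms(3)[OF s] Aut_fix[OF s] gen_incl[of "B \<union> S"] by auto
  thus "\<sigma> ` gen (B \<union> S) \<subseteq> gen (B \<union> S)"
    unfolding image_gen[OF Aut_fhom[OF s] Aut_bij[OF s]] by (rule gen_least[OF subfld_gen])
qed

lemma Gal_Union:
  fixes B :: "'w::alg_closed_field set"
  assumes "algcl B" "\<And>A. A \<in> \<A> ==> Gal B A" shows "Gal B (gen (B \<union> \<Union>\<A>))"
proof (rule Gal_gen[OF assms(1)])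
  show "\<Union>\<A> \<subseteq> Sep B" using assms(2) by (auto simp: Gal_def)
  fix \<sigma> x assume "\<sigma> \<in> Aut B" "x \<in> \<Union>\<A>"
  thus "\<sigma> x \<in> gen (B \<union> \<Union>\<A>)" using assms(2) gen_incl[of "B \<union> \<Union>\<A>"] by (meson Gal_mem UnI2 UnionE UnionI in_mono)
qed

lemma Gal_comp:
  fixes B :: "'w::alg_closed_field set"
  assumes "algcl B" "Gal B A1" "Gal B A2" shows "Gal B (gen (A1 \<union> A2))"
proof -
  have "B \<union> \<Union>{A1, A2} = A1 \<union> A2" using Gal_D(2)[OF assms(2)] by auto
  thus ?thesis using Gal_Union[OF assms(1), of "{A1, A2}"] assms(2,3) by auto
qed

lemma Gal_Int:
  "Gal B A1 ==> Gal B A2 ==> Gal B (A1 \<inter> A2)"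
  unfolding Gal_def by (auto simp: subfld_Int image_subset_iff)

lemma Gal_lift:
  fixes B :: "'w::alg_closed_field set"
  assumes "algcl B" "Gal B A" "B \<subseteq> C" "subfld C" shows "Gal C (gen (C \<union> A))"
proof (rule Gal_gen)
  show "algcl C" using algcl_mono assms by blast
  show "A \<subseteq> Sep C" using Gal_D(3)[OF assms(2)] Sep_mono[OF assms(3)] by auto
  fix \<sigma> x assume "\<sigma> \<in> Aut C" "x \<in> A"
  thus "\<sigma> x \<in> gen (C \<union> A)" using Aut_mono[OF assms(3)] Gal_mem[OF assms(2)] gen_incl[of "C \<union> A"] by blast
qed

lemma Gal_top:
  fixes B :: "'w::alg_closed_field set"
  assumes "Gal B A" "B \<subseteq> C" "C \<subseteq> A" shows "Gal C A"
  unfolding Gal_def using assms Sep_mono[OF assms(2)] Aut_mono[OF assms(2)] by (auto simp: Gal_def image_subset_iff)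

lemma Gal_fixed:
  fixes B :: "'w::alg_closed_field set"
  assumes "algcl B" "Gal B A" "B \<subseteq> C" "subfld C" "x \<in> A" "\<And>\<sigma>. \<sigma> \<in> Aut C ==> \<sigma> x = x" shows "x \<in> C"
  using Sep_fixed[OF algcl_mono[OF assms(1,4,3)]] assms Sep_mono[OF assms(3)] Gal_D(3)[OF assms(2)] by blast

section \<open>Linear algebra over subfields\<close>

text \<open>Indexed families rather than sets, so that a repeated entry counts as a
  dependence.\<close>

definition indep :: "'w::field set \<Rightarrow> 'i set \<Rightarrow> ('i \<Rightarrow> 'w) \<Rightarrow> bool" where
  "indep F I x \<longleftrightarrow> (\<forall>c. (\<forall>i\<in>I. c i \<in> F) \<longrightarrow> (\<Sum>i\<in>I. c i * x i) = 0 \<longrightarrow> (\<forall>i\<in>I. c i = 0))"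

abbreviation dimn :: "nat \<Rightarrow> 'w::field set \<Rightarrow> 'w set \<Rightarrow> bool" where
  "dimn \<equiv> ring.dimension (ring_of_type_algebra :: 'w ring)"

lemma ring_simps [simp]:
  "carrier (ring_of_type_algebra :: 'w::field ring) = UNIV"
  "x \<otimes>\<^bsub>(ring_of_type_algebra :: 'w::field ring)\<^esub> y = x * y"
  "x \<oplus>\<^bsub>(ring_of_type_algebra :: 'w::field ring)\<^esub> y = x + y"
  "\<one>\<^bsub>(ring_of_type_algebra :: 'w::field ring)\<^esub> = 1"
  "\<zero>\<^bsub>(ring_of_type_algebra :: 'w::field ring)\<^esub> = 0"
  by (auto simp: ring_of_type_algebra_def)

lemma field_Om: "Ring.field (ring_of_type_algebra :: 'w::field ring)"
  by (rule field_from_type_algebra)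

lemma ring_Om: "ring (ring_of_type_algebra :: 'w::field ring)"
  by (rule ring_from_type_algebra)

lemma Om_uminus [simp]: "\<ominus>\<^bsub>(ring_of_type_algebra :: 'w::field ring)\<^esub> x = - x"
proof -
  interpret ring "ring_of_type_algebra :: 'w ring" by (rule ring_Om)
  show ?thesis using minus_equality[of "- x" x] by simp
qed

lemma Om_inv: "x \<noteq> 0 ==> inv\<^bsub>(ring_of_type_algebra :: 'w::field ring)\<^esub> x = inverse x"
proof -
  assume x: "x \<noteq> 0"
  interpret Ring.field "ring_of_type_algebra :: 'w ring" by (rule field_Om)
  show ?thesis by (rule comm_inv_char) (use x in auto)
qed

lemma subfield_iff_subfld: "subfield B (ring_of_type_algebra :: 'w::field ring) \<longleftrightarrow> subfld B"
proof
  interpret Ring.field "ring_of_type_algebra :: 'w ring" by (rule field_Om)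
  assume B: "subfield B (ring_of_type_algebra :: 'w ring)"
  note sr = subringE[OF subfieldE(1)[OF B]]
  have add: "x + y \<in> B" "- x \<in> B" if "x \<in> B" "y \<in> B" for x y using sr(5)[of x] sr(7)[of x y] that by simp_all
  show "subfld B" unfolding subfld_def
  proof (intro conjI ballI)
    show "0 \<in> B" "1 \<in> B" using sr by auto
    fix x y assume "x \<in> B" "y \<in> B"
    thus "x - y \<in> B" "x * y \<in> B" using add(1)[of x "- y"] add(2)[of y x] sr(6)[of x y] by auto
  next
    fix x assume "x \<in> B"
    show "inverse x \<in> B"
    proof (cases "x = 0")
      case True thus ?thesis using sr by auto
    next
      case False thus ?thesis using subfield_m_inv(1)[OF B, of x] \<open>x \<in> B\<close> Om_inv[OF False] by simp
    qed
  qed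
next
  interpret Ring.field "ring_of_type_algebra :: 'w ring" by (rule field_Om)
  assume B: "subfld B"
  have sr: "subring B (ring_of_type_algebra :: 'w ring)"
    by (rule subringI) (use B in \<open>auto simp: subfld_closed\<close>)
  show "subfield B (ring_of_type_algebra :: 'w ring)"
    by (rule subfieldI'[OF sr]) (use B in \<open>auto simp: Om_inv subfld_closed\<close>)
qed

lemma generate_field_eq_gen: "generate_field (ring_of_type_algebra :: 'w::field ring) S = gen S"
proof
  interpret Ring.field "ring_of_type_algebra :: 'w ring" by (rule field_Om)
  show "generate_field ring_of_type_algebra S \<subseteq> gen S"
    by (rule generate_field_min_subfield1) (auto simp: subfield_iff_subfld subfld_gen gen_incl)
  have "subfld (generate_field ring_of_type_algebra S)"
    using generate_field_is_subfield[of S] by (simp add: subfield_iff_subfld)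
  thus "gen S \<subseteq> generate_field ring_of_type_algebra S"
    by (rule gen_least) (auto intro: generate_field.incl)
qed

lemma line_extension_iff: "u \<in> ring.line_extension (ring_of_type_algebra :: 'w::field ring) K a E 
    \<longleftrightarrow> (\<exists>k\<in>K. \<exists>v\<in>E. u = k * a + v)"
proof -
  interpret ring "ring_of_type_algebra :: 'w ring" by (rule ring_Om)
  show ?thesis by (auto simp: line_extension_mem_iff)
qed

lemma dimn_basis:
  assumes "dimn n F E" "subfld F"
  shows "\<exists>x. indep F {..<n} x \<and> E = {\<Sum>i<n. c i * x i | c. \<forall>i<n. c i \<in> F}"
proof -
  interpret ring "ring_of_type_algebra :: 'a ring" by (rule ring_Om)
  show ?thesis using assms
  proof (induction rule: dimension.induct)
    case (zero_dim F) thus ?case by (auto simp: indep_def)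
  next
    case (Suc_dim v E n F)
    then obtain x where x: "indep F {..<n} x" "E = {\<Sum>i<n. c i * x i | c. \<forall>i<n. c i \<in> F}" by blast
    define x' where "x' = x(n := v)"
    have s: "(\<Sum>i<Suc n. c i * x' i) = (\<Sum>i<n. c i * x i) + c n * v" for c
      by (simp add: x'_def)
    have "c i = 0" if c: "\<forall>i<Suc n. c i \<in> F" "(\<Sum>i<n. c i * x i) + c n * v = 0" "i < Suc n" for c i
    proof -
      have "c n = 0"
      proof (rule ccontr)
        assume "c n \<noteq> 0"
        hence "v = - inverse (c n) * (\<Sum>i<n. c i * x i)" using c(2)
          by (simp add: field_simps) (metis add.commute add_eq_0_iff)
        hence "v = (\<Sum>i<n. (- inverse (c n) * c i) * x i)" by (simp add: sum_distrib_left mult.assoc)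
        moreover have "\<forall>i<n. - inverse (c n) * c i \<in> F" using c(1) Suc_dim.prems by (auto intro!: subfld_closed)
        ultimately have "v \<in> E" unfolding x(2) mem_Collect_eq by (intro exI[of _ "\<lambda>i. - inverse (c n) * c i"]) simp
        thus False using Suc_dim.hyps by simp
      qed
      moreover from this have "\<forall>i<n. c i = 0" using x(1) c unfolding indep_def by simp
      ultimately show ?thesis using c(3) less_Suc_eq by auto
    qed
    hence "indep F {..<Suc n} x'" unfolding indep_def s by auto
    moreover have "line_extension F v E = {\<Sum>i<Suc n. c i * x' i | c. \<forall>i<Suc n. c i \<in> F}"
    proof (intro equalityI subsetI)
      fix u assume "u \<in> line_extension F v E"
      then obtain k c where k: "k \<in> F" "\<forall>i<n. c i \<in> F" "u = k * v + (\<Sum>i<n. c i * x i)"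
        unfolding line_extension_iff x(2) by auto
      hence "u = (\<Sum>i<Suc n. (c(n := k)) i * x' i)" unfolding s by simp
      moreover have "\<forall>i<Suc n. (c(n := k)) i \<in> F" using k by (auto simp: less_Suc_eq)
      ultimately show "u \<in> {\<Sum>i<Suc n. c i * x' i | c. \<forall>i<Suc n. c i \<in> F}" by blast
    next
      fix u assume "u \<in> {\<Sum>i<Suc n. c i * x' i | c. \<forall>i<Suc n. c i \<in> F}"
      then obtain c where c: "\<forall>i<Suc n. c i \<in> F" "u = (\<Sum>i<n. c i * x i) + c n * v" unfolding s by auto
      have "(\<Sum>i<n. c i * x i) \<in> E" unfolding x(2) using c by auto
      thus "u \<in> line_extension F v E" unfolding line_extension_iff using c by (force simp: add.commute)
    qed
    ultimately show ?case by blast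
  qed
qed

lemma basis_mem:
  fixes n :: nat
  assumes "subfld F" "i < n" shows "b i \<in> {\<Sum>i<n. c i * b i | c. \<forall>i<n. c i \<in> F}"
proof -
  have "(\<Sum>j<n. (if j = i then 1 else 0) * b j) = (\<Sum>j<n. if j = i then b j else 0)"
    by (rule sum.cong) auto
  also have "\<dots> = b i" using sum.delta[of "{..<n}" i b] assms(2) by auto
  finally have "b i = (\<Sum>j<n. (if j = i then 1 else 0) * b j)" by simp
  moreover have "\<forall>j<n. (if j = i then 1 else 0) \<in> F" using assms(1) by (auto simp: subfld_closed)
  ultimately show ?thesis unfolding mem_Collect_eq by (intro exI conjI)
qed

text \<open>Gaussian elimination, one equation at a time: a nonzero entry at \<open>i0\<close>
  removes the unknown \<open>i0\<close> from the other equations, which lowers both counts by one.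
  All steps stay inside \<open>F\<close>.\<close>

lemma homogeneous_system:
  fixes M :: "'j \<Rightarrow> 'i \<Rightarrow> 'w::field"
  assumes F: "subfld F" and "finite J" "finite I" "card J < card I" "\<And>j i. j \<in> J ==> i \<in> I ==> M j i \<in> F"
  shows "\<exists>c. (\<forall>i\<in>I. c i \<in> F) \<and> (\<exists>i\<in>I. c i \<noteq> 0) \<and> (\<forall>j\<in>J. (\<Sum>i\<in>I. M j i * c i) = 0)"
  using assms(2-)
proof (induction J arbitrary: I M rule: finite_induct)
  case empty
  then obtain i where "i \<in> I" by fastforce
  thus ?case using F by (intro exI[of _ "\<lambda>_. 1"]) (auto simp: subfld_1)
next
  case (insert j J)
  show ?case
  proof (cases "\<forall>i\<in>I. M j i = 0")
    case True
    have "card J < card I" using insert by simp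
    then obtain c where "\<forall>i\<in>I. c i \<in> F" "\<exists>i\<in>I. c i \<noteq> 0" "\<forall>j\<in>J. (\<Sum>i\<in>I. M j i * c i) = 0"
      using insert.IH[of I M] insert.prems by blast
    thus ?thesis using True by (intro exI[of _ c]) auto
  next
    case False
    then obtain i0 where i0: "i0 \<in> I" "M j i0 \<noteq> 0" by blast
    define I' where "I' = I - {i0}"
    define M' where "M' = (\<lambda>j' i. M j' i - M j' i0 * M j i / M j i0)"
    have "card J < card I'" using insert i0 by (simp add: I'_def)
    moreover have "M' j' i \<in> F" if "j' \<in> J" "i \<in> I'" for j' i
      unfolding M'_def using that insert.prems i0 F by (auto simp: I'_def intro!: subfld_closed)
    ultimately obtain c where c: "\<forall>i\<in>I'. c i \<in> F" "\<exists>i\<in>I'. c i \<noteq> 0" "\<forall>j\<in>J. (\<Sum>i\<in>I'. M' j i * c i) = 0"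
      using insert.IH[of I' M'] insert.prems by (auto simp: I'_def)
    define S where "S = (\<Sum>i\<in>I'. M j i * c i)"
    \<comment> \<open>The value at \<open>i0\<close> is the one forced by equation
      \<open>j\<close>.\<close>
    define c' where "c' = c(i0 := - S / M j i0)"
    have S: "S \<in> F" unfolding S_def using c(1) insert.prems F by (auto simp: I'_def intro!: subfld_closed)
    have sum: "(\<Sum>i\<in>I. M j' i * c' i) = M j' i0 * (- S / M j i0) + (\<Sum>i\<in>I'. M j' i * c i)" for j'
    proof -
      have "(\<Sum>i\<in>I'. M j' i * c' i) = (\<Sum>i\<in>I'. M j' i * c i)" 
        by (rule sum.cong) (auto simp: c'_def I'_def)
      thus ?thesis using sum.remove[OF \<open>finite I\<close> i0(1), of "\<lambda>i. M j' i * c' i"] by (simp add: I'_def c'_def)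
    qed
    have "(\<Sum>i\<in>I. M j' i * c' i) = 0" if "j' \<in> J" for j'
    proof -
      have "(\<Sum>i\<in>I'. M' j' i * c i) = (\<Sum>i\<in>I'. M j' i * c i) - M j' i0 / M j i0 * S"
        unfolding M'_def S_def sum_distrib_left sum_subtractf[symmetric] by (rule sum.cong) (auto simp: algebra_simps)
      thus ?thesis using c(3) that unfolding sum by (simp add: field_simps)
    qed
    moreover have "(\<Sum>i\<in>I. M j i * c' i) = 0" unfolding sum using i0(2) by (simp add: S_def[symmetric])
    moreover have "\<forall>i\<in>I. c' i \<in> F" using c(1) S i0 insert.prems F 
      by (auto simp: c'_def I'_def intro!: subfld_closed)
    moreover have "\<exists>i\<in>I. c' i \<noteq> 0" using c(2) by (auto simp: c'_def I'_def)
    ultimately show ?thesis by (intro exI[of _ c']) auto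
  qed
qed

lemma indep_le_dimn:
  assumes "dimn n F E" "subfld F" "finite I" "indep F I x" "\<And>i. i \<in> I ==> x i \<in> E"
  shows "card I \<le> n"
proof (rule ccontr)
  assume "\<not> card I \<le> n"
  obtain b where b: "E = {\<Sum>i<n. c i * b i | c. \<forall>i<n. c i \<in> F}" using dimn_basis[OF assms(1,2)] by blast
  have "\<forall>i\<in>I. \<exists>c. x i = (\<Sum>j<n. c j * b j) \<and> (\<forall>j<n. c j \<in> F)" using assms(5) b by auto
  then obtain C where C: "\<And>i. i \<in> I ==> x i = (\<Sum>j<n. C i j * b j)" "\<And>i j. i \<in> I ==> j < n ==> C i j \<in> F" by metis
  have "\<exists>c. (\<forall>i\<in>I. c i \<in> F) \<and> (\<exists>i\<in>I. c i \<noteq> 0) \<and> (\<forall>j\<in>{..<n}. (\<Sum>i\<in>I. C i j * c i) = 0)"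
    by (rule homogeneous_system[OF assms(2) _ assms(3)]) (use C \<open>\<not> card I \<le> n\<close> in auto)
  then obtain c where c: "\<forall>i\<in>I. c i \<in> F" "\<exists>i\<in>I. c i \<noteq> 0" "\<forall>j<n. (\<Sum>i\<in>I. C i j * c i) = 0" by auto
  have "(\<Sum>i\<in>I. c i * x i) = (\<Sum>i\<in>I. \<Sum>j<n. (C i j * c i) * b j)"
    by (rule sum.cong) (auto simp: C(1) sum_distrib_left algebra_simps)
  also have "\<dots> = (\<Sum>j<n. (\<Sum>i\<in>I. C i j * c i) * b j)" by (subst sum.swap) (simp add: sum_distrib_right)
  also have "\<dots> = 0" using c(3) by simp
  finally show False using assms(4) c unfolding indep_def by blast
qed

section \<open>Artin's theorem\<close>

text \<open>For \<open>H = Aut B\<close> and \<open>A\<close> Galois over \<open>B\<close> this is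
  the Galois group of A/B; extensional restriction makes equal actions count once.\<close>

definition Rst :: "('w \<Rightarrow> 'w) set \<Rightarrow> 'w set \<Rightarrow> ('w \<Rightarrow> 'w) set" where
  "Rst H A = (\<lambda>\<sigma>. restrict \<sigma> A) ` H"

lemma Rst_mem: "\<rho> \<in> Rst H A ==> \<exists>\<sigma>\<in>H. \<forall>x\<in>A. \<rho> x = \<sigma> x"
  by (auto simp: Rst_def)

lemma Rst_eqI: "\<rho> \<in> Rst H A ==> \<rho>' \<in> Rst H' A ==> (\<And>x. x \<in> A ==> \<rho> x = \<rho>' x) ==> \<rho> = \<rho>'"
  by (auto simp: Rst_def restrict_def fun_eq_iff)

lemma restrict_eq_iff: "restrict \<sigma> A = restrict \<tau> A \<longleftrightarrow> (\<forall>x\<in>A. \<sigma> x = \<tau> x)"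
  by (metis restrict_apply' restrict_ext)

definition fixed_in :: "('w \<Rightarrow> 'w) set \<Rightarrow> 'w set \<Rightarrow> 'w set" where
  "fixed_in H A = {x \<in> A. \<forall>\<sigma>\<in>H. \<sigma> x = x}"

lemma subfld_fixed_in:
  assumes H: "\<And>\<sigma>. \<sigma> \<in> H ==> fhom UNIV \<sigma>" and A: "subfld A" shows "subfld (fixed_in H A)"
proof -
  have "subfld {x. \<sigma> x = x}" if "\<sigma> \<in> H" for \<sigma>
  proof -
    note h = H[OF that]
    show ?thesis
      by (simp add: subfld_def hom_0[OF h] hom_1[OF h] hom_diff[OF h] 
        hom_mult[OF h] hom_inverse[OF h])
  qed
  hence "subfld (A \<inter> \<Inter>((\<lambda>\<sigma>. {x. \<sigma> x = x}) ` H))" by (intro subfld_Int[OF A] subfld_Inter) auto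
  moreover have "A \<inter> \<Inter>((\<lambda>\<sigma>. {x. \<sigma> x = x}) ` H) = fixed_in H A" by (auto simp: fixed_in_def)
  ultimately show ?thesis by simp
qed

context
  fixes H :: "('w::field \<Rightarrow> 'w) set" and A
  assumes H: "autgrp H" and A: "subfld A" and st: "\<And>\<sigma>. \<sigma> \<in> H ==> \<sigma> ` A \<subseteq> A"
    and fin: "finite (Rst H A)"
begin

text \<open>With more elements than restrictions, the conjugate vectors satisfy a common nontrivial
  relation. One of minimal support, scaled to have an entry 1, equals all its conjugates, as a
  difference would have smaller support; so its coefficients lie in the fixed field.\<close>

lemma artin_le:
  assumes I: "finite I" "\<And>i. i \<in> I ==> x i \<in> A" and ind: "indep (fixed_in H A) I x"
  shows "card I \<le> card (Rst H A)"
proof (rule ccontr)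
  assume "\<not> ?thesis"
  hence lt: "card (Rst H A) < card I" by simp
  define P where "P = (\<lambda>c. (\<forall>i\<in>I. c i \<in> A) \<and> (\<forall>\<sigma>\<in>H. (\<Sum>i\<in>I. \<sigma> (x i) * c i) = 0))"
  have "\<exists>c. (\<forall>i\<in>I. c i \<in> A) \<and> (\<exists>i\<in>I. c i \<noteq> 0) \<and> (\<forall>\<rho>\<in>Rst H A. (\<Sum>i\<in>I. \<rho> (x i) * c i) = 0)"
  proof (rule homogeneous_system[OF A fin I(1) lt])
    fix \<rho> i assume "\<rho> \<in> Rst H A" "i \<in> I"
    thus "\<rho> (x i) \<in> A" using Rst_mem[of \<rho> H A] I(2) st by fastforce
  qed
  then obtain c0 where c0: "\<forall>i\<in>I. c0 i \<in> A" "\<exists>i\<in>I. c0 i \<noteq> 0" "\<And>\<rho>. \<rho> \<in> Rst H A ==> (\<Sum>i\<in>I. \<rho> (x i) * c0 i) = 0"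
    by blast
  have "(\<Sum>i\<in>I. \<sigma> (x i) * c0 i) = 0" if "\<sigma> \<in> H" for \<sigma>
  proof -
    have "restrict \<sigma> A \<in> Rst H A" using that by (simp add: Rst_def)
    from c0(3)[OF this] have "(\<Sum>i\<in>I. restrict \<sigma> A (x i) * c0 i) = 0" .
    thus ?thesis using I(2) by (simp cong: sum.cong)
  qed
  hence P0: "P c0" using c0 by (auto simp: P_def)
  define s where "s = (\<lambda>c. card {i\<in>I. c i \<noteq> (0::'w)})"
  have "\<exists>c. P c \<and> s c > 0 \<and> (\<forall>c'. P c' \<and> s c' > 0 \<longrightarrow> s c \<le> s c')"
  proof -
    have s0: "s c0 > 0" using c0(2) I(1) by (auto simp: s_def card_gt_0_iff)
    define n where "n = (LEAST n. \<exists>c. P c \<and> s c > 0 \<and> s c = n)"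
    have "\<exists>c. P c \<and> s c > 0 \<and> s c = n" unfolding n_def by (rule LeastI_ex) (use P0 s0 in blast)
    moreover have "n \<le> s c'" if "P c'" "s c' > 0" for c' unfolding n_def by (rule Least_le) (use that in blast)
    ultimately show ?thesis by blast
  qed
  then obtain c1 where c1: "P c1" "s c1 > 0" and min: "\<And>c'. P c' ==> s c' > 0 ==> s c1 \<le> s c'" by blast
  obtain i0 where i0: "i0 \<in> I" "c1 i0 \<noteq> 0" using c1(2) by (auto simp: s_def card_gt_0_iff)
  define c where "c = (\<lambda>i. c1 i / c1 i0)"
  have "(\<Sum>i\<in>I. \<sigma> (x i) * c i) = (\<Sum>i\<in>I. \<sigma> (x i) * c1 i) / c1 i0" for \<sigma>
    by (simp add: c_def sum_divide_distrib)
  hence Pc: "P c" using c1(1) i0 A by (auto simp: P_def c_def intro!: subfld_closed)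
  have sc: "s c = s c1" by (simp add: s_def c_def i0)
  have fixc: "\<tau> (c i) = c i" if t: "\<tau> \<in> H" and i: "i \<in> I" for \<tau> i
  proof -
    note ht = autgrpD(1)[OF H t]
    define d where "d = (\<lambda>i. c i - \<tau> (c i))"
    have dA: "\<forall>i\<in>I. d i \<in> A" using Pc st[OF t] A by (auto simp: d_def P_def intro!: subfld_closed)
    have "(\<Sum>i\<in>I. \<sigma> (x i) * d i) = 0" if s: "\<sigma> \<in> H" for \<sigma>
    proof -
      have "finv \<tau> \<circ> \<sigma> \<in> H" using autgrpD[OF H] s t by blast
      hence "(\<Sum>i\<in>I. (finv \<tau> \<circ> \<sigma>) (x i) * c i) = 0" using Pc unfolding P_def by blast
      hence "\<tau> (\<Sum>i\<in>I. (finv \<tau> \<circ> \<sigma>) (x i) * c i) = 0" using hom_0[OF ht] by simp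
      hence "(\<Sum>i\<in>I. \<sigma> (x i) * \<tau> (c i)) = 0"
        using autgrpD(2)[OF H t] by (simp add: hom_sum[OF ht] hom_mult[OF ht] bij_inv_simps)
      thus ?thesis using Pc s by (simp add: d_def right_diff_distrib sum_subtractf P_def)
    qed
    hence Pd: "P d" using dA by (auto simp: P_def)
    have "{i\<in>I. d i \<noteq> 0} \<subset> {i\<in>I. c i \<noteq> 0}"
    proof
      show "{i\<in>I. d i \<noteq> 0} \<subseteq> {i\<in>I. c i \<noteq> 0}" using hom_0[OF ht] by (auto simp: d_def)
      have "i0 \<in> {i\<in>I. c i \<noteq> 0}" "i0 \<notin> {i\<in>I. d i \<noteq> 0}" using i0 hom_1[OF ht] by (auto simp: c_def d_def)
      thus "{i\<in>I. d i \<noteq> 0} \<noteq> {i\<in>I. c i \<noteq> 0}" by blast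
    qed
    hence "s d < s c1" unfolding sc[symmetric] unfolding s_def by (intro psubset_card_mono) (use I in auto)
    hence "s d = 0" using min[OF Pd] by auto
    hence "d i = 0" using i I(1) by (auto simp: s_def)
    thus ?thesis by (simp add: d_def)
  qed
  have "(\<Sum>i\<in>I. c i * x i) = 0" using Pc autgrpD(4)[OF H] by (force simp: P_def mult.commute)
  moreover have "\<forall>i\<in>I. c i \<in> fixed_in H A" using fixc Pc by (auto simp: fixed_in_def P_def)
  ultimately have "c i0 = 0" using ind i0 unfolding indep_def by blast
  thus False using i0 by (simp add: c_def)
qed

text \<open>Independence of characters: subtracting \<rho>0(z) times the relation at y from the
  relation at z y removes the term of \<rho>0 and multiplies the coefficient of \<rho> by \<rho>(z)
  - \<rho>0(z).\<close>

lemma dedekind: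
  assumes c: "\<And>y. y \<in> A ==> (\<Sum>\<rho>\<in>Rst H A. c \<rho> * \<rho> y) = 0" and "\<rho> \<in> Rst H A"
  shows "c \<rho> = 0"
proof -
  have *: "\<forall>\<rho>\<in>S. c \<rho> = 0" if "S \<subseteq> Rst H A" "\<And>y. y \<in> A ==> (\<Sum>\<rho>\<in>S. c \<rho> * \<rho> y) = 0" for S c
  proof -
    have "finite S" using that(1) fin finite_subset by blast
    thus ?thesis using that
    proof (induction S arbitrary: c rule: finite_induct)
      case (insert \<rho>0 S)
      have mult: "\<rho> (y * z) = \<rho> y * \<rho> z" if "\<rho> \<in> Rst H A" "y \<in> A" "z \<in> A" for \<rho> y z
      proof -
        obtain \<sigma> where "\<sigma> \<in> H" "\<forall>x\<in>A. \<rho> x = \<sigma> x" using Rst_mem[OF \<open>\<rho> \<in> Rst H A\<close>] by blast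
        thus ?thesis using \<open>y \<in> A\<close> \<open>z \<in> A\<close> subfld_mult[OF A] hom_mult[OF autgrpD(1)[OF H]] by simp
      qed
      have z: "c \<rho> = 0" if r: "\<rho> \<in> S" for \<rho>
      proof -
        have "\<rho> \<noteq> \<rho>0" using r insert by auto
        then obtain z where z: "z \<in> A" "\<rho> z \<noteq> \<rho>0 z" using Rst_eqI[of \<rho> H A \<rho>0 H] r insert.prems by blast
        have "(\<Sum>\<rho>\<in>S. (c \<rho> * (\<rho> z - \<rho>0 z)) * \<rho> y) = 0" if y: "y \<in> A" for y
        proof -
          have "0 = (\<Sum>\<rho>\<in>insert \<rho>0 S. c \<rho> * \<rho> (z * y)) - \<rho>0 z * (\<Sum>\<rho>\<in>insert \<rho>0 S. c \<rho> * \<rho> y)"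
            using insert.prems(2)[OF y] insert.prems(2)[OF subfld_mult[OF A z(1) y]] by simp
          also have "\<dots> = (\<Sum>\<rho>\<in>insert \<rho>0 S. (c \<rho> * (\<rho> z - \<rho>0 z)) * \<rho> y)"
            unfolding sum_distrib_left sum_subtractf[symmetric]
            by (rule sum.cong) (use mult z y insert.prems(1) in \<open>auto simp: algebra_simps\<close>)
          finally show ?thesis using insert.hyps by simp
        qed
        hence "\<forall>\<rho>\<in>S. c \<rho> * (\<rho> z - \<rho>0 z) = 0" using insert.IH[of "\<lambda>\<rho>. c \<rho> * (\<rho> z - \<rho>0 z)"] insert.prems(1) by blast
        hence "c \<rho> * (\<rho> z - \<rho>0 z) = 0" using r by blast
        thus ?thesis using z by simp
      qed
      have "\<rho>0 1 = 1" using Rst_mem[of \<rho>0 H A] insert.prems(1) subfld_1[OF A] hom_1[OF autgrpD(1)[OF H]] by auto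
      hence "c \<rho>0 = 0" using insert.prems(2)[OF subfld_1[OF A]] insert.hyps z by simp
      thus ?case using z by auto
    qed simp
  qed
  show ?thesis using *[of "Rst H A" c] assms by auto
qed

text \<open>Finite dimension is not known beforehand: \<open>artin_le\<close> bounds every
  finite-dimensional subspace of \<open>A\<close>, so one of maximal dimension exists and must be
  all of \<open>A\<close>. Fewer basis vectors than restrictions would give a relation between
  restrictions, against \<open>dedekind\<close>.\<close>

lemma artin: "dimn (card (Rst H A)) (fixed_in H A) A"
proof -
  interpret ring "ring_of_type_algebra :: 'w ring" by (rule ring_Om)
  define F where "F = fixed_in H A"
  have F: "subfld F" unfolding F_def by (rule subfld_fixed_in[OF autgrpD(1)[OF H] A])
  have FA: "F \<subseteq> A" by (auto simp: F_def fixed_in_def)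
  define r where "r = card (Rst H A)"
  have le: "n \<le> r" if n: "dimension n F E" "E \<subseteq> A" for n E
  proof -
    obtain x where x: "indep F {..<n} x" "E = {\<Sum>i<n. c i * x i | c. \<forall>i<n. c i \<in> F}" 
      using dimn_basis[OF n(1) F] by blast
    have "x i \<in> E" if "i < n" for i
      unfolding x(2) using basis_mem[OF F that] .
    thus ?thesis using artin_le[of "{..<n}" x] x(1) n(2) by (auto simp: F_def r_def)
  qed
  define n where "n = (GREATEST n. \<exists>E\<subseteq>A. dimension n F E)"
  have ex: "\<exists>n. \<exists>E\<subseteq>A. dimension n F E" using zero_dim[of F] subfld_0[OF A] by (intro exI[of _ 0] exI[of _ "{0}"]) auto
  have "\<exists>E\<subseteq>A. dimension n F E" unfolding n_def by (rule GreatestI_ex_nat[OF ex, of r]) (use le in blast)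
  then obtain E where E: "E \<subseteq> A" "dimension n F E" by blast
  have max: "n' \<le> n" if "\<exists>E\<subseteq>A. dimension n' F E" for n' 
    unfolding n_def by (rule Greatest_le_nat[where b = r], rule that) (use le in blast)
  have EA: "E = A"
  proof (rule ccontr)
    assume "E \<noteq> A"
    then obtain v where v: "v \<in> A" "v \<notin> E" using E by blast
    have "dimension (Suc n) F (line_extension F v E)" by (rule Suc_dim) (use v E in auto)
    moreover have "line_extension F v E \<subseteq> A"
    proof
      fix u assume "u \<in> line_extension F v E"
      then obtain k w where "k \<in> F" "w \<in> E" "u = k * v + w" unfolding line_extension_iff by blast
      thus "u \<in> A" using v E FA A by (auto intro!: subfld_closed)
    qed
    ultimately show False using max[of "Suc n"] by auto
  qed
  have "r \<le> n"
  proof (rule ccontr)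
    assume lt: "\<not> r \<le> n"
    obtain b where b: "A = {\<Sum>i<n. c i * b i | c. \<forall>i<n. c i \<in> F}" using dimn_basis[OF E(2) F] EA by auto
    have "\<exists>c. (\<forall>\<rho>\<in>Rst H A. c \<rho> \<in> UNIV) \<and> (\<exists>\<rho>\<in>Rst H A. c \<rho> \<noteq> 0) \<and> (\<forall>j\<in>{..<n}. (\<Sum>\<rho>\<in>Rst H A. \<rho> (b j) * c \<rho>) = 0)"
      by (rule homogeneous_system[OF subfld_UNIV _ fin]) (use lt r_def in auto)
    then obtain c where c: "\<exists>\<rho>\<in>Rst H A. c \<rho> \<noteq> 0" "\<And>j. j < n ==> (\<Sum>\<rho>\<in>Rst H A. \<rho> (b j) * c \<rho>) = 0" by auto
    have bA: "b i \<in> A" if "i < n" for i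
      using basis_mem[OF F that, of b] b by simp
    have "(\<Sum>\<rho>\<in>Rst H A. c \<rho> * \<rho> y) = 0" if y: "y \<in> A" for y
    proof -
      obtain a where a: "y = (\<Sum>i<n. a i * b i)" "\<forall>i<n. a i \<in> F" using y b by blast
      have ry: "\<rho> y = (\<Sum>i<n. a i * \<rho> (b i))" if r: "\<rho> \<in> Rst H A" for \<rho>
      proof -
        obtain \<sigma> where s: "\<sigma> \<in> H" "\<forall>x\<in>A. \<rho> x = \<sigma> x" using Rst_mem[OF r] by blast
        note h = autgrpD(1)[OF H s(1)]
        have "\<sigma> (\<Sum>i<n. a i * b i) = (\<Sum>i<n. \<sigma> (a i) * \<sigma> (b i))"
          by (simp add: hom_sum[OF h] hom_mult[OF h])
        also have "\<dots> = (\<Sum>i<n. a i * \<rho> (b i))"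
          by (rule sum.cong) (use a(2) s bA in \<open>auto simp: F_def fixed_in_def\<close>)
        finally show ?thesis using s y a(1) by simp
      qed
      hence "(\<Sum>\<rho>\<in>Rst H A. c \<rho> * \<rho> y) = (\<Sum>\<rho>\<in>Rst H A. \<Sum>i<n. a i * (\<rho> (b i) * c \<rho>))"
        by (intro sum.cong refl) (simp only: ry sum_distrib_left mult_ac)
      also have "\<dots> = (\<Sum>i<n. a i * (\<Sum>\<rho>\<in>Rst H A. \<rho> (b i) * c \<rho>))"
        by (subst sum.swap) (simp add: sum_distrib_left)
      finally show ?thesis using c(2) by simp
    qed
    thus False using c(1) dedekind[of c] by blast
  qed
  hence "n = r" using le[OF E(2,1)] by simp
  thus ?thesis using E(2) EA by (simp add: F_def r_def)
qed

end

lemma dimn_unique: "subfld F ==> dimn n F A ==> dimn n' F A ==> n = n'"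
  using ring.dimension_is_inj[OF ring_Om, of F n A n'] by (simp add: subfield_iff_subfld)

lemma dim_eqI: "subfld F ==> dimn n F A ==> ring.dim (ring_of_type_algebra :: 'w::field ring) F A = n"
  using ring.dimI[OF ring_Om, of F n A] by (simp add: subfield_iff_subfld over_def)

text \<open>Both groups have as many restrictions to \<open>A\<close> as the degree over the common
  fixed field, so the smaller group already has all of them.\<close>

lemma galois_correspondence:
  assumes "autgrp H" "autgrp H'" "H' \<subseteq> H" "subfld A" "\<And>\<sigma>. \<sigma> \<in> H ==> \<sigma> ` A \<subseteq> A" "finite (Rst H A)"
    and "fixed_in H' A \<subseteq> fixed_in H A" and "\<sigma> \<in> H"
  obtains \<tau> where "\<tau> \<in> H'" "\<And>x. x \<in> A ==> \<tau> x = \<sigma> x"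
proof -
  have sub: "Rst H' A \<subseteq> Rst H A" using assms(3) by (auto simp: Rst_def)
  have fin: "finite (Rst H' A)" using sub assms(6) finite_subset by blast
  have eq: "fixed_in H' A = fixed_in H A" using assms(3,7) by (auto simp: fixed_in_def)
  have d: "dimn (card (Rst H A)) (fixed_in H A) A" "dimn (card (Rst H' A)) (fixed_in H' A) A"
    using artin[OF assms(1,4,5,6)] artin[OF assms(2,4) _ fin] assms(3,5) by auto
  have "card (Rst H A) = card (Rst H' A)"
    using dimn_unique[OF subfld_fixed_in[OF autgrpD(1)[OF assms(1)] assms(4)] d(1)] d(2) eq by simp
  hence "Rst H' A = Rst H A" using card_subset_eq[OF assms(6) sub] by simp
  hence "restrict \<sigma> A \<in> Rst H' A" using assms(8) by (auto simp: Rst_def)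
  then obtain \<tau> where "\<tau> \<in> H'" "\<forall>x\<in>A. restrict \<sigma> A x = \<tau> x" using Rst_mem by blast
  thus ?thesis using that by auto
qed

text \<open>An automorphism fixing B(C \<inter> Y) agrees on \<open>Y\<close> with one fixing
  \<open>C\<close>, because the two groups have the same fixed elements in \<open>Y\<close>. They
  then agree on B Y, which contains \<open>C\<close>. Since \<open>Y\<close> may fail to contain
  \<open>B\<close>, the lemma applies to \<open>FF m\<close> and to \<open>cyc N\<close>.\<close>

lemma natural_irrationality:
  fixes B :: "'w::alg_closed_field set"
  assumes B: "algcl B" and C: "subfld C" "B \<subseteq> C" "C \<subseteq> gen (B \<union> Y)"
    and Y: "subfld Y" "Y \<subseteq> Sep B" "\<And>\<sigma>. \<sigma> \<in> Aut B ==> \<sigma> ` Y \<subseteq> Y" "finite (Rst (Aut B) Y)"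
  shows "C = gen (B \<union> (C \<inter> Y))"
proof
  define C' where "C' = gen (B \<union> (C \<inter> Y))"
  show "gen (B \<union> (C \<inter> Y)) \<subseteq> C" by (rule gen_least) (use C in auto)
  have sC': "subfld C'" "B \<subseteq> C'" "C' \<subseteq> C" using gen_incl[of "B \<union> (C \<inter> Y)"] \<open>gen (B \<union> (C \<inter> Y)) \<subseteq> C\<close> 
    by (auto simp: C'_def subfld_gen)
  have CS: "C \<subseteq> Sep B" 
    using C(3) gen_least[OF subfld_Sep[OF B], of "B \<union> Y"] Sep_base[OF algcl_subfld[OF B]] Y(2) by blast
  show "C \<subseteq> gen (B \<union> (C \<inter> Y))"
  proof
    fix x assume x: "x \<in> C"
    have "x \<in> C'"
    proof (rule Sep_fixed)
      show "algcl C'" using algcl_mono[OF B sC'(1,2)] .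
      show "x \<in> Sep C'" using x CS Sep_mono[OF sC'(2)] by auto
      fix \<sigma> assume s: "\<sigma> \<in> Aut C'"
      have le: "Aut C \<subseteq> Aut C'" "Aut C' \<subseteq> Aut B" using Aut_mono sC' by blast+
      have fx: "fixed_in (Aut C) Y \<subseteq> fixed_in (Aut C') Y"
      proof
        fix y assume y: "y \<in> fixed_in (Aut C) Y"
        hence "y \<in> C" using Sep_fixed[OF algcl_mono[OF B C(1,2)], of y] Y(2) Sep_mono[OF C(2)] by (auto simp: fixed_in_def)
        hence "y \<in> C'" using y gen_incl[of "B \<union> (C \<inter> Y)"] by (auto simp: C'_def fixed_in_def)
        thus "y \<in> fixed_in (Aut C') Y" using y by (auto simp: fixed_in_def Aut_fix)
      qed
      have fin: "finite (Rst (Aut C') Y)" 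
        by (rule finite_subset[OF _ Y(4)]) (use le in \<open>auto simp: Rst_def\<close>)
      obtain \<tau> where t: "\<tau> \<in> Aut C" "\<And>y. y \<in> Y ==> \<tau> y = \<sigma> y"
        using galois_correspondence[OF autgrp_Aut autgrp_Aut le(1) Y(1) _ fin fx s] Y(3) le(2) by blast
      have "\<tau> x = \<sigma> x"
        by (rule aut_agree_gen[OF Aut_fhom[OF t(1)] Aut_fhom[OF s], of "B \<union> Y"])
          (use t s x C sC'(2) in \<open>auto simp: Aut_fix subset_iff\<close>)
      thus "\<sigma> x = x" using Aut_fix[OF t(1) x] by simp
    qed
    thus "x \<in> gen (B \<union> (C \<inter> Y))" by (simp add: C'_def)
  qed
qed

lemma finite_image_kernel:
  assumes "finite (g ` S)" "\<And>x y. x \<in> S ==> y \<in> S ==> g x = g y ==> f x = f y"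
  shows "finite (f ` S)" "card (f ` S) \<le> card (g ` S)"
proof -
  have "f ` S \<subseteq> (\<lambda>z. f (inv_into S g z)) ` g ` S"
  proof (rule image_subsetI)
    fix x assume "x \<in> S"
    hence "f x = f (inv_into S g (g x))" using assms(2)[of x "inv_into S g (g x)"] by (simp add: f_inv_into_f inv_into_into)
    thus "f x \<in> (\<lambda>z. f (inv_into S g z)) ` g ` S" using \<open>x \<in> S\<close> by blast
  qed
  thus "finite (f ` S)" "card (f ` S) \<le> card (g ` S)"
    using assms(1) by (meson finite_imageI finite_subset, meson card_image_le card_mono finite_imageI order_trans)
qed

lemma card_image_kernel:
  assumes "\<And>x y. x \<in> S ==> y \<in> S ==> f x = f y \<longleftrightarrow> g x = g y" shows "card (f ` S) = card (g ` S)"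
proof -
  have "bij_betw (\<lambda>z. g (inv_into S f z)) (f ` S) (g ` S)"
  proof (rule bij_betw_imageI)
    have *: "g (inv_into S f (f x)) = g x" if "x \<in> S" for x
      using assms[of "inv_into S f (f x)" x] that by (simp add: f_inv_into_f inv_into_into)
    show "inj_on (\<lambda>z. g (inv_into S f z)) (f ` S)"
      by (rule inj_onI) (use * assms in auto)
    show "(\<lambda>z. g (inv_into S f z)) ` f ` S = g ` S" using * by (auto simp: image_image)
  qed
  thus ?thesis by (rule bij_betw_same_card)
qed

text \<open>Lagrange for restrictions: those with a prescribed restriction to \<open>K\<close> form
  a coset of the subgroup trivial on \<open>K\<close>.\<close>

lemma card_Rst_tower:
  assumes H: "autgrp H" and A: "K \<subseteq> A" "finite (Rst H A)"
  shows "card (Rst H A) = card (Rst H K) * card (Rst {\<sigma> \<in> H. \<forall>x\<in>K. \<sigma> x = x} A)"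
proof -
  define G where "G = {\<sigma> \<in> H. \<forall>x\<in>K. \<sigma> x = x}"
  have K: "restrict (restrict \<sigma> A) K = restrict \<sigma> K" for \<sigma> :: "'a \<Rightarrow> 'a" using A(1) by (simp add: restrict_restrict Int_absorb1)
  have fib: "card {\<rho> \<in> Rst H A. restrict \<rho> K = \<kappa>} = card (Rst G A)" if k: "\<kappa> \<in> Rst H K" for \<kappa>
  proof -
    obtain \<sigma> where s: "\<sigma> \<in> H" "\<kappa> = restrict \<sigma> K" using k by (auto simp: Rst_def)
    note b = bij_inv_simps[OF autgrpD(2)[OF H s(1)]]
    have "{\<rho> \<in> Rst H A. restrict \<rho> K = \<kappa>} = (\<lambda>\<tau>. restrict (\<sigma> \<circ> \<tau>) A) ` G"
    proof (intro equalityI subsetI)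
      fix \<rho> assume r: "\<rho> \<in> {\<rho> \<in> Rst H A. restrict \<rho> K = \<kappa>}"
      then obtain \<tau> where t: "\<tau> \<in> H" "\<rho> = restrict \<tau> A" unfolding Rst_def by blast
      have "\<forall>x\<in>K. \<tau> x = \<sigma> x" using r A(1) unfolding t(2) s(2) mem_Collect_eq restrict_eq_iff by (metis restrict_apply' subsetD)
      hence "finv \<sigma> \<circ> \<tau> \<in> G" using autgrpD(3,5)[OF H] s(1) t(1) b by (simp add: G_def)
      moreover have "\<rho> = restrict (\<sigma> \<circ> (finv \<sigma> \<circ> \<tau>)) A" using b t(2) by (simp add: restrict_def fun_eq_iff)
      ultimately show "\<rho> \<in> (\<lambda>\<tau>. restrict (\<sigma> \<circ> \<tau>) A) ` G" by blast
    next
      fix \<rho> assume "\<rho> \<in> (\<lambda>\<tau>. restrict (\<sigma> \<circ> \<tau>) A) ` G"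
      then obtain \<tau> where t: "\<tau> \<in> H" "\<forall>x\<in>K. \<tau> x = x" "\<rho> = restrict (\<sigma> \<circ> \<tau>) A" by (auto simp: G_def)
      have "restrict (restrict (\<sigma> \<circ> \<tau>) A) K = restrict \<sigma> K" unfolding K restrict_eq_iff using t(2) by simp
      thus "\<rho> \<in> {\<rho> \<in> Rst H A. restrict \<rho> K = \<kappa>}" unfolding Rst_def t(3) s(2) using autgrpD(5)[OF H s(1) t(1)] by blast
    qed
    moreover have "card ((\<lambda>\<tau>. restrict (\<sigma> \<circ> \<tau>) A) ` G) = card (Rst G A)" unfolding Rst_def
      by (rule card_image_kernel) (simp add: restrict_eq_iff, metis b(2))
    ultimately show ?thesis by simp
  qed
  have "card (Rst H A) = (\<Sum>\<kappa>\<in>(\<lambda>\<rho>. restrict \<rho> K) ` Rst H A. card {\<rho> \<in> Rst H A. restrict \<rho> K = \<kappa>})"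
    using sum.image_gen[OF A(2), of "\<lambda>_. 1 :: nat" "\<lambda>\<rho>. restrict \<rho> K"] by simp
  also have "(\<lambda>\<rho>. restrict \<rho> K) ` Rst H A = Rst H K" unfolding Rst_def image_image K ..
  also have "(\<Sum>\<kappa>\<in>Rst H K. card {\<rho> \<in> Rst H A. restrict \<rho> K = \<kappa>}) = (\<Sum>\<kappa>\<in>Rst H K. card (Rst G A))" by (rule sum.cong[OF refl fib])
  finally show ?thesis by (simp add: G_def)
qed

text \<open>The action on the generators determines the action on the field, and each of the
  finitely many generators has a finite orbit.\<close>

lemma finite_Rst_gen:
  assumes B: "algcl B" and R: "finite R"
  shows "finite (Rst (Aut B) (gen (B \<union> R)))"
  unfolding Rst_def
proof (rule finite_image_kernel)
  have "(\<lambda>\<sigma>. restrict \<sigma> R) ` Aut B \<subseteq> PiE R (\<lambda>x. (\<lambda>\<sigma>. \<sigma> x) ` Aut B)" by auto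
  thus "finite ((\<lambda>\<sigma>. restrict \<sigma> R) ` Aut B)" by (rule finite_subset) (rule finite_PiE[OF R finite_orbit[OF B]])
  fix \<sigma> \<tau> assume s: "\<sigma> \<in> Aut B" "\<tau> \<in> Aut B" and r: "restrict \<sigma> R = restrict \<tau> R"
  show "restrict \<sigma> (gen (B \<union> R)) = restrict \<tau> (gen (B \<union> R))" unfolding restrict_eq_iff
  proof
    fix x assume "x \<in> gen (B \<union> R)"
    thus "\<sigma> x = \<tau> x" by (rule aut_agree_gen[OF Aut_fhom[OF s(1)] Aut_fhom[OF s(2)], rotated])
      (use r s in \<open>auto simp: restrict_eq_iff Aut_fix\<close>)
  qed
qed

lemma finite_Rst_subset: "finite (Rst H A) ==> A' \<subseteq> A ==> finite (Rst H A')"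
proof -
  assume *: "finite (Rst H A)" "A' \<subseteq> A"
  have "Rst H A' \<subseteq> (\<lambda>\<rho>. restrict \<rho> A') ` Rst H A"
    using *(2) by (auto simp: Rst_def image_iff restrict_restrict Int_absorb1 intro!: exI)
  thus ?thesis using * finite_subset by blast
qed

lemma finite_Rst_mono: "finite (Rst H A) ==> H' \<subseteq> H ==> finite (Rst H' A)"
  unfolding Rst_def by (meson finite_subset image_mono)

lemma finite_Rst_comp:
  assumes "finite (Rst (Aut B) A1)" "finite (Rst (Aut B) A2)"
  shows "finite (Rst (Aut B) (gen (A1 \<union> A2)))"
  unfolding Rst_def
proof (rule finite_image_kernel)
  show "finite ((\<lambda>\<sigma>. (restrict \<sigma> A1, restrict \<sigma> A2)) ` Aut B)"
    by (rule finite_subset[OF _ finite_cartesian_product[OF assms]]) (auto simp: Rst_def)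
  fix \<sigma> \<tau> assume s: "\<sigma> \<in> Aut B" "\<tau> \<in> Aut B" and r: "(restrict \<sigma> A1, restrict \<sigma> A2) = (restrict \<tau> A1, restrict \<tau> A2)"
  show "restrict \<sigma> (gen (A1 \<union> A2)) = restrict \<tau> (gen (A1 \<union> A2))" unfolding restrict_eq_iff
  proof
    fix x assume "x \<in> gen (A1 \<union> A2)"
    thus "\<sigma> x = \<tau> x" by (rule aut_agree_gen[OF Aut_fhom[OF s(1)] Aut_fhom[OF s(2)], rotated])
      (use r in \<open>auto simp: restrict_eq_iff\<close>)
  qed
qed

lemma fixed_in_Gal:
  fixes B :: "'w::alg_closed_field set"
  shows "algcl B ==> Gal B A ==> fixed_in (Aut B) A = B"
  using Gal_fixed[of B A B] Gal_D[of B A] Aut_fix algcl_subfld unfolding fixed_in_def by blast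

lemma Gal_dimn:
  fixes B :: "'w::alg_closed_field set"
  assumes "algcl B" "Gal B A" "finite (Rst (Aut B) A)"
  shows "dimn (card (Rst (Aut B) A)) B A"
  using artin[OF autgrp_Aut Gal_D(1)[OF assms(2)] _ assms(3)] Gal_image[OF assms(2)] unfolding fixed_in_Gal[OF assms(1,2)] by blast

section \<open>Valuation rings and their extension\<close>

definition subrng :: "'w::field set \<Rightarrow> bool" where
  "subrng V \<longleftrightarrow> 1 \<in> V \<and> (\<forall>x\<in>V. \<forall>y\<in>V. x - y \<in> V \<and> x * y \<in> V)"

text \<open>\<open>V = A\<close> is allowed, i.e. the trivial valuation; primes exclude it
  separately in \<open>field_prime\<close>.\<close>

definition vring :: "'w::field set \<Rightarrow> 'w set \<Rightarrow> bool" where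
  "vring A V \<longleftrightarrow> subrng V \<and> V \<subseteq> A \<and> (\<forall>x\<in>A. x \<in> V \<or> inverse x \<in> V)"

definition mx :: "'w::field set \<Rightarrow> 'w set" where
  "mx V = {x \<in> V. x = 0 \<or> inverse x \<notin> V}"

lemma subrng_1: "subrng V ==> 1 \<in> V"
  and subrng_diff: "subrng V ==> x \<in> V ==> y \<in> V ==> x - y \<in> V"
  and subrng_mult: "subrng V ==> x \<in> V ==> y \<in> V ==> x * y \<in> V"
  by (auto simp: subrng_def)

lemma subrng_0: "subrng V ==> 0 \<in> V"
  using subrng_diff[of V 1 1] subrng_1 by auto

lemma subrng_uminus: "subrng V ==> x \<in> V ==> - x \<in> V"
  using subrng_diff[of V 0 x] subrng_0 by auto

lemma subrng_add: "subrng V ==> x \<in> V ==> y \<in> V ==> x + y \<in> V"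
  using subrng_diff[of V x "- y"] subrng_uminus by auto

lemma subrng_sum: "subrng B ==> (\<And>i. i \<in> I ==> f i \<in> B) ==> sum f I \<in> B"
  by (induction I rule: infinite_finite_induct) (auto simp: subrng_0 subrng_add)

lemma subrng_prod: "subrng B ==> (\<And>i. i \<in> I ==> f i \<in> B) ==> prod f I \<in> B"
  by (induction I rule: infinite_finite_induct) (auto simp: subrng_1 subrng_mult)

lemma subrng_power: "subrng B ==> x \<in> B ==> x ^ n \<in> B"
  by (induction n) (auto simp: subrng_1 subrng_mult)

lemmas subrng_closed = subrng_0 subrng_1 subrng_diff subrng_mult subrng_uminus subrng_add
  subrng_sum subrng_prod subrng_power

lemma vringD: "vring A V ==> subrng V" "vring A V ==> V \<subseteq> A"
  "vring A V ==> x \<in> A ==> x \<notin> V ==> inverse x \<in> V"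
  by (auto simp: vring_def)

lemma vring_Int: "vring A V ==> subfld B ==> B \<subseteq> A ==> vring B (V \<inter> B)"
  by (auto simp: vring_def subrng_def subfld_closed)

lemma mx_Int: "subfld B ==> mx (V \<inter> B) = mx V \<inter> B"
  by (auto simp: mx_def subfld_closed)

lemma mx_subset: "mx V \<subseteq> V"
  by (auto simp: mx_def)

lemma mx_0: "subrng V ==> 0 \<in> mx V"
  by (auto simp: mx_def subrng_0)

lemma mx_1: "subrng V ==> 1 \<notin> mx V"
  by (auto simp: mx_def subrng_1)

lemma mx_inverse: "subfld A ==> vring A V ==> x \<in> A ==> x \<notin> V ==> inverse x \<in> mx V"
  using vringD by (auto simp: mx_def)

context
  fixes A V :: "'w::field set"
  assumes A: "subfld A" and V: "vring A V"
begin

lemma mx_mult: assumes "x \<in> V" "y \<in> mx V" shows "x * y \<in> mx V"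
proof (cases "x * y = 0")
  case False
  hence "inverse y = x * inverse (x * y)" "x \<noteq> 0" "y \<noteq> 0" by (auto simp: field_simps)
  hence "inverse (x * y) \<notin> V" using assms(2) subrng_mult[OF vringD(1)[OF V] assms(1), of "inverse (x * y)"] 
    unfolding mx_def by (metis (mono_tags, lifting) mem_Collect_eq)
  thus ?thesis using assms subrng_mult[OF vringD(1)[OF V]] by (auto simp: mx_def)
qed (use mx_0[OF vringD(1)[OF V]] in auto)

lemma mx_add: assumes "x \<in> mx V" "y \<in> mx V" shows "x + y \<in> mx V"
proof -
  have *: "a + b \<in> mx V" if ab: "a \<in> mx V" "b \<in> mx V" "b \<noteq> 0" "a / b \<in> V" for a b
  proof -
    have "a + b = (a / b + 1) * b" using ab(3) by (simp add: field_simps)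
    thus ?thesis using mx_mult[of "a / b + 1" b] ab subrng_add[OF vringD(1)[OF V]] subrng_1[OF vringD(1)[OF V]] by simp
  qed
  show ?thesis
  proof (cases "x = 0 \<or> y = 0")
    case False
    have "x / y \<in> A" using assms mx_subset vringD(2)[OF V] A by (meson subfld_divide subsetD)
    hence "x / y \<in> V \<or> y / x \<in> V" using vringD(3)[OF V, of "x / y"] by auto
    thus ?thesis using *[of x y] *[of y x] assms False by (auto simp: add.commute)
  qed (use assms in auto)
qed

lemma mx_uminus: "x \<in> mx V ==> - x \<in> mx V"
  using mx_mult[of "- 1" x] subrng_uminus[OF vringD(1)[OF V] subrng_1[OF vringD(1)[OF V]]] by simp

lemma mx_diff: "x \<in> mx V ==> y \<in> mx V ==> x - y \<in> mx V"
  using mx_add[of x "- y"] mx_uminus by simp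

lemma mx_sum: "(\<And>i. i \<in> I ==> f i \<in> mx V) ==> sum f I \<in> mx V"
  by (induction I rule: infinite_finite_induct) (auto simp: mx_0[OF vringD(1)[OF V]] mx_add)

lemma mx_prime: assumes "x * y \<in> mx V" "x \<in> V" "y \<in> V" shows "x \<in> mx V \<or> y \<in> mx V"
proof (rule ccontr)
  assume "\<not> ?thesis"
  hence "inverse x \<in> V" "inverse y \<in> V" "x \<noteq> 0" "y \<noteq> 0" using assms by (auto simp: mx_def)
  hence "inverse (x * y) \<in> V" using subrng_mult[OF vringD(1)[OF V], of "inverse x" "inverse y"] by simp
  thus False using assms(1) \<open>x \<noteq> 0\<close> \<open>y \<noteq> 0\<close> by (auto simp: mx_def)
qed

lemma mx_power: "x ^ n \<in> mx V ==> x \<in> V ==> x \<in> mx V"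
  by (induction n) (use mx_1[OF vringD(1)[OF V]] mx_prime subrng_power[OF vringD(1)[OF V]] in auto)

lemma mx_pow: "x \<in> mx V ==> n > 0 ==> x ^ n \<in> mx V"
  using mx_mult[of "x ^ (n - 1)" x] mx_subset[of V] subrng_power[OF vringD(1)[OF V], of x]
  by (cases n) (auto simp: mult.commute)

text \<open>Dividing the equation by the n-th power of y writes 1 as a combination of positive
  powers of 1/y, which lies in the maximal ideal when \<open>y\<close> is outside
  \<open>V\<close>.\<close>

lemma vring_int_closed:
  assumes y: "y \<in> A" and p: "pover V p" "lead_coeff p = 1" "poly p y = 0" shows "y \<in> V"
proof (rule ccontr)
  assume "y \<notin> V"
  hence iy: "inverse y \<in> mx V" by (rule mx_inverse[OF A V y])
  have y0: "y \<noteq> 0" using \<open>y \<notin> V\<close> subrng_0[OF vringD(1)[OF V]] by auto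
  define n where "n = degree p"
  have n: "n > 0"
  proof (rule ccontr)
    assume "\<not> n > 0"
    then obtain c where "p = [:c:]" by (auto simp: n_def elim: degree_eq_zeroE)
    thus False using p by simp
  qed
  have "0 = (\<Sum>i\<le>n. coeff p i * y ^ i) * inverse y ^ n" using p(3) by (simp add: poly_altdef n_def)
  also have "\<dots> = (\<Sum>i\<le>n. coeff p i * inverse y ^ (n - i))"
    unfolding sum_distrib_right
  proof (rule sum.cong[OF refl])
    fix i assume "i \<in> {..n}"
    hence "inverse y ^ n = inverse y ^ i * inverse y ^ (n - i)" by (simp flip: power_add)
    thus "coeff p i * y ^ i * inverse y ^ n = coeff p i * inverse y ^ (n - i)" using y0
      by (simp add: power_inverse field_simps)
  qed
  also have "\<dots> = 1 + (\<Sum>i<n. coeff p i * inverse y ^ (n - i))"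
    using p(2) by (simp add: n_def lessThan_Suc_atMost[symmetric])
  finally have "1 = - (\<Sum>i<n. coeff p i * inverse y ^ (n - i))" by (simp add: eq_neg_iff_add_eq_0)
  moreover have "coeff p i * inverse y ^ (n - i) \<in> mx V" if i: "i < n" for i
  proof -
    have "inverse y ^ (n - i) \<in> mx V" using i by (intro mx_pow[OF iy]) simp
    thus ?thesis using p(1) mx_mult by (auto simp: pover_def)
  qed
  hence "- (\<Sum>i<n. coeff p i * inverse y ^ (n - i)) \<in> mx V" by (intro mx_uminus mx_sum) auto
  ultimately have "1 \<in> mx V" by argo
  thus False using mx_1[OF vringD(1)[OF V]] by simp
qed

text \<open>A maximal subring \<open>R\<close> of the field with \<open>R \<inter> A = V\<close> is a valuation ring.\<close>

lemma chevalley: "\<exists>W. vring UNIV W \<and> W \<inter> A = V"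
proof -
  note sV = vringD(1)[OF V]
  define \<A> where "\<A> = {R. subrng R \<and> V \<subseteq> R \<and> R \<inter> A \<subseteq> V}"
  have "\<exists>M\<in>\<A>. \<forall>Z\<in>\<A>. M \<subseteq> Z \<longrightarrow> Z = M"
  proof (rule subset_Zorn_nonempty)
    show "\<A> \<noteq> {}" using sV by (auto simp: \<A>_def)
    fix \<C> assume C: "\<C> \<noteq> {}" "subset.chain \<A> \<C>"
    have ch: "\<exists>Z\<in>\<C>. X1 \<subseteq> Z \<and> Y \<subseteq> Z" if "X1 \<in> \<C>" "Y \<in> \<C>" for X1 Y
      using C(2) that unfolding subset_chain_def by (metis order_refl)
    have em: "subrng R" "V \<subseteq> R" "R \<inter> A \<subseteq> V" if "R \<in> \<C>" for R using C(2) that unfolding subset_chain_def \<A>_def by auto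
    have "subrng (\<Union>\<C>)" unfolding subrng_def
    proof (intro conjI ballI)
      show "1 \<in> \<Union>\<C>" using C(1) em(1) subrng_1 by blast
      fix x y assume "x \<in> \<Union>\<C>" "y \<in> \<Union>\<C>"
      then obtain Z1 Z2 where "Z1 \<in> \<C>" "x \<in> Z1" "Z2 \<in> \<C>" "y \<in> Z2" by auto
      then obtain Z where "Z \<in> \<C>" "x \<in> Z" "y \<in> Z" using ch[of Z1 Z2] by auto
      thus "x - y \<in> \<Union>\<C>" "x * y \<in> \<Union>\<C>" using em(1)[of Z] subrng_diff subrng_mult by blast+
    qed
    thus "\<Union>\<C> \<in> \<A>" using C(1) em unfolding \<A>_def by blast
  qed
  then obtain R where R': "R \<in> \<A>" "\<forall>Z\<in>\<A>. R \<subseteq> Z \<longrightarrow> Z = R" by blast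
  have R: "subrng R" "V \<subseteq> R" "R \<inter> A \<subseteq> V" using R'(1) by (auto simp: \<A>_def)
  have max: "Z = R" if "subrng Z" "R \<subseteq> Z" "Z \<inter> A \<subseteq> V" for Z
  proof -
    have "Z \<in> \<A>" using that R(2) by (auto simp: \<A>_def)
    thus ?thesis using R'(2) that(2) by blast
  qed
  \<comment> \<open>The ideal of \<open>R\<close> generated by the maximal ideal of
    \<open>V\<close>; single products suffice because \<open>V\<close> is a valuation ring. It is
    proper: a r = 1 would put 1/a into R \<inter> A, which lies in \<open>V\<close>.\<close>
  define J where "J = {a * r | a r. a \<in> mx V \<and> r \<in> R}"
  have J0: "0 \<in> J" using mx_0[OF sV] subrng_0[OF R(1)] by (force simp: J_def)
  have Jm: "r * i \<in> J" if "r \<in> R" "i \<in> J" for r i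
  proof -
    obtain a s where "a \<in> mx V" "s \<in> R" "i = a * s" using \<open>i \<in> J\<close> by (auto simp: J_def)
    hence "r * i = a * (r * s)" "r * s \<in> R" using subrng_mult[OF R(1)] that by auto
    thus ?thesis using \<open>a \<in> mx V\<close> unfolding J_def by blast
  qed
  have Ja: "i + j \<in> J" if "i \<in> J" "j \<in> J" for i j
  proof -
    have *: "a * r + b * s \<in> J" if ab: "a \<in> mx V" "b \<in> mx V" "b \<noteq> 0" "a / b \<in> V" "r \<in> R" "s \<in> R" for a b r s
    proof -
      have "a * r + b * s = b * (a / b * r + s)" using ab(3) by (simp add: field_simps)
      moreover have "a / b * r + s \<in> R" using ab R subrng_add subrng_mult by (meson subsetD)
      ultimately show ?thesis using ab(2) by (auto simp: J_def)
    qed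
    obtain a r b s where ab: "a \<in> mx V" "r \<in> R" "i = a * r" "b \<in> mx V" "s \<in> R" "j = b * s" 
      using \<open>i \<in> J\<close> \<open>j \<in> J\<close> by (auto simp: J_def)
    show ?thesis
    proof (cases "a = 0 \<or> b = 0")
      case True thus ?thesis using that ab by auto
    next
      case False
      have "a / b \<in> A" using ab mx_subset vringD(2)[OF V] A by (meson subfld_divide subsetD)
      hence "a / b \<in> V \<or> b / a \<in> V" using vringD(3)[OF V, of "a / b"] by auto
      thus ?thesis using *[of a b r s] *[of b a s r] ab False by (auto simp: add.commute)
    qed
  qed
  have JR: "J \<subseteq> R" using subrng_mult[OF R(1)] mx_subset[of V] R(2) by (auto simp: J_def)
  have J1: "1 \<notin> J"
  proof
    assume "1 \<in> J"
    then obtain a r where ar: "a \<in> mx V" "r \<in> R" "a * r = 1" by (auto simp: J_def)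
    hence "inverse a = r" by (metis inverse_unique)
    moreover have "inverse a \<in> A" using ar mx_subset vringD(2)[OF V] A subfld_inverse by (meson subsetD)
    ultimately have "inverse a \<in> V" using R(3) ar by auto
    thus False using ar by (auto simp: mx_def)
  qed
  \<comment> \<open>A relation 1 = p(x) with coefficients in \<open>J\<close>. For x outside
    \<open>R\<close>, maximality makes R[x] meet \<open>A\<close> outside \<open>V\<close>, and
    dividing by such a value yields a relation.\<close>
  define E where "E = (\<lambda>x p. (\<forall>i. coeff p i \<in> J) \<and> poly p x = 1)"
  have exE: "\<exists>p. E x p" if x: "x \<notin> R" for x
  proof -
    define R2 where "R2 = {poly f x | f. \<forall>i. coeff f i \<in> R}"
    have "subrng R2" unfolding subrng_def
    proof (intro conjI ballI)
      have "\<forall>i. coeff 1 i \<in> R" using R(1) by (auto simp: subrng_closed)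
      thus "1 \<in> R2" unfolding R2_def by (intro CollectI exI[of _ 1]) simp
      fix y z assume "y \<in> R2" "z \<in> R2"
      then obtain f g where fg: "y = poly f x" "z = poly g x" "\<forall>i. coeff f i \<in> R" "\<forall>i. coeff g i \<in> R"
        by (auto simp: R2_def)
      have "\<forall>i. coeff (f - g) i \<in> R" "\<forall>i. coeff (f * g) i \<in> R"
        using fg R(1) by (auto simp: coeff_mult intro!: subrng_closed)
      moreover have "y - z = poly (f - g) x" "y * z = poly (f * g) x" using fg by auto
      ultimately show "y - z \<in> R2" "y * z \<in> R2" unfolding R2_def by blast+
    qed
    moreover have "R \<subseteq> R2"
    proof
      fix r assume "r \<in> R" 
      hence "\<forall>i. coeff [:r:] i \<in> R" using subrng_0[OF R(1)] by (auto simp: coeff_pCons split: nat.split)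
      moreover have "r = poly [:r:] x" by simp
      ultimately show "r \<in> R2" unfolding R2_def by blast
    qed
    moreover have "x \<in> R2"
    proof -
      have "\<forall>i. coeff [:0, 1:] i \<in> R" using R(1) by (auto simp: coeff_pCons subrng_closed split: nat.split)
      moreover have "x = poly [:0, 1:] x" by simp
      ultimately show ?thesis unfolding R2_def by blast
    qed
    ultimately have "\<not> R2 \<inter> A \<subseteq> V" using max[of R2] x by auto
    then obtain f where f: "\<forall>i. coeff f i \<in> R" "poly f x \<in> A" "poly f x \<notin> V" by (auto simp: R2_def)
    define b where "b = inverse (poly f x)"
    have b: "b \<in> mx V" "poly f x \<noteq> 0" unfolding b_def using mx_inverse[OF A V f(2,3)] f subrng_0[OF sV] by auto
    have "E x (smult b f)" unfolding E_def using f b by (auto simp: J_def b_def)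
    thus ?thesis by blast
  qed
  have degE: "degree p > 0" if "E x p" for x p
  proof (rule ccontr)
    assume "\<not> degree p > 0"
    then obtain c where "p = [:c:]" by (auto elim: degree_eq_zeroE)
    hence "c = 1" "c \<in> J" using that unfolding E_def by (auto simp: coeff_pCons dest: spec[of _ 0])
    thus False using J1 by simp
  qed
  \<comment> \<open>With a = q(0), the relation for 1/x reads (1 - a) x^l = h(x), where h has degree
    below l and coefficients in \<open>J\<close>. Substituting this for the leading term of (1 - a)
    p lowers the degree.\<close>
  have red: "\<exists>p'. E x p' \<and> degree p' < degree p"
    if p: "E x p" and q: "E (inverse x) q" and x0: "x \<noteq> 0" and le: "degree q \<le> degree p" for x p q
  proof -
    define n l where "n = degree p" "l = degree q"
    have nl: "0 < l" "l \<le> n" using degE[OF q] le by (auto simp: n_l_def)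
    define a h where "a = coeff q 0" "h = reflect_poly q - monom (coeff q 0) l"
    have aJ: "a \<in> J" using q by (simp add: E_def a_h_def)
    have ch: "coeff h i = (if i < l then coeff q (l - i) else 0)" for i
      by (auto simp: a_h_def coeff_reflect_poly n_l_def)
    have hx: "poly h x = x ^ l * (1 - a)"
      using q x0 by (simp add: a_h_def poly_reflect_poly_nz poly_monom E_def n_l_def algebra_simps)
    define c where "c = lead_coeff p"
    define p' where "p' = [:a:] + smult (1 - a) (p - monom c n) + monom c (n - l) * h"
    have R': "c \<in> R" "1 - a \<in> R" using p aJ JR subrng_diff[OF R(1) subrng_1[OF R(1)]] by (auto simp: c_def E_def)
    have cp': "coeff p' i = (if i = 0 then a else 0) + (1 - a) * (if i = n then 0 else coeff p i)
        + (if n - l \<le> i then c * coeff h (i - (n - l)) else 0)" for i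
      by (auto simp: p'_def c_def n_l_def coeff_monom_mult coeff_pCons split: nat.split)
    have "coeff p' i \<in> J" for i 
      unfolding cp' using p q aJ Jm[OF R'(1)] Jm[OF R'(2)] J0 by (intro Ja) (auto simp: E_def ch)
    moreover have "poly p' x = 1"
    proof -
      have "x ^ (n - l) * x ^ l = x ^ n" using nl by (simp flip: power_add)
      hence "poly (monom c (n - l) * h) x = c * x ^ n * (1 - a)" by (simp add: hx poly_monom mult.assoc)
      thus ?thesis using p by (simp add: p'_def poly_monom E_def algebra_simps)
    qed
    moreover have "degree p' < n"
    proof -
      have "coeff p' i = 0" if "i \<ge> n" for i
        unfolding cp' using that nl by (auto simp: n_l_def coeff_eq_0 ch)
      thus ?thesis using nl by (metis degree_lessI gr_zeroI not_less zero_less_iff_neq_zero less_le_trans)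
    qed
    ultimately show ?thesis unfolding E_def n_l_def by blast
  qed
  have "x \<in> R \<or> inverse x \<in> R" for x
  proof (rule ccontr)
    assume "\<not> ?thesis"
    hence x: "x \<notin> R" "inverse x \<notin> R" by auto
    hence x0: "x \<noteq> 0" using subrng_0[OF R(1)] by auto
    \<comment> \<open>Relations for \<open>x\<close> and its inverse of least total degree; the
      longer of the two could still be shortened.\<close>
    define D where "D = (\<lambda>n. \<exists>p q. E x p \<and> E (inverse x) q \<and> degree p + degree q = n)"
    have "\<exists>n. D n" using exE[OF x(1)] exE[OF x(2)] unfolding D_def by blast
    hence "D (LEAST n. D n)" by (rule LeastI_ex)
    then obtain p q where pq: "E x p" "E (inverse x) q" "degree p + degree q = (LEAST n. D n)"
      unfolding D_def by blast
    have min: "(LEAST n. D n) \<le> degree p' + degree q'" if "E x p'" "E (inverse x) q'" for p' q'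
      by (rule Least_le) (use that in \<open>auto simp: D_def\<close>)
    show False
    proof (cases "degree q \<le> degree p")
      case True
      then obtain p' where "E x p'" "degree p' < degree p" using red[OF pq(1,2) x0] by blast
      thus False using min[of p' q] pq by simp
    next
      case False
      then obtain q' where "E (inverse x) q'" "degree q' < degree q" 
        using red[of "inverse x" q p] pq x0 by auto
      thus False using min[of p q'] pq by simp
    qed
  qed
  hence "vring UNIV R" using R(1) by (auto simp: vring_def)
  moreover have "R \<inter> A = V" using R vringD(2)[OF V] by auto
  ultimately show ?thesis by blast
qed

end

section \<open>The valuation of a place\<close>

text \<open>A discrete valuation of \<open>k\<close> together with a valuation ring of the whole
  field above it. Besides the infinite places it serves, in \<open>unramified_refl\<close>, all
  primes.\<close>

locale place =
  fixes \<O> k :: "'w::field set" and \<pi> :: 'w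
  assumes vO: "vring UNIV \<O>" and k: "algcl k" and pi: "\<pi> \<in> k" "\<pi> \<in> mx \<O>" "\<pi> \<noteq> 0"
    and k_val: "\<And>x. x \<in> k ==> x \<noteq> 0 ==> \<exists>i::int. x * \<pi> powi i \<in> \<O> - mx \<O>"
begin

lemmas sO = vringD(1)[OF vO]
lemmas m_mult = mx_mult[OF subfld_UNIV vO]
lemmas m_add = mx_add[OF subfld_UNIV vO]
lemmas m_diff = mx_diff[OF subfld_UNIV vO]
lemmas m_uminus = mx_uminus[OF subfld_UNIV vO]
lemmas m_sum = mx_sum[OF subfld_UNIV vO]
lemmas m_prime = mx_prime[OF subfld_UNIV vO]
lemmas m_power = mx_power[OF subfld_UNIV vO]
lemmas m_0 = mx_0[OF sO]
lemmas m_1 = mx_1[OF sO]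
lemmas m_inverse = mx_inverse[OF subfld_UNIV vO UNIV_I]

definition U where "U = \<O> - mx \<O>"

lemma U_iff: "x \<in> U \<longleftrightarrow> x \<noteq> 0 \<and> x \<in> \<O> \<and> inverse x \<in> \<O>"
  by (auto simp: U_def mx_def subrng_0[OF sO])

lemma U_1: "1 \<in> U" by (auto simp: U_iff subrng_1[OF sO])

lemma U_mult: "x \<in> U ==> y \<in> U ==> x * y \<in> U"
  by (auto simp: U_iff subrng_mult[OF sO] nonzero_inverse_mult_distrib)

lemma U_inverse: "x \<in> U ==> inverse x \<in> U"
  by (auto simp: U_iff)

lemma U_power: "x \<in> U ==> x ^ n \<in> U"
  by (induction n) (auto simp: U_1 U_mult)

lemma pi_powi_U: "\<pi> powi i \<in> U \<longleftrightarrow> i = 0"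
proof
  have *: "\<pi> ^ n \<notin> U" if n: "n > 0" for n
  proof -
    show ?thesis using mx_pow[OF subfld_UNIV vO pi(2) n] by (simp add: U_def)
  qed
  assume i: "\<pi> powi i \<in> U"
  show "i = 0"
  proof (rule ccontr)
    assume "i \<noteq> 0"
    hence "nat \<bar>i\<bar> > 0" by simp
    hence "\<pi> ^ nat \<bar>i\<bar> \<notin> U" by (rule *)
    moreover have "\<pi> powi i = \<pi> ^ nat \<bar>i\<bar> \<or> \<pi> powi i = inverse (\<pi> ^ nat \<bar>i\<bar>)" by (auto simp: power_int_def power_inverse)
    ultimately show False using i U_inverse by fastforce
  qed
qed (simp add: U_1)

text \<open>Some term divides all others. The remaining quotients by it are non-units, so the sum
  divided by this term is congruent to 1.\<close>

lemma sum_nonzero_aux: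
  assumes "finite I" "I \<noteq> {}" "\<And>i. i \<in> I ==> f i \<noteq> 0" "\<And>i j. i \<in> I ==> j \<in> I ==> i \<noteq> j ==> f i / f j \<notin> U"
  shows "sum f I \<noteq> 0"
proof -
  have "\<exists>i\<in>I. \<forall>j\<in>I. f j / f i \<in> \<O>" using assms(1,2,3)
  proof (induction I rule: finite_ne_induct)
    case (singleton x) thus ?case by (auto simp: subrng_1[OF sO])
  next
    case (insert x F)
    then obtain i where i: "i \<in> F" "\<forall>j\<in>F. f j / f i \<in> \<O>" by auto
    show ?case
    proof (cases "f x / f i \<in> \<O>")
      case True thus ?thesis using i by auto
    next
      case False
      hence ix: "f i / f x \<in> \<O>" using vringD(3)[OF vO, of "f x / f i"] by auto
      have "f j / f x \<in> \<O>" if "j \<in> F" for j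
      proof -
        have "f j / f x = f j / f i * (f i / f x)" using insert.prems i by auto
        thus ?thesis using ix i that subrng_mult[OF sO] by metis
      qed
      thus ?thesis using insert.prems by (auto simp: subrng_1[OF sO])
    qed
  qed
  then obtain i where i: "i \<in> I" "\<forall>j\<in>I. f j / f i \<in> \<O>" by blast
  have "f j / f i \<in> mx \<O>" if "j \<in> I - {i}" for j using that assms(4)[of j i] i by (auto simp: U_def)
  hence "(\<Sum>j\<in>I - {i}. f j / f i) \<in> mx \<O>" by (rule m_sum)
  moreover have "sum f I / f i = 1 + (\<Sum>j\<in>I - {i}. f j / f i)"
    using sum.remove[OF assms(1) i(1), of "\<lambda>j. f j / f i"] assms(3)[OF i(1)] by (simp add: sum_divide_distrib)
  ultimately have "sum f I = 0 ==> 1 \<in> mx \<O>" using m_uminus by (metis add_eq_0_iff div_0 minus_minus)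
  thus ?thesis using m_1 by blast
qed

text \<open>Expresses that \<open>x\<close> has value a/b without a value group: the b-th power of
  \<open>x\<close> and the a-th power of \<open>\<pi>\<close> differ by a unit.\<close>

definition isval where
  "isval x a b \<longleftrightarrow> b > 0 \<and> x ^ b * \<pi> powi (- a) \<in> U" for a :: int and b :: nat

text \<open>Normalised by \<open>val \<pi> = 1\<close>. No pair satisfies
  \<open>isval 0 a b\<close>, so \<open>val 0\<close> is an arbitrary number and the rules assume
  nonzero arguments.\<close>

definition val :: "'w \<Rightarrow> real" where
  "val x = (THE r. \<exists>a b. isval x a b \<and> r = of_int a / of_nat b)"

lemma pi_powi: "\<pi> powi i * \<pi> powi j = \<pi> powi (i + j)" "inverse (\<pi> powi i) = \<pi> powi (- i)" "\<pi> powi i \<noteq> 0"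
  using pi(3) by (auto simp: power_int_add power_int_minus)

lemma pi_pow: "(\<pi> powi i) ^ n = \<pi> powi (i * int n)"
  by (simp add: power_int_mult)

lemma isval_unique:
  assumes "isval x a b" "isval x a' b'" shows "a * int b' = a' * int b"
proof -
  have "(x ^ b * \<pi> powi (- a)) ^ b' * inverse ((x ^ b' * \<pi> powi (- a')) ^ b) \<in> U"
    by (rule U_mult[OF U_power U_inverse[OF U_power]]) (use assms in \<open>auto simp: isval_def\<close>)
  moreover have "(x ^ b * \<pi> powi (- a)) ^ b' * inverse ((x ^ b' * \<pi> powi (- a')) ^ b) = \<pi> powi (a' * int b - a * int b')"
  proof -
    have x0: "x \<noteq> 0" using assms by (auto simp: isval_def U_iff zero_power)
    have "(x ^ b * \<pi> powi (- a)) ^ b' = x ^ (b * b') * \<pi> powi (- a * int b')"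
         "(x ^ b' * \<pi> powi (- a')) ^ b = x ^ (b * b') * \<pi> powi (- a' * int b)"
      by (auto simp: power_mult_distrib pi_pow mult.commute simp flip: power_mult)
    moreover have "\<pi> powi (- a * int b') * \<pi> powi (a' * int b) = \<pi> powi (a' * int b - a * int b')"
      by (simp add: pi_powi)
    ultimately show ?thesis using x0 by (simp add: pi_powi mult_ac)
  qed
  ultimately have "a' * int b - a * int b' = 0" by (simp only: pi_powi_U)
  thus ?thesis by simp
qed

lemma val_eqI: "isval x a b ==> val x = of_int a / of_nat b"
  unfolding val_def
proof (rule the_equality)
  fix r :: real assume i: "isval x a b" "\<exists>a b. isval x a b \<and> r = of_int a / of_nat b"
  then obtain a' b' where a': "isval x a' b'" "r = of_int a' / of_nat b'" by blast
  have "real_of_int (a * int b') = real_of_int (a' * int b)" using isval_unique[OF i(1) a'(1)] by simp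
  moreover have "real b > 0" "real b' > 0" using i(1) a' by (auto simp: isval_def)
  ultimately show "r = of_int a / of_nat b" unfolding a'(2) by (simp add: frac_eq_eq)
qed blast

text \<open>In a vanishing sum two terms have equal value. Their quotient is a power of x with
  exponent j - i times an element of \<open>k\<close>, so \<open>val x\<close> has a denominator
  bounded by the degree. The bound is what makes values of finite extensions discrete.\<close>

lemma isval_exists_bound:
  assumes "pover k p" "p \<noteq> 0" "poly p x = 0" "x \<noteq> 0"
  shows "\<exists>a b. isval x a b \<and> b \<le> degree p"
proof -
  define S where "S = {i. i \<le> degree p \<and> coeff p i \<noteq> 0}"
  have fS: "finite S" "S \<noteq> {}" using assms(2) by (auto simp: S_def intro: exI[of _ "degree p"])
  have "(\<Sum>i\<in>S. coeff p i * x ^ i) = poly p x"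
    unfolding poly_altdef by (rule sum.mono_neutral_left) (auto simp: S_def)
  hence "(\<Sum>i\<in>S. coeff p i * x ^ i) = 0" using assms(3) by simp
  hence "\<exists>i\<in>S. \<exists>j\<in>S. i \<noteq> j \<and> coeff p i * x ^ i / (coeff p j * x ^ j) \<in> U"
    using sum_nonzero_aux[OF fS, of "\<lambda>i. coeff p i * x ^ i"] assms(4) by (auto simp: S_def)
  then obtain i j where ij: "i \<in> S" "j \<in> S" "i \<noteq> j" "coeff p i * x ^ i / (coeff p j * x ^ j) \<in> U" by blast
  have "\<exists>i j. i \<in> S \<and> j \<in> S \<and> i < j \<and> coeff p i * x ^ i / (coeff p j * x ^ j) \<in> U"
  proof (cases "i < j")
    case False
    hence "j < i" "coeff p j * x ^ j / (coeff p i * x ^ i) \<in> U" using ij U_inverse[OF ij(4)] by auto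
    thus ?thesis using ij by blast
  qed (use ij in blast)
  then obtain i j where ij: "i \<in> S" "j \<in> S" "i < j" "coeff p i * x ^ i / (coeff p j * x ^ j) \<in> U" by blast
  define c where "c = coeff p i / coeff p j"
  have "c \<in> k" "c \<noteq> 0" using assms(1) ij algcl_subfld[OF k] by (auto simp: c_def S_def pover_def subfld_divide)
  then obtain e :: int where e: "c * \<pi> powi e \<in> U" using k_val[of c] by (auto simp: U_def)
  have "x ^ (j - i) = c * inverse (coeff p i * x ^ i / (coeff p j * x ^ j))"
    using ij assms(4) by (auto simp: c_def S_def field_simps power_diff)
  hence "x ^ (j - i) * \<pi> powi e = (c * \<pi> powi e) * inverse (coeff p i * x ^ i / (coeff p j * x ^ j))"
    by (simp add: mult_ac)
  hence "x ^ (j - i) * \<pi> powi e \<in> U" using U_mult[OF e U_inverse[OF ij(4)]] by (simp only:)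
  hence "isval x (- e) (j - i)" using ij by (auto simp: isval_def)
  moreover have "j - i \<le> degree p" using ij by (auto simp: S_def)
  ultimately show ?thesis by blast
qed

lemma isval_exists: "x \<noteq> 0 ==> \<exists>a b. isval x a b"
proof -
  assume "x \<noteq> 0"
  obtain p where "pover k p" "p \<noteq> 0" "poly p x = 0" using k by (auto simp: algcl_def)
  thus ?thesis using isval_exists_bound \<open>x \<noteq> 0\<close> by blast
qed

lemma val_1 [simp]: "val 1 = 0"
  using val_eqI[of 1 0 1] by (simp add: isval_def U_1)

lemma val_pi [simp]: "val \<pi> = 1"
  using val_eqI[of \<pi> 1 1] pi(3) U_1 by (simp add: isval_def power_int_minus)

lemma val_mult: assumes "x \<noteq> 0" "y \<noteq> 0" shows "val (x * y) = val x + val y"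
proof -
  obtain a b a' b' where i: "isval x a b" "isval y a' b'" using isval_exists assms by metis
  have "(x * y) ^ (b * b') * \<pi> powi (- (a * int b' + a' * int b)) = (x ^ b * \<pi> powi (- a)) ^ b' * (y ^ b' * \<pi> powi (- a')) ^ b"
  proof -
    have "(x ^ b * \<pi> powi (- a)) ^ b' = x ^ (b * b') * \<pi> powi (- a * int b')"
         "(y ^ b' * \<pi> powi (- a')) ^ b = y ^ (b * b') * \<pi> powi (- a' * int b)"
      by (auto simp: power_mult_distrib pi_pow mult.commute simp flip: power_mult)
    moreover have "\<pi> powi (- (a * int b' + a' * int b)) = \<pi> powi (- a * int b') * \<pi> powi (- a' * int b)"
      by (simp add: pi_powi)
    ultimately show ?thesis by (simp add: power_mult_distrib mult_ac)
  qed
  moreover have "(x ^ b * \<pi> powi (- a)) ^ b' * (y ^ b' * \<pi> powi (- a')) ^ b \<in> U" 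
    by (rule U_mult[OF U_power U_power]) (use i in \<open>auto simp: isval_def\<close>)
  ultimately have "isval (x * y) (a * int b' + a' * int b) (b * b')" using i by (auto simp: isval_def)
  hence "val (x * y) = of_int (a * int b' + a' * int b) / of_nat (b * b')" by (rule val_eqI)
  also have "\<dots> = val x + val y" unfolding val_eqI[OF i(1)] val_eqI[OF i(2)] 
    using i unfolding isval_def by (simp add: add_divide_distrib mult.commute)
  finally show ?thesis .
qed

lemma val_inverse: "x \<noteq> 0 ==> val (inverse x) = - val x"
  using val_mult[of x "inverse x"] by simp

lemma val_divide: "x \<noteq> 0 ==> y \<noteq> 0 ==> val (x / y) = val x - val y"
  using val_mult[of x "inverse y"] val_inverse[of y] by (simp add: field_class.field_divide_inverse)

lemma val_power: "x \<noteq> 0 ==> val (x ^ n) = of_nat n * val x"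
  by (induction n) (auto simp: val_mult algebra_simps)

lemma val_powi: "x \<noteq> 0 ==> val (x powi i) = of_int i * val x"
  by (cases "i \<ge> 0") (auto simp: power_int_def val_power val_inverse)

lemma isval_O: assumes i: "isval x a b" and a: "a \<ge> 0" shows "x \<in> \<O>"
proof (rule ccontr)
  assume "x \<notin> \<O>"
  hence x: "inverse x \<in> mx \<O>" "x \<noteq> 0" using m_inverse subrng_0[OF sO] by auto
  have u: "x ^ b * \<pi> powi (- a) \<in> \<O>" "b > 0" using i by (auto simp: isval_def U_def)
  have "(x ^ b * \<pi> powi (- a)) * \<pi> ^ nat a = x ^ b" using a pi(3) by (simp add: power_int_def power_inverse)
  moreover have "\<pi> ^ nat a \<in> \<O>" using pi(2) mx_subset[of \<O>] by (intro subrng_power[OF sO]) auto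
  ultimately have "x ^ b \<in> \<O>" using subrng_mult[OF sO u(1)] by metis
  from m_mult[OF this mx_pow[OF subfld_UNIV vO x(1) u(2)]] show False using x(2) m_1 by (simp add: power_inverse)
qed

lemma isval_inverse: "isval x a b ==> isval (inverse x) (- a) b"
  using U_inverse[of "x ^ b * \<pi> powi (- a)"] by (simp add: isval_def power_inverse power_int_minus mult.commute)

lemma O_val: assumes "x \<noteq> 0" shows "x \<in> \<O> \<longleftrightarrow> val x \<ge> 0" and U_val: "x \<in> U \<longleftrightarrow> val x = 0"
proof -
  obtain a b where i: "isval x a b" using isval_exists assms by metis
  hence b: "b > 0" and v: "val x = of_int a / of_nat b" using val_eqI by (auto simp: isval_def)
  show u: "x \<in> U \<longleftrightarrow> val x = 0"
  proof
    assume "val x = 0"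
    hence "a = 0" using v b by simp
    thus "x \<in> U" using isval_O[OF i] isval_O[OF isval_inverse[OF i]] assms by (simp add: U_iff)
  qed (use val_eqI[of x 0 1] in \<open>simp add: isval_def\<close>)
  have e: "a \<ge> 0 \<longleftrightarrow> val x \<ge> 0" using v b by (simp add: zero_le_divide_iff)
  show "x \<in> \<O> \<longleftrightarrow> val x \<ge> 0"
  proof (cases "a \<ge> 0")
    case False
    hence "inverse x \<in> \<O>" using isval_O[OF isval_inverse[OF i]] by simp
    hence "x \<in> \<O> ==> val x = 0" using u assms by (simp add: U_iff)
    thus ?thesis using False e by auto
  qed (use isval_O[OF i] e in simp)
qed

lemma m_val: "x \<noteq> 0 ==> x \<in> mx \<O> \<longleftrightarrow> val x > 0"
  using O_val[of x] U_val[of x] mx_subset[of \<O>] by (auto simp: U_def)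

lemma val_uminus [simp]: "x \<noteq> 0 ==> val (- x) = val x"
proof -
  assume "x \<noteq> 0"
  have "- 1 \<in> U" using subrng_uminus[OF sO subrng_1[OF sO]] by (simp add: U_iff)
  hence "val (- 1) = 0" using U_val by auto
  thus ?thesis using val_mult[of "- 1" x] \<open>x \<noteq> 0\<close> by simp
qed

lemma val_add_ge: assumes "x \<noteq> 0" "y \<noteq> 0" "x + y \<noteq> 0" shows "val (x + y) \<ge> min (val x) (val y)"
proof -
  have *: "val (x + y) \<ge> val x" if "x \<noteq> 0" "y \<noteq> 0" "x + y \<noteq> 0" "val x \<le> val y" for x y
  proof -
    have "y / x \<in> \<O>" using that O_val[of "y / x"] by (simp add: val_divide)
    hence "1 + y / x \<in> \<O>" using subrng_add[OF sO subrng_1[OF sO]] by blast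
    moreover have "1 + y / x \<noteq> 0" "x + y = x * (1 + y / x)" using that by (auto simp: field_simps add_eq_0_iff)
    ultimately show ?thesis using val_mult[of x "1 + y / x"] O_val[of "1 + y / x"] that by simp
  qed
  show ?thesis using *[of x y] *[of y x] assms by (cases "val x \<le> val y") (auto simp: add.commute)
qed

lemma val_add_lt: assumes "x \<noteq> 0" "y = 0 \<or> val x < val y" shows "x + y \<noteq> 0" "val (x + y) = val x"
proof -
  show nz: "x + y \<noteq> 0" using assms by (auto simp: add_eq_0_iff)
  show "val (x + y) = val x"
  proof (cases "y = 0")
    case False
    have "val (x + y) \<ge> val x" using val_add_ge[OF assms(1) False nz] assms False by auto
    moreover have "val x \<ge> min (val (x + y)) (val y)"
      using val_add_ge[of "x + y" "- y"] nz False assms by simp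
    ultimately show ?thesis using assms False by auto
  qed simp
qed

lemma sum_nonzero:
  assumes "finite I" "I \<noteq> {}" "\<And>i. i \<in> I ==> f i \<noteq> 0" "inj_on (\<lambda>i. val (f i)) I"
  shows "sum f I \<noteq> 0"
proof (rule sum_nonzero_aux[OF assms(1-3)])
  fix i j assume "i \<in> I" "j \<in> I" "i \<noteq> j"
  thus "f i / f j \<notin> U" using assms(3)[of i] assms(3)[of j] inj_onD[OF assms(4), of i j] U_val[of "f i / f j"]
    by (auto simp: val_divide)
qed

lemma val_k: "x \<in> k ==> x \<noteq> 0 ==> \<exists>i::int. val x = of_int i"
proof -
  assume x: "x \<in> k" "x \<noteq> 0"
  then obtain i :: int where "x * \<pi> powi i \<in> U" using k_val by (auto simp: U_def)
  hence "val (x * \<pi> powi i) = 0" using U_val x pi_powi(3) by simp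
  hence "val x = of_int (- i)" using x pi by (simp add: val_mult val_powi)
  thus ?thesis by blast
qed

lemma val_Aut:
  assumes "fhom UNIV \<sigma>" "\<sigma> \<pi> = \<pi>" "subfld A" "\<pi> \<in> A" "\<And>y. y \<in> A ==> y \<in> \<O> ==> \<sigma> y \<in> \<O>" "x \<in> A" "x \<noteq> 0"
  shows "val (\<sigma> x) = val x"
proof -
  note h = assms(1)
  obtain a b where i: "isval x a b" using isval_exists assms by metis
  have u: "x ^ b * \<pi> powi (- a) \<in> U" using i by (auto simp: isval_def)
  have A: "x ^ b * \<pi> powi (- a) \<in> A" using assms by (auto intro!: subfld_closed)
  have e: "\<sigma> (x ^ b * \<pi> powi (- a)) = \<sigma> x ^ b * \<pi> powi (- a)"
    by (simp add: hom_mult[OF h] hom_power[OF h] hom_powi[OF h] assms(2))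
  have "\<sigma> z \<in> U" if "z \<in> U" "z \<in> A" for z
    using assms(5)[OF that(2)] assms(5)[OF subfld_inverse[OF assms(3) that(2)]] that hom_inverse[OF h] 
      hom_nonzero[OF h] by (simp add: U_iff)
  hence "\<sigma> (x ^ b * \<pi> powi (- a)) \<in> U" using u A by blast
  hence "isval (\<sigma> x) a b" using i e by (auto simp: isval_def)
  thus ?thesis using val_eqI i by metis
qed

end

section \<open>Decomposition groups\<close>

text \<open>Every residue is 0 or a root of unity, as in a residue field algebraic over a finite
  field. Suitable powers then have residue 0 or 1, which gives approximation at several valuation
  rings at once.\<close>

definition tors :: "'w::field set \<Rightarrow> bool" where
  "tors V \<longleftrightarrow> (\<forall>y\<in>V. \<exists>j>0. y ^ j \<in> mx V \<or> y ^ j - 1 \<in> mx V)"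

context
  fixes A V :: "'w::field set"
  assumes A: "subfld A" and V: "vring A V"
begin

lemma cong1_mult: assumes "x - 1 \<in> mx V" "y - 1 \<in> mx V" shows "x * y - 1 \<in> mx V"
proof -
  have s: "subrng V" using vringD(1)[OF V] .
  have "x = (x - 1) + 1" by simp
  hence "x \<in> V" using assms(1) mx_subset subrng_add[OF s _ subrng_1[OF s]] by (metis subsetD)
  hence "x * (y - 1) + (x - 1) \<in> mx V" using mx_add[OF A V mx_mult[OF A V]] assms by blast
  thus ?thesis by (simp add: algebra_simps)
qed

lemma cong1_power: "x - 1 \<in> mx V ==> x ^ n - 1 \<in> mx V"
  by (induction n) (auto simp: mx_0[OF vringD(1)[OF V]] cong1_mult)

lemma cong1_prod: "(\<And>i. i \<in> I ==> f i - 1 \<in> mx V) ==> prod f I - 1 \<in> mx V"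
  by (induction I rule: infinite_finite_induct) (auto simp: mx_0[OF vringD(1)[OF V]] cong1_mult)

lemma cong1_in: "x - 1 \<in> mx V ==> x \<in> V \<and> x \<noteq> 0 \<and> inverse x \<in> V"
proof -
  assume x: "x - 1 \<in> mx V"
  have s: "subrng V" using vringD(1)[OF V] .
  have xV: "x \<in> V" using subrng_add[OF s _ subrng_1[OF s], of "x - 1"] x mx_subset[of V] by auto
  have "x \<notin> mx V"
  proof
    assume "x \<in> mx V"
    hence "x - (x - 1) \<in> mx V" using mx_diff[OF A V _ x] by blast
    thus False using mx_1[OF s] by simp
  qed
  thus ?thesis using xV by (auto simp: mx_def)
qed

lemma cong1_inverse: "x - 1 \<in> mx V ==> inverse x - 1 \<in> mx V"
proof -
  assume x: "x - 1 \<in> mx V"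
  have "inverse x - 1 = inverse x * - (x - 1)" using cong1_in[OF x] by (simp add: algebra_simps)
  thus ?thesis using mx_mult[OF A V _ mx_uminus[OF A V x]] cong1_in[OF x] by metis
qed

lemma mx_prod: 
  assumes "finite I" "i \<in> I" "f i \<in> mx V" "\<And>j. j \<in> I ==> f j \<in> V" shows "prod f I \<in> mx V"
proof -
  have "prod f I = prod f (I - {i}) * f i" using prod.remove[OF assms(1,2), of f] by (simp add: mult.commute)
  moreover have "prod f (I - {i}) \<in> V" by (rule subrng_prod[OF vringD(1)[OF V]]) (use assms in auto)
  ultimately show ?thesis using mx_mult[OF A V _ assms(3)] by simp
qed

end

text \<open>Take \<open>s = 1 / (1 - u + u\<^sup>2)\<close>, where \<open>u\<close> is a power of \<open>y\<close> with residue \<open>0\<close> or \<open>1\<close> wherever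
  \<open>y\<close> is integral.\<close>

lemma separating_element:
  assumes A: "subfld A" and fin: "finite \<W>" and W: "\<And>W. W \<in> \<W> ==> vring A W" "\<And>W. W \<in> \<W> ==> tors W"
    and y: "y \<in> A"
  shows "\<exists>s\<in>A. \<forall>W\<in>\<W>. (y \<in> W \<longrightarrow> s - 1 \<in> mx W) \<and> (y \<notin> W \<longrightarrow> s \<in> mx W)"
proof -
  have "\<exists>j. \<forall>W\<in>\<W>. j W > 0 \<and> (y \<in> W \<longrightarrow> y ^ j W \<in> mx W \<or> y ^ j W - 1 \<in> mx W)"
  proof (rule bchoice, rule ballI)
    fix W assume w: "W \<in> \<W>"
    show "\<exists>j>0. y \<in> W \<longrightarrow> y ^ j \<in> mx W \<or> y ^ j - 1 \<in> mx W"
    proof (cases "y \<in> W")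
      case True thus ?thesis using W(2)[OF w] by (auto simp: tors_def)
    qed (auto intro: exI[of _ 1])
  qed
  then obtain j where j: "\<And>W. W \<in> \<W> ==> (j W :: nat) > 0" 
    "\<And>W. W \<in> \<W> ==> y \<in> W ==> y ^ j W \<in> mx W \<or> y ^ j W - 1 \<in> mx W" by blast
  \<comment> \<open>A common multiple of the exponents, so that u has residue 0 or 1 at every ring
    containing \<open>y\<close>; then D - 1 = u (u - 1) is in the maximal ideal.\<close>
  define J where "J = prod j \<W>"
  have J: "J > 0" unfolding J_def by (rule prod_pos) (use j in auto)
  define u where "u = y ^ J"
  define D where "D = 1 - u + u ^ 2"
  have uA: "u \<in> A" unfolding u_def by (rule subfld_power[OF A y])
  have "inverse D - 1 \<in> mx W" if w: "W \<in> \<W>" "y \<in> W" for W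
  proof -
    note v = A W(1)[OF w(1)]
    have s: "subrng W" using vringD(1)[OF v(2)] .
    have "j W dvd J" unfolding J_def using fin w(1) by (rule dvd_prodI)
    then obtain l where l: "J = j W * l" by auto
    have l0: "l > 0" using l J by auto
    have u: "u = (y ^ j W) ^ l" by (simp add: u_def l power_mult)
    have "u \<in> mx W \<or> u - 1 \<in> mx W"
    proof (cases "y ^ j W \<in> mx W")
      case True
      thus ?thesis using mx_pow[OF v True l0] u by simp
    next
      case False
      thus ?thesis unfolding u using cong1_power[OF v] j(2)[OF w] by blast
    qed
    moreover have "u \<in> W" unfolding u_def by (rule subrng_power[OF s w(2)])
    moreover have "D - 1 = u * (u - 1)" "D - 1 = (u - 1) * u" by (auto simp: D_def power2_eq_square algebra_simps)
    ultimately have "D - 1 \<in> mx W" using mx_mult[OF v] subrng_diff[OF s _ subrng_1[OF s]] by metis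
    thus ?thesis by (rule cong1_inverse[OF v])
  qed
  moreover have "inverse D \<in> mx W" if w: "W \<in> \<W>" "y \<notin> W" for W
  proof -
    note v = A W(1)[OF w(1)]
    have s: "subrng W" using vringD(1)[OF v(2)] .
    have y0: "y \<noteq> 0" using w(2) subrng_0[OF s] by auto
    have i: "inverse y \<in> mx W" by (rule mx_inverse[OF v y w(2)])
    define z where "z = inverse u"
    have z: "z \<in> mx W" using mx_pow[OF v i J] by (simp add: z_def u_def power_inverse)
    have zW: "z \<in> W" using z mx_subset by blast
    have u0: "u \<noteq> 0" using y0 by (simp add: u_def)
    define E where "E = z ^ 2 - z + 1"
    have "E - 1 = (z - 1) * z" by (simp add: E_def power2_eq_square algebra_simps)
    hence "E - 1 \<in> mx W" using mx_mult[OF v _ z] subrng_diff[OF s zW subrng_1[OF s]] by metis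
    hence E: "inverse E \<in> W" "E \<noteq> 0" using cong1_in[OF v] by auto
    \<comment> \<open>Where \<open>y\<close> is not integral, z = 1/u is in the maximal ideal and
      1/D = z^2 / (1 - z + z^2).\<close>
    have "D = E * (u * u)" using u0 by (simp add: D_def E_def z_def power2_eq_square field_simps)
    hence "inverse D = inverse E * z * z" by (simp add: z_def)
    thus ?thesis using mx_mult[OF v _ z, of "inverse E * z"] subrng_mult[OF s E(1) zW] by simp
  qed
  moreover have "inverse D \<in> A" unfolding D_def using uA A by (auto intro!: subfld_closed)
  ultimately show ?thesis by blast
qed

lemma separating_pair:
  assumes A: "subfld A" and fin: "finite \<W>" and W: "\<And>W. W \<in> \<W> ==> vring A W" "\<And>W. W \<in> \<W> ==> tors W"
    and VW: "V \<in> \<W>" "W \<in> \<W>" "\<not> V \<subseteq> W"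
  shows "\<exists>s. s \<in> A \<and> s - 1 \<in> mx V \<and> s \<in> mx W \<and> (\<forall>W'\<in>\<W>. s \<in> W')"
proof -
  obtain y where y: "y \<in> V" "y \<notin> W" using VW(3) by blast
  have yA: "y \<in> A" using y(1) vringD(2)[OF W(1)[OF VW(1)]] by blast
  obtain s where s: "s \<in> A" "\<And>W. W \<in> \<W> ==> y \<in> W ==> s - 1 \<in> mx W" "\<And>W. W \<in> \<W> ==> y \<notin> W ==> s \<in> mx W"
    using separating_element[OF A fin W yA] by blast
  have "s \<in> W'" if w': "W' \<in> \<W>" for W'
    using s(2,3)[OF w'] cong1_in[OF A W(1)[OF w']] mx_subset[of W'] by blast
  thus ?thesis using s y VW by blast
qed

lemma mx_image:
  assumes "fhom UNIV \<sigma>" "bij \<sigma>" shows "mx (\<sigma> ` V) = \<sigma> ` mx V"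
proof -
  have *: "inverse (\<sigma> x) \<in> \<sigma> ` V \<longleftrightarrow> inverse x \<in> V" for x
    using hom_inverse[OF assms(1)] assms(2) by (metis bij_is_inj inj_image_mem_iff iso_tuple_UNIV_I)
  have "\<sigma> x = 0 \<longleftrightarrow> x = 0" for x using hom_0[OF assms(1)] hom_nonzero[OF assms(1)] by auto
  thus ?thesis using * by (auto simp: mx_def)
qed

lemma vring_image:
  assumes "fhom UNIV \<sigma>" "bij \<sigma>" "\<sigma> ` A = A" "vring A V" shows "vring A (\<sigma> ` V)"
  unfolding vring_def subrng_def
proof (intro conjI ballI)
  note h = assms(1)
  note s = vringD(1)[OF assms(4)]
  show "1 \<in> \<sigma> ` V" using subrng_1[OF s] hom_1[OF h] by (metis imageI)
  fix x y assume "x \<in> \<sigma> ` V" "y \<in> \<sigma> ` V"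
  then obtain a b where "a \<in> V" "b \<in> V" "x = \<sigma> a" "y = \<sigma> b" by auto
  thus "x - y \<in> \<sigma> ` V" "x * y \<in> \<sigma> ` V"
    using imageI[OF subrng_diff[OF s, of a b], of \<sigma>] imageI[OF subrng_mult[OF s, of a b], of \<sigma>] 
      hom_diff[OF h, of a b] hom_mult[OF h, of a b] by simp_all
next
  show "\<sigma> ` V \<subseteq> A" using assms(3) vringD(2)[OF assms(4)] by blast
next
  fix x assume "x \<in> A"
  then obtain a where a: "a \<in> A" "x = \<sigma> a" using assms(3) by blast
  hence "a \<in> V \<or> inverse a \<in> V" using vringD(3)[OF assms(4)] by blast
  thus "x \<in> \<sigma> ` V \<or> inverse x \<in> \<sigma> ` V" using a(2) hom_inverse[OF assms(1), of a] by (auto intro: image_eqI[of _ \<sigma> "inverse a"])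
qed

lemma tors_image:
  assumes "fhom UNIV \<sigma>" "bij \<sigma>" "tors V" shows "tors (\<sigma> ` V)"
  unfolding tors_def mx_image[OF assms(1,2)]
proof
  fix y assume "y \<in> \<sigma> ` V"
  then obtain x where x: "x \<in> V" "y = \<sigma> x" by auto
  then obtain j where j: "j > 0" "x ^ j \<in> mx V \<or> x ^ j - 1 \<in> mx V" using assms(3) by (auto simp: tors_def)
  have "\<sigma> (x ^ j) = y ^ j" "\<sigma> (x ^ j - 1) = y ^ j - 1" using x(2) hom_1[OF assms(1)]
    by (simp_all add: hom_power[OF assms(1)] hom_diff[OF assms(1)])
  thus "\<exists>j>0. y ^ j \<in> \<sigma> ` mx V \<or> y ^ j - 1 \<in> \<sigma> ` mx V" using j by (metis imageI)
qed

text \<open>Orbits under \<open>Aut B\<close> are finite, and an injective self-map of the finite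
  set orbit \<inter> V is onto.\<close>

lemma Aut_image_subset_eq:
  fixes B :: "'w::field set"
  assumes B: "algcl B" and s: "\<sigma> \<in> Aut B" "\<sigma> ` V \<subseteq> V" shows "\<sigma> ` V = V"
proof
  show "V \<subseteq> \<sigma> ` V"
  proof
    fix x assume x: "x \<in> V"
    define R where "R = (\<lambda>\<tau>. \<tau> x) ` Aut B"
    have R: "\<sigma> ` R = R" unfolding R_def by (rule autgrp_orbit[OF autgrp_Aut s(1)])
    have "finite (R \<inter> V)" using finite_orbit[OF B] by (simp add: R_def)
    moreover have "\<sigma> ` (R \<inter> V) \<subseteq> R \<inter> V" using R s(2) by blast
    moreover have "inj_on \<sigma> (R \<inter> V)" using Aut_bij[OF s(1)] by (meson bij_is_inj inj_on_subset subset_UNIV)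
    ultimately have "\<sigma> ` (R \<inter> V) = R \<inter> V" by (rule endo_inj_surj)
    moreover have "x \<in> R" unfolding R_def by (rule self_orbit[OF autgrp_Aut]) simp
    ultimately show "x \<in> \<sigma> ` V" using x by blast
  qed
qed (rule s(2))

lemma finite_Rst_image:
  assumes "finite (Rst H A)" "V \<subseteq> A" shows "finite ((\<lambda>\<sigma>. \<sigma> ` V) ` H)"
proof -
  have "(\<lambda>\<sigma>. \<sigma> ` V) ` H \<subseteq> (\<lambda>\<rho>. \<rho> ` V) ` Rst H A"
  proof (rule image_subsetI)
    fix \<sigma> assume "\<sigma> \<in> H"
    hence r: "restrict \<sigma> A \<in> Rst H A" by (simp add: Rst_def)
    have e: "\<sigma> ` V = restrict \<sigma> A ` V" by (rule image_cong) (use assms(2) in auto)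
    show "\<sigma> ` V \<in> (\<lambda>\<rho>. \<rho> ` V) ` Rst H A" unfolding e using r by (rule imageI)
  qed
  thus ?thesis by (rule finite_subset) (simp add: assms(1))
qed

lemma Gal_orbit_coeffs:
  fixes B :: "'w::alg_closed_field set"
  assumes B: "algcl B" and G: "Gal B A" and x: "x \<in> A"
  shows "pover B (root_poly ((\<lambda>\<sigma>. \<sigma> x) ` Aut B))"
  unfolding pover_def
proof (intro allI Gal_fixed[OF B G order_refl algcl_subfld[OF B]])
  fix i
  have "(\<lambda>\<sigma>. \<sigma> x) ` Aut B \<subseteq> A" using Gal_mem[OF G] x by blast
  thus "coeff (root_poly ((\<lambda>\<sigma>. \<sigma> x) ` Aut B)) i \<in> A" 
    using pover_coeff[OF Gal_D(1)[OF G]] by (simp add: pover_def)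
qed (rule orbit_poly(3)[OF B autgrp_Aut order.refl])

lemma root_poly_coeff_subrng:
  assumes s: "subrng V" and "R \<subseteq> V" shows "coeff (root_poly R) i \<in> V"
  using assms(2)
proof (induction R arbitrary: i rule: infinite_finite_induct)
  case (insert r R)
  have "coeff ([:- r, 1:] * root_poly R) i \<in> V"
    using insert by (auto simp: coeff_pCons split: nat.split intro!: subrng_closed[OF s])
  thus ?case using prod.insert[OF insert.hyps(1,2), of "\<lambda>r. [:- r, 1:]"] by simp
qed (auto simp: subrng_closed[OF s])

text \<open>If no conjugate of \<open>V1\<close> lay in \<open>V2\<close>, some z would be congruent
  to 1 at all conjugates of \<open>V1\<close> and lie in the maximal ideal of \<open>V2\<close>.
  Then 1/z is integral over V1 \<inter> B, hence over \<open>V2\<close>, so it lies in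
  \<open>V2\<close>, a contradiction.\<close>

lemma vrings_dominated:
  fixes B :: "'w::alg_closed_field set"
  assumes B: "algcl B" and G: "Gal B A" and fin: "finite (Rst (Aut B) A)"
    and V1: "vring A V1" "tors V1" and V2: "vring A V2" "tors V2" and le: "V1 \<inter> B \<subseteq> V2"
  obtains \<sigma> where "\<sigma> \<in> Aut B" "\<sigma> ` V1 \<subseteq> V2"
proof (rule ccontr)
  assume not: "\<not> thesis"
  note th = that
  have A: "subfld A" using Gal_D(1)[OF G] .
  define \<W> where "\<W> = (\<lambda>\<sigma>. \<sigma> ` V1) ` Aut B"
  have fW: "finite \<W>" unfolding \<W>_def by (rule finite_Rst_image[OF fin vringD(2)[OF V1(1)]])
  have W: "vring A W" "tors W" if "W \<in> insert V2 \<W>" for W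
    using that V2 vring_image[OF Aut_fhom Aut_bij Gal_image[OF G] V1(1)] tors_image[OF Aut_fhom Aut_bij V1(2)] 
    by (auto simp: \<W>_def)
  have "\<forall>W\<in>\<W>. \<exists>s. s \<in> A \<and> s - 1 \<in> mx W \<and> s \<in> mx V2 \<and> (\<forall>W'\<in>insert V2 \<W>. s \<in> W')"
  proof
    fix W assume w: "W \<in> \<W>"
    then obtain \<sigma> where "\<sigma> \<in> Aut B" "W = \<sigma> ` V1" by (auto simp: \<W>_def)
    hence "\<not> W \<subseteq> V2" using not th[of \<sigma>] by metis
    thus "\<exists>s. s \<in> A \<and> s - 1 \<in> mx W \<and> s \<in> mx V2 \<and> (\<forall>W'\<in>insert V2 \<W>. s \<in> W')"
      by (intro separating_pair[OF A _ W]) (use fW w in auto)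
  qed
  from bchoice[OF this] obtain s where 
    s0: "\<forall>W\<in>\<W>. s W \<in> A \<and> s W - 1 \<in> mx W \<and> s W \<in> mx V2 \<and> (\<forall>W'\<in>insert V2 \<W>. s W \<in> W')" ..
  have s: "s W \<in> A" "s W - 1 \<in> mx W" "W' \<in> insert V2 \<W> ==> s W \<in> W'" "s W \<in> mx V2" if "W \<in> \<W>" for W W'
    using s0 that by auto
  \<comment> \<open>The factor for \<open>W\<close> is small at \<open>W\<close>, which makes z
    congruent to 1 there; all factors are congruent to 1 at \<open>V2\<close>, which makes z small
    there.\<close>
  define z where "z = 1 - (\<Prod>W\<in>\<W>. 1 - s W)"
  have zA: "z \<in> A" unfolding z_def using s(1) A by (auto intro!: subfld_closed)
  have zW: "inverse z \<in> W" "z \<noteq> 0" if w: "W \<in> \<W>" for W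
  proof -
    have w': "W \<in> insert V2 \<W>" using w by simp
    note v = A W(1)[OF w']
    have "(\<Prod>W\<in>\<W>. 1 - s W) \<in> mx W"
    proof (rule mx_prod[OF v fW w])
      show "1 - s W \<in> mx W" using mx_uminus[OF v s(2)[OF w]] by simp
      fix W' assume "W' \<in> \<W>"
      thus "1 - s W' \<in> W" using s(3)[OF _ w'] subrng_diff[OF vringD(1)[OF v(2)] subrng_1[OF vringD(1)[OF v(2)]]] by blast
    qed
    hence "z - 1 \<in> mx W" using mx_uminus[OF v] by (simp add: z_def)
    thus "inverse z \<in> W" "z \<noteq> 0" using cong1_in[OF v] by auto
  qed
  have v2: "z \<in> mx V2"
  proof -
    have "(\<Prod>W\<in>\<W>. 1 - s W) - 1 \<in> mx V2"
      by (rule cong1_prod[OF A V2(1)]) (use mx_uminus[OF A V2(1) s(4)] in auto)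
    thus ?thesis using mx_uminus[OF A V2(1)] unfolding z_def by (metis minus_diff_eq)
  qed
  have V1W: "V1 \<in> \<W>" unfolding \<W>_def by (rule self_orbit[OF autgrp_Aut]) simp
  note z0 = zW(2)[OF V1W]
  define x where "x = inverse z"
  have xA: "x \<in> A" unfolding x_def by (rule subfld_inverse[OF A zA])
  define R where "R = (\<lambda>\<sigma>. \<sigma> x) ` Aut B"
  have "R \<subseteq> V1"
  proof
    fix r assume "r \<in> R"
    then obtain \<sigma> where t: "\<sigma> \<in> Aut B" "r = \<sigma> x" by (auto simp: R_def)
    have "finv \<sigma> ` V1 \<in> \<W>" using autgrpD(3)[OF autgrp_Aut t(1)] by (auto simp: \<W>_def)
    hence "x \<in> finv \<sigma> ` V1" using zW(1) by (simp add: x_def)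
    thus "r \<in> V1" using t by (auto simp: bij_inv_simps[OF Aut_bij[OF t(1)]])
  qed
  hence "coeff (root_poly R) i \<in> V1" for i
    using root_poly_coeff_subrng[OF vringD(1)[OF V1(1)]] by blast
  moreover have "pover B (root_poly R)" unfolding R_def by (rule Gal_orbit_coeffs[OF B G xA])
  ultimately have "pover V2 (root_poly R)" using le by (auto simp: pover_def)
  moreover have "poly (root_poly R) x = 0"
    unfolding R_def poly_root_poly[OF finite_orbit[OF B]] by (rule self_orbit[OF autgrp_Aut]) simp
  ultimately have "x \<in> V2" using vring_int_closed[OF A V2(1) xA] monic_root_poly by blast
  thus False using v2 z0 by (auto simp: mx_def x_def)
qed

text \<open>Domination in both directions composes to a self-inclusion of \<open>V2\<close>, and
  such an inclusion is an equality.\<close>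

lemma vrings_conjugate:
  fixes B :: "'w::alg_closed_field set"
  assumes B: "algcl B" and G: "Gal B A" and fin: "finite (Rst (Aut B) A)"
    and V1: "vring A V1" "tors V1" and V2: "vring A V2" "tors V2" and eq: "V1 \<inter> B = V2 \<inter> B"
  obtains \<sigma> where "\<sigma> \<in> Aut B" "\<sigma> ` V1 = V2"
proof -
  obtain \<sigma> where s: "\<sigma> \<in> Aut B" "\<sigma> ` V1 \<subseteq> V2" using vrings_dominated[OF B G fin V1 V2] eq by blast
  obtain \<tau> where t: "\<tau> \<in> Aut B" "\<tau> ` V2 \<subseteq> V1" using vrings_dominated[OF B G fin V2 V1] eq by blast
  have "\<sigma> \<circ> \<tau> \<in> Aut B" using autgrpD(5)[OF autgrp_Aut] s t by blast
  moreover have "(\<sigma> \<circ> \<tau>) ` V2 \<subseteq> V2" using s t by auto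
  ultimately have "(\<sigma> \<circ> \<tau>) ` V2 = V2" by (rule Aut_image_subset_eq[OF B])
  moreover have "(\<sigma> \<circ> \<tau>) ` V2 \<subseteq> \<sigma> ` V1" unfolding image_comp[symmetric] by (rule image_mono[OF t(2)])
  ultimately have "\<sigma> ` V1 = V2" using s(2) by auto
  thus ?thesis using that s by blast
qed

text \<open>The decomposition group when \<open>V = \<O> \<inter> A\<close>, inflated to the ambient
  field. With a field in place of \<open>V\<close> it describes the automorphisms over
  \<open>B\<close> that stabilise that field.\<close>

definition Dec :: "'w::field set \<Rightarrow> 'w set \<Rightarrow> ('w \<Rightarrow> 'w) set" where
  "Dec B V = {\<sigma> \<in> Aut B. \<sigma> ` V = V}"

lemma autgrp_Dec: "autgrp (Dec B V)"
  unfolding autgrp_def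
proof (intro conjI ballI)
  fix \<sigma> assume s: "\<sigma> \<in> Dec B V"
  hence a: "\<sigma> \<in> Aut B" "\<sigma> ` V = V" by (auto simp: Dec_def)
  show "fhom UNIV \<sigma>" "bij \<sigma>" using Aut_fhom Aut_bij a(1) by auto
  have "finv \<sigma> ` \<sigma> ` V = V" using Aut_bij[OF a(1)] by (simp add: image_comp bij_inv_simps)
  thus "finv \<sigma> \<in> Dec B V" using a autgrpD(3)[OF autgrp_Aut a(1)] by (simp add: Dec_def)
next
  show "id \<in> Dec B V" using autgrpD(4)[OF autgrp_Aut] by (simp add: Dec_def)
next
  fix \<sigma> \<tau> assume "\<sigma> \<in> Dec B V" "\<tau> \<in> Dec B V"
  hence a: "\<sigma> \<in> Aut B" "\<tau> \<in> Aut B" "\<sigma> ` V = V" "\<tau> ` V = V" by (auto simp: Dec_def)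
  have "(\<sigma> \<circ> \<tau>) ` V = V" unfolding image_comp[symmetric] a ..
  thus "\<sigma> \<circ> \<tau> \<in> Dec B V" using autgrpD(5)[OF autgrp_Aut a(1,2)] by (simp add: Dec_def)
qed

lemma Dec_Aut: "\<sigma> \<in> Dec B V ==> \<sigma> \<in> Aut B"
  by (simp add: Dec_def)

locale tors_place = place \<O> k \<pi> for \<O> k :: "'w::alg_closed_field set" and \<pi> +
  assumes tors_O: "tors \<O>"
begin

lemma vring_O_Int: "subfld A ==> vring A (\<O> \<inter> A)"
  using vring_Int[OF vO] by simp

lemma tors_O_Int: assumes "subfld A" shows "tors (\<O> \<inter> A)"
  unfolding tors_def mx_Int[OF assms]
proof
  fix y assume y: "y \<in> \<O> \<inter> A"
  then obtain j where j: "j > 0" "y ^ j \<in> mx \<O> \<or> y ^ j - 1 \<in> mx \<O>" using tors_O by (auto simp: tors_def)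
  have "y ^ j \<in> A" "y ^ j - 1 \<in> A" using y assms by (auto intro!: subfld_closed)
  thus "\<exists>j>0. y ^ j \<in> mx \<O> \<inter> A \<or> y ^ j - 1 \<in> mx \<O> \<inter> A" using j by blast
qed

text \<open>The decomposition field is an immediate extension: for \<open>t\<close> congruent to \<open>1\<close> at \<open>V\<close> and to
  \<open>0\<close> at the other conjugates of \<open>V\<close>, the trace of \<open>z t\<^sup>j\<close> is close to \<open>z\<close>.\<close>

lemma decomposition_field_immediate:
  assumes B: "algcl B" and kB: "k \<subseteq> B" and G: "Gal B A" and fin: "finite (Rst (Aut B) A)"
    and z: "z \<in> A" "z \<noteq> 0" "\<And>\<sigma>. \<sigma> \<in> Dec B (\<O> \<inter> A) ==> \<sigma> z = z"
  shows "\<exists>x\<in>B. x \<noteq> 0 \<and> x / z - 1 \<in> mx \<O>"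
proof -
  have A: "subfld A" using Gal_D(1)[OF G] .
  define V where "V = \<O> \<inter> A"
  have V: "vring A V" "tors V" unfolding V_def using vring_O_Int[OF A] tors_O_Int[OF A] by auto
  have mV: "mx V = mx \<O> \<inter> A" unfolding V_def by (rule mx_Int[OF A])
  define \<W> where "\<W> = (\<lambda>\<sigma>. \<sigma> ` V) ` Aut B"
  have fW: "finite \<W>" unfolding \<W>_def by (rule finite_Rst_image[OF fin vringD(2)[OF V(1)]])
  have W: "vring A W" "tors W" if "W \<in> \<W>" for W
    using that vring_image[OF Aut_fhom Aut_bij Gal_image[OF G] V(1)] tors_image[OF Aut_fhom Aut_bij V(2)] 
    by (auto simp: \<W>_def)
  have VW: "V \<in> \<W>" unfolding \<W>_def by (rule self_orbit[OF autgrp_Aut]) simp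
  have "\<forall>W\<in>\<W> - {V}. \<exists>s. s \<in> A \<and> s - 1 \<in> mx V \<and> s \<in> mx W \<and> (\<forall>W'\<in>\<W>. s \<in> W')"
  proof
    fix W assume w: "W \<in> \<W> - {V}"
    then obtain \<sigma> where s: "\<sigma> \<in> Aut B" "W = \<sigma> ` V" by (auto simp: \<W>_def)
    have "\<not> V \<subseteq> W"
    proof
      assume "V \<subseteq> W"
      hence "finv \<sigma> ` V \<subseteq> V" using s by (auto simp: bij_inv_simps[OF Aut_bij[OF s(1)]] dest!: subsetD)
      hence "finv \<sigma> ` V = V" by (rule Aut_image_subset_eq[OF B autgrpD(3)[OF autgrp_Aut s(1)]])
      hence "\<sigma> ` finv \<sigma> ` V = \<sigma> ` V" by simp
      thus False using s w by (simp add: image_comp bij_inv_simps[OF Aut_bij[OF s(1)]])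
    qed
    thus "\<exists>s. s \<in> A \<and> s - 1 \<in> mx V \<and> s \<in> mx W \<and> (\<forall>W'\<in>\<W>. s \<in> W')"
      by (intro separating_pair[OF A fW W VW]) (use w in auto)
  qed
  from bchoice[OF this] obtain s where
    s0: "\<forall>W\<in>\<W> - {V}. s W \<in> A \<and> s W - 1 \<in> mx V \<and> s W \<in> mx W \<and> (\<forall>W'\<in>\<W>. s W \<in> W')" ..
  \<comment> \<open>Congruent to 1 at \<open>V\<close> and in the maximal ideal of every other
    conjugate of \<open>V\<close>.\<close>
  define t0 where "t0 = (\<Prod>W\<in>\<W> - {V}. s W)"
  have t0A: "t0 \<in> A" unfolding t0_def using s0 by (intro subfld_prod[OF A]) auto
  have t01: "t0 - 1 \<in> mx V" unfolding t0_def by (rule cong1_prod[OF A V(1)]) (use s0 in auto)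
  have t0W: "t0 \<in> mx W" if w: "W \<in> \<W> - {V}" for W
    unfolding t0_def by (rule mx_prod[OF A W(1) _ w]) (use s0 w fW in auto)
  \<comment> \<open>The product over the orbit under the decomposition group is fixed by that group
    and keeps the congruences of \<open>t0\<close>.\<close>
  define R where "R = (\<lambda>\<sigma>. \<sigma> t0) ` Dec B V"
  have fR: "finite R" unfolding R_def by (rule finite_subset[OF _ finite_orbit[OF B]]) (auto simp: Dec_def)
  define t where "t = \<Prod>R"
  have sV: "\<sigma> ` mx W = mx (\<sigma> ` W)" if "\<sigma> \<in> Aut B" for \<sigma> W
    using mx_image[OF Aut_fhom[OF that] Aut_bij[OF that]] by simp
  have comp: "\<sigma> ` W \<in> \<W>" if s: "\<sigma> \<in> Aut B" and W: "W \<in> \<W>" for \<sigma> W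
  proof -
    obtain \<tau> where t: "\<tau> \<in> Aut B" "W = \<tau> ` V" using W by (auto simp: \<W>_def)
    show ?thesis unfolding \<W>_def t(2) image_comp by (rule imageI[OF autgrpD(5)[OF autgrp_Aut s t(1)]])
  qed
  have tA: "t \<in> A" unfolding t_def R_def
    by (rule subfld_prod[OF A]) (use Gal_mem[OF G Dec_Aut t0A] in blast)
  have t1: "t - 1 \<in> mx V" unfolding t_def
  proof (rule cong1_prod[OF A V(1)])
    fix r assume "r \<in> R"
    then obtain \<sigma> where d: "\<sigma> \<in> Dec B V" "r = \<sigma> t0" by (auto simp: R_def)
    note a = Dec_Aut[OF d(1)]
    have "\<sigma> (t0 - 1) \<in> mx V" using imageI[OF t01, of \<sigma>] sV[OF a, of V] d(1) by (simp add: Dec_def)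
    thus "r - 1 \<in> mx V" using d hom_diff[OF Aut_fhom[OF a]] hom_1[OF Aut_fhom[OF a]] by simp
  qed
  have tW: "t \<in> mx W" if w: "W \<in> \<W> - {V}" for W
  proof -
    have e: "\<sigma> t0 \<in> mx W" if d: "\<sigma> \<in> Dec B V" for \<sigma>
    proof -
      note a = Dec_Aut[OF d]
      have sw: "\<sigma> ` finv \<sigma> ` W = W" by (simp add: image_comp bij_inv_simps[OF Aut_bij[OF a]])
      have "finv \<sigma> ` W \<in> \<W> - {V}" using comp[OF autgrpD(3)[OF autgrp_Aut a]] w sw d by (auto simp: Dec_def)
      from imageI[OF t0W[OF this], of \<sigma>] show ?thesis using sw sV[OF a] by simp
    qed
    have "t0 \<in> R" unfolding R_def by (rule self_orbit[OF autgrp_Dec]) simp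
    moreover have "r \<in> mx W" if "r \<in> R" for r using that e unfolding R_def by blast
    moreover have "vring A W" using w W by blast
    ultimately show ?thesis unfolding t_def using mx_prod[OF A _ fR, of W t0 "\<lambda>r. r"] mx_subset by blast
  qed
  have tD: "\<sigma> t = t" if d: "\<sigma> \<in> Dec B V" for \<sigma>
  proof -
    note a = Dec_Aut[OF d]
    have "\<sigma> t = (\<Prod>r\<in>R. \<sigma> r)" unfolding t_def by (rule hom_prod[OF Aut_fhom[OF a]]) simp
    also have "\<dots> = \<Prod>(\<sigma> ` R)" using bij_is_inj[OF Aut_bij[OF a]] by (subst prod.reindex) (auto intro: inj_on_subset)
    also have "\<sigma> ` R = R" unfolding R_def by (rule autgrp_orbit[OF autgrp_Dec d])
    finally show ?thesis unfolding t_def .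
  qed
  define S where "S = {\<sigma> \<in> Aut B. \<sigma> ` V \<noteq> V}"
  have q: "\<sigma> t \<in> mx \<O>" if s: "\<sigma> \<in> S" for \<sigma>
  proof -
    have a: "\<sigma> \<in> Aut B" "\<sigma> ` V \<noteq> V" using s by (auto simp: S_def)
    have sw: "\<sigma> ` finv \<sigma> ` V = V" by (simp add: image_comp bij_inv_simps[OF Aut_bij[OF a(1)]])
    have "finv \<sigma> ` V \<in> \<W> - {V}" using comp[OF autgrpD(3)[OF autgrp_Aut a(1)] VW] sw a(2) by auto
    from imageI[OF tW[OF this], of \<sigma>] show ?thesis using sw sV[OF a(1)] mV by simp
  qed
  \<comment> \<open>Only finitely many pairs occur, although \<open>S\<close> may be infinite; so
    one exponent can serve all of \<open>S\<close>.\<close>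
  define Q where "Q = (\<lambda>\<sigma>. (\<sigma> z, \<sigma> t)) ` S"
  have fQ: "finite Q" unfolding Q_def
    by (rule finite_subset[OF _ finite_cartesian_product[OF finite_orbit[OF B, of z] finite_orbit[OF B, of t]]]) (auto simp: S_def)
  have "\<forall>p\<in>Q. \<exists>j. \<forall>i\<ge>j. fst p / z * snd p ^ i \<in> mx \<O>"
  proof
    fix p assume "p \<in> Q"
    then obtain \<sigma> where s: "\<sigma> \<in> S" "p = (\<sigma> z, \<sigma> t)" by (auto simp: Q_def)
    have h: "fhom UNIV \<sigma>" using s(1) Aut_fhom by (auto simp: S_def)
    show "\<exists>j. \<forall>i\<ge>j. fst p / z * snd p ^ i \<in> mx \<O>"
    proof (cases "\<sigma> t = 0")
      case True
      have "fst p / z * snd p ^ i \<in> mx \<O>" if "i \<ge> 1" for i using that True m_0 s(2) by (simp add: zero_power)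
      thus ?thesis by blast
    next
      case False
      have cz: "\<sigma> z \<noteq> 0" using hom_nonzero[OF h] z(2) by blast
      have v: "val (\<sigma> t) > 0" using m_val[OF False] q[OF s(1)] by simp
      obtain j :: nat where j: "- val (\<sigma> z / z) < of_nat j * val (\<sigma> t)" using ex_less_of_nat_mult[OF v] by blast
      have "fst p / z * snd p ^ i \<in> mx \<O>" if "i \<ge> j" for i
      proof -
        have "of_nat j * val (\<sigma> t) \<le> of_nat i * val (\<sigma> t)" using that v by simp
        hence "val (\<sigma> z / z * \<sigma> t ^ i) > 0" using j cz z(2) False val_mult[of "\<sigma> z / z" "\<sigma> t ^ i"] by (simp add: val_power)
        moreover have "\<sigma> z / z * \<sigma> t ^ i \<noteq> 0" using cz z(2) False by simp
        ultimately show ?thesis using m_val s(2) by simp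
      qed
      thus ?thesis by blast
    qed
  qed
  from bchoice[OF this] obtain j where j: "\<forall>p\<in>Q. \<forall>i\<ge>j p. fst p / z * snd p ^ i \<in> mx \<O>" ..
  \<comment> \<open>A large power of \<open>t\<close> makes all conjugates of y outside the
    decomposition group small compared with z, even where the conjugates of z are large.\<close>
  define y where "y = z * t ^ (\<Sum>p\<in>Q. j p)"
  have ys: "\<sigma> y = \<sigma> z * \<sigma> t ^ (\<Sum>p\<in>Q. j p)" if "\<sigma> \<in> Aut B" for \<sigma>
    unfolding y_def by (simp add: hom_mult[OF Aut_fhom[OF that]] hom_power[OF Aut_fhom[OF that]])
  have jJ: "\<sigma> y / z \<in> mx \<O>" if s: "\<sigma> \<in> S" for \<sigma>
  proof -
    have p: "(\<sigma> z, \<sigma> t) \<in> Q" unfolding Q_def using s by blast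
    have "j (\<sigma> z, \<sigma> t) \<le> (\<Sum>p\<in>Q. j p)" by (rule member_le_sum[OF p _ fQ]) simp
    from bspec[OF j p, THEN spec, THEN mp, OF this] show ?thesis using ys[of \<sigma>] s by (simp add: S_def)
  qed
  have yA: "y \<in> A" unfolding y_def using z tA A by (intro subfld_closed)
  have yD: "\<sigma> y = y" if "\<sigma> \<in> Dec B V" for \<sigma>
    using tD[OF that] z(3)[of \<sigma>] that ys[OF Dec_Aut[OF that]] by (simp add: y_def V_def)
  define Y where "Y = (\<lambda>\<sigma>. \<sigma> y) ` Aut B"
  have fY: "finite Y" unfolding Y_def by (rule finite_orbit[OF B])
  have yY: "y \<in> Y" unfolding Y_def by (rule self_orbit[OF autgrp_Aut]) simp
  \<comment> \<open>The sum runs over distinct conjugates instead of automorphisms, so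
    \<open>y\<close> occurs exactly once however many automorphisms fix it.\<close>
  have "\<Sum>Y \<in> B"
  proof (rule Gal_fixed[OF B G order_refl algcl_subfld[OF B]])
    show "\<Sum>Y \<in> A" unfolding Y_def using Gal_mem[OF G _ yA] by (intro subfld_sum[OF A]) blast
    fix \<tau> assume t: "\<tau> \<in> Aut B"
    have "\<tau> (\<Sum>Y) = (\<Sum>r\<in>Y. \<tau> r)" by (rule hom_sum[OF Aut_fhom[OF t]]) simp
    also have "\<dots> = \<Sum>(\<tau> ` Y)" using bij_is_inj[OF Aut_bij[OF t]] by (subst sum.reindex) (auto intro: inj_on_subset)
    also have "\<tau> ` Y = Y" unfolding Y_def by (rule autgrp_orbit[OF autgrp_Aut t])
    finally show "\<tau> (\<Sum>Y) = \<Sum>Y" .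
  qed
  moreover have m: "\<Sum>Y / z - 1 \<in> mx \<O>"
  proof -
    have "\<Sum>Y / z = y / z + (\<Sum>r\<in>Y - {y}. r / z)"
      using sum.remove[OF fY yY, of "\<lambda>r. r"] by (simp add: add_divide_distrib sum_divide_distrib)
    hence "\<Sum>Y / z - 1 = (t ^ (\<Sum>p\<in>Q. j p) - 1) + (\<Sum>r\<in>Y - {y}. r / z)" using z(2) by (simp add: y_def)
    moreover have "t ^ (\<Sum>p\<in>Q. j p) - 1 \<in> mx \<O>" using cong1_power[OF A V(1) t1] mV by blast
    moreover have "(\<Sum>r\<in>Y - {y}. r / z) \<in> mx \<O>"
    proof (rule m_sum)
      fix r assume "r \<in> Y - {y}"
      then obtain \<sigma> where s: "\<sigma> \<in> Aut B" "r = \<sigma> y" "r \<noteq> y" by (auto simp: Y_def)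
      hence "\<sigma> \<in> S" using yD[of \<sigma>] by (auto simp: S_def Dec_def)
      thus "r / z \<in> mx \<O>" using jJ s(2) by simp
    qed
    ultimately show ?thesis using m_add by metis
  qed
  moreover have "\<Sum>Y \<noteq> 0" using cong1_in[OF subfld_UNIV vO m] by auto
  ultimately show ?thesis by blast
qed

text \<open>By independence of residues, each inner combination of the \<open>u j\<close> has the
  value of an element of \<open>F\<close>. The factors \<open>x i\<close> move these values into
  different cosets, so nothing can cancel.\<close>

lemma indep_products:
  assumes F: "subfld F" and fin: "finite I" "finite J" and x: "\<And>i. i \<in> I ==> x i \<noteq> 0" and u: "\<And>j. j \<in> J ==> u j \<in> \<O>"
    and res: "\<And>c. (\<And>j. j \<in> J ==> c j \<in> F \<inter> \<O>) ==> (\<Sum>j\<in>J. c j * u j) \<in> mx \<O> ==> (\<forall>j\<in>J. c j \<in> mx \<O>)"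
    and vals: "\<And>i i' a b. i \<in> I ==> i' \<in> I ==> i \<noteq> i' ==> a \<in> F - {0} ==> b \<in> F - {0} ==> val (x i) + val a \<noteq> val (x i') + val b"
  shows "indep F (I \<times> J) (\<lambda>(i, j). x i * u j)"
  unfolding indep_def
proof (intro allI impI)
  fix c assume c: "\<forall>p\<in>I \<times> J. c p \<in> F" and sum0: "(\<Sum>p\<in>I \<times> J. c p * (case p of (i, j) \<Rightarrow> x i * u j)) = 0"
  define w where "w = (\<lambda>i. \<Sum>j\<in>J. c (i, j) * u j)"
  define I' where "I' = {i\<in>I. \<exists>j\<in>J. c (i, j) \<noteq> 0}"
  have w: "\<exists>a\<in>F - {0}. w i \<noteq> 0 \<and> val (w i) = val a" if i: "i \<in> I'" for i
  proof -
    define J' where "J' = {j\<in>J. c (i, j) \<noteq> 0}"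
    have J': "finite J'" "J' \<noteq> {}" using i fin by (auto simp: J'_def I'_def)
    \<comment> \<open>Dividing by a coefficient of least value makes all coefficients integral and
      one of them equal to 1.\<close>
    define l where "l = Min ((\<lambda>j. val (c (i, j))) ` J')"
    have "l \<in> (\<lambda>j. val (c (i, j))) ` J'" unfolding l_def using J' by (intro Min_in) auto
    then obtain j0 where j0: "j0 \<in> J'" "l = val (c (i, j0))" by auto
    have min: "val (c (i, j0)) \<le> val (c (i, j))" if "j \<in> J'" for j 
      unfolding j0(2)[symmetric] l_def using J' that by (intro Min_le) auto
    define a where "a = c (i, j0)"
    have a: "a \<in> F - {0}" using j0 c i by (auto simp: a_def J'_def I'_def)
    define d where "d = (\<lambda>j. c (i, j) / a)"
    have d: "d j \<in> F \<inter> \<O>" if "j \<in> J" for j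
    proof
      show "d j \<in> F" unfolding d_def using that c i a F by (auto simp: I'_def intro!: subfld_divide)
      show "d j \<in> \<O>"
      proof (cases "c (i, j) = 0")
        case True thus ?thesis by (simp add: d_def subrng_0[OF sO])
      next
        case False
        hence "j \<in> J'" using that by (simp add: J'_def)
        thus ?thesis using min[of j] False a by (subst O_val) (auto simp: d_def val_divide a_def)
      qed
    qed
    have "(\<Sum>j\<in>J. d j * u j) \<notin> mx \<O>"
    proof
      assume "(\<Sum>j\<in>J. d j * u j) \<in> mx \<O>"
      hence "d j0 \<in> mx \<O>" using res[of d] d j0(1) by (auto simp: J'_def)
      moreover have "d j0 = 1" using a by (simp add: d_def a_def)
      ultimately show False using m_1 by simp
    qed
    moreover have "(\<Sum>j\<in>J. d j * u j) \<in> \<O>" using d u by (intro subrng_sum[OF sO] subrng_mult[OF sO]) auto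
    ultimately have U: "(\<Sum>j\<in>J. d j * u j) \<in> U" by (simp add: U_def)
    have wa: "w i = a * (\<Sum>j\<in>J. d j * u j)" using a by (simp add: w_def d_def sum_distrib_left)
    have "(\<Sum>j\<in>J. d j * u j) \<noteq> 0" using U by (simp add: U_iff)
    thus ?thesis using a U wa U_val by (intro bexI[of _ a]) (auto simp: val_mult)
  qed
  have w0: "w i = 0" if "i \<in> I - I'" for i using that by (auto simp: w_def I'_def intro!: sum.neutral)
  have "0 = (\<Sum>i\<in>I. \<Sum>j\<in>J. c (i, j) * (x i * u j))" using sum0 by (simp add: sum.cartesian_product case_prod_beta)
  also have "\<dots> = (\<Sum>i\<in>I. x i * w i)" by (simp add: w_def sum_distrib_left mult_ac)
  also have "\<dots> = (\<Sum>i\<in>I'. x i * w i)" by (rule sum.mono_neutral_right) (use fin w0 in \<open>auto simp: I'_def\<close>)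
  finally have s0: "(\<Sum>i\<in>I'. x i * w i) = 0" by simp
  have "I' = {}"
  proof (rule ccontr)
    assume ne: "I' \<noteq> {}"
    have "(\<Sum>i\<in>I'. x i * w i) \<noteq> 0"
    proof (rule sum_nonzero[OF _ ne])
      show "finite I'" using fin by (simp add: I'_def)
      show "x i * w i \<noteq> 0" if "i \<in> I'" for i using w[OF that] x that by (auto simp: I'_def)
      show "inj_on (\<lambda>i. val (x i * w i)) I'"
      proof (rule inj_onI, rule ccontr)
        fix i i' assume i: "i \<in> I'" "i' \<in> I'" "val (x i * w i) = val (x i' * w i')" "i \<noteq> i'"
        obtain a b where ab: "a \<in> F - {0}" "w i \<noteq> 0" "val (w i) = val a" "b \<in> F - {0}" "w i' \<noteq> 0" "val (w i') = val b"
          using w[OF i(1)] w[OF i(2)] by blast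
        have ii: "i \<in> I" "i' \<in> I" using i by (auto simp: I'_def)
        have "val (x i) + val a = val (x i') + val b" using i(3) ab x[OF ii(1)] x[OF ii(2)] by (simp add: val_mult)
        thus False using vals[OF ii i(4) ab(1,4)] by simp
      qed
    qed
    thus False using s0 by simp
  qed
  thus "\<forall>p\<in>I \<times> J. c p = 0" by (auto simp: I'_def)
qed

text \<open>The powers of \<open>\<gamma>\<close> below \<open>e\<close> represent different cosets
  modulo the multiples of \<open>g\<close>, among which all values of the fixed field lie. Their
  products with the \<open>u j\<close> are independent, and Artin's theorem bounds their
  number.\<close>

lemma ef_le:
  fixes g :: real
  assumes H: "autgrp H" and K: "subfld K" and st: "\<And>\<sigma>. \<sigma> \<in> H ==> \<sigma> ` K \<subseteq> K" and fin: "finite (Rst H K)"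
    and vF: "\<And>x. x \<in> fixed_in H K - {0} ==> \<exists>i::int. val x = of_int i * g" and g: "g > 0"
    and \<gamma>: "\<gamma> \<in> K" "\<gamma> \<noteq> 0" "of_nat e * val \<gamma> = g"
    and J: "finite J" "\<And>j. j \<in> J ==> u j \<in> \<O> \<inter> K"
    and ind: "\<And>c. (\<And>j. j \<in> J ==> c j \<in> fixed_in H K \<inter> \<O>) ==> (\<Sum>j\<in>J. c j * u j) \<in> mx \<O> ==> (\<forall>j\<in>J. c j \<in> mx \<O>)"
  shows "e * card J \<le> card (Rst H K)"
proof -
  have v: "val \<gamma> > 0" using g \<gamma>(3) by (metis of_nat_0_le_iff zero_less_mult_iff not_less)
  have "indep (fixed_in H K) ({..<e} \<times> J) (\<lambda>(i, j). \<gamma> ^ i * u j)"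
  proof (rule indep_products[OF subfld_fixed_in[OF autgrpD(1)[OF H] K] _ J(1)])
    fix i i' x y assume *: "i \<in> {..<e}" "i' \<in> {..<e}" "i \<noteq> i'" "x \<in> fixed_in H K - {0}" "y \<in> fixed_in H K - {0}"
    obtain a c :: int where ac: "val x = of_int a * g" "val y = of_int c * g" using vF * by blast
    show "val (\<gamma> ^ i) + val x \<noteq> val (\<gamma> ^ i') + val y"
    proof
      assume "val (\<gamma> ^ i) + val x = val (\<gamma> ^ i') + val y"
      hence "(of_nat i + of_int a * of_nat e) * val \<gamma> = (of_nat i' + of_int c * of_nat e) * val \<gamma>"
        using ac \<gamma>(2) by (simp add: val_power distrib_right flip: \<gamma>(3))
      hence "real_of_int (int i + a * int e) = real_of_int (int i' + c * int e)" using v by simp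
      hence "int i + a * int e = int i' + c * int e" by (simp only: of_int_eq_iff)
      from arg_cong[OF this, of "\<lambda>x. x mod int e"] show False using * by simp
    qed
  qed (use J \<gamma> ind in auto)
  hence "card ({..<e} \<times> J) \<le> card (Rst H K)"
    by (intro artin_le[OF H K st fin]) (use J \<gamma> subfld_mult[OF K] subfld_power[OF K] in auto)
  thus ?thesis by (simp add: card_cartesian_product)
qed

lemma cong1_val:
  assumes "x / z - 1 \<in> mx \<O>" "x \<noteq> 0" "z \<noteq> 0"
  shows "val x = val z" "z \<in> \<O> ==> x - z \<in> mx \<O>" "z \<in> \<O> ==> x \<in> \<O>"
proof -
  have "x / z \<in> \<O> - mx \<O>" using cong1_in[OF subfld_UNIV vO assms(1)] by (auto simp: mx_def)
  hence "val (x / z) = 0" using U_val[of "x / z"] assms by (simp add: U_def)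
  thus v: "val x = val z" using assms by (simp add: val_divide)
  have "z * (x / z - 1) = x - z" using assms by (simp add: field_simps)
  thus "x - z \<in> mx \<O>" if "z \<in> \<O>" using m_mult[OF that assms(1)] by simp
  show "x \<in> \<O>" if "z \<in> \<O>" using that assms v by (simp add: O_val)
qed

text \<open>The inequality e f \<le> |D|. The fixed field of the decomposition group in
  \<open>K\<close> has the same values and residues as \<open>B\<close>, so the conditions of
  \<open>ef_le\<close> need only be checked over \<open>B\<close>.\<close>

lemma Dec_ef_le:
  fixes g :: real
  assumes B: "algcl B" "k \<subseteq> B" and G: "Gal B A" "finite (Rst (Aut B) A)"
    and K: "subfld K" "K \<subseteq> A" and st: "\<And>\<sigma>. \<sigma> \<in> Aut B ==> \<sigma> ` K \<subseteq> K"
    and vB: "\<And>x. x \<in> B - {0} ==> \<exists>i::int. val x = of_int i * g" and g: "g > 0"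
    and \<gamma>: "\<gamma> \<in> K" "\<gamma> \<noteq> 0" "of_nat e * val \<gamma> = g"
    and J: "finite J" "\<And>j. j \<in> J ==> u j \<in> \<O> \<inter> K"
    and ind: "\<And>c. (\<And>j. j \<in> J ==> c j \<in> B \<inter> \<O>) ==> (\<Sum>j\<in>J. c j * u j) \<in> mx \<O> ==> (\<forall>j\<in>J. c j \<in> mx \<O>)"
  shows "e * card J \<le> card (Rst (Dec B (\<O> \<inter> A)) K)"
proof (rule ef_le[OF autgrp_Dec K(1) st[OF Dec_Aut] _ _ g \<gamma> J])
  define Z where "Z = fixed_in (Dec B (\<O> \<inter> A)) K"
  have imm: "\<exists>x\<in>B. x \<noteq> 0 \<and> x / z - 1 \<in> mx \<O>" if "z \<in> Z" "z \<noteq> 0" for z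
    by (rule decomposition_field_immediate[OF B G]) (use that K(2) in \<open>auto simp: Z_def fixed_in_def\<close>)
  show "\<exists>i::int. val z = of_int i * g" if "z \<in> Z - {0}" for z using imm[of z] that cong1_val(1) vB by fastforce
  have "\<exists>x. x \<in> B \<inter> \<O> \<and> x - z \<in> mx \<O>" if "z \<in> Z \<inter> \<O>" for z
  proof (cases "z = 0")
    case True thus ?thesis using m_0 subrng_0[OF sO] subfld_0[OF algcl_subfld[OF B(1)]] by (intro exI[of _ 0]) auto
  next
    case False thus ?thesis using imm[of z] that cong1_val(2,3)[OF _ _ False] by blast
  qed
  then obtain h where h: "\<And>z. z \<in> Z \<inter> \<O> ==> h z \<in> B \<inter> \<O> \<and> h z - z \<in> mx \<O>" by metis
  fix c assume c: "\<And>j. j \<in> J ==> c j \<in> Z \<inter> \<O>" and s: "(\<Sum>j\<in>J. c j * u j) \<in> mx \<O>"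
  have "(\<Sum>j\<in>J. u j * (h (c j) - c j)) \<in> mx \<O>" by (rule m_sum, rule m_mult) (use h[OF c] J in auto)
  from m_add[OF s this] have "(\<Sum>j\<in>J. h (c j) * u j) \<in> mx \<O>" by (simp add: algebra_simps flip: sum.distrib)
  with ind[of "\<lambda>j. h (c j)"] h[OF c] have hm: "\<forall>j\<in>J. h (c j) \<in> mx \<O>" by blast
  show "\<forall>j\<in>J. c j \<in> mx \<O>"
  proof
    fix j assume j: "j \<in> J"
    show "c j \<in> mx \<O>" using m_diff[OF bspec[OF hm j], of "h (c j) - c j"] h[OF c[OF j]] by simp
  qed
next
  show "finite (Rst (Dec B (\<O> \<inter> A)) K)"
    using finite_Rst_mono[OF finite_Rst_subset[OF G(2) K(2)]] Dec_Aut by (metis subsetI)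
qed

end

section \<open>Dimension and cardinality\<close>

lemma (in ring) dimension_card:
  assumes "dimension n K E" "subfield K R" "finite K"
  shows "finite E \<and> card E = card K ^ n"
  using assms
proof (induction rule: dimension.induct)
  case (Suc_dim v E n K)
  note K = Suc_dim.prems(1)
  note sp = space_subgroup_props[OF K Suc_dim.hyps(3)]
  have KR: "K \<subseteq> carrier R" using subfieldE(3)[OF K] .
  have fE: "finite E" "card E = card K ^ n" using Suc_dim by auto
  define \<Phi> where "\<Phi> = (\<lambda>(k, e). k \<otimes> v \<oplus> e)"
  have "line_extension K v E = \<Phi> ` (K \<times> E)" 
  proof (intro equalityI subsetI)
    fix u assume "u \<in> \<Phi> ` (K \<times> E)"
    then obtain a b where "a \<in> K" "b \<in> E" "u = a \<otimes> v \<oplus> b" by (auto simp: \<Phi>_def)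
    thus "u \<in> line_extension K v E" unfolding line_extension_mem_iff by blast
  qed (auto simp: \<Phi>_def line_extension_mem_iff image_iff)
  moreover have "inj_on \<Phi> (K \<times> E)"
  proof (rule inj_onI, clarify)
    fix k e k' e' assume *: "k \<in> K" "e \<in> E" "k' \<in> K" "e' \<in> E" "\<Phi> (k, e) = \<Phi> (k', e')"
    have c: "k \<in> carrier R" "e \<in> carrier R" "k' \<in> carrier R" "e' \<in> carrier R" using * KR sp(1) by auto
    note v = Suc_dim.hyps(1)
    have "k \<otimes> v \<oplus> e = k' \<otimes> v \<oplus> e'" using * by (simp add: \<Phi>_def)
    moreover have "x \<ominus> y = e' \<ominus> e" if "x \<oplus> e = y \<oplus> e'" "x \<in> carrier R" "y \<in> carrier R" for x y
    proof -
      have "x \<ominus> y = (x \<oplus> e) \<oplus> (\<ominus> e \<oplus> \<ominus> y)" using that(2,3) c by (simp add: a_minus_def a_assoc r_neg1 r_neg2)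
      also have "\<dots> = (y \<oplus> e') \<oplus> (\<ominus> e \<oplus> \<ominus> y)" using that(1) by simp
      also have "\<dots> = (y \<oplus> \<ominus> y) \<oplus> (e' \<oplus> \<ominus> e)" using that(2,3) c by (simp only: a_ac a_inv_closed add.m_closed)
      also have "\<dots> = e' \<ominus> e" using that(2,3) c by (simp add: a_minus_def r_neg)
      finally show ?thesis .
    qed
    ultimately have eq: "(k \<ominus> k') \<otimes> v = e' \<ominus> e" using c v by (simp add: a_minus_def l_distr l_minus)
    have "k \<ominus> k' = \<zero>"
    proof (rule ccontr)
      assume nz: "k \<ominus> k' \<noteq> \<zero>"
      have "k \<ominus> k' \<in> K" using subringE(5,7)[OF subfieldE(1)[OF K]] * by (auto simp: a_minus_def)
      hence "k \<ominus> k' \<in> K - {\<zero>}" using nz by simp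
      moreover have "e' \<ominus> e \<in> E" using sp(3)[of e' "\<ominus> e"] sp(4) * by (simp add: a_minus_def)
      ultimately have "v \<in> E" using sp(6)[of "k \<ominus> k'" v] v eq by simp
      thus False using Suc_dim.hyps(2) by simp
    qed
    moreover from this have "e' \<ominus> e = \<zero>" using eq v by simp
    ultimately show "k = k' \<and> e = e'" using c by (simp add: r_right_minus_eq)
  qed
  ultimately show ?case using fE Suc_dim.prems by (simp add: card_image card_cartesian_product)
qed simp

lemma (in ring) finite_dim_card:
  assumes "subfield K R" "finite (carrier R)"
  shows "card (carrier R) = card K ^ dim K (carrier R)"
proof -
  obtain Us where Us: "set Us = carrier R" using finite_list[OF assms(2)] by blast
  have "Span K Us \<subseteq> carrier R" using Span_in_carrier[OF subfieldE(3)[OF assms(1)], of Us] Us by simp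
  moreover have "set Us \<subseteq> Span K Us" using Span_base_incl[OF assms(1), of Us] Us by simp
  ultimately have "Span K Us = carrier R" using Us by auto
  hence "finite_dimension K (carrier R)" using Span_finite_dimension[OF assms(1), of Us] Us by simp
  hence d: "dimension (dim K (carrier R)) K (carrier R)"
    using finite_dimensionE[OF assms(1)] by (simp add: over_def)
  have "finite K" using assms subfieldE(3) finite_subset by blast
  thus ?thesis using dimension_card[OF d assms(1)] by simp
qed

lemma finite_subfld_card:
  fixes B A :: "'w::field set"
  assumes "subfld B" "subfld A" "B \<subseteq> A" "finite A"
  obtains n where "dimn n B A" "card A = card B ^ n"
proof -
  interpret ring "ring_of_type_algebra :: 'w ring" by (rule ring_Om)
  obtain Us where Us: "set Us = A" using finite_list[OF assms(4)] by blast
  have sB: "subfield B ring_of_type_algebra" using assms(1) by (simp add: subfield_iff_subfld)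
  have "subgroup A (add_monoid ring_of_type_algebra)"
    by (rule add.subgroupI) (use assms(2) subfld_0[OF assms(2)] in \<open>auto simp: subfld_uminus subfld_add a_inv_def[symmetric]\<close>)
  hence "subalgebra B A ring_of_type_algebra"
    by (rule subalgebra.intro) (use assms(2,3) in \<open>auto simp: subalgebra_axioms_def subfld_closed\<close>)
  hence "Span B Us = A" using subalgebra_Span_incl[OF sB, of A Us] Span_base_incl[OF sB, of Us] Us by auto
  hence "finite_dimension B A" using Span_finite_dimension[OF sB, of Us] by simp
  then obtain n where "dimension n B A" by (auto simp: finite_dimension_def)
  thus ?thesis using that[of n] dimension_card[OF _ sB] finite_subset[OF assms(3,4)] by blast
qed

section \<open>The rational function field\<close>

lemma const_emb_simps [simp]:
  "const_emb 0 = 0" "const_emb 1 = 1" "const_emb (a + b) = const_emb a + const_emb b"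
  "const_emb (a * b) = const_emb a * const_emb b" "const_emb (a - b) = const_emb a - const_emb b"
  "const_emb (- a) = - const_emb a"
proof -
  have p: "[:a + b:] = [:a:] + [:b:]" "[:a * b:] = [:a:] * [:b:]" "[:a - b:] = [:a:] - [:b:]" "[:- a:] = - [:a:]" by auto
  show "const_emb 0 = 0" "const_emb 1 = 1" "const_emb (a + b) = const_emb a + const_emb b"
  "const_emb (a * b) = const_emb a * const_emb b" "const_emb (a - b) = const_emb a - const_emb b"
  "const_emb (- a) = - const_emb a"
    by (simp_all only: const_emb_def p to_fract_add to_fract_mult to_fract_diff to_fract_uminus 
        to_ac_add to_ac_mult to_ac_diff to_ac_minus pCons_0_0 to_fract_0 to_ac_0) (simp flip: one_pCons)
qed

lemma const_emb_eq_0 [simp]: "const_emb a = 0 \<longleftrightarrow> a = 0"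
  by (simp add: const_emb_def to_fract_eq_0_iff)

lemma const_emb_inj: "inj const_emb"
proof (rule injI)
  fix a b :: 'a assume "const_emb a = const_emb b"
  hence "const_emb (a - b) = 0" by simp
  thus "a = b" unfolding const_emb_eq_0 by simp
qed

lemma const_emb_inverse: "const_emb (inverse a) = inverse (const_emb a)"
proof (cases "a = 0")
  case False
  hence "const_emb a * const_emb (inverse a) = 1" by (simp flip: const_emb_simps(4))
  thus ?thesis by (metis inverse_unique)
qed simp

lemma const_emb_power: "const_emb (a ^ n) = const_emb a ^ n"
  by (induction n) auto

lemma const_emb_sum: "const_emb (sum f I) = (\<Sum>i\<in>I. const_emb (f i))"
  by (induction I rule: infinite_finite_induct) auto

abbreviation FFq :: "'a::{finite,field} rat_closure set" where
  "FFq \<equiv> range const_emb"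

lemma subfld_FFq: "subfld (FFq :: 'a::{finite,field} rat_closure set)"
  unfolding subfld_def 
proof (intro conjI ballI)
  show "0 \<in> FFq" "1 \<in> FFq" using rangeI[of const_emb 0] rangeI[of const_emb 1] by simp_all
qed (auto simp flip: const_emb_simps const_emb_inverse)

lemma subfld_ratfun: "subfld (\<kk> :: 'a::{finite,field} rat_closure set)"
  unfolding subfld_def ratfun_field_def
proof (intro conjI ballI)
  show "0 \<in> range to_ac" "1 \<in> range to_ac" using rangeI[of to_ac 0] rangeI[of to_ac 1] by simp_all
qed (auto simp flip: to_ac_diff to_ac_mult to_ac_inverse)

lemma algcl_ratfun: "algcl (\<kk> :: 'a::{finite,field} rat_closure set)"
  unfolding algcl_def
proof (intro conjI allI subfld_ratfun)
  fix x :: "'a rat_closure"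
  obtain p :: "'a poly fract poly" where p: "p \<noteq> 0" "poly (map_poly to_ac p) x = 0"
    using alg_closure_algebraic[of x] by blast
  have "pover \<kk> (map_poly to_ac p)" by (auto simp: pover_def ratfun_field_def coeff_map_poly)
  moreover have "map_poly to_ac p \<noteq> 0" using p(1) by (subst map_poly_eq_0_iff) auto
  ultimately show "\<exists>p. pover \<kk> p \<and> p \<noteq> 0 \<and> poly p x = 0" using p(2) by blast
qed

lemma FFq_le: "FFq \<subseteq> \<kk>"
  by (auto simp: const_emb_def ratfun_field_def)

lemma T_in: "ratfun_T \<in> \<kk>" by (auto simp: ratfun_T_def ratfun_field_def)

lemma T_nonzero [simp]: "ratfun_T \<noteq> 0"
  by (simp add: ratfun_T_def to_fract_eq_0_iff)

text \<open>Substitution into a polynomial over F_q; taking T or 1/T for \<open>x\<close> treats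
  F_q[T] and F_q[1/T] alike.\<close>

definition ev :: "'a::{finite,field} rat_closure \<Rightarrow> 'a poly \<Rightarrow> 'a rat_closure" where
  "ev x f = poly (map_poly const_emb f) x"

lemma ev_0 [simp]: "ev x 0 = 0" and ev_1 [simp]: "ev x 1 = 1"
  by (simp_all add: ev_def)

lemma ev_add [simp]: "ev x (f + g) = ev x f + ev x g"
proof -
  have "map_poly const_emb (f + g) = map_poly const_emb f + map_poly const_emb g"
    by (rule poly_eqI) (simp add: coeff_map_poly)
  thus ?thesis by (simp add: ev_def)
qed

lemma ev_mult [simp]: "ev x (f * g) = ev x f * ev x g"
proof -
  have "map_poly const_emb (f * g) = map_poly const_emb f * map_poly const_emb g"
    by (rule poly_eqI) (simp add: coeff_map_poly coeff_mult const_emb_sum)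
  thus ?thesis by (simp add: ev_def)
qed

lemma ev_power [simp]: "ev x (f ^ n) = ev x f ^ n"
  by (induction n) auto

lemma ev_pCons [simp]: "ev x (pCons a f) = const_emb a + x * ev x f"
  by (simp add: ev_def map_poly_pCons)

lemma ev_monom [simp]: "ev x (monom a n) = const_emb a * x ^ n"
  by (simp add: ev_def map_poly_monom poly_monom)

lemma ev_T: "ev ratfun_T f = to_ac (to_fract f)"
proof (induction f)
  case (pCons a f)
  have "pCons a f = [:a:] + [:0, 1:] * f" by simp
  hence "to_ac (to_fract (pCons a f)) = const_emb a + ratfun_T * to_ac (to_fract f)"
    unfolding const_emb_def ratfun_T_def by (metis to_ac_add to_ac_mult to_fract_add to_fract_mult)
  thus ?case using pCons by simp
qed simp

lemma ev_T_eq_0: "ev ratfun_T f = 0 \<longleftrightarrow> f = 0"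
  by (simp add: ev_T to_fract_eq_0_iff)

lemma ratfun_cases:
  assumes "x \<in> \<kk>" obtains a b where "b \<noteq> 0" "x = to_ac (Fract a b)" "x = ev ratfun_T a / ev ratfun_T b"
proof -
  obtain y where y: "x = to_ac y" using assms by (auto simp: ratfun_field_def)
  obtain a b where ab: "y = Fract a b" "b \<noteq> 0" by (cases y) auto
  have "x = ev ratfun_T a / ev ratfun_T b" 
    using ab by (simp add: y ev_T Fract_conv_to_fract)
  thus ?thesis using that y ab by blast
qed

lemma inf_ring_iff: "x \<in> inf_ring \<longleftrightarrow> (\<exists>a b. b \<noteq> 0 \<and> degree a \<le> degree b \<and> x = ev ratfun_T a / ev ratfun_T b)"
  unfolding inf_ring_def by (auto simp: ev_T Fract_conv_to_fract)

lemma ev_reflect: "x \<noteq> 0 ==> ev (inverse x) f * x ^ degree f = ev x (reflect_poly f)"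
proof -
  assume x: "x \<noteq> 0"
  have d: "degree (map_poly const_emb f) = degree f" by (rule degree_map_poly) simp
  have "map_poly const_emb (reflect_poly f) = reflect_poly (map_poly const_emb f)"
    by (rule poly_eqI) (simp add: coeff_map_poly coeff_reflect_poly d)
  thus ?thesis using x poly_reflect_poly_nz[OF x, of "map_poly const_emb f"] by (simp add: ev_def d mult.commute)
qed

lemma ev_inv_T: "ev ratfun_T f = ev (inverse ratfun_T) (reflect_poly f) * ratfun_T ^ degree f"
  using ev_reflect[of "inverse ratfun_T" f] by (simp add: power_inverse field_simps)

lemma subring_iff: "subring V (ring_of_type_algebra :: 'w::field ring) \<longleftrightarrow> subrng V"
proof
  interpret ring "ring_of_type_algebra :: 'w ring" by (rule ring_Om)
  assume "subring V (ring_of_type_algebra :: 'w ring)"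
  note sr = subringE[OF this]
  have "x - y \<in> V" if "x \<in> V" "y \<in> V" for x y using sr(7)[of x "- y"] sr(5)[of y] that by simp
  thus "subrng V" using sr(3,6) by (auto simp: subrng_def)
next
  interpret ring "ring_of_type_algebra :: 'w ring" by (rule ring_Om)
  assume V: "subrng V"
  show "subring V (ring_of_type_algebra :: 'w ring)"
    by (rule subringI) (use V in \<open>auto simp: subrng_closed\<close>)
qed

lemma field_prime_iff: "field_prime A V \<longleftrightarrow> vring A V \<and> FFq \<subseteq> V \<and> V \<noteq> A"
  by (auto simp: field_prime_def vring_def subring_iff)

lemma prime_ideal_of_eq: "prime_ideal_of V = mx V"
  by (auto simp: prime_ideal_of_def mx_def)

text \<open>A place of \<open>k\<close> comes from a prime of \<open>\<bbbF>\<^sub>q[T]\<close> or of \<open>\<bbbF>\<^sub>q[1/T]\<close>.\<close>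

lemma base_uniformizer:
  assumes V: "vring \<kk> V" "FFq \<subseteq> V" "V \<noteq> \<kk>"
  obtains \<pi> where "\<pi> \<in> mx V" "\<pi> \<noteq> 0" "\<And>x. x \<in> \<kk> ==> x \<noteq> 0 ==> \<exists>i::int. x * \<pi> powi i \<in> V - mx V"
proof -
  note s = vringD(1)[OF V(1)]
  \<comment> \<open>Whichever of T and 1/T is integral generates a polynomial ring inside
    \<open>V\<close> with fraction field k.\<close>
  obtain x0 where x0: "x0 = ratfun_T \<or> x0 = inverse ratfun_T" "x0 \<in> V" using vringD(3)[OF V(1) T_in] by blast
  have x00: "x0 \<noteq> 0" using x0 by auto
  have ev_V: "ev x0 f \<in> V" for f
    by (induction f) (use V(2) x0(2) in \<open>auto intro!: subrng_closed[OF s]\<close>)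
  have ev0: "ev x0 f \<noteq> 0" if "f \<noteq> 0" for f
  proof (cases "x0 = ratfun_T")
    case False
    hence x: "x0 = inverse ratfun_T" using x0 by simp
    have "ev x0 f * ratfun_T ^ degree f = ev ratfun_T (reflect_poly f)" unfolding x by (rule ev_reflect) simp
    moreover have "ev ratfun_T (reflect_poly f) \<noteq> 0" using that by (simp add: ev_T_eq_0)
    ultimately show ?thesis by auto
  qed (use that in \<open>simp add: ev_T_eq_0\<close>)
  have quot: "\<exists>f g. g \<noteq> 0 \<and> x = ev x0 f / ev x0 g" if x: "x \<in> \<kk>" for x
  proof -
    obtain a b where ab: "b \<noteq> 0" "x = ev ratfun_T a / ev ratfun_T b" using ratfun_cases[OF x] by metis
    show ?thesis
    proof (cases "x0 = ratfun_T")
      case False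
      hence x0': "x0 = inverse ratfun_T" using x0 by simp
      have "x = ev x0 (reflect_poly a * monom 1 (degree b)) / ev x0 (reflect_poly b * monom 1 (degree a))"
        unfolding ab(2) ev_inv_T[of a] ev_inv_T[of b] by (simp add: x0' power_inverse field_simps)
      moreover have "reflect_poly b * monom 1 (degree a) \<noteq> 0" using ab(1) by (simp add: monom_eq_0_iff)
      ultimately show ?thesis by blast
    qed (use ab in blast)
  qed
  \<comment> \<open>A polynomial of least degree whose value lies in the maximal ideal divides every
    other one; its value is the uniformizer.\<close>
  define P where "P = (\<lambda>f. f \<noteq> 0 \<and> ev x0 f \<in> mx V)"
  have "\<exists>f. P f"
  proof -
    obtain x where x: "x \<in> \<kk>" "x \<notin> V" using V(3) vringD(2)[OF V(1)] by blast
    then obtain f g where fg: "g \<noteq> 0" "x = ev x0 f / ev x0 g" using quot by blast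
    have "ev x0 g \<in> mx V"
    proof (rule ccontr)
      assume "ev x0 g \<notin> mx V"
      hence "inverse (ev x0 g) \<in> V" using ev_V by (auto simp: mx_def)
      hence "x \<in> V" using fg(2) subrng_mult[OF s ev_V] by (simp add: field_class.field_divide_inverse)
      thus False using x by simp
    qed
    thus ?thesis using fg by (auto simp: P_def)
  qed
  then obtain p where p: "P p" and min: "\<And>f. P f ==> degree p \<le> degree f"
    using exists_least_iff[of "\<lambda>n. \<exists>p. P p \<and> degree p = n"] by (metis not_le_imp_less)
  define \<pi> where "\<pi> = ev x0 p"
  have pi: "\<pi> \<in> mx V" "\<pi> \<noteq> 0" using p ev0 by (auto simp: \<pi>_def P_def)
  note mm = mx_mult[OF subfld_ratfun V(1)] mx_diff[OF subfld_ratfun V(1)]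
  have dv: "p dvd f" if "ev x0 f \<in> mx V" for f
  proof -
    have f: "f = p * (f div p) + f mod p" by simp
    have "ev x0 (f mod p) = ev x0 f - ev x0 (f div p) * \<pi>"
      unfolding \<pi>_def by (subst (2) f, unfold ev_add ev_mult) simp
    hence "ev x0 (f mod p) \<in> mx V" using mm(2)[OF that mm(1)[OF ev_V pi(1)]] by simp
    hence "f mod p = 0 \<or> degree p \<le> degree (f mod p)" using min[of "f mod p"] by (auto simp: P_def)
    moreover have "f mod p = 0 \<or> degree (f mod p) < degree p" 
      using p degree_mod_less by (auto simp: P_def)
    ultimately show ?thesis by (auto simp: dvd_eq_mod_eq_0)
  qed
  have pd: "degree p > 0"
  proof (rule ccontr)
    assume "\<not> ?thesis"
    hence "is_unit p" using p by (auto simp: P_def is_unit_iff_degree)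
    hence "ev x0 p * ev x0 (1 div p) = 1" by (simp flip: ev_mult)
    moreover have "ev x0 p * ev x0 (1 div p) \<in> mx V" using mm(1)[OF ev_V pi(1), of "1 div p"] unfolding \<pi>_def by (subst mult.commute)
    ultimately show False using mx_1[OF s] by simp
  qed
  have fac: "\<exists>i h. f = p ^ i * h \<and> ev x0 h \<in> V - mx V" if "f \<noteq> 0" for f
    using that
  proof (induction "degree f" arbitrary: f rule: less_induct)
    case less
    show ?case
    proof (cases "ev x0 f \<in> mx V")
      case True
      then obtain g where g: "f = p * g" using dv by (auto elim: dvdE)
      hence "g \<noteq> 0" "degree g < degree f" 
        using less.prems pd degree_mult_eq[of p g] by (auto simp: P_def)
      then obtain i h where "g = p ^ i * h" "ev x0 h \<in> V - mx V" using less.hyps by blast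
      thus ?thesis using g by (intro exI[of _ "Suc i"] exI[of _ h]) (auto simp: mult.assoc)
    next
      case False
      thus ?thesis using ev_V by (intro exI[of _ 0] exI[of _ f]) auto
    qed
  qed
  have "\<exists>i::int. x * \<pi> powi i \<in> V - mx V" if x: "x \<in> \<kk>" "x \<noteq> 0" for x
  proof -
    obtain f g where fg: "g \<noteq> 0" "x = ev x0 f / ev x0 g" using quot[OF x(1)] by blast
    have "f \<noteq> 0" using fg x by auto
    obtain i h where i: "f = p ^ i * h" "ev x0 h \<in> V - mx V" using fac[OF \<open>f \<noteq> 0\<close>] by blast
    obtain j l where j: "g = p ^ j * l" "ev x0 l \<in> V - mx V" using fac[OF fg(1)] by blast
    have nz: "ev x0 h \<noteq> 0" "ev x0 l \<noteq> 0" using i j mx_0[OF s] by auto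
    have "x * \<pi> powi (int j - int i) = ev x0 h * inverse (ev x0 l)"
      using pi(2) nz by (simp add: fg(2) i(1) j(1) power_int_diff \<pi>_def[symmetric] field_simps)
    moreover have "inverse (ev x0 l) \<in> V" "inverse (ev x0 h) \<in> V" using i j by (auto simp: mx_def)
    ultimately have "x * \<pi> powi (int j - int i) \<in> V" "inverse (x * \<pi> powi (int j - int i)) \<in> V" "x * \<pi> powi (int j - int i) \<noteq> 0"
      using i j nz by (auto intro!: subrng_mult[OF s])
    thus ?thesis by (auto simp: mx_def)
  qed
  thus ?thesis using that pi by blast
qed

context place
begin

text \<open>Elements of \<open>K\<close> have degree at most n, so by
  \<open>isval_exists_bound\<close> their values lie in (1/n!) Z. The least positive value generates
  all of them by division with remainder.\<close>

lemma discrete: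
  assumes K: "subfld K" "k \<subseteq> K" "dimn n k K"
  obtains piK where "piK \<in> K" "piK \<noteq> 0" "val piK > 0" "\<And>x. x \<in> K - {0} ==> \<exists>i::int. val x = of_int i * val piK"
proof -
  have sk: "subfld k" using k by (rule algcl_subfld)
  define N where "N = real (fact n)"
  have N: "N > 0" by (simp add: N_def)
  have int: "\<exists>i::int. N * val x = of_int i" if x: "x \<in> K" "x \<noteq> 0" for x
  proof -
    have "\<not> indep k {..n} (\<lambda>i. x ^ i)"
      using indep_le_dimn[OF K(3) sk, of "{..n}" "\<lambda>i. x ^ i"] x subfld_power[OF K(1)] by auto
    then obtain c where c: "\<forall>i\<le>n. c i \<in> k" "(\<Sum>i\<le>n. c i * x ^ i) = 0" "\<exists>i\<le>n. c i \<noteq> 0" by (auto simp: indep_def)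
    define p where "p = (\<Sum>i\<le>n. monom (c i) i)"
    have cp: "coeff p i = (if i \<le> n then c i else 0)" for i by (simp add: p_def coeff_sum if_distrib cong: if_cong)
    have p: "pover k p" "p \<noteq> 0" "poly p x = 0" 
    proof -
      show "pover k p" using c(1) subfld_0[OF sk] by (simp add: pover_def cp)
      show "p \<noteq> 0" using c(3) cp by (metis coeff_0)
      show "poly p x = 0" using c(2) by (simp add: p_def poly_sum poly_monom)
    qed
    have dp: "degree p \<le> n" by (rule degree_le) (simp add: cp)
    obtain a b where ab: "isval x a b" "b \<le> degree p" using isval_exists_bound[OF p x(2)] by blast
    have b: "b > 0" "b \<le> n" using ab dp by (auto simp: isval_def)
    hence "b dvd fact n" by (simp add: dvd_fact)
    then obtain m where m: "fact n = b * m" by (auto elim: dvdE)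
    have "N * val x = of_int (a * int m)" using val_eqI[OF ab(1)] b m by (simp add: N_def field_simps)
    thus ?thesis by blast
  qed
  define P where "P = (\<lambda>l::nat. l > 0 \<and> (\<exists>x\<in>K - {0}. N * val x = of_nat l))"
  have "P (fact n)" unfolding P_def using pi K(2) by (auto simp: N_def intro!: bexI[of _ \<pi>])
  hence PL: "P (LEAST l. P l)" by (rule LeastI)
  define l where "l = (LEAST l. P l)"
  obtain piK where p: "piK \<in> K" "piK \<noteq> 0" "N * val piK = of_nat l" "l > 0" using PL by (auto simp: P_def l_def)
  have "\<exists>i::int. val x = of_int i * val piK" if x: "x \<in> K - {0}" for x
  proof -
    obtain a :: int where a: "N * val x = of_int a" using int x by auto
    define r where "r = a mod int l"
    define q where "q = a div int l"
    have aq: "a = q * int l + r" by (simp add: q_def r_def)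
    define y where "y = x / piK powi q"
    have y: "y \<in> K - {0}" using x p K(1) by (auto simp: y_def intro!: subfld_closed)
    have "val y = val x - of_int q * val piK" using x p by (simp add: y_def val_divide val_powi)
    hence "N * val y = N * (val x - of_int q * val piK)" by simp
    also have "\<dots> = N * val x - of_int q * (N * val piK)" by (simp add: right_diff_distrib)
    finally have "N * val y = N * val x - of_int q * (N * val piK)" .
    hence v: "N * val y = of_int r" unfolding a p(3) aq by simp
    have "r = 0"
    proof (rule ccontr)
      assume "r \<noteq> 0"
      moreover have "0 \<le> r" "r < int l" using p(4) by (simp_all add: r_def)
      ultimately have r: "0 < r" "r < int l" by simp_all
      hence "P (nat r)" unfolding P_def using y v by auto
      hence "l \<le> nat r" unfolding l_def by (rule Least_le)
      thus False using r by simp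
    qed
    hence "N * val x = N * (of_int q * val piK)" using a aq p(3) by simp
    thus ?thesis using N by auto
  qed
  moreover have "val piK > 0" using zero_less_mult_pos[OF _ N, of "val piK"] p by simp
  ultimately show ?thesis using p by (intro that[of piK]) blast+
qed

text \<open>\<open>e\<close> is the absolute ramification index: \<open>\<pi>\<close> has value 1, a
  multiple of the least positive value.\<close>

lemma discrete_index:
  assumes K: "subfld K" "k \<subseteq> K" "dimn n k K"
  obtains piK e where "piK \<in> K" "piK \<noteq> 0" "val piK > 0" "\<And>x. x \<in> K - {0} ==> \<exists>i::int. val x = of_int i * val piK"
    "(e::nat) > 0" "of_nat e * val piK = 1"
proof -
  obtain piK where p: "piK \<in> K" "piK \<noteq> 0" "val piK > 0" "\<And>x. x \<in> K - {0} ==> \<exists>i::int. val x = of_int i * val piK"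
    using discrete[OF K] by blast
  obtain i :: int where i: "of_int i * val piK = 1" using p(4)[of \<pi>] pi K(2) by auto
  hence "i > 0" using p(3) by (metis of_int_0_less_iff zero_less_mult_pos2 zero_less_one)
  thus ?thesis using that[of piK "nat i"] p i by simp
qed

end

text \<open>Links the ideal-theoretic uniformizers of the definitions to the real-valued
  \<open>val\<close>: they are the elements of least positive value.\<close>

lemma (in place) prime_val_eq:
  fixes K :: "'w set"
  assumes K: "subfld K" "k \<subseteq> K" and p: "piK \<in> K" "piK \<noteq> 0" "val piK > 0" "\<And>x. x \<in> K - {0} ==> \<exists>i::int. val x = of_int i * val piK"
  shows "mx (\<O> \<inter> K) = {q * y | y. y \<in> \<O> \<inter> K} \<longleftrightarrow> q \<in> K \<and> q \<noteq> 0 \<and> val q = val piK"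
proof
  have m: "mx (\<O> \<inter> K) = mx \<O> \<inter> K" by (rule mx_Int[OF K(1)])
  have pm: "piK \<in> mx \<O> \<inter> K" using p m_val by auto
  have ge: "val x \<ge> val piK" if x: "x \<in> mx \<O> \<inter> K" "x \<noteq> 0" for x
  proof -
    obtain i :: int where i: "val x = of_int i * val piK" using p(4)[of x] x by auto
    have "val x > 0" using x m_val[of x] by auto
    hence "i \<ge> 1" using i p(3) by (simp add: zero_less_mult_iff)
    hence "1 * val piK \<le> of_int i * val piK" by (intro mult_right_mono) (use p(3) in auto)
    thus ?thesis using i by simp
  qed
  assume e: "mx (\<O> \<inter> K) = {q * y | y. y \<in> \<O> \<inter> K}"
  have "q * 1 \<in> mx (\<O> \<inter> K)" unfolding e using subrng_1[OF sO] subfld_1[OF K(1)] by blast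
  hence qm: "q \<in> mx \<O> \<inter> K" by (simp add: m)
  obtain y where y: "piK = q * y" "y \<in> \<O> \<inter> K" using pm e m by blast
  hence q0: "q \<noteq> 0" "y \<noteq> 0" using p(2) by auto
  have "val piK \<ge> val q" using y q0 O_val[of y] by (simp add: val_mult)
  thus "q \<in> K \<and> q \<noteq> 0 \<and> val q = val piK" using ge[OF qm q0(1)] qm q0 by auto
next
  have m: "mx (\<O> \<inter> K) = mx \<O> \<inter> K" by (rule mx_Int[OF K(1)])
  assume q: "q \<in> K \<and> q \<noteq> 0 \<and> val q = val piK"
  show "mx (\<O> \<inter> K) = {q * y | y. y \<in> \<O> \<inter> K}"
  proof (intro equalityI subsetI)
    fix x assume x: "x \<in> mx (\<O> \<inter> K)"
    have "x / q \<in> \<O> \<inter> K"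
    proof (cases "x = 0")
      case False
      obtain i :: int where i: "val x = of_int i * val piK" using p(4)[of x] x m False by auto
      have "val x > 0" using x m m_val[OF False] by auto
      hence "i \<ge> 1" using i p(3) by (simp add: zero_less_mult_iff)
      hence "1 * val piK \<le> of_int i * val piK" by (intro mult_right_mono) (use p(3) in auto)
      hence "val (x / q) \<ge> 0" using i q False by (simp add: val_divide)
      thus ?thesis using O_val[of "x / q"] False q x m K(1) by (auto intro: subfld_divide)
    qed (simp add: subrng_0[OF sO] subfld_0[OF K(1)])
    moreover have "x = q * (x / q)" using q by simp
    ultimately show "x \<in> {q * y | y. y \<in> \<O> \<inter> K}" by blast
  next
    fix x assume "x \<in> {q * y | y. y \<in> \<O> \<inter> K}"
    then obtain y where y: "x = q * y" "y \<in> \<O>" "y \<in> K" by blast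
    have "q \<in> mx \<O>" using q p(3) m_val by auto
    hence "x \<in> mx \<O>" using m_mult[OF y(2)] y(1) by (simp add: mult.commute)
    thus "x \<in> mx (\<O> \<inter> K)" using y q K(1) m by (auto intro: subfld_mult)
  qed
qed

section \<open>Ramification index and inertia degree\<close>

lemma prime_val_O:
  fixes K :: "'a::{finite,field} rat_closure set"
  assumes "place \<O> k \<pi>" and K: "subfld K" "k \<subseteq> K" 
    and p: "piK \<in> K" "piK \<noteq> 0" "place.val \<O> \<pi> piK > 0" 
      "\<And>x. x \<in> K - {0} ==> \<exists>i::int. place.val \<O> \<pi> x = of_int i * place.val \<O> \<pi> piK"
    and x: "x \<in> K" "x \<noteq> 0" "place.val \<O> \<pi> x = of_int i * place.val \<O> \<pi> piK"
  shows "prime_val (\<O> \<inter> K) x = i"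
proof -
  interpret place \<O> k \<pi> by fact
  have un: "uniformizer (\<O> \<inter> K) q \<longleftrightarrow> q \<in> K \<and> q \<noteq> 0 \<and> val q = val piK" for q
    unfolding uniformizer_def prime_ideal_of_eq by (rule prime_val_eq[OF K p])
  have m: "mx (\<O> \<inter> K) = mx \<O> \<inter> K" by (rule mx_Int[OF K(1)])
  show ?thesis unfolding prime_val_def
  proof (rule the_equality)
    define u where "u = x / piK powi i"
    have u: "u \<noteq> 0" "u \<in> K" using x p K(1) by (auto simp: u_def intro!: subfld_closed)
    have "val u = 0" using x p by (simp add: u_def val_divide val_powi)
    hence "u \<in> U" using U_val u by simp
    hence "u \<in> \<O> \<inter> K" "u \<notin> prime_ideal_of (\<O> \<inter> K)" using u by (auto simp: U_def prime_ideal_of_eq m)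
    moreover have "x = piK powi i * u" using p by (simp add: u_def)
    moreover have "uniformizer (\<O> \<inter> K) piK" using un p by simp
    ultimately show "\<exists>\<pi> u. uniformizer (\<O> \<inter> K) \<pi> \<and> u \<in> \<O> \<inter> K \<and> u \<notin> prime_ideal_of (\<O> \<inter> K) \<and> x = \<pi> powi i * u" by blast
  next
    fix j assume "\<exists>\<pi> u. uniformizer (\<O> \<inter> K) \<pi> \<and> u \<in> \<O> \<inter> K \<and> u \<notin> prime_ideal_of (\<O> \<inter> K) \<and> x = \<pi> powi j * u"
    then obtain q u where q: "uniformizer (\<O> \<inter> K) q" "u \<in> \<O> \<inter> K" "u \<notin> prime_ideal_of (\<O> \<inter> K)" "x = q powi j * u" by blast
    have q': "q \<in> K" "q \<noteq> 0" "val q = val piK" using un q(1) by auto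
    have "u \<in> U" using q by (auto simp: U_def prime_ideal_of_eq m)
    hence "val u = 0" "u \<noteq> 0" using U_val by (auto simp: U_iff)
    hence "of_int j * val piK = of_int i * val piK" using q q' x(3) by (simp add: val_mult val_powi)
    hence "real_of_int j = of_int i" using p(3) by simp
    thus "j = i" by simp
  qed
qed

text \<open>Both normalised valuations are \<open>val\<close> divided by its least positive value,
  so their ratio on \<open>F\<close> is the quotient of the two least values.\<close>

lemma ram_index_O:
  fixes K :: "'a::{finite,field} rat_closure set"
  assumes pl: "place \<O> k \<pi>" and K: "subfld K" "F \<subseteq> K" and F: "subfld F" "k \<subseteq> F"
    and p: "piK \<in> K" "piK \<noteq> 0" "place.val \<O> \<pi> piK > 0" 
      "\<And>x. x \<in> K - {0} ==> \<exists>i::int. place.val \<O> \<pi> x = of_int i * place.val \<O> \<pi> piK"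
    and pF: "piF \<in> F" "piF \<noteq> 0" "place.val \<O> \<pi> piF > 0" 
      "\<And>x. x \<in> F - {0} ==> \<exists>i::int. place.val \<O> \<pi> x = of_int i * place.val \<O> \<pi> piF"
    and e: "place.val \<O> \<pi> piF = of_nat e * place.val \<O> \<pi> piK"
  shows "ram_index F (\<O> \<inter> K) = e"
proof -
  interpret place \<O> k \<pi> by fact
  have kK: "k \<subseteq> K" using K F by blast
  have VF: "\<O> \<inter> K \<inter> F = \<O> \<inter> F" using K(2) by auto
  have *: "prime_val (\<O> \<inter> K) x = int e * prime_val (\<O> \<inter> F) x" if x: "x \<in> F - {0}" for x
  proof -
    obtain i :: int where i: "val x = of_int i * val piF" using pF(4)[OF x] by blast
    have "val x = of_int (int e * i) * val piK" using i e by simp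
    hence "prime_val (\<O> \<inter> K) x = int e * i" using prime_val_O[OF pl K(1) kK p] x K(2) by blast
    moreover have "prime_val (\<O> \<inter> F) x = i" using prime_val_O[OF pl F pF] x i by blast
    ultimately show ?thesis by simp
  qed
  show ?thesis unfolding ram_index_def VF
  proof (rule the_equality)
    show "\<forall>x\<in>F - {0}. prime_val (\<O> \<inter> K) x = int e * prime_val (\<O> \<inter> F) x" using * by blast
    fix e' assume e': "\<forall>x\<in>F - {0}. prime_val (\<O> \<inter> K) x = int e' * prime_val (\<O> \<inter> F) x"
    have "prime_val (\<O> \<inter> F) piF = 1" using prime_val_O[OF pl F pF, of piF 1] pF by simp
    thus "e' = e" using *[of piF] e' pF by simp
  qed
qed

text \<open>Residue classes as subsets of \<open>V\<close>; counting them with \<open>rcard\<close>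
  stands in for the degree of a residue field over F_q.\<close>

definition rclass :: "'w::field set \<Rightarrow> 'w \<Rightarrow> 'w set" where
  "rclass V x = {y \<in> V. y - x \<in> mx V}"

definition rcard :: "'w::field set \<Rightarrow> nat" where
  "rcard V = card (rclass V ` V)"

context
  fixes A V :: "'w::field set"
  assumes A: "subfld A" and V: "vring A V"
begin

lemma rclass_eq_iff: "x \<in> V ==> y \<in> V ==> rclass V x = rclass V y \<longleftrightarrow> x - y \<in> mx V"
proof
  assume "x \<in> V" "y \<in> V" "rclass V x = rclass V y"
  moreover have "x \<in> rclass V x" using \<open>x \<in> V\<close> mx_0[OF vringD(1)[OF V]] by (simp add: rclass_def)
  ultimately show "x - y \<in> mx V" by (auto simp: rclass_def)
next
  assume *: "x \<in> V" "y \<in> V" "x - y \<in> mx V"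
  have "z - x \<in> mx V \<longleftrightarrow> z - y \<in> mx V" for z
    using mx_add[OF A V *(3), of "z - x"] mx_diff[OF A V _ *(3), of "z - y"] by auto
  thus "rclass V x = rclass V y" by (auto simp: rclass_def)
qed

lemma rcard_image:
  assumes s: "fhom UNIV \<sigma>" "bij \<sigma>" "\<sigma> ` A = A" shows "rcard (\<sigma> ` V) = rcard V"
proof -
  have V': "vring A (\<sigma> ` V)" by (rule vring_image[OF s V])
  have "rcard (\<sigma> ` V) = card ((\<lambda>x. rclass (\<sigma> ` V) (\<sigma> x)) ` V)" by (simp add: rcard_def image_image)
  also have "\<dots> = card (rclass V ` V)"
  proof (rule card_image_kernel)
    fix x y assume xy: "x \<in> V" "y \<in> V"
    have "rclass (\<sigma> ` V) (\<sigma> x) = rclass (\<sigma> ` V) (\<sigma> y) \<longleftrightarrow> \<sigma> x - \<sigma> y \<in> mx (\<sigma> ` V)"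
      unfolding rclass_def using xy 
    proof -
      note A V'
      show "({z \<in> \<sigma> ` V. z - \<sigma> x \<in> mx (\<sigma> ` V)} = {z \<in> \<sigma> ` V. z - \<sigma> y \<in> mx (\<sigma> ` V)}) \<longleftrightarrow> \<sigma> x - \<sigma> y \<in> mx (\<sigma> ` V)"
      proof
        assume e: "{z \<in> \<sigma> ` V. z - \<sigma> x \<in> mx (\<sigma> ` V)} = {z \<in> \<sigma> ` V. z - \<sigma> y \<in> mx (\<sigma> ` V)}"
        have "\<sigma> x \<in> {z \<in> \<sigma> ` V. z - \<sigma> x \<in> mx (\<sigma> ` V)}" using xy mx_0[OF vringD(1)[OF V']] by simp
        thus "\<sigma> x - \<sigma> y \<in> mx (\<sigma> ` V)" using e by auto
      next
        assume m: "\<sigma> x - \<sigma> y \<in> mx (\<sigma> ` V)"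
        have "z - \<sigma> x \<in> mx (\<sigma> ` V) \<longleftrightarrow> z - \<sigma> y \<in> mx (\<sigma> ` V)" for z
          using mx_add[OF A V' m, of "z - \<sigma> x"] mx_diff[OF A V' _ m, of "z - \<sigma> y"] by auto
        thus "{z \<in> \<sigma> ` V. z - \<sigma> x \<in> mx (\<sigma> ` V)} = {z \<in> \<sigma> ` V. z - \<sigma> y \<in> mx (\<sigma> ` V)}" by auto
      qed
    qed
    also have "\<sigma> x - \<sigma> y = \<sigma> (x - y)" by (simp add: hom_diff[OF s(1)])
    also have "\<sigma> (x - y) \<in> mx (\<sigma> ` V) \<longleftrightarrow> x - y \<in> mx V"
      unfolding mx_image[OF s(1,2)] using s(2) by (simp add: bij_is_inj inj_image_mem_iff)
    also have "\<dots> \<longleftrightarrow> rclass V x = rclass V y" using rclass_eq_iff[OF xy] by simp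
    finally show "rclass (\<sigma> ` V) (\<sigma> x) = rclass (\<sigma> ` V) (\<sigma> y) \<longleftrightarrow> rclass V x = rclass V y" .
  qed
  finally show ?thesis by (simp add: rcard_def)
qed

end

text \<open>Counts a finite vector space: the residue field has dimension
  \<open>inertia_degree B V\<close> over the image of V \<inter> B. The work lies in recognising the
  quotient ring as a field and that image as a subfield.\<close>

lemma inertia_card:
  fixes A V :: "'a::{finite,field} rat_closure set"
  assumes A: "subfld A" and V: "vring A V" and B: "subfld B" and fin: "finite (rclass V ` V)"
  shows "rcard V = rcard (V \<inter> B) ^ inertia_degree B V"
proof -
  define P where "P = prime_ideal_of V"
  define R where "R = (ring_of_type_algebra :: 'a rat_closure ring)\<lparr>carrier := V\<rparr>"
  interpret \<Omega>: Ring.field "ring_of_type_algebra :: 'a rat_closure ring" by (rule field_Om)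
  note s = vringD(1)[OF V]
  have P: "P = mx V" by (simp add: P_def prime_ideal_of_eq)
  have subV: "subring V (ring_of_type_algebra :: 'a rat_closure ring)" using s by (simp add: subring_iff)
  interpret R: ring R unfolding R_def by (rule \<Omega>.subring_is_ring[OF subV])
  have Rs [simp]: "carrier R = V" "x \<otimes>\<^bsub>R\<^esub> y = x * y" "x \<oplus>\<^bsub>R\<^esub> y = x + y" "\<one>\<^bsub>R\<^esub> = 1" "\<zero>\<^bsub>R\<^esub> = 0" for x y
    by (simp_all add: R_def)
  interpret R: cring R
    by unfold_locales (simp add: mult.commute)
  have ideal: "ideal P R"
  proof (rule idealI)
    show "ring R" by unfold_locales
    have "a_inv R x = - x" if "x \<in> V" for x
      by (rule R.minus_equality) (use that in \<open>auto simp: subrng_uminus[OF s]\<close>)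
    thus "subgroup P (add_monoid R)"
      by (intro R.add.subgroupI) (use mx_subset[of V] mx_0[OF s] mx_uminus[OF A V] mx_add[OF A V] in \<open>auto simp: P a_inv_def\<close>)
  next
    fix a x assume "a \<in> P" "x \<in> carrier R"
    hence "x * a \<in> mx V" using mx_mult[OF A V] by (simp add: P)
    thus "x \<otimes>\<^bsub>R\<^esub> a \<in> P" "a \<otimes>\<^bsub>R\<^esub> x \<in> P" by (simp_all add: P mult.commute)
  qed
  interpret I: ideal P R by (rule ideal)
  have coset: "P +>\<^bsub>R\<^esub> x = rclass V x" if x: "x \<in> V" for x
  proof -
    have "P +>\<^bsub>R\<^esub> x = (\<lambda>p. p + x) ` mx V" by (auto simp: a_r_coset_def' P)
    moreover have "z \<in> (\<lambda>p. p + x) ` mx V" if "z - x \<in> mx V" for z using imageI[OF that, of "\<lambda>p. p + x"] by simp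
    ultimately show ?thesis using subrng_add[OF s _ x] mx_subset[of V] by (auto simp: rclass_def)
  qed
  note coset_eq = rclass_eq_iff[OF A V]
  define Q where "Q = R Quot P"
  have cQ: "carrier Q = rclass V ` V"
    using coset by (auto simp: Q_def FactRing_def A_RCOSETS_def')
  have homQ: "(\<lambda>x. P +>\<^bsub>R\<^esub> x) \<in> ring_hom R Q" unfolding Q_def by (rule I.rcos_ring_hom)
  interpret Q: cring Q unfolding Q_def by (rule I.quotient_is_cring) unfold_locales
  interpret h: ring_hom_ring R Q "\<lambda>x. P +>\<^bsub>R\<^esub> x"
    by (rule ring_hom_ringI2[OF _ _ homQ]) unfold_locales
  have one: "\<one>\<^bsub>Q\<^esub> = rclass V 1" and zero: "\<zero>\<^bsub>Q\<^esub> = rclass V 0"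
    using h.hom_one h.hom_zero by (simp_all add: coset subrng_1[OF s] subrng_0[OF s])
  have mul: "rclass V x \<otimes>\<^bsub>Q\<^esub> rclass V y = rclass V (x * y)" if "x \<in> V" "y \<in> V" for x y
    using h.hom_mult[of x y] that subrng_mult[OF s that] by (simp add: coset)
  have "Ring.field Q"
  proof (rule Q.cring_fieldI2)
    show "\<zero>\<^bsub>Q\<^esub> \<noteq> \<one>\<^bsub>Q\<^esub>" unfolding one zero 
      using coset_eq[of 0 1] mx_uminus[OF A V, of "- 1"] mx_1[OF s] subrng_0[OF s] subrng_1[OF s] by auto
    fix a assume a: "a \<in> carrier Q" "a \<noteq> \<zero>\<^bsub>Q\<^esub>"
    then obtain x where x: "x \<in> V" "a = rclass V x" by (auto simp: cQ)
    hence "x \<notin> mx V" using a(2) coset_eq[of x 0] subrng_0[OF s] by (auto simp: zero)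
    hence i: "inverse x \<in> V" "x \<noteq> 0" using x by (auto simp: mx_def)
    show "\<exists>b\<in>carrier Q. a \<otimes>\<^bsub>Q\<^esub> b = \<one>\<^bsub>Q\<^esub>"
      using mul[OF x(1) i(1)] i x(2) by (auto simp: cQ one)
  qed
  then interpret Q: Ring.field Q .
  define S where "S = (\<lambda>x. P +>\<^bsub>R\<^esub> x) ` (V \<inter> B)"
  have subVB: "subring (V \<inter> B) R"
  proof (rule R.subringI)
    have "a_inv R x = - x" if "x \<in> V" for x
      by (rule R.minus_equality) (use that in \<open>auto simp: subrng_uminus[OF s]\<close>)
    thus "\<ominus>\<^bsub>R\<^esub> x \<in> V \<inter> B" if "x \<in> V \<inter> B" for x using that by (auto simp: subrng_uminus[OF s] subfld_uminus[OF B])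
  qed (use B in \<open>auto simp: subrng_closed[OF s] subfld_closed\<close>)
  have "subfield S Q"
  proof (rule Q.subfieldI')
    show "subring S Q" unfolding S_def by (rule h.img_is_subring[OF subVB])
    fix a assume a: "a \<in> S - {\<zero>\<^bsub>Q\<^esub>}"
    then obtain x where x: "x \<in> V" "x \<in> B" "a = rclass V x" by (auto simp: S_def coset)
    hence "x \<notin> mx V" using a coset_eq[of x 0] subrng_0[OF s] by (auto simp: zero)
    hence i: "inverse x \<in> V" "x \<noteq> 0" using x by (auto simp: mx_def)
    have "inv\<^bsub>Q\<^esub> a = rclass V (inverse x)"
      by (rule Q.comm_inv_char) (use x i mul[OF x(1) i(1)] in \<open>auto simp: cQ one\<close>)
    thus "inv\<^bsub>Q\<^esub> a \<in> S" using i x subfld_inverse[OF B] coset[OF i(1)] by (auto simp: S_def)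
  qed
  moreover have "card S = rcard (V \<inter> B)"
  proof -
    have AB: "subfld (A \<inter> B)" "vring (A \<inter> B) (V \<inter> (A \<inter> B))" using subfld_Int[OF A B] vring_Int[OF V subfld_Int[OF A B]] by auto
    have e: "V \<inter> (A \<inter> B) = V \<inter> B" using vringD(2)[OF V] by auto
    show ?thesis unfolding S_def rcard_def
    proof (rule card_image_kernel)
      fix x y assume xy: "x \<in> V \<inter> B" "y \<in> V \<inter> B"
      thus "P +>\<^bsub>R\<^esub> x = P +>\<^bsub>R\<^esub> y \<longleftrightarrow> rclass (V \<inter> B) x = rclass (V \<inter> B) y"
        using coset_eq[of x y] rclass_eq_iff[OF AB[unfolded e] xy] subfld_diff[OF B] by (auto simp: coset mx_Int[OF B])
    qed
  qed
  moreover have "card (carrier Q) = rcard V" by (simp add: cQ rcard_def)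
  ultimately have "rcard V = rcard (V \<inter> B) ^ ring.dim Q S (carrier Q)" using Q.finite_dim_card[of S] fin cQ by simp
  moreover have "ring.dim Q S (carrier Q) = inertia_degree B V"
    by (simp add: inertia_degree_def Let_def Q_def S_def R_def P_def)
  ultimately show ?thesis by simp
qed

section \<open>Infinite places\<close>

locale inf_place =
  fixes \<O> :: "'a::{finite,field} rat_closure set"
  assumes vO': "vring UNIV \<O>" and inf: "\<O> \<inter> \<kk> = inf_ring"
begin

abbreviation \<theta> :: "'a rat_closure" where "\<theta> \<equiv> inverse ratfun_T"

lemma FFq_inf: "FFq \<subseteq> (inf_ring :: 'a rat_closure set)"
proof
  fix x :: "'a rat_closure" assume "x \<in> FFq"
  then obtain a where "x = ev ratfun_T [:a:] / ev ratfun_T 1" by auto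
  thus "x \<in> inf_ring" unfolding inf_ring_iff by (intro exI[of _ "[:a:]"] exI[of _ 1]) auto
qed

lemma theta_mx: "\<theta> \<in> mx \<O>"
proof -
  have "\<theta> = ev ratfun_T 1 / ev ratfun_T [:0, 1:]" by (simp add: field_class.field_divide_inverse)
  hence "\<theta> \<in> inf_ring" unfolding inf_ring_iff by (intro exI[of _ 1] exI[of _ "[:0,1:]"]) auto
  moreover have "ratfun_T \<notin> (inf_ring :: 'a rat_closure set)"
  proof
    assume "ratfun_T \<in> (inf_ring :: 'a rat_closure set)"
    then obtain a b :: "'a poly" where ab: "b \<noteq> 0" "degree a \<le> degree b" "ratfun_T = ev ratfun_T a / ev ratfun_T b"
      unfolding inf_ring_iff by blast
    have "ev ratfun_T b \<noteq> 0" using ab(1) by (simp add: ev_T_eq_0)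
    hence "ratfun_T * ev ratfun_T b = ev ratfun_T a" using ab(3) by (metis nonzero_eq_divide_eq)
    hence "ev ratfun_T ([:0, 1:] * b) = ev ratfun_T a" by simp
    hence "[:0, 1:] * b = a" by (simp only: ev_T to_ac_eq_iff to_fract_eq_iff)
    hence "degree a = Suc (degree b)" using ab(1) by (auto simp: degree_mult_eq)
    thus False using ab(2) by simp
  qed
  ultimately show ?thesis using inf T_in by (auto simp: mx_def)
qed

lemma FFq_O: "FFq \<subseteq> \<O>" using FFq_inf inf by blast

lemma ev_O: "y \<in> \<O> ==> ev y f \<in> \<O>"
  by (induction f) (use FFq_O in \<open>auto intro!: subrng_closed[OF vringD(1)[OF vO']]\<close>)

text \<open>1/T lies in the maximal ideal, so the value is congruent to the nonzero constant
  term.\<close>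

lemma ev_theta_unit: assumes "coeff f 0 \<noteq> 0" shows "ev \<theta> f \<in> \<O> - mx \<O>"
proof -
  obtain a g where f: "f = pCons a g" by (cases f)
  hence a: "a \<noteq> 0" using assms by simp
  have e: "const_emb (inverse a) * ev \<theta> f - 1 = (const_emb (inverse a) * ev \<theta> g) * \<theta>"
    using a by (simp add: f algebra_simps const_emb_inverse)
  have t: "\<theta> \<in> \<O>" using theta_mx mx_subset by blast
  have "const_emb (inverse a) * ev \<theta> g \<in> \<O>" using FFq_O ev_O[OF t] by (intro subrng_mult[OF vringD(1)[OF vO']]) auto
  hence "const_emb (inverse a) * ev \<theta> f - 1 \<in> mx \<O>" unfolding e by (rule mx_mult[OF subfld_UNIV vO' _ theta_mx])
  hence "inverse (const_emb (inverse a) * ev \<theta> f) \<in> \<O>" "const_emb (inverse a) * ev \<theta> f \<noteq> 0" 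
    using cong1_in[OF subfld_UNIV vO'] by blast+
  hence "const_emb (inverse a) * inverse (const_emb (inverse a) * ev \<theta> f) \<in> \<O>" "ev \<theta> f \<noteq> 0"
    using FFq_O by (auto intro!: subrng_mult[OF vringD(1)[OF vO']])
  moreover have "const_emb (inverse a) * inverse (const_emb (inverse a) * ev \<theta> f) = inverse (ev \<theta> f)"
    using a by (simp add: const_emb_inverse)
  ultimately have "inverse (ev \<theta> f) \<in> \<O>" by metis
  thus ?thesis using ev_O[OF t] \<open>ev \<theta> f \<noteq> 0\<close> by (auto simp: mx_def)
qed

sublocale place \<O> "\<kk>" \<theta>
proof
  show "vring UNIV \<O>" by (rule vO')
  show "algcl (\<kk> :: 'a rat_closure set)" by (rule algcl_ratfun)
  show "\<theta> \<in> \<kk>" using T_in subfld_inverse[OF subfld_ratfun] by blast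
  show "\<theta> \<in> mx \<O>" by (rule theta_mx)
  show "\<theta> \<noteq> 0" by simp
  fix x :: "'a rat_closure" assume x: "x \<in> \<kk>" "x \<noteq> 0"
  obtain a b where ab: "b \<noteq> 0" "x = ev ratfun_T a / ev ratfun_T b" using ratfun_cases[OF x(1)] by metis
  have a0: "a \<noteq> 0" using ab x by auto
  define m n where "m = degree a" and "n = degree b"
  have e: "x * \<theta> powi (int m - int n) = ev \<theta> (reflect_poly a) * inverse (ev \<theta> (reflect_poly b))"
    unfolding ab(2) ev_inv_T[of a] ev_inv_T[of b] by (simp add: m_def n_def power_int_diff power_inverse field_simps)
  have "ev \<theta> (reflect_poly a) \<in> \<O> - mx \<O>" "ev \<theta> (reflect_poly b) \<in> \<O> - mx \<O>"
    by (rule ev_theta_unit, use a0 ab(1) in simp)+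
  hence "x * \<theta> powi (int m - int n) \<in> \<O>" "inverse (x * \<theta> powi (int m - int n)) \<in> \<O>" "x * \<theta> powi (int m - int n) \<noteq> 0"
    unfolding e by (auto simp: mx_def intro!: subrng_mult[OF vringD(1)[OF vO']])
  thus "\<exists>i::int. x * \<theta> powi i \<in> \<O> - mx \<O>" by (auto simp: mx_def)
qed

lemma val_T: "val ratfun_T = - 1"
  using val_inverse[of \<theta>] val_pi by simp

text \<open>P_infinity has degree one: dividing numerator and denominator by the power of T of
  exponent deg b gives polynomials in 1/T with a unit as denominator, and the residue is the
  quotient of the constant terms.\<close>

lemma const_residue:
  assumes "x \<in> \<O>" "x \<in> \<kk>" shows "\<exists>a. x - const_emb a \<in> mx \<O>"
proof -
  have "x \<in> inf_ring" using assms inf by blast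
  then obtain a b where ab: "b \<noteq> 0" "degree a \<le> degree b" "x = ev ratfun_T a / ev ratfun_T b"
    unfolding inf_ring_iff by blast
  define n where "n = degree b - degree a"
  \<comment> \<open>The monomial makes up for deg a < deg b, so that \<open>f\<close> is the
    numerator rescaled by the degree of the denominator.\<close>
  define f where "f = reflect_poly a * monom 1 n"
  have ub: "ev \<theta> (reflect_poly b) \<in> \<O> - mx \<O>" by (rule ev_theta_unit) (use ab(1) in simp)
  have x: "x = ev \<theta> f / ev \<theta> (reflect_poly b)"
  proof -
    have "ratfun_T ^ degree b = ratfun_T ^ degree a * ratfun_T ^ n" 
      using ab(2) by (simp add: n_def flip: power_add)
    moreover have "ratfun_T ^ n * \<theta> ^ n = 1" by (simp add: power_inverse)
    moreover have "(u * P) / (w * (P * N)) = (u * t) / w" if "P \<noteq> 0" "N * t = 1" for u P w N t :: "'a rat_closure"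
    proof -
      have "t = inverse N" "N \<noteq> 0" using that by (auto simp: inverse_unique)
      thus ?thesis using that(1) by (simp add: field_class.field_divide_inverse)
    qed
    ultimately have "x = ev \<theta> (reflect_poly a) * \<theta> ^ n / ev \<theta> (reflect_poly b)"
      unfolding ab(3) ev_inv_T[of a] ev_inv_T[of b] by (metis T_nonzero power_not_zero)
    thus ?thesis by (simp add: f_def)
  qed
  define c where "c = coeff f 0 / lead_coeff b"
  obtain g where g: "f - smult c (reflect_poly b) = pCons 0 g"
  proof -
    obtain z g where "f - smult c (reflect_poly b) = pCons z g" by (cases "f - smult c (reflect_poly b)")
    moreover have "coeff (f - smult c (reflect_poly b)) 0 = 0" using ab(1) by (simp add: c_def)
    ultimately show ?thesis using that by simp
  qed
  have "f = [:c:] * reflect_poly b + pCons 0 g" using g by (simp add: algebra_simps)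
  hence "ev \<theta> f = const_emb c * ev \<theta> (reflect_poly b) + \<theta> * ev \<theta> g" by (simp only: ev_add ev_mult) simp
  hence "x - const_emb c = (inverse (ev \<theta> (reflect_poly b)) * ev \<theta> g) * \<theta>"
  proof -
    have nz: "ev \<theta> (reflect_poly b) \<noteq> 0" using ub mx_0[OF vringD(1)[OF vO']] by auto
    have aux: "(d * w + t * u) / w - d = (inverse w * u) * t" if "w \<noteq> 0" for d w t u :: "'a rat_closure"
      using that by (simp add: add_divide_distrib) (simp add: field_class.field_divide_inverse mult.commute mult.left_commute)
    show ?thesis unfolding x \<open>ev \<theta> f = _\<close> by (rule aux[OF nz])
  qed
  moreover have "inverse (ev \<theta> (reflect_poly b)) * ev \<theta> g \<in> \<O>"
    using ub ev_O[of \<theta> g] theta_mx mx_subset by (intro subrng_mult[OF vringD(1)[OF vO']]) (auto simp: mx_def)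
  ultimately have "x - const_emb c \<in> mx \<O>" using mx_mult[OF subfld_UNIV vO' _ theta_mx] by metis
  thus ?thesis by blast
qed

text \<open>Divide an equation over k by a coefficient of least value and replace the coefficients
  by their residues in F_q. The reduction is nonzero because one coefficient has become 1. So
  residues are algebraic over F_q.\<close>

lemma ev_const_poly_mx:
  assumes y: "y \<in> \<O>" shows "\<exists>g. g \<noteq> 0 \<and> ev y g \<in> mx \<O>"
proof -
  obtain p where p: "pover \<kk> p" "p \<noteq> 0" "poly p y = 0" using k by (auto simp: algcl_def)
  define S where "S = {i. i \<le> degree p \<and> coeff p i \<noteq> 0}"
  have fS: "finite S" "S \<noteq> {}" using p(2) by (auto simp: S_def intro: exI[of _ "degree p"])
  define l where "l = Min ((\<lambda>i. val (coeff p i)) ` S)"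
  have "l \<in> (\<lambda>i. val (coeff p i)) ` S" unfolding l_def using fS by (intro Min_in) auto
  then obtain i0 where i0: "i0 \<in> S" "l = val (coeff p i0)" by auto
  define c where "c = (\<lambda>i. coeff p i / coeff p i0)"
  have c0: "coeff p i0 \<noteq> 0" using i0 by (simp add: S_def)
  have ck: "c i \<in> \<kk>" for i using p(1) subfld_divide[OF subfld_ratfun] by (auto simp: c_def pover_def)
  have cO: "c i \<in> \<O>" for i
  proof (cases "coeff p i = 0")
    case True thus ?thesis by (simp add: c_def subrng_0[OF sO])
  next
    case False
    hence "i \<in> S" by (simp add: S_def le_degree)
    hence "val (coeff p i0) \<le> val (coeff p i)" unfolding i0(2)[symmetric] l_def using fS by (intro Min_le) auto
    thus ?thesis using False c0 by (subst O_val) (auto simp: c_def val_divide)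
  qed
  have "\<forall>i. \<exists>a. c i - const_emb a \<in> mx \<O>" using const_residue cO ck by blast
  then obtain a where a: "\<And>i. c i - const_emb (a i) \<in> mx \<O>" by metis
  define g where "g = (\<Sum>i\<le>degree p. monom (a i) i)"
  have "a i0 \<noteq> 0"
  proof
    assume "a i0 = 0"
    hence "(1 :: 'a rat_closure) \<in> mx \<O>" using a[of i0] c0 by (simp add: c_def)
    thus False using m_1 by simp
  qed
  moreover have "coeff g i0 = a i0" using i0 by (simp add: g_def coeff_sum S_def)
  ultimately have "g \<noteq> 0" by auto
  moreover have "ev y g \<in> mx \<O>"
  proof -
    have evg: "ev y (\<Sum>i\<in>I. monom (a i) i) = (\<Sum>i\<in>I. const_emb (a i) * y ^ i)" for I
      by (induction I rule: infinite_finite_induct) auto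
    have "(\<Sum>i\<le>degree p. c i * y ^ i) = poly p y / coeff p i0" 
      by (simp add: poly_altdef c_def sum_divide_distrib)
    hence "(\<Sum>i\<le>degree p. c i * y ^ i) = 0" using p(3) by simp
    hence "ev y g = - (\<Sum>i\<le>degree p. y ^ i * (c i - const_emb (a i)))"
      unfolding g_def evg by (simp add: algebra_simps sum_subtractf)
    moreover have "(\<Sum>i\<le>degree p. y ^ i * (c i - const_emb (a i))) \<in> mx \<O>"
      by (intro m_sum m_mult a subrng_power[OF sO] y)
    ultimately show ?thesis using m_uminus by simp
  qed
  ultimately show ?thesis by blast
qed

lemma finite_poly_degree_less: "finite {r :: 'b::{finite,zero} poly. r = 0 \<or> degree r < d}"
proof -
  have "{r :: 'b poly. r = 0 \<or> degree r < d} \<subseteq> Poly ` {xs. set xs \<subseteq> UNIV \<and> length xs \<le> d}"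
  proof
    fix r :: "'b poly" assume "r \<in> {r. r = 0 \<or> degree r < d}"
    hence "length (coeffs r) \<le> d" by (cases "r = 0") (auto simp: length_coeffs_degree)
    thus "r \<in> Poly ` {xs. set xs \<subseteq> UNIV \<and> length xs \<le> d}" by (intro image_eqI[of _ _ "coeffs r"]) auto
  qed
  moreover have "finite {xs :: 'b list. set xs \<subseteq> UNIV \<and> length xs \<le> d}" by (rule finite_lists_length_le) simp
  ultimately show ?thesis using finite_subset by blast
qed

text \<open>Modulo a polynomial g over F_q with g(y) in the maximal ideal, the powers of the
  variable leave finitely many remainders; hence two different powers of \<open>y\<close> have the
  same residue.\<close>

sublocale tors_place \<O> "\<kk>" \<theta>
proof
  show "tors \<O>" unfolding tors_def
  proof
    fix y assume y: "y \<in> \<O>"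
    obtain g where g: "g \<noteq> 0" "ev y g \<in> mx \<O>" using ev_const_poly_mx[OF y] by blast
    define r where "r = (\<lambda>j. monom 1 j mod g)"
    have "range r \<subseteq> {r. r = 0 \<or> degree r < degree g}"
      using degree_mod_less[OF g(1)] by (auto simp: r_def)
    hence "finite (range r)" using finite_poly_degree_less finite_subset by blast
    hence "\<not> inj r" using finite_imageD infinite_UNIV_nat by blast
    then obtain i j where ij: "r i = r j" "i < j" by (metis injI linorder_neqE_nat)
    have yr: "y ^ j - ev y (r j) \<in> mx \<O>" for j
    proof -
      have "monom 1 j = (monom 1 j div g) * g + r j" by (simp add: r_def)
      hence "ev y (monom 1 j) = ev y (monom 1 j div g) * ev y g + ev y (r j)"
        by (metis ev_add ev_mult)
      hence "y ^ j - ev y (r j) = ev y (monom 1 j div g) * ev y g" by simp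
      thus ?thesis using m_mult[OF ev_O[OF y] g(2)] by simp
    qed
    have "(y ^ j - ev y (r j)) - (y ^ i - ev y (r i)) \<in> mx \<O>" by (rule m_diff[OF yr yr])
    hence "y ^ j - y ^ i \<in> mx \<O>" using ij by simp
    moreover have "y ^ j - y ^ i = y ^ i * (y ^ (j - i) - 1)" using ij by (simp add: algebra_simps flip: power_add)
    ultimately have "y ^ i \<in> mx \<O> \<or> y ^ (j - i) - 1 \<in> mx \<O>"
      using m_prime[of "y ^ i" "y ^ (j - i) - 1"] subrng_power[OF sO y] subrng_diff[OF sO _ subrng_1[OF sO]] by auto
    thus "\<exists>j>0. y ^ j \<in> mx \<O> \<or> y ^ j - 1 \<in> mx \<O>"
    proof
      assume "y ^ i \<in> mx \<O>"
      hence "y \<in> mx \<O>" using m_power y by blast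
      thus ?thesis by (intro exI[of _ 1]) simp
    next
      assume "y ^ (j - i) - 1 \<in> mx \<O>"
      thus ?thesis using ij by (intro exI[of _ "j - i"]) simp
    qed
  qed
qed

end

text \<open>By Chevalley's theorem every infinite prime of \<open>A\<close> extends to the whole
  closure, so statements about primes may be proved for places \<open>\<O>\<close>.\<close>

lemma inf_prime_iff_place:
  fixes A :: "'a::{finite,field} rat_closure set"
  assumes A: "subfld A" "\<kk> \<subseteq> A"
  shows "inf_prime A V \<longleftrightarrow> (\<exists>\<O>. inf_place \<O> \<and> V = \<O> \<inter> A)"
proof
  assume "inf_prime A V"
  hence V: "vring A V" "V \<inter> \<kk> = inf_ring" by (auto simp: inf_prime_def field_prime_iff)
  obtain \<O> where O: "vring UNIV \<O>" "\<O> \<inter> A = V" using chevalley[OF A(1) V(1)] by blast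
  hence "\<O> \<inter> \<kk> = inf_ring" using V(2) A(2) by auto
  thus "\<exists>\<O>. inf_place \<O> \<and> V = \<O> \<inter> A" using O by (auto simp: inf_place_def)
next
  assume "\<exists>\<O>. inf_place \<O> \<and> V = \<O> \<inter> A"
  then obtain \<O> where O: "inf_place \<O>" "V = \<O> \<inter> A" by blast
  interpret inf_place \<O> by fact
  have "vring A V" unfolding O(2) by (rule vring_O_Int[OF A(1)])
  moreover have "FFq \<subseteq> V" using FFq_O FFq_le A(2) O(2) by auto
  moreover have "V \<noteq> A"
  proof
    assume "V = A"
    hence "ratfun_T \<in> \<O>" using T_in A(2) O(2) by auto
    thus False using theta_mx by (auto simp: mx_def)
  qed
  moreover have "V \<inter> \<kk> = inf_ring" using inf A(2) O(2) by auto
  ultimately show "inf_prime A V" by (auto simp: inf_prime_def field_prime_iff)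
qed

lemma vring_inf_ring: "vring \<kk> (inf_ring :: 'a::{finite,field} rat_closure set)"
proof -
  have frac: "x - y \<in> inf_ring \<and> x * y \<in> inf_ring" if xy: "x \<in> inf_ring" "y \<in> inf_ring" for x y :: "'a rat_closure"
  proof -
    obtain a b where ab: "b \<noteq> 0" "degree a \<le> degree b" "x = ev ratfun_T a / ev ratfun_T b"
      using xy(1) unfolding inf_ring_iff by blast
    obtain c d where cd: "d \<noteq> 0" "degree c \<le> degree d" "y = ev ratfun_T c / ev ratfun_T d"
      using xy(2) unfolding inf_ring_iff by blast
    have nz: "ev ratfun_T b \<noteq> 0" "ev ratfun_T d \<noteq> 0" using ab cd by (simp_all add: ev_T_eq_0)
    have bd: "b * d \<noteq> 0" "degree (b * d) = degree b + degree d" using ab cd by (auto simp: degree_mult_eq)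
    have "x * y = ev ratfun_T (a * c) / ev ratfun_T (b * d)" using ab cd by simp
    moreover have "degree (a * c) \<le> degree (b * d)" 
      using degree_mult_le[of a c] ab(2) cd(2) bd(2) by linarith
    ultimately have "x * y \<in> inf_ring" unfolding inf_ring_iff using bd(1) by blast
    moreover have "x - y = ev ratfun_T (a * d + [:- 1:] * (c * b)) / ev ratfun_T (b * d)"
      using ab cd nz by (simp only: ev_add ev_mult) (simp add: field_simps)
    moreover have "degree (a * d + [:- 1:] * (c * b)) \<le> degree (b * d)"
    proof (rule degree_add_le)
      show "degree (a * d) \<le> degree (b * d)" using degree_mult_le[of a d] ab(2) bd(2) by linarith
      have "degree ([:- 1:] * (c * b)) \<le> degree (c * b)" by simp
      also have "\<dots> \<le> degree (b * d)" using degree_mult_le[of c b] cd(2) bd(2) by linarith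
      finally show "degree ([:- 1:] * (c * b)) \<le> degree (b * d)" .
    qed
    ultimately show ?thesis unfolding inf_ring_iff[of "x - y"] using bd(1) by blast
  qed
  have one: "(1 :: 'a rat_closure) \<in> inf_ring" unfolding inf_ring_iff by (intro exI[of _ 1]) auto
  have le: "inf_ring \<subseteq> (\<kk> :: 'a rat_closure set)" by (auto simp: inf_ring_def ratfun_field_def)
  have "x \<in> inf_ring \<or> inverse x \<in> inf_ring" if x: "x \<in> \<kk>" for x :: "'a rat_closure"
  proof -
    obtain a b where ab: "b \<noteq> 0" "x = ev ratfun_T a / ev ratfun_T b" using ratfun_cases[OF x] by metis
    show ?thesis
    proof (cases "a = 0 \<or> degree a \<le> degree b")
      case True
      hence "degree a \<le> degree b" by auto
      thus ?thesis using ab unfolding inf_ring_iff by blast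
    next
      case False
      hence "inverse x = ev ratfun_T b / ev ratfun_T a" "a \<noteq> 0" "degree b \<le> degree a" using ab by auto
      thus ?thesis unfolding inf_ring_iff by blast
    qed
  qed
  thus ?thesis using frac one le by (auto simp: vring_def subrng_def)
qed

lemma inf_place_exists: "\<exists>\<O> :: 'a::{finite,field} rat_closure set. inf_place \<O>"
proof -
  obtain \<O> where "vring UNIV \<O>" "\<O> \<inter> \<kk> = (inf_ring :: 'a rat_closure set)"
    using chevalley[OF subfld_ratfun vring_inf_ring] by blast
  thus ?thesis by (auto simp: inf_place_def)
qed

text \<open>When residue counts are the same at all infinite places, the definite description in
  \<open>f_inf\<close> has a value, and it is read off from the exponents of q.\<close>

lemma f_inf_eqI:
  fixes A B :: "'a::{finite,field} rat_closure set"
  assumes A: "subfld A" "\<kk> \<subseteq> A" and B: "subfld B"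
    and a: "\<And>\<O>. inf_place \<O> ==> rcard (\<O> \<inter> A) = CARD('a) ^ a" and b: "\<And>\<O>. inf_place \<O> ==> rcard (\<O> \<inter> A \<inter> B) = CARD('a) ^ b"
    and ab: "a = b * f" "b > 0"
  shows "f_inf A B = f"
proof -
  have q: "CARD('a) > 1"
  proof -
    have "card {0, 1 :: 'a} \<le> CARD('a)" by (rule card_mono) auto
    thus ?thesis by simp
  qed
  have *: "inertia_degree B V = f" if iV: "inf_prime A V" for V
  proof -
    obtain \<O> where O: "inf_place \<O>" "V = \<O> \<inter> A" using inf_prime_iff_place[OF A] iV by blast
    have V: "vring A V" using iV by (auto simp: inf_prime_def field_prime_iff)
    have "rcard V > 0" using a[OF O(1)] O(2) by simp
    hence "finite (rclass V ` V)" unfolding rcard_def by (rule card_ge_0_finite)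
    hence "CARD('a) ^ a = (CARD('a) ^ b) ^ inertia_degree B V"
      using inertia_card[OF A(1) V B] a[OF O(1)] b[OF O(1)] O(2) by simp
    hence "CARD('a) ^ a = CARD('a) ^ (b * inertia_degree B V)" by (simp add: power_mult)
    hence "a = b * inertia_degree B V" using q by (simp only: power_inject_exp)
    thus ?thesis using ab by simp
  qed
  obtain \<O> :: "'a rat_closure set" where "inf_place \<O>" using inf_place_exists by blast
  hence ex: "inf_prime A (\<O> \<inter> A)" using inf_prime_iff_place[OF A] by blast
  show ?thesis unfolding f_inf_def
    by (rule the_equality) (use * ex in auto)
qed

text \<open>Infinite primes of a Galois extension of k are conjugate, and conjugation preserves the
  number of residue classes.\<close>

lemma rcard_conj:
  fixes A :: "'a::{finite,field} rat_closure set"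
  assumes G: "Gal \<kk> A" "finite (Rst (Aut \<kk>) A)" and O: "inf_place \<O>" "inf_place \<O>'"
  shows "rcard (\<O> \<inter> A) = rcard (\<O>' \<inter> A)"
proof -
  interpret o1: inf_place \<O> by fact
  interpret o2: inf_place \<O>' by fact
  have A: "subfld A" "\<kk> \<subseteq> A" using Gal_D[OF G(1)] by auto
  have "\<O> \<inter> A \<inter> \<kk> = \<O>' \<inter> A \<inter> \<kk>" using o1.inf o2.inf A(2) by auto
  then obtain \<sigma> where s: "\<sigma> \<in> Aut \<kk>" "\<sigma> ` (\<O> \<inter> A) = \<O>' \<inter> A"
    using vrings_conjugate[OF algcl_ratfun G o1.vring_O_Int[OF A(1)] o1.tors_O_Int[OF A(1)] o2.vring_O_Int[OF A(1)] o2.tors_O_Int[OF A(1)]] by blast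
  thus ?thesis using rcard_image[OF A(1) o1.vring_O_Int[OF A(1)] Aut_fhom[OF s(1)] Aut_bij[OF s(1)] Gal_image[OF G(1) s(1)]] by simp
qed

section \<open>Finite constant fields\<close>

text \<open>Multiplication by \<open>x\<close> permutes the nonzero elements and leaves their
  product unchanged.\<close>

lemma finite_fld_power:
  fixes A :: "'w::field set"
  assumes A: "subfld A" "finite A" and x: "x \<in> A" shows "x ^ card A = x"
proof (cases "x = 0")
  case True
  have "card A > 0" using A subfld_0[OF A(1)] by (auto simp: card_gt_0_iff)
  thus ?thesis using True by (simp add: zero_power)
next
  case False
  define S where "S = A - {0}"
  have fS: "finite S" using A by (simp add: S_def)
  have inj: "inj_on ((*) x) S" using False by (auto intro: inj_onI)
  have "(*) x ` S \<subseteq> S" using x A False by (auto simp: S_def subfld_mult)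
  hence im: "(*) x ` S = S" by (rule endo_inj_surj[OF fS _ inj])
  have "(\<Prod>y\<in>S. y) = (\<Prod>y\<in>(*) x ` S. y)" by (simp only: im)
  also have "\<dots> = (\<Prod>y\<in>S. x * y)" by (subst prod.reindex[OF inj]) simp
  also have "\<dots> = x ^ card S * (\<Prod>y\<in>S. y)" by (simp add: prod.distrib)
  finally have "(x ^ card S - 1) * (\<Prod>y\<in>S. y) = 0" by (simp add: algebra_simps)
  moreover have "(\<Prod>y\<in>S. y) \<noteq> 0" using fS by (auto simp: S_def)
  ultimately have "x ^ card S = 1" by simp
  moreover have "card A = Suc (card S)" using A subfld_0[OF A(1)] card_Suc_Diff1[of A 0] by (simp add: S_def)
  ultimately show ?thesis by simp
qed

lemma card_ge_2: "CARD('a::{finite,field}) \<ge> 2"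
  using card_mono[of "UNIV :: 'a set" "{0, 1}"] by simp

text \<open>The fixed field of the p-th power map has at most p elements as roots of X^p - X and at
  least p as multiples of 1; the whole field is a vector space over it.\<close>

lemma card_finite_field:
  obtains r where "r > 0" "CARD('a::{finite,field}) = CHAR('a) ^ r"
proof -
  define p where "p = CHAR('a)"
  have p: "prime p" unfolding p_def by (rule prime_CHAR_semidom) (rule finite_imp_CHAR_pos, simp)
  have add: "(x + y) ^ p = x ^ p + y ^ p" for x y :: 'a unfolding p_def by (rule freshmans_dream) (use p in \<open>simp_all add: p_def\<close>)
  have diff: "(x - y) ^ p = x ^ p - y ^ p" for x y :: 'a using add[of "x - y" y] by simp
  define B where "B = {x :: 'a. x ^ p = x}"
  have "subfld B" unfolding subfld_def B_def
    using prime_gt_0_nat[OF p] by (auto simp: diff power_mult_distrib power_inverse zero_power)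
  then obtain n where n: "CARD('a) = card B ^ n"
    using finite_subfld_card[of B "UNIV :: 'a set"] subfld_UNIV by (metis finite subset_UNIV)
  have "card B \<le> p"
  proof -
    define f where "f = monom (1 :: 'a) p - [:0, 1:]"
    have "coeff f p = 1" using prime_gt_1_nat[OF p] by (simp add: f_def coeff_pCons split: nat.split)
    hence "f \<noteq> 0" by auto
    moreover have "degree f \<le> p" unfolding f_def
      by (rule degree_diff_le) (use prime_gt_0_nat[OF p] in \<open>simp_all add: degree_monom_le\<close>)
    moreover have "B = {x. poly f x = 0}" by (auto simp: B_def f_def poly_monom)
    ultimately show ?thesis using card_poly_roots_bound[of f] by simp
  qed
  moreover have "of_nat i \<in> B" for i unfolding B_def
    using prime_gt_0_nat[OF p] by (induction i) (auto simp: add zero_power)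
  hence "card (of_nat ` {..<p} :: 'a set) \<le> card B" by (intro card_mono) auto
  moreover have "inj_on (of_nat :: nat \<Rightarrow> 'a) {..<p}"
    by (rule linorder_inj_onI) (auto simp: of_nat_eq_iff_char_dvd p_def dest: dvd_imp_le)
  ultimately have "card B = p" by (simp add: card_image)
  hence "CARD('a) = CHAR('a) ^ n" using n by (simp add: p_def)
  moreover from this have "n > 0" using card_ge_2[where 'a = 'a] by (cases n) auto
  ultimately show ?thesis using that by blast
qed

lemma CHAR_rat_closure: "CHAR('a::{finite,field} rat_closure) = CHAR('a)"
proof (rule CHAR_eqI)
  have e: "(of_nat n :: 'a rat_closure) = const_emb (of_nat n)" for n by (induction n) auto
  show "of_nat CHAR('a) = (0 :: 'a rat_closure)" by (simp add: e)
  fix n assume "of_nat n = (0 :: 'a rat_closure)"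
  thus "CHAR('a) dvd n" by (simp add: e of_nat_eq_0_iff_char_dvd)
qed

lemma CHAR_ratfun [simp]: "CHAR('a::{finite,field} poly fract) = CHAR('a)"
  using CHAR_rat_closure[where 'a = 'a] by simp

lemma frob_add:
  fixes x y :: "'a::{finite,field} rat_closure"
  shows "(x + y) ^ (CARD('a) ^ n) = x ^ (CARD('a) ^ n) + y ^ (CARD('a) ^ n)"
proof -
  obtain r where r: "CARD('a) = CHAR('a) ^ r" using card_finite_field by blast
  have "prime CHAR('a)" by (rule prime_CHAR_semidom) (rule finite_imp_CHAR_pos, simp)
  thus ?thesis
    by (intro freshmans_dream'[of _ "r * n"]) (simp_all add: r power_mult)
qed

lemma frob_diff:
  fixes x y :: "'a::{finite,field} rat_closure"
  shows "(x - y) ^ (CARD('a) ^ n) = x ^ (CARD('a) ^ n) - y ^ (CARD('a) ^ n)"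
  using frob_add[of "x - y" y n] by simp

lemma of_nat_card_0: "(of_nat CARD('a) :: 'a::{finite,field} rat_closure) = 0"
proof -
  obtain r where "r > 0" "CARD('a) = CHAR('a) ^ r" using card_finite_field by blast
  hence "CHAR('a) dvd CARD('a)" by (metis dvd_power)
  thus ?thesis by (simp add: of_nat_eq_0_iff_char_dvd)
qed

text \<open>For m = 0 the condition reads x = x and \<open>FF 0\<close> is the whole closure, which
  is why positive indices are assumed throughout.\<close>

definition FF :: "nat \<Rightarrow> 'a::{finite,field} rat_closure set" where
  "FF m = {x. x ^ (CARD('a) ^ m) = x}"

lemma subfld_FF: "subfld (FF m :: 'a::{finite,field} rat_closure set)"
  unfolding subfld_def FF_def by (auto simp: frob_diff power_mult_distrib power_inverse zero_power)

lemma const_emb_q: "const_emb a ^ CARD('a) = const_emb (a :: 'a::{finite,field})"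
proof -
  have "a ^ CARD('a) = a" by (rule finite_fld_power[OF subfld_UNIV]) auto
  thus ?thesis by (metis const_emb_power)
qed

lemma const_emb_qn: "const_emb a ^ (CARD('a) ^ m) = const_emb (a :: 'a::{finite,field})"
  by (induction m) (simp_all add: power_mult const_emb_q)

lemma const_emb_pow: "a \<noteq> 0 ==> const_emb (a :: 'a::{finite,field}) ^ (CARD('a) - Suc 0) = 1"
  using const_emb_q[of a] power_Suc2[of "const_emb a" "CARD('a) - Suc 0"] card_ge_2[where 'a = 'a] by simp

lemma FFq_FF: "FFq \<subseteq> FF m"
  by (auto simp: FF_def const_emb_qn)

text \<open>A root of the cofactor left after splitting off all distinct roots would be a multiple
  root of \<open>p\<close>.\<close>

lemma separable_roots:
  fixes p :: "'w::alg_closed_field poly"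
  assumes p: "p \<noteq> 0" and sep: "\<And>x. poly p x = 0 ==> poly (pderiv p) x \<noteq> 0"
  defines "R \<equiv> {x. poly p x = 0}"
  shows "card R = degree p" "p = smult (lead_coeff p) (root_poly R)"
proof -
  have fR: "finite R" unfolding R_def by (rule poly_roots_finite[OF p])
  have "\<exists>h. p = root_poly S * h" if "finite S" "S \<subseteq> R" for S
    using that
  proof (induction S rule: finite_induct)
    case (insert r S)
    then obtain h where h: "p = root_poly S * h" by auto
    have "poly (root_poly S) r \<noteq> 0" using insert by (simp add: poly_root_poly)
    moreover have "poly p r = 0" using insert by (simp add: R_def)
    ultimately have "poly h r = 0" using h by (metis mult_eq_0_iff poly_mult)
    then obtain h' where "h = [:- r, 1:] * h'" by (auto simp: poly_eq_0_iff_dvd)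
    hence "p = ([:- r, 1:] * root_poly S) * h'" using h by (simp only: mult.assoc mult.left_commute)
    thus ?case using prod.insert[OF insert.hyps(1,2), of "\<lambda>r. [:- r, 1:]"] by metis
  qed (intro exI[of _ p], simp)
  then obtain h where h: "p = root_poly R * h" using fR by blast
  have "degree h = 0"
  proof (rule ccontr)
    assume "degree h \<noteq> 0"
    then obtain y where y: "poly h y = 0" using alg_closed_imp_poly_has_root by blast
    hence py: "poly p y = 0" using h by simp
    hence "poly (root_poly R) y = 0" using poly_root_poly[OF fR, of y] by (simp add: R_def)
    hence "poly (pderiv p) y = 0" using y unfolding h pderiv_mult by simp
    thus False using sep[OF py] by simp
  qed
  then obtain c where c: "h = [:c:]" by (auto elim: degree_eq_zeroE)
  have pc: "p = smult c (root_poly R)" using h c by simp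
  have c0: "c \<noteq> 0" using p pc by auto
  show "card R = degree p" unfolding pc using c0 degree_root_poly[OF fR] by simp
  have "lead_coeff (smult c (root_poly R)) = c * lead_coeff (root_poly R)" by (rule lead_coeff_smult)
  hence "lead_coeff p = c" unfolding pc[symmetric] using monic_root_poly[of R] by simp
  thus "p = smult (lead_coeff p) (root_poly R)" using pc by metis
qed

lemma Sep_roots:
  fixes p :: "'w::alg_closed_field poly"
  assumes B: "subfld B" and p: "p \<noteq> 0" "pover B p" and sep: "\<And>x. poly p x = 0 ==> poly (pderiv p) x \<noteq> 0"
    and x: "poly p x = 0"
  shows "x \<in> Sep B"
proof -
  define R where "R = {x. poly p x = 0}"
  have fR: "finite R" unfolding R_def by (rule poly_roots_finite[OF p(1)])
  have e: "p = smult (lead_coeff p) (root_poly R)" using separable_roots(2)[OF p(1) sep] by (simp add: R_def)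
  have "smult (inverse (lead_coeff p)) p = root_poly R" using p(1) by (subst e) (simp del: e)
  moreover have "pover B (smult (inverse (lead_coeff p)) p)"
    by (rule pover_smult[OF B _ p(2)]) (use p(2) B in \<open>auto simp: pover_def intro: subfld_inverse\<close>)
  ultimately have "pover B (root_poly R)" by simp
  thus ?thesis using fR x by (auto simp: Sep_def R_def)
qed

definition fpoly :: "nat \<Rightarrow> 'a::{finite,field} rat_closure poly" where
  "fpoly m = monom 1 (CARD('a) ^ m) - [:0, 1:]"

lemma fpoly_facts:
  fixes x :: "'a::{finite,field} rat_closure"
  assumes "m > 0"
  shows "poly (fpoly m) x = x ^ (CARD('a) ^ m) - x" "degree (fpoly m :: 'a rat_closure poly) = CARD('a) ^ m"
    "fpoly m \<noteq> (0 :: 'a rat_closure poly)" "pderiv (fpoly m) = (- 1 :: 'a rat_closure poly)" "pover FFq (fpoly m :: 'a rat_closure poly)"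
proof -
  show "poly (fpoly m) x = x ^ (CARD('a) ^ m) - x" by (simp add: fpoly_def poly_monom)
  have q: "CARD('a) ^ m > 1" by (rule one_less_power) (use card_ge_2[where 'a = 'a] assms in auto)
  have "degree (monom (1 :: 'a rat_closure) (CARD('a) ^ m) + (- [:0, 1:])) = degree (monom (1 :: 'a rat_closure) (CARD('a) ^ m))"
    by (rule degree_add_eq_left) (use q in \<open>simp add: degree_monom_eq\<close>)
  thus d: "degree (fpoly m :: 'a rat_closure poly) = CARD('a) ^ m" 
    unfolding fpoly_def diff_conv_add_uminus by (simp only: degree_monom_eq[OF one_neq_zero])
  show "fpoly m \<noteq> (0 :: 'a rat_closure poly)" using d q by auto
  have "(of_nat (CARD('a) ^ m) :: 'a rat_closure) = 0" using assms by (simp add: of_nat_card_0 zero_power)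
  thus "pderiv (fpoly m) = (- 1 :: 'a rat_closure poly)" by (simp add: fpoly_def pderiv_diff pderiv_monom pderiv_pCons one_pCons del: of_nat_power)
  show "pover FFq (fpoly m :: 'a rat_closure poly)" unfolding fpoly_def using subfld_FFq[where 'a = 'a]
    by (intro pover_diff pover_monom) (auto simp: pover_pCons pover_0 subfld_closed)
qed

lemma FF_card: assumes "m > 0" shows "finite (FF m :: 'a::{finite,field} rat_closure set)" "card (FF m :: 'a rat_closure set) = CARD('a) ^ m"
proof -
  have FF: "FF m = {x :: 'a rat_closure. poly (fpoly m) x = 0}" by (simp add: FF_def fpoly_facts(1)[OF assms])
  show "finite (FF m :: 'a rat_closure set)" unfolding FF by (rule poly_roots_finite[OF fpoly_facts(3)[OF assms]])
  show "card (FF m :: 'a rat_closure set) = CARD('a) ^ m" unfolding FF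
    by (subst separable_roots(1)[OF fpoly_facts(3)[OF assms]]) (simp_all add: fpoly_facts(2,4)[OF assms])
qed

lemma FF_Sep: "m > 0 ==> FFq \<subseteq> B ==> subfld B ==> FF m \<subseteq> Sep B"
proof
  fix x :: "'a rat_closure" assume *: "m > 0" "FFq \<subseteq> B" "subfld B" "x \<in> FF m"
  show "x \<in> Sep B"
    by (rule Sep_roots[OF *(3) fpoly_facts(3)[OF *(1)] pover_mono[OF fpoly_facts(5)[OF *(1)] *(2)]])
      (use * in \<open>auto simp: fpoly_facts(1,4) FF_def\<close>)
qed

lemma FF_stable: "fhom UNIV \<sigma> ==> \<sigma> ` FF m \<subseteq> FF m"
  by (auto simp: FF_def simp flip: hom_power)

lemma FF_1: "FF 1 = (FFq :: 'a::{finite,field} rat_closure set)"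
proof -
  have "card (FFq :: 'a rat_closure set) = CARD('a)" by (rule card_image[OF const_emb_inj])
  also have "\<dots> = card (FF 1 :: 'a rat_closure set)" using FF_card(2)[of 1, where 'a = 'a] by simp
  finally show ?thesis using card_subset_eq[of "FF 1 :: 'a rat_closure set" FFq] FFq_FF[of 1, where 'a = 'a] FF_card(1)[of 1, where 'a = 'a] by simp
qed

text \<open>A field with q^n elements consists of roots of the polynomial defining
  \<open>FF n\<close>, and \<open>FF n\<close> has equally many elements.\<close>

lemma finite_subfld_FF:
  fixes A :: "'a::{finite,field} rat_closure set"
  assumes A: "subfld A" "finite A" "FFq \<subseteq> A"
  obtains j where "j > 0" "A = FF j" "card A = CARD('a) ^ j"
proof -
  obtain n where n: "card A = card (FFq :: 'a rat_closure set) ^ n" using finite_subfld_card[OF subfld_FFq A(1,3,2)] by blast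
  have c: "card (FFq :: 'a rat_closure set) = CARD('a)" by (rule card_image[OF const_emb_inj])
  have n0: "n > 0"
  proof (rule ccontr)
    assume "\<not> n > 0"
    hence "card A = 1" using n by simp
    moreover have "card {0, 1 :: 'a rat_closure} \<le> card A" by (rule card_mono[OF A(2)]) (use A(1) in \<open>auto simp: subfld_closed\<close>)
    ultimately show False by simp
  qed
  have "A \<subseteq> FF n" using finite_fld_power[OF A(1,2)] n c by (auto simp: FF_def)
  hence "A = FF n" using card_subset_eq[OF FF_card(1)[OF n0]] FF_card(2)[OF n0] n c by metis
  thus ?thesis using that n0 n c by simp
qed

lemma dim_FF:
  assumes "m > 0" "j > 0" "FF j \<subseteq> (FF m :: 'a::{finite,field} rat_closure set)" "dimn d (FF j) (FF m :: 'a rat_closure set)"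
  shows "m = j * d"
proof -
  interpret ring "ring_of_type_algebra :: 'a rat_closure ring" by (rule ring_Om)
  have "card (FF m :: 'a rat_closure set) = card (FF j :: 'a rat_closure set) ^ d"
    using dimension_card[OF assms(4)] subfld_FF[of j, where 'a = 'a] FF_card(1)[OF assms(2), where 'a = 'a] by (simp add: subfield_iff_subfld)
  hence "CARD('a) ^ m = CARD('a) ^ (j * d)" using FF_card(2)[OF assms(1), where 'a = 'a] FF_card(2)[OF assms(2), where 'a = 'a] by (simp add: power_mult)
  thus ?thesis using card_ge_2[where 'a = 'a] by (simp add: power_inject_exp)
qed

section \<open>The Carlitz module\<close>

definition phi :: "'a::{finite,field} rat_closure \<Rightarrow> 'a rat_closure \<Rightarrow> 'a rat_closure" where
  "phi \<theta> u = u ^ CARD('a) + \<theta> * u"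

lemma carlitz_act_phi: "carlitz_act \<theta> N u = (\<Sum>i\<le>degree N. const_emb (coeff N i) * (phi \<theta> ^^ i) u)"
proof -
  have "phi \<theta> = (\<lambda>v. v ^ CARD('a) + \<theta> * v)" by (auto simp: phi_def)
  thus ?thesis by (simp add: carlitz_act_def)
qed

lemma phi_add: "phi \<theta> (u + v) = phi \<theta> u + phi \<theta> v"
  using frob_add[of u v 1] by (simp add: phi_def algebra_simps)

lemma phi_0 [simp]: "phi \<theta> 0 = 0"
  by (simp add: phi_def zero_power)

lemma phi_const: "phi \<theta> (const_emb a * u) = const_emb a * phi \<theta> u"
  by (simp add: phi_def power_mult_distrib const_emb_q algebra_simps)

lemma phi_pow_add: "(phi \<theta> ^^ i) (u + v) = (phi \<theta> ^^ i) u + (phi \<theta> ^^ i) v"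
  by (induction i) (auto simp: phi_add)

lemma phi_pow_0 [simp]: "(phi \<theta> ^^ i) 0 = 0"
  by (induction i) auto

lemma phi_pow_const: "(phi \<theta> ^^ i) (const_emb a * u) = const_emb a * (phi \<theta> ^^ i) u"
  by (induction i) (auto simp: phi_const)

lemma phi_pow_diff: "(phi \<theta> ^^ i) (u - v) = (phi \<theta> ^^ i) u - (phi \<theta> ^^ i) v"
  using phi_pow_add[where u = "u - v" and v = v and i = i and \<theta> = \<theta>] by simp

lemma act_sum: "degree N \<le> n ==> carlitz_act \<theta> N u = (\<Sum>i\<le>n. const_emb (coeff N i) * (phi \<theta> ^^ i) u)"
  unfolding carlitz_act_phi by (rule sum.mono_neutral_left) (auto simp: coeff_eq_0)

lemma act_0 [simp]: "carlitz_act \<theta> 0 u = 0"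
  by (simp add: carlitz_act_phi)

lemma act_pCons: "carlitz_act \<theta> (pCons a N) u = const_emb a * u + carlitz_act \<theta> N (phi \<theta> u)"
proof -
  have "carlitz_act \<theta> (pCons a N) u = (\<Sum>i\<le>Suc (degree N). const_emb (coeff (pCons a N) i) * (phi \<theta> ^^ i) u)"
    by (rule act_sum) (simp add: degree_pCons_le)
  also have "\<dots> = const_emb a * u + (\<Sum>i\<le>degree N. const_emb (coeff N i) * (phi \<theta> ^^ i) (phi \<theta> u))"
    by (subst sum.atMost_Suc_shift) (simp add: funpow_swap1)
  finally show ?thesis by (simp add: carlitz_act_phi)
qed

lemma act_add: "carlitz_act \<theta> (N + M) u = carlitz_act \<theta> N u + carlitz_act \<theta> M u"
proof -
  define n where "n = max (degree N) (degree M)"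
  have "degree (N + M) \<le> n" "degree N \<le> n" "degree M \<le> n" 
    using degree_add_le_max[of N M] by (auto simp: n_def)
  thus ?thesis by (simp add: act_sum[of _ n] sum.distrib algebra_simps)
qed

lemma act_smult: "carlitz_act \<theta> (smult a N) u = const_emb a * carlitz_act \<theta> N u"
  using degree_smult_le[of a N] by (simp add: act_sum[of _ "degree N"] sum_distrib_left mult.assoc)

lemma act_arg_add: "carlitz_act \<theta> N (u + v) = carlitz_act \<theta> N u + carlitz_act \<theta> N v"
  by (simp add: carlitz_act_phi phi_pow_add sum.distrib algebra_simps)

lemma act_arg_0 [simp]: "carlitz_act \<theta> N 0 = 0"
  by (simp add: carlitz_act_phi)

lemma act_arg_const: "carlitz_act \<theta> N (const_emb a * u) = const_emb a * carlitz_act \<theta> N u"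
  by (simp add: carlitz_act_phi phi_pow_const sum_distrib_left mult.left_commute)

lemma act_arg_phi: "carlitz_act \<theta> N (phi \<theta> u) = phi \<theta> (carlitz_act \<theta> N u)"
  by (induction N arbitrary: u) (simp_all add: act_pCons phi_add phi_const)

lemma act_mult: "carlitz_act \<theta> (N * M) u = carlitz_act \<theta> N (carlitz_act \<theta> M u)"
proof (induction N)
  case (pCons a N)
  have "pCons a N * M = smult a M + pCons 0 (N * M)" by simp
  thus ?case using pCons act_arg_phi[of \<theta> N "carlitz_act \<theta> M u"]
    by (simp add: act_add act_smult act_pCons act_arg_phi)
qed simp

lemma act_commute: "carlitz_act \<theta> N (carlitz_act \<theta> M u) = carlitz_act \<theta> M (carlitz_act \<theta> N u)"
  by (metis act_mult mult.commute)

lemma act_monom: "carlitz_act \<theta> (monom 1 n) u = (phi \<theta> ^^ n) u"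
  by (induction n arbitrary: u) (simp_all add: monom_Suc act_pCons funpow_swap1 one_pCons monom_0)

lemma phi_Aut: "\<sigma> \<in> Aut \<kk> ==> \<theta> \<in> \<kk> ==> \<sigma> (phi \<theta> u) = phi \<theta> (\<sigma> u)"
  using hom_add[OF Aut_fhom, of \<sigma> \<kk>] hom_mult[OF Aut_fhom, of \<sigma> \<kk>] hom_power[OF Aut_fhom, of \<sigma> \<kk>]
  by (simp add: phi_def Aut_fix)

lemma const_Aut: "\<sigma> \<in> Aut \<kk> ==> \<sigma> (const_emb a) = const_emb a"
  using FFq_le Aut_fix by blast

lemma phi_pow_Aut: "\<sigma> \<in> Aut \<kk> ==> \<theta> \<in> \<kk> ==> \<sigma> ((phi \<theta> ^^ i) u) = (phi \<theta> ^^ i) (\<sigma> u)"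
  by (induction i) (auto simp: phi_Aut)

lemma act_Aut: assumes "\<sigma> \<in> Aut \<kk>" "\<theta> \<in> \<kk>" shows "\<sigma> (carlitz_act \<theta> N u) = carlitz_act \<theta> N (\<sigma> u)"
  unfolding carlitz_act_phi hom_sum[OF Aut_fhom[OF assms(1)] UNIV_I]
  by (rule sum.cong) (simp_all add: hom_mult[OF Aut_fhom[OF assms(1)]] const_Aut[OF assms(1)] phi_pow_Aut[OF assms])

primrec ppoly :: "'a::{finite,field} rat_closure \<Rightarrow> nat \<Rightarrow> 'a rat_closure poly" where
  "ppoly \<theta> 0 = [:0, 1:]"
| "ppoly \<theta> (Suc i) = ppoly \<theta> i ^ CARD('a) + smult \<theta> (ppoly \<theta> i)"

lemma poly_ppoly: "poly (ppoly \<theta> i) u = (phi \<theta> ^^ i) u"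
  by (induction i) (auto simp: phi_def)

lemma ppoly_degree: "degree (ppoly \<theta> i :: 'a::{finite,field} rat_closure poly) = CARD('a) ^ i \<and> lead_coeff (ppoly \<theta> i) = 1"
proof (induction i)
  case (Suc i)
  define p where "p = ppoly \<theta> i"
  have q: "CARD('a) \<ge> 2" by (rule card_ge_2)
  have d: "degree (p ^ CARD('a)) = CARD('a) ^ Suc i" using Suc degree_power_eq[of p "CARD('a)"] by (cases "p = 0") (auto simp: p_def)
  have "degree (smult \<theta> p) \<le> CARD('a) ^ i" using Suc degree_smult_le[of \<theta> p] by (simp add: p_def)
  also have "\<dots> < CARD('a) ^ Suc i" using q by simp
  finally have lt: "degree (smult \<theta> p) < degree (p ^ CARD('a))" using d by simp
  have "degree (p ^ CARD('a) + smult \<theta> p) = CARD('a) ^ Suc i" using degree_add_eq_left[OF lt] d by simp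
  moreover have "lead_coeff (p ^ CARD('a) + smult \<theta> p) = lead_coeff (p ^ CARD('a))"
    using lead_coeff_add_le[OF lt] by (simp add: add.commute)
  moreover have l: "lead_coeff p = 1" unfolding p_def by (rule conjunct2[OF Suc])
  hence "lead_coeff (p ^ CARD('a)) = 1" by (simp only: lead_coeff_power l power_one)
  ultimately show ?case by (simp only: p_def[symmetric] ppoly.simps(2))
qed simp

lemma ppoly_pderiv: "pderiv (ppoly \<theta> i) = [:\<theta> ^ i:]"
proof (induction i)
  case (Suc i)
  have q: "CARD('a) = Suc (CARD('a) - 1)" using card_ge_2[where 'a = 'a] by simp
  have "pderiv (ppoly \<theta> i ^ CARD('a)) = 0"
  proof -
    have "pderiv (ppoly \<theta> i ^ Suc (CARD('a) - 1)) = smult (of_nat (Suc (CARD('a) - 1))) (ppoly \<theta> i ^ (CARD('a) - 1)) * pderiv (ppoly \<theta> i)"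
      by (rule pderiv_power_Suc)
    moreover have "(of_nat (Suc (CARD('a) - 1)) :: 'a rat_closure) = 0" using of_nat_card_0[where 'a = 'a] q by simp
    ultimately show ?thesis using q by simp
  qed
  thus ?case using Suc by (simp add: pderiv_add pderiv_smult)
qed (simp add: pderiv_pCons)

lemma ppoly_pover: "\<theta> \<in> \<kk> ==> pover \<kk> (ppoly \<theta> i)"
proof (induction i)
  case (Suc i)
  have "pover \<kk> (p ^ n)" if "pover \<kk> p" for p :: "'a rat_closure poly" and n
    using that by (induction n) (auto simp: pover_1[OF subfld_ratfun] intro!: pover_mult[OF subfld_ratfun])
  thus ?case using Suc by (auto intro!: pover_add[OF subfld_ratfun] pover_smult[OF subfld_ratfun])
qed (auto simp: pover_pCons[OF subfld_ratfun] pover_0[OF subfld_ratfun] subfld_0[OF subfld_ratfun] subfld_1[OF subfld_ratfun])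

definition cpoly :: "'a::{finite,field} rat_closure \<Rightarrow> 'a poly \<Rightarrow> 'a rat_closure poly" where
  "cpoly \<theta> N = (\<Sum>i\<le>degree N. smult (const_emb (coeff N i)) (ppoly \<theta> i))"

lemma poly_cpoly: "poly (cpoly \<theta> N) u = carlitz_act \<theta> N u"
  by (simp add: cpoly_def carlitz_act_phi poly_sum poly_ppoly)

lemma cpoly_degree: 
  assumes "N \<noteq> 0" shows "degree (cpoly \<theta> N :: 'a::{finite,field} rat_closure poly) = CARD('a) ^ degree N"
proof -
  define d where "d = degree N"
  have q: "CARD('a) \<ge> 2" by (rule card_ge_2)
  have "coeff (cpoly \<theta> N) (CARD('a) ^ d) = (\<Sum>i\<le>d. const_emb (coeff N i) * coeff (ppoly \<theta> i) (CARD('a) ^ d))"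
    by (simp add: cpoly_def coeff_sum d_def)
  also have "\<dots> = const_emb (coeff N d) * coeff (ppoly \<theta> d) (CARD('a) ^ d)"
  proof (subst sum.mono_neutral_right[of "{..d}" "{d}"])
    show "\<forall>i\<in>{..d} - {d}. const_emb (coeff N i) * coeff (ppoly \<theta> i) (CARD('a) ^ d) = 0"
    proof
      fix i assume "i \<in> {..d} - {d}"
      hence "CARD('a) ^ i < CARD('a) ^ d" using q by (intro power_strict_increasing) auto
      hence "degree (ppoly \<theta> i) < CARD('a) ^ d" using ppoly_degree[of \<theta> i] by simp
      thus "const_emb (coeff N i) * coeff (ppoly \<theta> i) (CARD('a) ^ d) = 0" by (simp add: coeff_eq_0)
    qed
  qed auto
  also have "\<dots> \<noteq> 0" using ppoly_degree[of \<theta> d] assms by (auto simp: d_def)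
  finally have nz: "coeff (cpoly \<theta> N) (CARD('a) ^ d) \<noteq> 0" .
  have "degree (cpoly \<theta> N) \<le> CARD('a) ^ d" unfolding cpoly_def
  proof (rule degree_sum_le)
    fix i assume i: "i \<in> {..degree N}"
    have "degree (smult (const_emb (coeff N i)) (ppoly \<theta> i)) \<le> CARD('a) ^ i" 
      using ppoly_degree[of \<theta> i] degree_smult_le[of "const_emb (coeff N i)" "ppoly \<theta> i"] by simp
    also have "\<dots> \<le> CARD('a) ^ d" using i q by (intro power_increasing) (auto simp: d_def)
    finally show "degree (smult (const_emb (coeff N i)) (ppoly \<theta> i)) \<le> CARD('a) ^ d" .
  qed simp
  thus ?thesis using le_degree[OF nz] by (simp add: d_def)
qed

text \<open>Terms of degree q^i with i > 0 have derivative 0 and only the linear term remains. A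
  constant nonzero derivative makes all roots simple, so the torsion has q^deg N points and is
  separable.\<close>

lemma cpoly_pderiv: "pderiv (cpoly \<theta> N) = [:ev \<theta> N:]"
proof -
  have "pderiv (\<Sum>i\<in>I. smult (const_emb (coeff N i)) (ppoly \<theta> i)) = [:\<Sum>i\<in>I. const_emb (coeff N i) * \<theta> ^ i:]" for I
    by (induction I rule: infinite_finite_induct) (auto simp: pderiv_add pderiv_smult ppoly_pderiv)
  moreover have "degree (map_poly const_emb N) = degree N" by (rule degree_map_poly) simp
  ultimately show ?thesis by (simp add: cpoly_def ev_def poly_altdef coeff_map_poly)
qed

lemma cpoly_pover: assumes "\<theta> \<in> \<kk>" shows "pover \<kk> (cpoly \<theta> N)"
proof -
  have "pover \<kk> (\<Sum>i\<in>I. smult (const_emb (coeff N i)) (ppoly \<theta> i))" for I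
    using FFq_le by (induction I rule: infinite_finite_induct) 
      (auto simp: pover_0[OF subfld_ratfun] intro!: pover_add[OF subfld_ratfun] pover_smult[OF subfld_ratfun] ppoly_pover[OF assms])
  thus ?thesis by (simp add: cpoly_def)
qed

lemma torsion_roots: "carlitz_torsion \<theta> N = {u. poly (cpoly \<theta> N) u = 0}"
  by (simp add: carlitz_torsion_def poly_cpoly)

context
  fixes \<theta> :: "'a::{finite,field} rat_closure" and N :: "'a poly"
  assumes th: "\<theta> \<in> \<kk>" and evN: "ev \<theta> N \<noteq> 0"
begin

lemma N_nonzero: "N \<noteq> 0" using evN by auto

lemma cpoly_nonzero: "cpoly \<theta> N \<noteq> 0"
  using cpoly_pderiv[of \<theta> N] evN by auto

lemma torsion_finite: "finite (carlitz_torsion \<theta> N)"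
  unfolding torsion_roots by (rule poly_roots_finite[OF cpoly_nonzero])

lemma torsion_card: "card (carlitz_torsion \<theta> N) = CARD('a) ^ degree N"
  unfolding torsion_roots using separable_roots(1)[OF cpoly_nonzero] cpoly_degree[OF N_nonzero] by (simp add: cpoly_pderiv evN)

lemma torsion_Sep: "carlitz_torsion \<theta> N \<subseteq> Sep \<kk>"
proof
  fix u assume "u \<in> carlitz_torsion \<theta> N"
  thus "u \<in> Sep \<kk>" using Sep_roots[OF subfld_ratfun cpoly_nonzero cpoly_pover[OF th]]
    by (simp add: cpoly_pderiv evN torsion_roots)
qed

lemma torsion_Aut: "\<sigma> \<in> Aut \<kk> ==> u \<in> carlitz_torsion \<theta> N ==> \<sigma> u \<in> carlitz_torsion \<theta> N"
  using act_Aut[OF _ th, of \<sigma> N u] hom_0[OF Aut_fhom, of \<sigma> \<kk>] by (simp add: carlitz_torsion_def)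

lemma cyclotomic_gen: "cyclotomic_field \<theta> N = gen (\<kk> \<union> carlitz_torsion \<theta> N)"
  by (simp add: cyclotomic_field_def generate_field_eq_gen)

lemma Gal_cyclotomic: "Gal \<kk> (cyclotomic_field \<theta> N)"
  unfolding cyclotomic_gen 
  by (rule Gal_gen[OF algcl_ratfun torsion_Sep]) (use torsion_Aut gen_incl[of "\<kk> \<union> carlitz_torsion \<theta> N"] in blast)

lemma finite_Rst_cyclotomic: "finite (Rst (Aut \<kk>) (cyclotomic_field \<theta> N))"
  unfolding cyclotomic_gen by (rule finite_Rst_gen[OF algcl_ratfun torsion_finite])

lemma torsion_act: "u \<in> carlitz_torsion \<theta> N ==> carlitz_act \<theta> M u \<in> carlitz_torsion \<theta> N"
  using act_commute[of \<theta> N M u] by (simp add: carlitz_torsion_def)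

lemma torsion_phi_pow: "u \<in> carlitz_torsion \<theta> N ==> (phi \<theta> ^^ i) u \<in> carlitz_torsion \<theta> N"
  using torsion_act[of u "monom 1 i"] by (simp add: act_monom)

lemma torsion_const: "u \<in> carlitz_torsion \<theta> N ==> const_emb a * u \<in> carlitz_torsion \<theta> N"
  by (simp add: carlitz_torsion_def act_arg_const)

lemma torsion_add: "u \<in> carlitz_torsion \<theta> N ==> v \<in> carlitz_torsion \<theta> N ==> u + v \<in> carlitz_torsion \<theta> N"
  by (simp add: carlitz_torsion_def act_arg_add)

end

lemma torsion_dvd: "N dvd M ==> carlitz_torsion \<theta> N \<subseteq> carlitz_torsion \<theta> M"
  by (auto simp: carlitz_torsion_def act_mult elim!: dvdE) (metis act_arg_0 act_mult mult.commute)

section \<open>Torsion points at the infinite places\<close>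

text \<open>The value of a root of u^(q-1) = - 1/T. Its negative is the critical value for u^q + T
  u: above it T u dominates, below it u^q does.\<close>

definition slope :: "'a::finite itself \<Rightarrow> real" where "slope _ = 1 / (real CARD('a) - 1)"

context inf_place
begin

lemma val_const: "a \<noteq> 0 ==> val (const_emb a) = 0"
proof -
  assume a: "a \<noteq> 0"
  have "const_emb a \<in> U" using a FFq_O rangeI[of const_emb "inverse a"] by (auto simp: U_iff const_emb_inverse)
  thus ?thesis using U_val a by simp
qed

text \<open>Distinct values make the iterates of \<open>lam\<close> independent over F_q, so their
  combinations are as numerous as the torsion points.\<close>

lemma torsion_generator:
  assumes th: "th \<in> \<kk>" and evN: "ev th N \<noteq> 0" and l: "lam \<in> carlitz_torsion th N"
    and nz: "\<And>i. i < degree N ==> (phi th ^^ i) lam \<noteq> 0" 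
    and inj: "inj_on (\<lambda>i. val ((phi th ^^ i) lam)) {..<degree N}"
    and u: "u \<in> carlitz_torsion th N"
  obtains c where "u = (\<Sum>i<degree N. const_emb (c i) * (phi th ^^ i) lam)"
proof -
  define d where "d = degree N"
  define \<Psi> where "\<Psi> = (\<lambda>c :: nat \<Rightarrow> 'a. \<Sum>i<d. const_emb (c i) * (phi th ^^ i) lam)"
  define S where "S = PiE {..<d} (\<lambda>_. UNIV :: 'a set)"
  have "inj_on \<Psi> S"
  proof (rule inj_onI, rule ccontr)
    fix c c' assume c: "c \<in> S" "c' \<in> S" "\<Psi> c = \<Psi> c'" "c \<noteq> c'"
    define I where "I = {i. i < d \<and> c i \<noteq> c' i}"
    have "I \<noteq> {}"
    proof
      assume "I = {}"
      hence "c = c'" using c(1,2) unfolding S_def I_def by (intro PiE_ext[of c "{..<d}" _ c']) auto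
      thus False using c(4) by simp
    qed
    have "(\<Sum>i\<in>I. const_emb (c i - c' i) * (phi th ^^ i) lam) \<noteq> 0"
    proof (rule sum_nonzero[OF _ \<open>I \<noteq> {}\<close>])
      show "finite I" by (simp add: I_def)
      fix i assume "i \<in> I"
      hence "const_emb (c i - c' i) \<noteq> 0" "i < d" unfolding const_emb_eq_0 by (auto simp: I_def)
      thus "const_emb (c i - c' i) * (phi th ^^ i) lam \<noteq> 0" using nz by (simp add: d_def)
    next
      show "inj_on (\<lambda>i. val (const_emb (c i - c' i) * (phi th ^^ i) lam)) I"
      proof (rule inj_onI)
        fix i j assume ij: "i \<in> I" "j \<in> I" "val (const_emb (c i - c' i) * (phi th ^^ i) lam) = val (const_emb (c j - c' j) * (phi th ^^ j) lam)"
        have v: "val (const_emb (c i - c' i) * (phi th ^^ i) lam) = val ((phi th ^^ i) lam)" if i: "i \<in> I" for i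
        proof -
          have n: "c i - c' i \<noteq> 0" "i < d" using i by (auto simp: I_def)
          hence "const_emb (c i - c' i) \<noteq> 0" unfolding const_emb_eq_0 by simp
          thus ?thesis using val_mult val_const[OF n(1)] nz n(2) by (simp add: d_def)
        qed
        have "val ((phi th ^^ i) lam) = val ((phi th ^^ j) lam)" using ij v by simp
        thus "i = j" using inj_onD[OF inj] ij by (auto simp: I_def d_def)
      qed
    qed
    moreover have "(\<Sum>i\<in>I. const_emb (c i - c' i) * (phi th ^^ i) lam) = (\<Sum>i<d. const_emb (c i - c' i) * (phi th ^^ i) lam)"
      by (rule sum.mono_neutral_left) (auto simp: I_def)
    moreover have "\<dots> = \<Psi> c - \<Psi> c'" by (simp add: \<Psi>_def sum_subtractf algebra_simps)
    ultimately show False using c(3) by simp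
  qed
  hence "card (\<Psi> ` S) = CARD('a) ^ d" by (simp add: card_image S_def card_PiE)
  moreover have sum_tors: "(\<Sum>i\<in>I. const_emb (c i) * (phi th ^^ i) lam) \<in> carlitz_torsion th N" for c and I :: "nat set"
  proof (induction I rule: infinite_finite_induct)
    case (insert i I)
    thus ?case using torsion_add[OF th evN] torsion_const[OF th evN] torsion_phi_pow[OF th evN l] by simp
  qed (simp_all add: carlitz_torsion_def)
  hence "\<Psi> ` S \<subseteq> carlitz_torsion th N" by (auto simp: \<Psi>_def)
  ultimately have "\<Psi> ` S = carlitz_torsion th N"
    using card_subset_eq[OF torsion_finite[OF th evN]] torsion_card[OF th evN] by (simp add: d_def)
  thus ?thesis using u that by (auto simp: \<Psi>_def d_def)
qed

end

lemma aut_agree_torsion: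
  assumes s: "\<sigma> \<in> Aut \<kk>" "\<tau> \<in> Aut \<kk>" and th: "th \<in> \<kk>" and l: "\<sigma> lam = \<tau> lam"
    and u: "u = (\<Sum>i\<in>I. const_emb (c i) * (phi th ^^ i) lam)"
  shows "\<sigma> u = \<tau> u"
proof -
  have e: "\<rho> u = (\<Sum>i\<in>I. const_emb (c i) * (phi th ^^ i) (\<rho> lam))" if "\<rho> \<in> Aut \<kk>" for \<rho>
    unfolding u hom_sum[OF Aut_fhom[OF that] UNIV_I]
    by (rule sum.cong) (simp_all add: hom_mult[OF Aut_fhom[OF that]] const_Aut[OF that] phi_pow_Aut[OF that th])
  show ?thesis using e[OF s(1)] e[OF s(2)] l by simp
qed

lemma aut_agree_cyclotomic:
  assumes s: "\<sigma> \<in> Aut \<kk>" "\<tau> \<in> Aut \<kk>" and "th \<in> \<kk>" "ev th N \<noteq> 0"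
    and l: "\<And>u. u \<in> carlitz_torsion th N ==> \<sigma> u = \<tau> u" and x: "x \<in> cyclotomic_field th N"
  shows "\<sigma> x = \<tau> x"
  by (rule aut_agree_gen[OF Aut_fhom[OF s(1)] Aut_fhom[OF s(2)], of "\<kk> \<union> carlitz_torsion th N"])
    (use s l x cyclotomic_gen[OF assms(3,4)] in \<open>auto simp: Aut_fix\<close>)

context inf_place
begin

lemma card_q: "real CARD('a) \<ge> 2" using card_ge_2[where 'a = 'a] by simp

lemma slope: "slope TYPE('a) > 0" "slope TYPE('a) * (real CARD('a) - 1) = 1" "slope TYPE('a) \<le> 1" using card_q by (auto simp: slope_def)

text \<open>T has value -1, so the inequality says that T u has smaller value than u^q.\<close>

lemma phi_T_gt:
  assumes "u \<noteq> 0" "val u > - slope TYPE('a)" shows "phi ratfun_T u \<noteq> 0" "val (phi ratfun_T u) = val u - 1"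
proof -
  have v: "val (ratfun_T * u) = val u - 1" using assms val_T by (simp add: val_mult)
  have "(real CARD('a) - 1) * val u > (real CARD('a) - 1) * (- slope TYPE('a))" by (rule mult_strict_left_mono[OF assms(2)]) (use card_q in simp)
  hence "val (ratfun_T * u) < val (u ^ CARD('a))" using v assms slope(2) by (simp add: val_power algebra_simps)
  hence "ratfun_T * u + u ^ CARD('a) \<noteq> 0" "val (ratfun_T * u + u ^ CARD('a)) = val (ratfun_T * u)"
    using val_add_lt[of "ratfun_T * u" "u ^ CARD('a)"] assms by auto
  thus "phi ratfun_T u \<noteq> 0" "val (phi ratfun_T u) = val u - 1" using v by (simp_all add: phi_def add.commute)
qed

lemma phi_T_lt:
  assumes "u \<noteq> 0" "val u < - slope TYPE('a)" shows "phi ratfun_T u \<noteq> 0" "val (phi ratfun_T u) = real CARD('a) * val u"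
proof -
  have v: "val (ratfun_T * u) = val u - 1" using assms val_T by (simp add: val_mult)
  have "(real CARD('a) - 1) * val u < (real CARD('a) - 1) * (- slope TYPE('a))" by (rule mult_strict_left_mono[OF assms(2)]) (use card_q in simp)
  hence "val (u ^ CARD('a)) < val (ratfun_T * u)" using v assms slope(2) by (simp add: val_power algebra_simps)
  hence "u ^ CARD('a) + ratfun_T * u \<noteq> 0" "val (u ^ CARD('a) + ratfun_T * u) = val (u ^ CARD('a))"
    using val_add_lt[of "u ^ CARD('a)" "ratfun_T * u"] assms by auto
  thus "phi ratfun_T u \<noteq> 0" "val (phi ratfun_T u) = real CARD('a) * val u" using assms by (simp_all add: phi_def val_power)
qed

abbreviation a_T where "a_T u i \<equiv> (phi ratfun_T ^^ i) u"

text \<open>As long as the orbit avoids the critical value, one of the terms of u^q + T u dominates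
  and the value drops strictly.\<close>

lemma orbit_decreasing:
  assumes "u \<noteq> 0" "\<And>i'. i' < i ==> val (a_T u i') \<noteq> - slope TYPE('a)"
  shows "a_T u i \<noteq> 0 \<and> (\<forall>i'<i. val (a_T u i) < val (a_T u i'))"
  using assms(2)
proof (induction i)
  case (Suc i)
  hence IH: "a_T u i \<noteq> 0" "\<forall>i'<i. val (a_T u i) < val (a_T u i')" by auto
  have "val (a_T u i) \<noteq> - slope TYPE('a)" using Suc.prems by blast
  hence "phi ratfun_T (a_T u i) \<noteq> 0 \<and> val (phi ratfun_T (a_T u i)) < val (a_T u i)"
  proof (cases "val (a_T u i) > - slope TYPE('a)")
    case False
    hence lt: "val (a_T u i) < - slope TYPE('a)" using \<open>val (a_T u i) \<noteq> - slope TYPE('a)\<close> by simp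
    hence "val (a_T u i) < 0" using slope by simp
    hence "real CARD('a) * val (a_T u i) < 1 * val (a_T u i)" by (intro mult_strict_right_mono_neg) (use card_q in auto)
    thus ?thesis using phi_T_lt[OF IH(1) lt] by simp
  qed (use phi_T_gt[OF IH(1)] in simp)
  thus ?case using IH by (auto simp: less_Suc_eq intro: less_trans)
qed (use assms(1) in simp)

text \<open>If the orbit never met the critical value, its values would decrease strictly and no
  combination could vanish. Before the first hit the values lie above the critical one and drop by
  exactly 1, so \<open>j\<close> is the hitting time.\<close>

lemma torsion_T_val:
  assumes N: "N \<noteq> 0" and u: "u \<in> carlitz_torsion ratfun_T N" "u \<noteq> 0"
  obtains j where "j < degree N" "val u = real j - slope TYPE('a)"
proof -
  define d where "d = degree N"
  have "\<exists>i<d. val (a_T u i) = - slope TYPE('a)"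
  proof (rule ccontr)
    assume no: "\<not> ?thesis"
    have dec: "a_T u i \<noteq> 0" "\<forall>i'<i. val (a_T u i) < val (a_T u i')" if "i \<le> d" for i
      using orbit_decreasing[OF u(2), of i] no that by auto
    define I where "I = {i. i \<le> d \<and> coeff N i \<noteq> 0}"
    have "(\<Sum>i\<in>I. const_emb (coeff N i) * a_T u i) \<noteq> 0"
    proof (rule sum_nonzero)
      show "finite I" "I \<noteq> {}" using N by (auto simp: I_def d_def intro: exI[of _ "degree N"])
      show "const_emb (coeff N i) * a_T u i \<noteq> 0" if "i \<in> I" for i using dec that by (simp add: I_def)
      show "inj_on (\<lambda>i. val (const_emb (coeff N i) * a_T u i)) I"
      proof (rule inj_onI)
        fix i j assume ij: "i \<in> I" "j \<in> I" "val (const_emb (coeff N i) * a_T u i) = val (const_emb (coeff N j) * a_T u j)"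
        hence "val (a_T u i) = val (a_T u j)" using dec by (simp add: I_def val_mult val_const)
        thus "i = j" using dec(2)[of i] dec(2)[of j] ij by (metis (no_types, lifting) I_def less_irrefl linorder_neqE_nat mem_Collect_eq)
      qed
    qed
    moreover have "(\<Sum>i\<in>I. const_emb (coeff N i) * a_T u i) = carlitz_act ratfun_T N u"
      unfolding carlitz_act_phi by (rule sum.mono_neutral_left) (auto simp: I_def d_def)
    ultimately show False using u(1) by (simp add: carlitz_torsion_def)
  qed
  then obtain i0 where i0: "i0 < d" "val (a_T u i0) = - slope TYPE('a)" by blast
  define i where "i = (LEAST i. val (a_T u i) = - slope TYPE('a))"
  have i: "val (a_T u i) = - slope TYPE('a)" unfolding i_def by (rule LeastI[of _ i0]) (rule i0(2))
  have id: "i \<le> i0" unfolding i_def by (rule Least_le) (rule i0(2))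
  have min: "val (a_T u i') \<noteq> - slope TYPE('a)" if "i' < i" for i' using not_less_Least[of i' "\<lambda>i. val (a_T u i) = - slope TYPE('a)"] that by (simp add: i_def)
  have dec: "a_T u i' \<noteq> 0" "i'' < i' ==> val (a_T u i') < val (a_T u i'')" if "i' \<le> i" for i' i''
    using orbit_decreasing[OF u(2), of i'] min that by auto
  have "val (a_T u i') = val u - real i'" if "i' \<le> i" for i'
    using that
  proof (induction i')
    case (Suc i')
    have "val (a_T u i') > - slope TYPE('a)" using dec(2)[of i i'] i Suc.prems by simp
    hence "val (phi ratfun_T (a_T u i')) = val (a_T u i') - 1" using phi_T_gt(2) dec(1)[of i'] Suc.prems by simp
    thus ?case using Suc by simp
  qed simp
  hence "val u = real i - slope TYPE('a)" using i by simp
  thus ?thesis using that[of i] id i0(1) by (simp add: d_def)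
qed

lemma a_T_val:
  assumes "u \<noteq> 0" "val u = real j - slope TYPE('a)" "i \<le> j" shows "a_T u i \<noteq> 0 \<and> val (a_T u i) = real j - real i - slope TYPE('a)"
  using assms(3)
proof (induction i)
  case (Suc i)
  hence "a_T u i \<noteq> 0" "val (a_T u i) = real j - real i - slope TYPE('a)" by auto
  moreover from this have "val (a_T u i) > - slope TYPE('a)" using Suc.prems by simp
  ultimately show ?case using phi_T_gt[of "a_T u i"] by simp
qed (use assms in simp)

text \<open>X^q - X is the product of X - r over r in F_q, and the maximal ideal is prime.\<close>

lemma residue_FFq:
  assumes y: "y \<in> \<O>" "y ^ CARD('a) - y \<in> mx \<O>" shows "\<exists>c. y - const_emb c \<in> mx \<O>"
proof -
  have q: "CARD('a) \<ge> 2" by (rule card_ge_2)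
  have f: "fpoly 1 = smult (lead_coeff (fpoly 1)) (root_poly {x :: 'a rat_closure. poly (fpoly 1) x = 0})"
    by (rule separable_roots(2)) (use fpoly_facts[of 1, where 'a = 'a] in auto)
  have R: "{x :: 'a rat_closure. poly (fpoly 1) x = 0} = FFq" using fpoly_facts(1)[of 1, where 'a = 'a] FF_1[where 'a = 'a] by (auto simp: FF_def)
  have l: "lead_coeff (fpoly 1 :: 'a rat_closure poly) = 1"
    using fpoly_facts(2)[of 1, where 'a = 'a] q by (simp add: fpoly_def coeff_pCons split: nat.split)
  have "poly (fpoly 1) y = (\<Prod>r\<in>FFq. y - r)" by (subst f) (simp add: l[unfolded One_nat_def] R[unfolded One_nat_def] poly_prod)
  hence 1: "(\<Prod>r\<in>FFq. y - r) \<in> mx \<O>" using y(2) fpoly_facts(1)[of 1 y] by simp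
  have 2: "finite S ==> S \<subseteq> FFq ==> (\<Prod>r\<in>S. y - r) \<in> mx \<O> ==> \<exists>r\<in>S. y - r \<in> mx \<O>" for S
  proof (induction S rule: finite_induct)
    case (insert r S)
    have "y - r \<in> \<O>" "(\<Prod>r\<in>S. y - r) \<in> \<O>" using insert.prems(1) FFq_O y(1) by (auto intro!: subrng_prod[OF sO] subrng_diff[OF sO])
    moreover have "(y - r) * (\<Prod>r\<in>S. y - r) \<in> mx \<O>" using insert.prems(2) by (simp only: prod.insert[OF insert.hyps])
    ultimately have "y - r \<in> mx \<O> \<or> (\<Prod>r\<in>S. y - r) \<in> mx \<O>" by (metis m_prime)
    thus ?case
    proof
      assume "(\<Prod>r\<in>S. y - r) \<in> mx \<O>"
      from insert.IH[OF _ this] insert.prems(1) show ?thesis by blast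
    qed blast
  qed (use m_1 in simp)
  obtain r where r: "r \<in> FFq" "y - r \<in> mx \<O>"
    using 2[OF _ order.refl 1] by auto
  then obtain c where "r = const_emb c" by (rule_tac rangeE)
  thus ?thesis using r by (intro exI[of _ c]) simp
qed

lemma ev_T_nz: "N \<noteq> 0 ==> ev ratfun_T N \<noteq> 0"
  by (simp add: ev_T_eq_0)

text \<open>By \<open>phi\<close> one reduces to \<open>j = 0\<close>, where \<open>u\<^bsup>q-1\<^esup> / T\<close> has residue \<open>-1\<close>.\<close>

lemma torsion_graded:
  assumes N: "N \<noteq> 0" and u: "u \<in> carlitz_torsion ratfun_T N" "u \<noteq> 0" "val u = real j - slope TYPE('a)"
    and w: "w \<in> carlitz_torsion ratfun_T N" "w \<noteq> 0" "val w = real j - slope TYPE('a)"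
  shows "\<exists>c. w - const_emb c * u = 0 \<or> val (w - const_emb c * u) > real j - slope TYPE('a)"
proof -
  note tt = T_in ev_T_nz[OF N]
  \<comment> \<open>At the critical value \<open>phi\<close> of the point is 0 or again torsion, so
    its value is at least one more than that of T v. Thus v^(q-1) is - T up to a factor congruent to
    1.\<close>
  have res: "\<exists>z. z \<in> mx \<O> \<and> v ^ CARD('a) = v * ratfun_T * (z - 1)" 
    if v: "v \<in> carlitz_torsion ratfun_T N" "v \<noteq> 0" "val v = - slope TYPE('a)" for v
  proof -
    define z where "z = phi ratfun_T v / (v * ratfun_T)"
    have "v ^ CARD('a) = v * ratfun_T * (z - 1)" using v by (simp add: z_def phi_def field_simps)
    moreover have "z \<in> mx \<O>"
    proof (cases "phi ratfun_T v = 0")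
      case False
      have "phi ratfun_T v \<in> carlitz_torsion ratfun_T N" using torsion_phi_pow[OF tt v(1), of 1] by simp
      then obtain i where "val (phi ratfun_T v) = real i - slope TYPE('a)" using torsion_T_val[OF N _ False] by blast
      hence "val z > 0" using False v val_T by (simp add: z_def val_divide val_mult)
      thus ?thesis using m_val[of z] False v by (simp add: z_def)
    qed (simp add: z_def m_0)
    ultimately show ?thesis by blast
  qed
  define u0 w0 where "u0 = a_T u j" and "w0 = a_T w j"
  have u0: "u0 \<noteq> 0" "val u0 = - slope TYPE('a)" "u0 \<in> carlitz_torsion ratfun_T N"
    using a_T_val[OF u(2,3), of j] torsion_phi_pow[OF tt u(1)] by (auto simp: u0_def)
  have w0: "w0 \<noteq> 0" "val w0 = - slope TYPE('a)" "w0 \<in> carlitz_torsion ratfun_T N"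
    using a_T_val[OF w(2,3), of j] torsion_phi_pow[OF tt w(1)] by (auto simp: w0_def)
  obtain z where z: "z \<in> mx \<O>" "u0 ^ CARD('a) = u0 * ratfun_T * (z - 1)" using res u0 by blast
  obtain z' where z': "z' \<in> mx \<O>" "w0 ^ CARD('a) = w0 * ratfun_T * (z' - 1)" using res w0 by blast
  \<comment> \<open>The quotient is congruent to its q-th power, so its residue lies in F_q and
    provides the constant \<open>c\<close>.\<close>
  define y where "y = w0 / u0"
  have "val y = 0" "y \<noteq> 0" using u0 w0 by (auto simp: y_def val_divide)
  hence yO: "y \<in> \<O>" using O_val by simp
  have i1: "1 - z \<noteq> 0" "inverse (1 - z) \<in> \<O>" using cong1_in[OF subfld_UNIV vO, of "1 - z"] m_uminus[OF z(1)] by auto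
  have "y ^ CARD('a) = (w0 * ratfun_T * (z' - 1)) / (u0 * ratfun_T * (z - 1))" by (simp add: y_def power_divide z z')
  also have "\<dots> = y * ((1 - z') * inverse (1 - z))" using u0 i1
    by (simp add: y_def field_simps)
  finally have yq: "y ^ CARD('a) = y * ((1 - z') * inverse (1 - z))" .
  have "(1 - z') * inverse (1 - z) - 1 = inverse (1 - z) * (z - z')" using i1 by (simp add: field_simps)
  moreover have "y ^ CARD('a) - y = y * ((1 - z') * inverse (1 - z) - 1)" unfolding yq by (simp add: right_diff_distrib)
  ultimately have "y ^ CARD('a) - y = (y * inverse (1 - z)) * (z - z')" by (simp add: mult.assoc)
  moreover have "(y * inverse (1 - z)) * (z - z') \<in> mx \<O>" 
    by (rule m_mult[OF subrng_mult[OF sO yO i1(2)] m_diff[OF z(1) z'(1)]])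
  ultimately obtain c where c: "y - const_emb c \<in> mx \<O>" using residue_FFq[OF yO] by auto
  define x where "x = w - const_emb c * u"
  have xt: "x \<in> carlitz_torsion ratfun_T N" 
    using torsion_add[OF tt w(1) torsion_const[OF tt u(1), of "- c"]] by (simp add: x_def)
  have ax: "a_T x j = w0 - const_emb c * u0" by (simp add: x_def phi_pow_diff phi_pow_const u0_def w0_def)
  have "x = 0 \<or> val x > real j - slope TYPE('a)"
  proof (rule ccontr)
    assume no: "\<not> ?thesis"
    hence x0: "x \<noteq> 0" "val x \<le> real j - slope TYPE('a)" by auto
    have "val x \<ge> real j - slope TYPE('a)"
    proof (cases "c = 0")
      case False
      have cu: "const_emb c * u \<noteq> 0" "val (const_emb c * u) = real j - slope TYPE('a)" using u False by (auto simp: val_mult val_const)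
      have "val (w + (- (const_emb c * u))) \<ge> min (val w) (val (- (const_emb c * u)))"
        by (rule val_add_ge) (use w cu x0 in \<open>auto simp: x_def\<close>)
      thus ?thesis using w cu by (simp add: x_def)
    qed (use w in \<open>simp add: x_def\<close>)
    hence v: "val x = real j - slope TYPE('a)" using x0 by simp
    have a: "a_T x j \<noteq> 0" "val (a_T x j) = - slope TYPE('a)" using a_T_val[OF x0(1) v, of j] by auto
    have "a_T x j = (y - const_emb c) * u0" using u0 by (simp add: ax y_def field_simps)
    moreover from this a have "y - const_emb c \<noteq> 0" by auto
    ultimately have "val (a_T x j) > - slope TYPE('a)" using u0 c m_val[of "y - const_emb c"] by (simp add: val_mult)
    thus False using a by simp
  qed
  thus ?thesis unfolding x_def by blast
qed

text \<open>A torsion point of largest value generates: by \<open>torsion_graded\<close> the pieces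
  of the filtration by value are at most one-dimensional over F_q, and the iterates of
  \<open>lam\<close> represent the levels from J down to 0.\<close>

lemma torsion_T_generator:
  assumes N: "N \<noteq> 0" and d: "degree N > 0"
  obtains lam J where "lam \<in> carlitz_torsion ratfun_T N" "lam \<noteq> 0" "val lam = real J - slope TYPE('a)"
    "\<And>u. u \<in> carlitz_torsion ratfun_T N ==> \<exists>c. u = (\<Sum>i<Suc J. const_emb (c i) * a_T lam i)"
    "\<And>u. u \<in> carlitz_torsion ratfun_T N ==> u \<noteq> 0 ==> val u = val lam ==> \<exists>a. a \<noteq> 0 \<and> u = const_emb a * lam"
proof -
  define \<Lambda> where "\<Lambda> = (carlitz_torsion ratfun_T N :: 'a rat_closure set)"
  note tt = T_in ev_T_nz[OF N]
  have int: "\<exists>j<degree N. val u = real j - slope TYPE('a)" if "u \<in> \<Lambda>" "u \<noteq> 0" for u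
    using torsion_T_val[OF N, of u] that unfolding \<Lambda>_def by blast
  define P where "P = (\<lambda>j. \<exists>u\<in>\<Lambda>. u \<noteq> 0 \<and> val u = real j - slope TYPE('a))"
  have "CARD('a) ^ 1 \<le> card \<Lambda>" unfolding \<Lambda>_def torsion_card[OF tt] using d card_ge_2[where 'a = 'a] by (intro power_increasing) auto
  hence "\<not> \<Lambda> \<subseteq> {0}" using card_mono[of "{0}" \<Lambda>] card_ge_2[where 'a = 'a] by auto
  then obtain u0 where "u0 \<in> \<Lambda>" "u0 \<noteq> 0" by blast
  then obtain j0 where P0: "P j0" using int unfolding P_def by blast
  have bd: "j \<le> degree N" if "P j" for j using that int unfolding P_def by fastforce
  define J where "J = (GREATEST j. P j)"
  have "P J" unfolding J_def by (rule GreatestI_nat[where P = P, OF P0]) (use bd in blast)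
  then obtain lam where l: "lam \<in> \<Lambda>" "lam \<noteq> 0" "val lam = real J - slope TYPE('a)" by (auto simp: P_def)
  have max: "j \<le> J" if "P j" for j unfolding J_def by (rule Greatest_le_nat[where P = P, OF that]) (use bd in blast)
  have sub: "w - const_emb c * u \<in> \<Lambda>" if "w \<in> \<Lambda>" "u \<in> \<Lambda>" for w u c
    using torsion_add[OF tt, of w "const_emb (- c) * u"] torsion_const[OF tt, of u "- c"] that by (simp add: \<Lambda>_def)
  have gr: "\<exists>c. w - const_emb c * u = 0 \<or> val (w - const_emb c * u) \<ge> real (Suc j) - slope TYPE('a)"
    if h: "u \<in> \<Lambda>" "u \<noteq> 0" "val u = real j - slope TYPE('a)" "w \<in> \<Lambda>" "w \<noteq> 0" "val w = real j - slope TYPE('a)" for u w j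
  proof -
    obtain c where c: "w - const_emb c * u = 0 \<or> val (w - const_emb c * u) > real j - slope TYPE('a)"
      using torsion_graded[OF N h[unfolded \<Lambda>_def]] by (rule exE)
    have "val (w - const_emb c * u) \<ge> real (Suc j) - slope TYPE('a)" if nz: "w - const_emb c * u \<noteq> 0"
      using int[OF sub[OF h(4,1)] nz] c nz by auto
    thus ?thesis by blast
  qed
  have zero: "u = 0" if h: "u \<in> \<Lambda>" "u = 0 \<or> val u \<ge> real (Suc J) - slope TYPE('a)" for u
  proof (rule ccontr)
    assume u0: "u \<noteq> 0"
    obtain j where j: "val u = real j - slope TYPE('a)" using int[OF h(1) u0] by blast
    hence "P j" using h(1) u0 unfolding P_def by blast
    thus False using max[of j] h(2) u0 j by simp
  qed
  \<comment> \<open>Induction on the number \<open>k\<close> of top levels. A multiple of the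
    iterate of index \<open>k\<close>, whose value is J - k - 1/(q - 1), is subtracted to reach the
    levels of the induction hypothesis.\<close>
  have gen: "\<exists>c. u = (\<Sum>i<k. const_emb (c i) * a_T lam i)"
    if "k \<le> Suc J" "u \<in> \<Lambda>" "u = 0 \<or> val u + real k \<ge> real (Suc J) - slope TYPE('a)" for k u
    using that
  proof (induction k arbitrary: u)
    case 0
    hence "u = 0 \<or> val u \<ge> real (Suc J) - slope TYPE('a)" by (simp only: of_nat_0 add_0_right)
    from zero[OF 0(2) this] show ?case by simp
  next
    case (Suc k)
    have v: "a_T lam k \<noteq> 0" "val (a_T lam k) = real (J - k) - slope TYPE('a)"
      using a_T_val[OF l(2,3), of k] Suc.prems(1) by auto
    have t: "a_T lam k \<in> \<Lambda>" using torsion_phi_pow[OF tt] l(1) by (simp add: \<Lambda>_def)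
    have "\<exists>c. u - const_emb c * a_T lam k = 0 \<or> val (u - const_emb c * a_T lam k) + real k \<ge> real (Suc J) - slope TYPE('a)"
    proof (cases "u \<noteq> 0 \<and> val u = real (J - k) - slope TYPE('a)")
      case True
      have "real (Suc (J - k)) + real k = real (Suc J)" using Suc.prems(1) by simp
      moreover obtain c where "u - const_emb c * a_T lam k = 0 \<or> val (u - const_emb c * a_T lam k) \<ge> real (Suc (J - k)) - slope TYPE('a)"
        using gr[OF t v Suc.prems(2) conjunct1[OF True] conjunct2[OF True]] by (rule exE)
      ultimately show ?thesis by (intro exI[of _ c]) linarith
    next
      case False
      have "val u + real k \<ge> real (Suc J) - slope TYPE('a)" if u: "u \<noteq> 0"
      proof -
        obtain j where j: "val u = real j - slope TYPE('a)" using int[OF Suc.prems(2) u] by blast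
        hence "j \<noteq> J - k" "J - k \<le> j" using False u Suc.prems(3) by auto
        thus ?thesis using j by simp
      qed
      thus ?thesis by (intro exI[of _ 0]) auto
    qed
    then obtain c where c: "u - const_emb c * a_T lam k = 0 \<or> val (u - const_emb c * a_T lam k) + real k \<ge> real (Suc J) - slope TYPE('a)" by (rule exE)
    obtain c' where c': "u - const_emb c * a_T lam k = (\<Sum>i<k. const_emb (c' i) * a_T lam i)"
      using Suc.IH[OF _ sub[OF Suc.prems(2) t] c] Suc.prems(1) by auto
    have "u = (\<Sum>i<k. const_emb ((c'(k := c)) i) * a_T lam i) + const_emb c * a_T lam k"
      using c' by (simp add: diff_eq_eq)
    thus ?case by (intro exI[of _ "c'(k := c)"]) simp
  qed
  show ?thesis
  proof (rule that[OF l[unfolded \<Lambda>_def]])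
    fix u assume "u \<in> carlitz_torsion ratfun_T N"
    hence u: "u \<in> \<Lambda>" by (simp add: \<Lambda>_def)
    have "u = 0 \<or> val u + real (Suc J) \<ge> real (Suc J) - slope TYPE('a)" using int[OF u] by force
    thus "\<exists>c. u = (\<Sum>i<Suc J. const_emb (c i) * a_T lam i)" by (rule gen[OF order.refl u])
    assume u': "u \<noteq> 0" "val u = val lam"
    obtain a where "u - const_emb a * lam = 0 \<or> val (u - const_emb a * lam) \<ge> real (Suc J) - slope TYPE('a)"
      using gr[OF l u u'(1)] u'(2) l(3) by auto
    from zero[OF sub[OF u l(1)] this] show "\<exists>a. a \<noteq> 0 \<and> u = const_emb a * lam" using u'(1) by (intro exI[of _ a]) auto
  qed
qed

text \<open>The wild part: iterated \<open>phi\<close>-preimages of a root of \<open>u\<^bsup>q-1\<^esup> = - 1/T\<close>.\<close>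

lemma wild_point:
  "\<exists>l. l \<noteq> 0 \<and> val l = slope TYPE('a) / real CARD('a) ^ n \<and> (\<forall>i\<le>n. (phi \<theta> ^^ i) l \<noteq> 0 \<and> val ((phi \<theta> ^^ i) l) = slope TYPE('a) / real CARD('a) ^ (n - i)) \<and> (phi \<theta> ^^ Suc n) l = 0"
proof (induction n)
  case 0
  have q1: "CARD('a) - 1 > 0" using card_ge_2[where 'a = 'a] by simp
  obtain l where l: "l ^ (CARD('a) - 1) = - \<theta>" using nth_root_exists[OF q1, of "- \<theta>"] by auto
  have l0: "l \<noteq> 0"
  proof
    assume "l = 0"
    hence "l ^ (CARD('a) - 1) = 0" using q1 by (simp add: power_0_left)
    hence "\<theta> = 0" using l by (metis neg_equal_0_iff_equal)
    thus False using pi(3) by simp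
  qed
  have "real (CARD('a) - 1) * val l = 1" using val_power[OF l0, of "CARD('a) - 1"] l val_pi by simp
  moreover have "real (CARD('a) - 1) = real CARD('a) - 1" using q1 by simp
  ultimately have "val l = slope TYPE('a)" using card_q by (simp add: slope_def field_simps)
  moreover have "phi \<theta> l = 0"
  proof -
    have "l ^ CARD('a) = l ^ (CARD('a) - 1) * l" using q1 by (metis Suc_diff_1 card_gt_0_iff finite_UNIV_card_ge_0 power_Suc2 finite)
    thus ?thesis by (simp only: phi_def l) simp
  qed
  ultimately show ?case using l0 by (intro exI[of _ l]) simp
next
  case (Suc n)
  then obtain l where l: "l \<noteq> 0" "val l = slope TYPE('a) / real CARD('a) ^ n" 
    "\<And>i. i \<le> n ==> (phi \<theta> ^^ i) l \<noteq> 0 \<and> val ((phi \<theta> ^^ i) l) = slope TYPE('a) / real CARD('a) ^ (n - i)" "(phi \<theta> ^^ Suc n) l = 0" by blast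
  have "degree (ppoly \<theta> 1 + [:- l:]) = degree (ppoly \<theta> 1)"
    by (rule degree_add_eq_left) (use ppoly_degree[of \<theta> 1] card_ge_2[where 'a = 'a] in simp)
  hence "degree (ppoly \<theta> 1 + [:- l:]) > 0" using ppoly_degree[of \<theta> 1] card_ge_2[where 'a = 'a] by simp
  then obtain m where "poly (ppoly \<theta> 1 + [:- l:]) m = 0" using alg_closed_imp_poly_has_root by blast
  hence "poly (ppoly \<theta> 1) m + poly [:- l:] m = 0" by (simp only: poly_add)
  hence m: "phi \<theta> m = l" by (simp only: poly_ppoly) simp
  have m0: "m \<noteq> 0" using m l(1) by auto
  have qn: "real CARD('a) ^ n \<ge> 1" using card_q by (intro one_le_power) simp
  have vl: "val l \<le> slope TYPE('a)" using l(2) slope(1) qn by (simp add: divide_le_eq mult_le_cancel_left1)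
  have vt: "val (\<theta> * m) = 1 + val m" using m0 val_pi by (simp add: val_mult)
  have vq: "val (m ^ CARD('a)) = real CARD('a) * val m" using m0 by (simp add: val_power)
  \<comment> \<open>Otherwise m^q and m/T both have value at least q/(q - 1) = 1 + 1/(q - 1), too
    much for their sum \<open>l\<close>. Below this bound m^q dominates, which determines
    \<open>val m\<close>.\<close>
  have "val m < slope TYPE('a)"
  proof (rule ccontr)
    assume "\<not> val m < slope TYPE('a)"
    hence ge: "val m \<ge> slope TYPE('a)" by simp
    have m1: "real CARD('a) * val m \<ge> real CARD('a) * slope TYPE('a)" using ge card_q by (intro mult_left_mono) auto
    hence "val (m ^ CARD('a)) \<ge> real CARD('a) * slope TYPE('a)" "val (\<theta> * m) \<ge> real CARD('a) * slope TYPE('a)" using vq vt ge slope(2) m1 by (simp, simp add: algebra_simps)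
    hence "val (m ^ CARD('a) + \<theta> * m) \<ge> real CARD('a) * slope TYPE('a)"
      using val_add_ge[of "m ^ CARD('a)" "\<theta> * m"] m m0 l(1) by (simp add: phi_def)
    hence "val l \<ge> real CARD('a) * slope TYPE('a)" using m by (simp add: phi_def)
    moreover have "real CARD('a) * slope TYPE('a) = 1 + slope TYPE('a)" using slope(2) by (simp add: algebra_simps)
    ultimately show False using vl by simp
  qed
  hence "(real CARD('a) - 1) * val m < (real CARD('a) - 1) * slope TYPE('a)" using card_q by (intro mult_strict_left_mono) auto
  hence "val (m ^ CARD('a)) < val (\<theta> * m)" using vq vt slope(2) by (simp add: algebra_simps)
  hence "val (m ^ CARD('a) + \<theta> * m) = real CARD('a) * val m" using val_add_lt(2)[of "m ^ CARD('a)" "\<theta> * m"] m0 vq by simp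
  hence "real CARD('a) * val m = slope TYPE('a) / real CARD('a) ^ n" using m l(2) by (simp add: phi_def)
  hence vm: "val m = slope TYPE('a) / real CARD('a) ^ Suc n" using card_q by (simp add: field_simps)
  have "(phi \<theta> ^^ i) m \<noteq> 0 \<and> val ((phi \<theta> ^^ i) m) = slope TYPE('a) / real CARD('a) ^ (Suc n - i)" if i: "i \<le> Suc n" for i
  proof (cases i)
    case (Suc i')
    hence "(phi \<theta> ^^ i) m = (phi \<theta> ^^ i') l" using m by (simp add: funpow_Suc_right del: funpow.simps)
    thus ?thesis using l(3)[of i'] Suc i by simp
  qed (use m0 vm in simp)
  moreover have "(phi \<theta> ^^ Suc (Suc n)) m = 0" using l(4) m by (simp add: funpow_Suc_right del: funpow.simps)
  ultimately show ?case using m0 vm by (intro exI[of _ m]) blast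
qed

end

section \<open>Automorphisms of subfields and automorphisms of the closure\<close>

lemma field_auts_Dec:
  assumes A: "subfld A" and B: "subfld B" "\<kk> \<subseteq> B" "B \<subseteq> A" and s: "\<sigma> \<in> field_auts A B"
  obtains \<tau> where "\<tau> \<in> Dec B A" "\<And>x. x \<in> A ==> \<tau> x = \<sigma> x"
proof -
  have h: "\<sigma> \<in> ring_hom (\<Omega>\<lparr>carrier := A\<rparr>) (\<Omega>\<lparr>carrier := A\<rparr>)" and b: "bij_betw \<sigma> A A" and fx: "\<And>x. x \<in> B ==> \<sigma> x = x"
    using s by (auto simp: field_auts_def ring_iso_def)
  have add: "\<sigma> (x + y) = \<sigma> x + \<sigma> y" and mult: "\<sigma> (x * y) = \<sigma> x * \<sigma> y" if "x \<in> A" "y \<in> A" for x y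
    using ring_hom_add[OF h, of x y] ring_hom_mult[OF h, of x y] that by simp_all
  have "fhom A \<sigma>" unfolding fhom_def
  proof (intro conjI ballI)
    show "\<sigma> 1 = 1" using ring_hom_one[OF h] by simp
    fix x y assume xy: "x \<in> A" "y \<in> A"
    show "\<sigma> (x - y) = \<sigma> x - \<sigma> y" using add[OF subfld_diff[OF A xy] xy(2)] by (simp add: eq_diff_eq)
  qed (rule mult)
  then obtain \<tau> where t: "\<tau> \<in> Aut B" "\<And>x. x \<in> A ==> \<tau> x = \<sigma> x"
    using Aut_extends[OF algcl_mono[OF algcl_ratfun B(1,2)] A B(3)] fx by blast
  have "\<tau> ` A = \<sigma> ` A" by (rule image_cong[OF refl t(2)])
  hence "\<tau> ` A = A" using bij_betw_imp_surj_on[OF b] by simp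
  thus ?thesis using that[of \<tau>] t by (simp add: Dec_def)
qed

lemma Dec_field_auts:
  assumes A: "subfld A" and s: "\<sigma> \<in> Dec B A" shows "\<sigma> \<in> field_auts A B"
proof -
  have s': "\<sigma> \<in> Aut B" "\<sigma> ` A = A" using s by (auto simp: Dec_def)
  have h: "fhom UNIV \<sigma>" by (rule Aut_fhom[OF s'(1)])
  have "\<sigma> \<in> ring_hom (\<Omega>\<lparr>carrier := A\<rparr>) (\<Omega>\<lparr>carrier := A\<rparr>)"
    by (rule ring_hom_memI) (use s'(2) hom_mult[OF h] hom_add[OF h] hom_1[OF h] in auto)
  moreover have "bij_betw \<sigma> A A" unfolding bij_betw_def using s'(2) inj_on_subset[OF bij_is_inj[OF Aut_bij[OF s'(1)]]] by blast
  ultimately show ?thesis using Aut_fix[OF s'(1)] by (simp add: field_auts_def ring_iso_def)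
qed

text \<open>Each element of \<open>A\<close> has an orbit under \<open>Dec B A\<close> that stays in
  \<open>A\<close> and whose polynomial is over \<open>B\<close>; this yields separability and
  normality from a definition that speaks only of automorphisms of \<open>A\<close>.\<close>

lemma finite_abelian_Gal:
  assumes f: "finite_abelian_ext A B" and kB: "\<kk> \<subseteq> B"
  shows "subfld A" "subfld B" "Gal B A" "finite (Rst (Aut B) A)"
    "\<sigma> \<in> Aut B ==> \<tau> \<in> Aut B ==> x \<in> A ==> \<sigma> (\<tau> x) = \<tau> (\<sigma> x)"
proof -
  show A: "subfld A" and B: "subfld B" using f by (auto simp: finite_abelian_ext_def subfield_iff_subfld)
  have BA: "B \<subseteq> A" using f by (simp add: finite_abelian_ext_def)
  have aB: "algcl B" by (rule algcl_mono[OF algcl_ratfun B kB])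
  have fx: "x \<in> B" if x: "x \<in> A" "\<And>\<sigma>. \<sigma> \<in> Dec B A ==> \<sigma> x = x" for x
  proof -
    have "\<sigma> x = x" if "\<sigma> \<in> field_auts A B" for \<sigma>
      using field_auts_Dec[OF A B kB BA that] x by metis
    thus ?thesis using f x(1) unfolding finite_abelian_ext_def by blast
  qed
  have orb: "finite ((\<lambda>\<sigma>. \<sigma> x) ` Dec B A) \<and> (\<lambda>\<sigma>. \<sigma> x) ` Dec B A \<subseteq> A \<and> x \<in> (\<lambda>\<sigma>. \<sigma> x) ` Dec B A \<and> pover B (root_poly ((\<lambda>\<sigma>. \<sigma> x) ` Dec B A))" if x: "x \<in> A" for x
  proof -
    define R where "R = (\<lambda>\<sigma>. \<sigma> x) ` Dec B A"
    have "Dec B A \<subseteq> Aut B" using Dec_Aut by blast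
    note o = orbit_poly[OF aB autgrp_Dec this, where x = x, folded R_def]
    have RA: "R \<subseteq> A" using x by (auto simp: R_def Dec_def)
    have "pover B (root_poly R)" unfolding pover_def
      using pover_coeff[OF A RA] by (intro allI fx o(3)) (auto simp: pover_def)
    thus ?thesis using o(1,2) RA unfolding R_def by blast
  qed
  show G: "Gal B A" unfolding Gal_def
  proof (intro conjI A BA subsetI ballI)
    show "x \<in> Sep B" if "x \<in> A" for x using orb[OF that] unfolding Sep_def by blast
    fix \<sigma> y assume s: "\<sigma> \<in> Aut B" and "y \<in> \<sigma> ` A"
    then obtain x where x: "x \<in> A" "y = \<sigma> x" by blast
    define R where "R = (\<lambda>\<sigma>. \<sigma> x) ` Dec B A"
    have R: "finite R" "R \<subseteq> A" "x \<in> R" "pover B (root_poly R)" using orb[OF x(1)] unfolding R_def by auto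
    have "poly (root_poly R) x = 0" using poly_root_poly[OF R(1)] R(3) by simp
    hence "\<sigma> (poly (root_poly R) x) = 0" using hom_0[OF Aut_fhom[OF s]] by simp
    moreover have "map_poly \<sigma> (root_poly R) = root_poly R"
      by (rule fhom_map_id[OF B fhom_subset[OF Aut_fhom[OF s]] R(4) Aut_fix[OF s]]) auto
    ultimately have "poly (root_poly R) (\<sigma> x) = 0"
      using hom_poly[OF Aut_fhom[OF s], of "root_poly R" x] by (simp add: pover_def)
    thus "y \<in> A" using poly_root_poly[OF R(1)] R(2) x by auto
  qed
  obtain n where n: "dimn n B A" using f by (auto simp: finite_abelian_ext_def ring.finite_dimension_def[OF ring_Om])
  obtain b where b: "indep B {..<n} b" "A = {\<Sum>i<n. c i * b i | c. \<forall>i<n. c i \<in> B}" using dimn_basis[OF n B] by blast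
  have "A \<subseteq> gen (B \<union> b ` {..<n})"
  proof
    fix y assume "y \<in> A"
    then obtain c where c: "\<forall>i<n. c i \<in> B" "y = (\<Sum>i<n. c i * b i)" using b(2) by blast
    show "y \<in> gen (B \<union> b ` {..<n})" unfolding c(2)
      by (intro subfld_sum[OF subfld_gen] subfld_mult[OF subfld_gen]) (use c(1) gen_incl[of "B \<union> b ` {..<n}"] in auto)
  qed
  thus "finite (Rst (Aut B) A)" using finite_Rst_subset[OF finite_Rst_gen[OF aB]] by blast
  assume s: "\<sigma> \<in> Aut B" "\<tau> \<in> Aut B" and x: "x \<in> A"
  have "\<sigma> \<in> field_auts A B" "\<tau> \<in> field_auts A B" using s Gal_image[OF G] by (auto intro!: Dec_field_auts[OF A] simp: Dec_def)
  thus "\<sigma> (\<tau> x) = \<tau> (\<sigma> x)" using f x unfolding finite_abelian_ext_def by blast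
qed

text \<open>The converse translation; it lets the genus field results apply to E.\<close>

lemma finite_abelian_extI:
  assumes B: "subfld B" "\<kk> \<subseteq> B" and G: "Gal B A" and fin: "finite (Rst (Aut B) A)"
    and ab: "\<And>\<sigma> \<tau> x. \<sigma> \<in> Aut B ==> \<tau> \<in> Aut B ==> x \<in> A ==> \<sigma> (\<tau> x) = \<tau> (\<sigma> x)"
  shows "finite_abelian_ext A B"
proof -
  have aB: "algcl B" by (rule algcl_mono[OF algcl_ratfun B])
  have A: "subfld A" "B \<subseteq> A" using Gal_D[OF G] by auto
  have "dimn (card (Rst (Aut B) A)) (fixed_in (Aut B) A) A"
    by (rule artin[OF autgrp_Aut A(1) _ fin]) (simp add: Gal_image[OF G])
  hence "ring.finite_dimension \<Omega> B A" unfolding fixed_in_Gal[OF aB G] ring.finite_dimension_def[OF ring_Om] by blast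
  moreover have "{x \<in> A. \<forall>\<sigma>\<in>field_auts A B. \<sigma> x = x} = B"
  proof
    show "{x \<in> A. \<forall>\<sigma>\<in>field_auts A B. \<sigma> x = x} \<subseteq> B"
      using Gal_fixed[OF aB G order.refl B(1)] Dec_field_auts[OF A(1)] Gal_image[OF G] by (auto simp: Dec_def)
  qed (use A(2) in \<open>auto simp: field_auts_def\<close>)
  moreover have "\<sigma> (\<tau> x) = \<tau> (\<sigma> x)" if s: "\<sigma> \<in> field_auts A B" "\<tau> \<in> field_auts A B" and x: "x \<in> A" for \<sigma> \<tau> x
  proof -
    obtain \<sigma>' where s': "\<sigma>' \<in> Dec B A" "\<And>x. x \<in> A ==> \<sigma>' x = \<sigma> x" using field_auts_Dec[OF A(1) B A(2) s(1)] by blast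
    obtain \<tau>' where t': "\<tau>' \<in> Dec B A" "\<And>x. x \<in> A ==> \<tau>' x = \<tau> x" using field_auts_Dec[OF A(1) B A(2) s(2)] by blast
    have "\<sigma>' x \<in> A" "\<tau>' x \<in> A" using s'(1) t'(1) x by (auto simp: Dec_def)
    thus ?thesis using ab[OF Dec_Aut[OF s'(1)] Dec_Aut[OF t'(1)] x] s'(2) t'(2) x by simp
  qed
  ultimately show ?thesis using A B by (simp add: finite_abelian_ext_def subfield_iff_subfld)
qed

section \<open>The wild field \<open>\<L> n\<close> and its degree\<close>

abbreviation wild_torsion :: "nat \<Rightarrow> 'a::{finite,field} rat_closure set" where
  "wild_torsion n \<equiv> carlitz_torsion (inverse ratfun_T) (monom 1 (n + 1))"

abbreviation wild_cyclotomic :: "nat \<Rightarrow> 'a::{finite,field} rat_closure set" where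
  "wild_cyclotomic n \<equiv> cyclotomic_field (inverse ratfun_T) (monom 1 (n + 1))"

lemma inv_T_in: "inverse ratfun_T \<in> \<kk>"
  by (rule subfld_inverse[OF subfld_ratfun T_in])

lemma ev_inv_T_monom: "ev (inverse ratfun_T) (monom 1 n) \<noteq> 0"
  by simp

text \<open>The group of scalars that defines \<open>\<L> n\<close>, inflated to automorphisms of
  the closure.\<close>

definition scal :: "nat \<Rightarrow> ('a::{finite,field} rat_closure \<Rightarrow> 'a rat_closure) set" where
  "scal n = {\<sigma> \<in> Aut \<kk>. \<exists>a. a \<noteq> 0 \<and> (\<forall>u\<in>wild_torsion n. \<sigma> u = const_emb a * u)}"

lemma scal_Aut: "scal n \<subseteq> Aut \<kk>"
  by (auto simp: scal_def)

lemma wild_torsion_const: "u \<in> wild_torsion n ==> const_emb a * u \<in> wild_torsion n"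
  by (rule torsion_const[OF inv_T_in ev_inv_T_monom])

lemma wild_torsion_Aut: "\<sigma> \<in> Aut \<kk> ==> u \<in> wild_torsion n ==> \<sigma> u \<in> wild_torsion n"
  by (rule torsion_Aut[OF inv_T_in ev_inv_T_monom])

lemmas Gal_wild_cyclotomic = Gal_cyclotomic[OF inv_T_in ev_inv_T_monom]
lemmas finite_Rst_wild_cyclotomic = finite_Rst_cyclotomic[OF inv_T_in ev_inv_T_monom]

lemma wild_field_fixed: "\<L> n = fixed_in (scal n) (wild_cyclotomic n)"
proof -
  note G = Gal_wild_cyclotomic[of "n + 1", where 'a = 'a] and C = Gal_D[OF Gal_wild_cyclotomic[of "n + 1", where 'a = 'a]]
  have t: "wild_torsion n \<subseteq> (wild_cyclotomic n :: 'a rat_closure set)"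
    unfolding cyclotomic_gen[OF inv_T_in ev_inv_T_monom] using gen_incl by blast
  have "(\<forall>\<sigma>\<in>field_auts (wild_cyclotomic n) \<kk>. (\<exists>a. a \<noteq> 0 \<and> (\<forall>u\<in>wild_torsion n. \<sigma> u = const_emb a * u)) \<longrightarrow> \<sigma> x = x)
    \<longleftrightarrow> (\<forall>\<sigma>\<in>scal n. \<sigma> x = x)" (is "?L = ?R") if x: "x \<in> wild_cyclotomic n" for x :: "'a rat_closure"
  proof
    assume ?L thus ?R using Dec_field_auts[OF C(1)] Gal_image[OF G] by (auto simp: scal_def Dec_def)
  next
    assume R: ?R
    show ?L
    proof (intro ballI impI)
      fix \<sigma> :: "'a rat_closure \<Rightarrow> 'a rat_closure"
      assume s: "\<sigma> \<in> field_auts (wild_cyclotomic n) \<kk>" and "\<exists>a. a \<noteq> 0 \<and> (\<forall>u\<in>wild_torsion n. \<sigma> u = const_emb a * u)"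
      then obtain a where a: "a \<noteq> 0" "\<And>u. u \<in> wild_torsion n ==> \<sigma> u = const_emb a * u" by blast
      obtain \<tau> where tau: "\<tau> \<in> Dec \<kk> (wild_cyclotomic n)" "\<And>x. x \<in> wild_cyclotomic n ==> \<tau> x = \<sigma> x"
        using field_auts_Dec[OF C(1) subfld_ratfun order.refl C(2) s] by blast
      have "\<tau> u = const_emb a * u" if "u \<in> wild_torsion n" for u using a(2)[OF that] tau(2) t that by auto
      hence "\<tau> \<in> scal n" using a(1) Dec_Aut[OF tau(1)] by (auto simp: scal_def)
      from bspec[OF R this] show "\<sigma> x = x" using tau(2)[OF x] by simp
    qed
  qed
  thus ?thesis unfolding wild_field_def Let_def fixed_in_def by blast
qed

text \<open>Conjugating a scalar action on the torsion by an automorphism over k gives the same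
  scalar; so \<open>scal n\<close> is normalised by \<open>Aut \<kk>\<close> and its fixed field is
  stable.\<close>

lemma Gal_wild: "Gal \<kk> (\<L> n :: 'a::{finite,field} rat_closure set)"
proof -
  note G = Gal_wild_cyclotomic[of "n + 1", where 'a = 'a] and C = Gal_D[OF Gal_wild_cyclotomic[of "n + 1", where 'a = 'a]]
  have sub: "\<L> n \<subseteq> (wild_cyclotomic n :: 'a rat_closure set)" by (auto simp: wild_field_fixed fixed_in_def)
  show ?thesis unfolding Gal_def
  proof (intro conjI ballI subsetI)
    show "subfld (\<L> n :: 'a rat_closure set)" unfolding wild_field_fixed
      by (rule subfld_fixed_in[OF Aut_fhom[OF subsetD[OF scal_Aut]] C(1)])
    show "x \<in> \<L> n" if "x \<in> \<kk>" for x :: "'a rat_closure"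
      using that C(2) scal_Aut[of n] by (auto simp: wild_field_fixed fixed_in_def intro: Aut_fix)
    show "x \<in> Sep \<kk>" if "x \<in> \<L> n" for x :: "'a rat_closure" using that sub C(3) by blast
    fix \<tau> and y :: "'a rat_closure" assume t: "\<tau> \<in> Aut \<kk>" and "y \<in> \<tau> ` \<L> n"
    then obtain x where x: "x \<in> \<L> n" "y = \<tau> x" by blast
    have "\<sigma> (\<tau> x) = \<tau> x" if s: "\<sigma> \<in> scal n" for \<sigma>
    proof -
      obtain a where a: "a \<noteq> 0" "\<And>u. u \<in> wild_torsion n ==> \<sigma> u = const_emb a * u" using s by (auto simp: scal_def)
      define \<rho> where "\<rho> = finv \<tau> \<circ> (\<sigma> \<circ> \<tau>)"
      have rA: "\<rho> \<in> Aut \<kk>" unfolding \<rho>_def using t s scal_Aut[of n] by (intro autgrpD(3,5)[OF autgrp_Aut]) auto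
      have tr: "\<tau> (\<rho> z) = \<sigma> (\<tau> z)" for z by (simp add: \<rho>_def bij_inv_simps(1)[OF Aut_bij[OF t]])
      have "\<rho> u = const_emb a * u" if u: "u \<in> wild_torsion n" for u
      proof -
        have "\<tau> (\<rho> u) = \<tau> (const_emb a * u)" unfolding tr
          by (simp add: a(2)[OF wild_torsion_Aut[OF t u]] hom_mult[OF Aut_fhom[OF t]] const_Aut[OF t])
        thus ?thesis using bij_is_inj[OF Aut_bij[OF t]] by (simp add: inj_eq)
      qed
      hence "\<rho> \<in> scal n" using a(1) rA by (auto simp: scal_def)
      hence "\<rho> x = x" using x(1) by (simp add: wild_field_fixed fixed_in_def)
      thus ?thesis using tr[of x] by simp
    qed
    thus "y \<in> \<L> n" using x sub Gal_mem[OF G t] by (auto simp: wild_field_fixed fixed_in_def)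
  qed
qed

lemma finite_Rst_wild: "finite (Rst (Aut \<kk>) (\<L> n :: 'a::{finite,field} rat_closure set))"
  by (rule finite_Rst_subset[OF finite_Rst_wild_cyclotomic]) (auto simp: wild_field_fixed fixed_in_def)

lemma wild_mono:
  assumes "n \<le> n'" shows "\<L> n \<subseteq> (\<L> n' :: 'a::{finite,field} rat_closure set)"
proof -
  have "(monom 1 (n + 1) :: 'a poly) dvd monom 1 (n' + 1)"
    by (rule dvdI[of _ _ "monom 1 (n' - n)"]) (use assms in \<open>simp add: mult_monom\<close>)
  hence t: "wild_torsion n \<subseteq> (wild_torsion n' :: 'a rat_closure set)" by (rule torsion_dvd)
  hence "scal n' \<subseteq> (scal n :: ('a rat_closure \<Rightarrow> 'a rat_closure) set)" unfolding scal_def by blast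
  moreover have "wild_cyclotomic n \<subseteq> (wild_cyclotomic n' :: 'a rat_closure set)"
    unfolding cyclotomic_gen[OF inv_T_in ev_inv_T_monom] using t by (intro gen_mono) auto
  ultimately show ?thesis by (auto simp: wild_field_fixed fixed_in_def)
qed

context inf_place
begin

lemma wild_generator:
  obtains lam where "lam \<in> wild_torsion n" "lam \<noteq> 0" "val lam = slope TYPE('a) / real CARD('a) ^ n" "(phi \<theta> ^^ n) lam \<noteq> 0"
    "\<And>u. u \<in> wild_torsion n ==> \<exists>c. u = (\<Sum>i<n + 1. const_emb (c i) * (phi \<theta> ^^ i) lam)"
proof -
  obtain l where l: "l \<noteq> 0" "val l = slope TYPE('a) / real CARD('a) ^ n"
    "\<And>i. i \<le> n ==> (phi \<theta> ^^ i) l \<noteq> 0 \<and> val ((phi \<theta> ^^ i) l) = slope TYPE('a) / real CARD('a) ^ (n - i)" "(phi \<theta> ^^ Suc n) l = 0"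
    using wild_point[of n] by blast
  have lt: "l \<in> wild_torsion n" using l(4) by (simp add: carlitz_torsion_def act_monom)
  have dg: "degree (monom (1 :: 'a) (n + 1)) = n + 1" by (simp add: degree_monom_eq)
  have inj: "inj_on (\<lambda>i. val ((phi \<theta> ^^ i) l)) {..<n + 1}"
  proof (rule inj_onI)
    fix i j assume ij: "i \<in> {..<n + 1}" "j \<in> {..<n + 1}" "val ((phi \<theta> ^^ i) l) = val ((phi \<theta> ^^ j) l)"
    hence "slope TYPE('a) / real CARD('a) ^ (n - i) = slope TYPE('a) / real CARD('a) ^ (n - j)" using l(3)[of i] l(3)[of j] by simp
    hence "real CARD('a) ^ (n - i) = real CARD('a) ^ (n - j)" using slope(1) card_q by (simp add: field_simps)
    hence "n - i = n - j" using card_q by (subst (asm) power_inject_exp) auto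
    thus "i = j" using ij by simp
  qed
  have "\<exists>c. u = (\<Sum>i<n + 1. const_emb (c i) * (phi \<theta> ^^ i) l)" if u: "u \<in> wild_torsion n" for u
    using torsion_generator[OF inv_T_in ev_inv_T_monom lt _ _ u, unfolded dg] l(3) inj by (metis less_Suc_eq_le Suc_eq_plus1)
  thus ?thesis using that[of l] lt l by simp
qed

text \<open>The (q - 1)-th power of a torsion generator \<open>lam\<close> is invariant under
  scalars. Automorphisms that agree on it differ on \<open>lam\<close> by a (q - 1)-th root of
  unity, i.e. by a scalar, so they agree on \<open>\<L> n\<close>. The last clause serves to bound
  its orbit.\<close>

lemma wild_uniformizer:
  obtains \<beta> where "\<beta> \<in> \<L> n" "\<beta> \<noteq> 0" "val \<beta> = 1 / real CARD('a) ^ n"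
    "\<And>\<sigma> \<tau> x. \<sigma> \<in> Aut \<kk> ==> \<tau> \<in> Aut \<kk> ==> \<sigma> \<beta> = \<tau> \<beta> ==> x \<in> (\<L> n :: 'a rat_closure set) ==> \<sigma> x = \<tau> x"
    "(\<lambda>\<sigma>. \<sigma> \<beta>) ` Aut \<kk> \<subseteq> (\<lambda>u. u ^ (CARD('a) - 1)) ` {u \<in> wild_torsion n. (phi \<theta> ^^ n) u \<noteq> 0}"
proof -
  obtain lam where lam: "lam \<in> wild_torsion n" "lam \<noteq> 0" "val lam = slope TYPE('a) / real CARD('a) ^ n" "(phi \<theta> ^^ n) lam \<noteq> 0"
    and g: "\<And>u. u \<in> wild_torsion n ==> \<exists>c. u = (\<Sum>i<n + 1. const_emb (c i) * (phi \<theta> ^^ i) lam)" using wild_generator[of n] by blast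
  have q1: "CARD('a) - 1 > 0" "Suc (CARD('a) - 1) = CARD('a)" using card_ge_2[where 'a = 'a] by auto
  define \<beta> where "\<beta> = lam ^ (CARD('a) - 1)"
  have bp: "\<sigma> \<beta> = \<sigma> lam ^ (CARD('a) - 1)" if "\<sigma> \<in> Aut \<kk>" for \<sigma>
    unfolding \<beta>_def by (rule hom_power[OF Aut_fhom[OF that]]) simp
  show ?thesis
  proof (rule that[of \<beta>])
    have "lam \<in> wild_cyclotomic n" using lam(1) gen_incl unfolding cyclotomic_gen[OF inv_T_in ev_inv_T_monom] by blast
    hence "\<beta> \<in> wild_cyclotomic n" unfolding \<beta>_def by (rule subfld_power[OF Gal_D(1)[OF Gal_wild_cyclotomic]])
    moreover have "\<sigma> \<beta> = \<beta>" if "\<sigma> \<in> scal n" for \<sigma>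
    proof -
      obtain a where a: "a \<noteq> 0" "\<And>u. u \<in> wild_torsion n ==> \<sigma> u = const_emb a * u" using \<open>\<sigma> \<in> scal n\<close> by (auto simp: scal_def)
      have "\<sigma> \<beta> = (const_emb a * lam) ^ (CARD('a) - 1)" using bp[of \<sigma>] scal_Aut[of n] \<open>\<sigma> \<in> scal n\<close> a(2)[OF lam(1)] by auto
      also have "\<dots> = \<beta>" by (simp add: power_mult_distrib \<beta>_def const_emb_pow[OF a(1)])
      finally show ?thesis .
    qed
    ultimately show "\<beta> \<in> \<L> n" by (simp add: wild_field_fixed fixed_in_def)
    show "\<beta> \<noteq> 0" using lam(2) by (simp add: \<beta>_def)
    have "real (CARD('a) - 1) = real CARD('a) - 1" using q1 by simp
    moreover have "val \<beta> = real (CARD('a) - 1) * (slope TYPE('a) / real CARD('a) ^ n)" unfolding \<beta>_def by (simp only: val_power[OF lam(2)] lam(3))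
    ultimately have "val \<beta> = (slope TYPE('a) * (real CARD('a) - 1)) / real CARD('a) ^ n" by simp
    thus "val \<beta> = 1 / real CARD('a) ^ n" unfolding slope(2) .
    fix \<sigma> \<tau> x assume s: "\<sigma> \<in> Aut \<kk>" "\<tau> \<in> Aut \<kk>" and eq: "\<sigma> \<beta> = \<tau> \<beta>" and x: "x \<in> (\<L> n :: 'a rat_closure set)"
    have t0: "\<tau> lam \<noteq> 0" by (rule hom_nonzero[OF Aut_fhom[OF s(2)] UNIV_I lam(2)])
    define r where "r = \<sigma> lam / \<tau> lam"
    have "r ^ (CARD('a) - 1) = 1" using eq bp[OF s(1)] bp[OF s(2)] t0 by (simp add: r_def power_divide)
    hence "r ^ CARD('a) = r" using power_Suc[of r "CARD('a) - 1"] q1(2) by simp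
    hence "r \<in> FFq" unfolding FF_1[symmetric] FF_def by simp
    then obtain a where a: "r = const_emb a" by blast
    have sl: "\<sigma> lam = const_emb a * \<tau> lam" using t0 a by (simp add: r_def field_simps)
    have "\<sigma> lam \<noteq> 0" by (rule hom_nonzero[OF Aut_fhom[OF s(1)] UNIV_I lam(2)])
    hence a0: "a \<noteq> 0" using sl by auto
    define \<rho> where "\<rho> = finv \<tau> \<circ> \<sigma>"
    have rA: "\<rho> \<in> Aut \<kk>" unfolding \<rho>_def using s by (intro autgrpD(3,5)[OF autgrp_Aut]) auto
    have tr: "\<tau> (\<rho> z) = \<sigma> z" for z by (simp add: \<rho>_def bij_inv_simps(1)[OF Aut_bij[OF s(2)]])
    have "\<tau> (\<rho> lam) = \<tau> (const_emb a * lam)" unfolding tr sl by (simp add: hom_mult[OF Aut_fhom[OF s(2)]] const_Aut[OF s(2)])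
    hence rl: "\<rho> lam = const_emb a * lam" using bij_is_inj[OF Aut_bij[OF s(2)]] by (simp add: inj_eq)
    have "\<rho> u = const_emb a * u" if "u \<in> wild_torsion n" for u
    proof -
      obtain c where c: "u = (\<Sum>i<n + 1. const_emb (c i) * (phi \<theta> ^^ i) lam)" using g[OF \<open>u \<in> wild_torsion n\<close>] by blast
      have "\<rho> u = (\<Sum>i<n + 1. \<rho> (const_emb (c i) * (phi \<theta> ^^ i) lam))" unfolding c
        by (rule hom_sum[OF Aut_fhom[OF rA]]) simp
      also have "\<dots> = (\<Sum>i<n + 1. const_emb a * (const_emb (c i) * (phi \<theta> ^^ i) lam))"
        by (rule sum.cong) (simp_all add: hom_mult[OF Aut_fhom[OF rA]] const_Aut[OF rA] phi_pow_Aut[OF rA inv_T_in] rl phi_pow_const)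
      finally show ?thesis unfolding c by (simp only: sum_distrib_left)
    qed
    hence "\<rho> \<in> scal n" using a0 rA by (auto simp: scal_def)
    hence "\<rho> x = x" using x by (simp add: wild_field_fixed fixed_in_def)
    thus "\<sigma> x = \<tau> x" using tr[of x] by simp
  next
    show "(\<lambda>\<sigma>. \<sigma> \<beta>) ` Aut \<kk> \<subseteq> (\<lambda>u. u ^ (CARD('a) - 1)) ` {u \<in> wild_torsion n. (phi \<theta> ^^ n) u \<noteq> 0}"
    proof (rule image_subsetI)
      fix \<sigma> :: "'a rat_closure \<Rightarrow> 'a rat_closure" assume s: "\<sigma> \<in> Aut \<kk>"
      have "\<sigma> ((phi \<theta> ^^ n) lam) \<noteq> 0" by (rule hom_nonzero[OF Aut_fhom[OF s] UNIV_I lam(4)])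
      hence "(phi \<theta> ^^ n) (\<sigma> lam) \<noteq> 0" by (simp add: phi_pow_Aut[OF s inv_T_in])
      thus "\<sigma> \<beta> \<in> (\<lambda>u. u ^ (CARD('a) - 1)) ` {u \<in> wild_torsion n. (phi \<theta> ^^ n) u \<noteq> 0}"
        using wild_torsion_Aut[OF s lam(1)] by (intro image_eqI[where x = "\<sigma> lam"]) (auto simp: bp[OF s])
    qed
  qed
qed

text \<open>There are q^(n+1) - q^n points not killed by the n-th iterate, and the (q - 1)-th power
  is constant on the q - 1 nonzero constant multiples of each.\<close>

lemma card_scalar_classes: "card ((\<lambda>u. u ^ (CARD('a) - 1)) ` {u \<in> wild_torsion n. (phi \<theta> ^^ n) u \<noteq> 0}) \<le> CARD('a) ^ n"
proof -
  define P where "P = {u \<in> wild_torsion n. (phi \<theta> ^^ n) u \<noteq> 0}"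
  define g where "g = (\<lambda>u :: 'a rat_closure. u ^ (CARD('a) - 1))"
  have fT: "finite (wild_torsion n :: 'a rat_closure set)" by (rule torsion_finite[OF inv_T_in ev_inv_T_monom])
  have fin: "finite P" unfolding P_def using fT by simp
  have q2: "CARD('a) \<ge> 2" by (rule card_ge_2)
  have sub: "carlitz_torsion \<theta> (monom 1 n) \<subseteq> wild_torsion n" by (auto simp: carlitz_torsion_def act_monom)
  have "P = wild_torsion n - carlitz_torsion \<theta> (monom 1 n)" by (auto simp: P_def carlitz_torsion_def act_monom)
  hence "card P = card (wild_torsion n :: 'a rat_closure set) - card (carlitz_torsion \<theta> (monom 1 n))"
    using card_Diff_subset[OF finite_subset[OF sub fT] sub] by simp
  also have "\<dots> = CARD('a) ^ (n + 1) - CARD('a) ^ n" using torsion_card[OF inv_T_in ev_inv_T_monom, where 'a = 'a] by (simp add: degree_monom_eq)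
  also have "\<dots> = (CARD('a) - 1) * CARD('a) ^ n" by (simp add: diff_mult_distrib)
  finally have cP: "card P = (CARD('a) - 1) * CARD('a) ^ n" .
  have fib: "CARD('a) - 1 \<le> card {v. v \<in> P \<and> g v = y}" if y: "y \<in> g ` P" for y
  proof -
    obtain u where u: "u \<in> P" "y = g u" using y by blast
    have u0: "u \<noteq> 0" using u(1) by (auto simp: P_def)
    have "(\<lambda>a. const_emb a * u) ` (UNIV - {0}) \<subseteq> {v. v \<in> P \<and> g v = y}"
    proof (rule image_subsetI)
      fix a :: 'a assume "a \<in> UNIV - {0}"
      hence a: "a \<noteq> 0" by simp
      hence "g (const_emb a * u) = g u" by (simp add: g_def power_mult_distrib const_emb_pow)
      thus "const_emb a * u \<in> {v. v \<in> P \<and> g v = y}" using u a wild_torsion_const[of u n a] by (simp add: P_def phi_pow_const)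
    qed
    hence "card ((\<lambda>a. const_emb a * u) ` (UNIV - {0})) \<le> card {v. v \<in> P \<and> g v = y}" using fin by (intro card_mono) auto
    moreover have "inj_on (\<lambda>a. const_emb a * u) (UNIV - {0})" by (rule inj_onI) (use u0 injD[OF const_emb_inj] in auto)
    ultimately show ?thesis by (simp add: card_image card_Diff_singleton)
  qed
  have "card P = (\<Sum>y\<in>g ` P. \<Sum>v\<in>{v. v \<in> P \<and> g v = y}. 1)" using sum.image_gen[OF fin, of "\<lambda>_. 1::nat" g] by simp
  also have "\<dots> \<ge> (\<Sum>y\<in>g ` P. CARD('a) - 1)" by (rule sum_mono) (use fib in simp)
  finally have "card (g ` P) * (CARD('a) - 1) \<le> (CARD('a) - 1) * CARD('a) ^ n" using cP by simp
  thus ?thesis using q2 unfolding g_def P_def by (simp add: mult.commute)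
qed

text \<open>At most q^n by the orbit of \<open>\<beta>\<close>; at least q^n by
  \<open>ef_le\<close>, because \<open>\<beta>\<close> has value 1/q^n. So \<open>\<L> n\<close> is
  totally ramified at infinity.\<close>

lemma card_Rst_wild_aux: "card (Rst (Aut \<kk>) (\<L> n :: 'a rat_closure set)) = CARD('a) ^ n"
proof (rule antisym)
  obtain \<beta> where b: "\<beta> \<in> \<L> n" "\<beta> \<noteq> 0" "val \<beta> = 1 / real CARD('a) ^ n"
    "\<And>\<sigma> \<tau> x. \<sigma> \<in> Aut \<kk> ==> \<tau> \<in> Aut \<kk> ==> \<sigma> \<beta> = \<tau> \<beta> ==> x \<in> \<L> n ==> \<sigma> x = \<tau> x"
    "(\<lambda>\<sigma>. \<sigma> \<beta>) ` Aut \<kk> \<subseteq> (\<lambda>u. u ^ (CARD('a) - 1)) ` {u \<in> wild_torsion n. (phi \<theta> ^^ n) u \<noteq> 0}" using wild_uniformizer[of n] by blast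
  have "card ((\<lambda>\<sigma>. restrict \<sigma> (\<L> n :: 'a rat_closure set)) ` Aut \<kk>) \<le> card ((\<lambda>\<sigma>. \<sigma> \<beta>) ` Aut \<kk>)"
  proof (rule finite_image_kernel(2))
    show "finite ((\<lambda>\<sigma>. \<sigma> \<beta>) ` Aut \<kk>)" by (rule finite_orbit[OF algcl_ratfun])
    fix \<sigma> \<tau> assume "\<sigma> \<in> Aut \<kk>" "\<tau> \<in> Aut \<kk>" "\<sigma> \<beta> = \<tau> \<beta>"
    from b(4)[OF this] show "restrict \<sigma> (\<L> n) = restrict \<tau> (\<L> n)" by (simp add: restrict_eq_iff)
  qed
  also have "\<dots> \<le> card ((\<lambda>u. u ^ (CARD('a) - 1)) ` {u \<in> wild_torsion n. (phi \<theta> ^^ n) u \<noteq> 0})"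
    by (rule card_mono[OF _ b(5)], rule finite_imageI, rule finite_subset[OF _ torsion_finite[OF inv_T_in ev_inv_T_monom]]) blast
  also note card_scalar_classes
  finally show "card (Rst (Aut \<kk>) (\<L> n :: 'a rat_closure set)) \<le> CARD('a) ^ n" by (simp add: Rst_def)
  have "CARD('a) ^ n * card {0::nat} \<le> card (Rst (Aut \<kk>) (\<L> n :: 'a rat_closure set))"
  proof (rule ef_le[OF autgrp_Aut Gal_D(1)[OF Gal_wild] _ finite_Rst_wild _ zero_less_one b(1,2)])
    show "\<exists>i::int. val x = of_int i * 1" if "x \<in> fixed_in (Aut \<kk>) (\<L> n) - {0}" for x
      using that val_k[of x] unfolding fixed_in_Gal[OF algcl_ratfun Gal_wild] by simp
  qed (use Gal_image[OF Gal_wild] b(3) subrng_1[OF sO] subfld_1[OF Gal_D(1)[OF Gal_wild]] in \<open>auto intro: exI[of _ "\<lambda>_. 1"]\<close>)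
  thus "CARD('a) ^ n \<le> card (Rst (Aut \<kk>) (\<L> n :: 'a rat_closure set))" by simp
qed

end

lemma card_Rst_wild: "card (Rst (Aut \<kk>) (\<L> n :: 'a::{finite,field} rat_closure set)) = CARD('a) ^ n"
proof -
  obtain \<O> :: "'a rat_closure set" where "inf_place \<O>" using inf_place_exists by blast
  thus ?thesis by (rule inf_place.card_Rst_wild_aux)
qed

section \<open>Constant extensions and constants at an infinite place\<close>

lemma const_ext_gen: "const_ext A m = gen (A \<union> FF m)"
  by (simp add: const_ext_def composite_def generate_field_eq_gen FF_def)

lemma ncyc_gen: "ncyc n N = gen (\<L> n \<union> cyc N)"
  by (simp add: ncyc_def composite_def generate_field_eq_gen)

lemma Gal_const_ext:
  fixes B :: "'a::{finite,field} rat_closure set"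
  assumes B: "algcl B" "FFq \<subseteq> B" and G: "Gal B A" and m: "m > 0"
  shows "Gal B (const_ext A m)" "finite (Rst (Aut B) A) ==> finite (Rst (Aut B) (const_ext A m))"
proof -
  have sB: "subfld B" by (rule algcl_subfld[OF B(1)])
  have e: "const_ext A m = gen (A \<union> gen (B \<union> FF m))"
    unfolding const_ext_gen gen_Un_gen' using Gal_D(2)[OF G] by (intro arg_cong[where f = gen]) auto
  have "Gal B (gen (B \<union> FF m))"
  proof (rule Gal_gen[OF B(1) FF_Sep[OF m B(2) sB]])
    show "\<sigma> x \<in> gen (B \<union> FF m)" if "\<sigma> \<in> Aut B" "x \<in> FF m" for \<sigma> x
      using FF_stable[OF Aut_fhom[OF that(1)]] that(2) gen_incl[of "B \<union> FF m"] by blast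
  qed
  thus "Gal B (const_ext A m)" unfolding e by (rule Gal_comp[OF B(1) G])
  show "finite (Rst (Aut B) (const_ext A m))" if "finite (Rst (Aut B) A)"
    unfolding e by (rule finite_Rst_comp[OF that finite_Rst_gen[OF B(1) FF_card(1)[OF m]]])
qed

context inf_place
begin

text \<open>A nonzero constant has the same value as its power with exponent q^m, so its value is 0.
  Hence \<open>FF m\<close> maps injectively to the residue field.\<close>

lemma FF_O: assumes "m > 0" shows "FF m \<subseteq> \<O>" "x \<in> FF m ==> x \<in> mx \<O> ==> x = 0"
proof -
  have v: "val x = 0" if x: "x \<in> FF m" "x \<noteq> 0" for x
  proof -
    have "real (CARD('a) ^ m) * val x = val x" using val_power[OF x(2), of "CARD('a) ^ m"] x(1) by (simp add: FF_def)
    hence "(real (CARD('a) ^ m) - 1) * val x = 0" by (simp add: algebra_simps)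
    moreover have "CARD('a) ^ m > 1" using card_ge_2[where 'a = 'a] assms by (intro one_less_power) auto
    hence "real (CARD('a) ^ m) \<noteq> real 1" by (simp only: of_nat_eq_iff)
    ultimately show ?thesis by simp
  qed
  show "FF m \<subseteq> \<O>"
  proof
    fix x :: "'a rat_closure" assume "x \<in> FF m"
    thus "x \<in> \<O>" using v[of x] O_val[of x] subrng_0[OF sO] by (cases "x = 0") auto
  qed
  show "x = 0" if "x \<in> FF m" "x \<in> mx \<O>" using v[OF that(1)] that(2) m_val[of x] by (cases "x = 0") auto
qed

lemma FF_Int_ratfun_aux: assumes "m > 0" shows "FF m \<inter> \<kk> \<subseteq> (FFq :: 'a rat_closure set)"
proof
  fix x :: "'a rat_closure" assume x: "x \<in> FF m \<inter> \<kk>"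
  obtain a where a: "x - const_emb a \<in> mx \<O>" using const_residue[of x] x FF_O(1)[OF assms] by blast
  have "x - const_emb a \<in> FF m" using x FFq_FF[of m] by (intro subfld_diff[OF subfld_FF]) auto
  from FF_O(2)[OF assms this a] show "x \<in> FFq" by simp
qed

end

lemma FF_Int_ratfun: assumes "m > 0" shows "FF m \<inter> \<kk> = (FFq :: 'a::{finite,field} rat_closure set)"
proof -
  obtain \<O> :: "'a rat_closure set" where "inf_place \<O>" using inf_place_exists by blast
  thus ?thesis using inf_place.FF_Int_ratfun_aux[OF _ assms] FFq_FF[of m] FFq_le by blast
qed

text \<open>Artin's theorem gives the order of the group as the dimension over F_q, and comparing
  cardinalities identifies this dimension as m.\<close>

lemma Rst_FF:
  assumes m: "m > 0"
  shows "finite (Rst (Aut \<kk>) (FF m :: 'a::{finite,field} rat_closure set))" "card (Rst (Aut \<kk>) (FF m :: 'a rat_closure set)) = m"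
    "dimn m FFq (FF m :: 'a rat_closure set)"
proof -
  show fin: "finite (Rst (Aut \<kk>) (FF m :: 'a rat_closure set))"
    by (rule finite_Rst_subset[OF finite_Rst_gen[OF algcl_ratfun FF_card(1)[OF m]]]) (use gen_incl in blast)
  have "fixed_in (Aut \<kk>) (FF m :: 'a rat_closure set) \<subseteq> FF m \<inter> \<kk>"
    using Sep_fixed[OF algcl_ratfun] FF_Sep[OF m FFq_le subfld_ratfun] unfolding fixed_in_def by blast
  hence fx: "fixed_in (Aut \<kk>) (FF m :: 'a rat_closure set) = FFq"
    using FF_Int_ratfun[OF m] const_Aut FFq_FF[of m] by (auto simp: fixed_in_def)
  have d: "dimn (card (Rst (Aut \<kk>) (FF m :: 'a rat_closure set))) FFq (FF m :: 'a rat_closure set)"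
    using artin[OF autgrp_Aut subfld_FF[of m] _ fin] FF_stable[OF Aut_fhom] unfolding fx by blast
  thus c: "card (Rst (Aut \<kk>) (FF m :: 'a rat_closure set)) = m"
    using dim_FF[OF m, of 1 "card (Rst (Aut \<kk>) (FF m :: 'a rat_closure set))"] FFq_FF[of m] by (simp add: FF_1[unfolded One_nat_def] eq_commute[of m])
  show "dimn m FFq (FF m :: 'a rat_closure set)" using d unfolding c .
qed

lemma carlitz_act_ex: "\<exists>M. (\<Sum>i<d. const_emb (c i) * (phi th ^^ i) u) = carlitz_act th M u"
proof (induction d)
  case 0 show ?case by (intro exI[of _ 0]) simp
next
  case (Suc d)
  then obtain M where "(\<Sum>i<d. const_emb (c i) * (phi th ^^ i) u) = carlitz_act th M u" by blast
  thus ?case by (intro exI[of _ "M + smult (c d) (monom 1 d)"]) (simp only: act_add act_smult act_monom sum.lessThan_Suc)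
qed

lemma torsion_const_modulus:
  assumes N: "N \<noteq> 0" and d: "degree N = 0" shows "carlitz_torsion ratfun_T N = {0 :: 'a::{finite,field} rat_closure}"
proof -
  have ev: "ev ratfun_T N \<noteq> (0 :: 'a rat_closure)" using N by (simp add: ev_T_eq_0)
  have "(0 :: 'a rat_closure) \<in> carlitz_torsion ratfun_T N" by (simp add: carlitz_torsion_def)
  moreover have "card (carlitz_torsion ratfun_T N :: 'a rat_closure set) = 1" using torsion_card[OF T_in ev] d by simp
  ultimately show ?thesis by (metis card_1_singletonE singletonD)
qed

text \<open>All torsion points are images of one generator under the Carlitz action; automorphisms
  commute with this action, and the actions of two polynomials commute.\<close>

lemma cyc_commute:
  fixes x :: "'a::{finite,field} rat_closure"
  assumes N: "N \<noteq> 0" and s: "\<sigma> \<in> Aut \<kk>" "\<tau> \<in> Aut \<kk>" and x: "x \<in> cyc N" shows "\<sigma> (\<tau> x) = \<tau> (\<sigma> x)"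
proof -
  obtain \<O> :: "'a rat_closure set" where "inf_place \<O>" using inf_place_exists by blast
  then interpret inf_place \<O> .
  have ev: "ev ratfun_T N \<noteq> (0 :: 'a rat_closure)" using N by (simp add: ev_T_eq_0)
  obtain lam :: "'a rat_closure" where lam: "lam \<in> carlitz_torsion ratfun_T N" "\<And>u. u \<in> carlitz_torsion ratfun_T N ==> \<exists>M. u = carlitz_act ratfun_T M lam"
  proof (cases "degree N = 0")
    case True
    show ?thesis by (rule that[of 0]) (simp_all add: torsion_const_modulus[OF N True])
  next
    case False
    hence d: "degree N > 0" by simp
    show ?thesis
    proof (rule torsion_T_generator[OF N d])
      fix lam J assume l: "lam \<in> carlitz_torsion ratfun_T N"
        and g: "\<And>u. u \<in> carlitz_torsion ratfun_T N ==> \<exists>c. u = (\<Sum>i<Suc J. const_emb (c i) * a_T lam i)"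
      show ?thesis
      proof (rule that[OF l])
        fix u :: "'a rat_closure" assume "u \<in> carlitz_torsion ratfun_T N"
        then obtain c where "u = (\<Sum>i<Suc J. const_emb (c i) * a_T lam i)" using g by blast
        thus "\<exists>M. u = carlitz_act ratfun_T M lam" by (simp only: carlitz_act_ex)
      qed
    qed
  qed
  obtain M1 where M1: "\<sigma> lam = carlitz_act ratfun_T M1 lam" using lam(2)[OF torsion_Aut[OF T_in ev s(1) lam(1)]] by blast
  obtain M2 where M2: "\<tau> lam = carlitz_act ratfun_T M2 lam" using lam(2)[OF torsion_Aut[OF T_in ev s(2) lam(1)]] by blast
  have l: "\<sigma> (\<tau> lam) = \<tau> (\<sigma> lam)"
    by (simp only: M1 M2 act_Aut[OF s(1) T_in] act_Aut[OF s(2) T_in] act_commute[of _ M1 M2])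
  have "(\<sigma> \<circ> \<tau>) x = (\<tau> \<circ> \<sigma>) x"
  proof (rule aut_agree_cyclotomic[OF _ _ T_in ev _ x])
    show "\<sigma> \<circ> \<tau> \<in> Aut \<kk>" "\<tau> \<circ> \<sigma> \<in> Aut \<kk>" by (rule autgrpD(5)[OF autgrp_Aut]; fact)+
    fix u assume "u \<in> carlitz_torsion ratfun_T N"
    then obtain M where M: "u = carlitz_act ratfun_T M lam" using lam(2) by blast
    show "(\<sigma> \<circ> \<tau>) u = (\<tau> \<circ> \<sigma>) u" unfolding M by (simp add: act_Aut[OF s(1) T_in] act_Aut[OF s(2) T_in] l)
  qed
  thus ?thesis by simp
qed

context inf_place
begin

section \<open>The decomposition group at infinity of the large cyclotomic field\<close>

lemma Dec_val:
  assumes A: "subfld A" "\<kk> \<subseteq> A" and s: "\<sigma> \<in> Dec \<kk> (\<O> \<inter> A)" and x: "x \<in> A" "x \<noteq> 0"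
  shows "val (\<sigma> x) = val x"
proof (rule val_Aut[OF Aut_fhom[OF Dec_Aut[OF s]] Aut_fix[OF Dec_Aut[OF s] pi(1)] A(1) _ _ x])
  show "\<theta> \<in> A" using pi(1) A(2) by blast
  show "\<sigma> y \<in> \<O>" if "y \<in> A" "y \<in> \<O>" for y using s that by (auto simp: Dec_def)
qed

text \<open>The decomposition group preserves values, so it takes a torsion point \<open>lam\<close>
  of largest value to one of its q - 1 nonzero constant multiples. The value of \<open>lam\<close>
  has denominator q - 1, so ramification matches the bound. For constant N the torsion is 0 and c =
  1.\<close>

lemma cyc_inertia:
  assumes N: "N \<noteq> 0"
  obtains c a \<alpha> where "c > 0" "coprime a (int c)" "coprime c CARD('a)" "\<alpha> \<in> cyc N" "\<alpha> \<noteq> 0" "val \<alpha> = of_int a / real c"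
    "\<And>A. subfld A ==> cyc N \<subseteq> A ==> card (Rst (Dec \<kk> (\<O> \<inter> A)) (cyc N)) \<le> c"
proof (cases "degree N = 0")
  case True
  have ev: "ev ratfun_T N \<noteq> (0 :: 'a rat_closure)" using N by (simp add: ev_T_eq_0)
  have "card (Rst (Dec \<kk> (\<O> \<inter> A)) (cyc N)) \<le> 1" for A
  proof -
    have "\<sigma> x = x" if s: "\<sigma> \<in> Aut \<kk>" and x: "x \<in> cyc N" for \<sigma> and x :: "'a rat_closure"
    proof -
      have "\<sigma> x = id x"
        by (rule aut_agree_cyclotomic[OF s autgrpD(4)[OF autgrp_Aut] T_in ev _ x])
          (simp add: torsion_const_modulus[OF N True] hom_0[OF Aut_fhom[OF s]])
      thus ?thesis by simp
    qed
    hence "Rst (Dec \<kk> (\<O> \<inter> A)) (cyc N) \<subseteq> {restrict id (cyc N)}"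
      unfolding Rst_def by (intro image_subsetI) (simp add: restrict_eq_iff Dec_Aut)
    thus ?thesis using card_mono[of "{restrict id (cyc N :: 'a rat_closure set)}"] by fastforce
  qed
  moreover have "(1 :: 'a rat_closure) \<in> cyc N" by (rule subfld_1[OF Gal_D(1)[OF Gal_cyclotomic[OF T_in ev]]])
  ultimately show ?thesis using that[of 1 0 1] by simp
next
  case False
  have ev: "ev ratfun_T N \<noteq> (0 :: 'a rat_closure)" using N by (simp add: ev_T_eq_0)
  have q2: "CARD('a) \<ge> 2" by (rule card_ge_2)
  define c where "c = CARD('a) - 1"
  have c: "c > 0" "real c = real CARD('a) - 1" "CARD('a) = c + 1" using q2 by (auto simp: c_def)
  obtain lam J where l: "lam \<in> carlitz_torsion ratfun_T N" "lam \<noteq> 0" "val lam = real J - slope TYPE('a)"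
    and lg: "\<And>u. u \<in> carlitz_torsion ratfun_T N ==> \<exists>c. u = (\<Sum>i<Suc J. const_emb (c i) * a_T lam i)"
    and ld: "\<And>u. u \<in> carlitz_torsion ratfun_T N ==> u \<noteq> 0 ==> val u = val lam ==> \<exists>a. a \<noteq> 0 \<and> u = const_emb a * lam"
  proof (rule torsion_T_generator[OF N])
    show "degree N > 0" using False by simp
  qed (rule that)
  \<comment> \<open>Numerator of J - 1/(q - 1) over \<open>c\<close>; it is congruent to -1 modulo
    \<open>c\<close>, hence coprime to it.\<close>
  define b where "b = int J * int c - 1"
  note G = Gal_cyclotomic[OF T_in ev]
  show ?thesis
  proof (rule that[OF c(1)])
    show "coprime c CARD('a)" unfolding c(3) by simp
    show "coprime b (int c)"
    proof (rule coprimeI)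
      fix d assume "d dvd b" "d dvd int c"
      hence "d dvd int J * int c - b" by (intro dvd_diff dvd_mult)
      thus "is_unit d" by (simp add: b_def)
    qed
    show lc: "lam \<in> cyc N" using l(1) gen_incl unfolding cyclotomic_gen[OF T_in ev] by blast
    show "lam \<noteq> 0" by (rule l(2))
    show "val lam = of_int b / real c" unfolding l(3) slope_def b_def using c by (simp add: divide_simps)
    fix A :: "'a rat_closure set" assume A: "subfld A" "cyc N \<subseteq> A"
    have kA: "\<kk> \<subseteq> A" using Gal_D(2)[OF G] A(2) by blast
    define D where "D = Dec \<kk> (\<O> \<inter> A)"
    have im: "(\<lambda>\<sigma>. \<sigma> lam) ` D \<subseteq> (\<lambda>a. const_emb a * lam) ` (UNIV - {0})"
    proof (rule image_subsetI)
      fix \<sigma> assume s: "\<sigma> \<in> D"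
      hence sA: "\<sigma> \<in> Aut \<kk>" by (simp add: D_def Dec_Aut)
      have "val (\<sigma> lam) = val lam" using Dec_val[OF A(1) kA _ _ l(2)] s lc A(2) unfolding D_def by blast
      then obtain a where "a \<noteq> 0" "\<sigma> lam = const_emb a * lam"
        using ld[OF torsion_Aut[OF T_in ev sA l(1)] hom_nonzero[OF Aut_fhom[OF sA] UNIV_I l(2)]] by blast
      thus "\<sigma> lam \<in> (\<lambda>a. const_emb a * lam) ` (UNIV - {0})" by blast
    qed
    have "card ((\<lambda>\<sigma>. restrict \<sigma> (cyc N)) ` D) \<le> card ((\<lambda>\<sigma>. \<sigma> lam) ` D)"
    proof (rule finite_image_kernel(2))
      show "finite ((\<lambda>\<sigma>. \<sigma> lam) ` D)" by (rule finite_subset[OF im]) simp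
      fix \<sigma> \<tau> assume s: "\<sigma> \<in> D" "\<tau> \<in> D" "\<sigma> lam = \<tau> lam"
      have sA: "\<sigma> \<in> Aut \<kk>" "\<tau> \<in> Aut \<kk>" using s by (simp_all add: D_def Dec_Aut)
      have "\<sigma> x = \<tau> x" if x: "x \<in> cyc N" for x
      proof (rule aut_agree_cyclotomic[OF sA T_in ev _ x])
        fix u assume "u \<in> carlitz_torsion ratfun_T N"
        then obtain c where "u = (\<Sum>i<Suc J. const_emb (c i) * a_T lam i)" using lg by blast
        thus "\<sigma> u = \<tau> u" by (rule aut_agree_torsion[OF sA T_in s(3)])
      qed
      thus "restrict \<sigma> (cyc N) = restrict \<tau> (cyc N)" by (simp add: restrict_eq_iff)
    qed
    also have "\<dots> \<le> card ((\<lambda>a. const_emb a * lam) ` (UNIV - {0}))" by (rule card_mono[OF _ im]) simp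
    also have "\<dots> \<le> card (UNIV - {0 :: 'a})" by (rule card_image_le) simp
    also have "\<dots> = c" by (simp add: c_def card_Diff_singleton)
    finally show "card (Rst (Dec \<kk> (\<O> \<inter> A)) (cyc N)) \<le> c" unfolding Rst_def D_def .
  qed
qed

text \<open>Ramification c q^n and residue degree m force at least c q^n m restrictions to A, while
  restricting to \<open>cyc N\<close>, \<open>\<L> n\<close> and \<open>FF m\<close> embeds them
  into a set of at most that size. Equality makes every triple of actions occur and leaves no room
  for further residues.\<close>

lemma decomposition:
  fixes m n :: nat
  assumes N: "N \<noteq> 0" and m: "m > 0" defines "A \<equiv> const_ext (ncyc n N) m"
  shows "\<tau> \<in> Aut \<kk> ==> \<rho> \<in> Aut \<kk> ==> \<exists>\<sigma>\<in>Dec \<kk> (\<O> \<inter> A). (\<forall>x\<in>cyc N. \<sigma> x = x) \<and> (\<forall>x\<in>\<L> n. \<sigma> x = \<tau> x) \<and> (\<forall>x\<in>FF m. \<sigma> x = \<rho> x)"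
    and "y \<in> \<O> \<inter> A ==> \<exists>x\<in>FF m. y - x \<in> mx \<O>"
    and "\<exists>E \<gamma>. E > 0 \<and> \<gamma> \<in> A \<and> \<gamma> \<noteq> 0 \<and> of_nat E * val \<gamma> = 1 \<and> card (Rst (Dec \<kk> (\<O> \<inter> A)) A) = E * m"
proof -
  have ev: "ev ratfun_T N \<noteq> (0 :: 'a rat_closure)" using N by (simp add: ev_T_eq_0)
  have A: "A = gen (\<L> n \<union> cyc N \<union> FF m)" unfolding A_def const_ext_gen ncyc_gen gen_Un_gen ..
  have G: "Gal \<kk> A" unfolding A_def ncyc_gen by (intro Gal_const_ext(1)[OF algcl_ratfun FFq_le] Gal_comp[OF algcl_ratfun] Gal_wild Gal_cyclotomic[OF T_in ev] m)
  have fin: "finite (Rst (Aut \<kk>) A)" unfolding A_def ncyc_gen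
    by (intro Gal_const_ext(2)[OF algcl_ratfun FFq_le _ m] Gal_comp[OF algcl_ratfun] Gal_wild Gal_cyclotomic[OF T_in ev] finite_Rst_comp finite_Rst_wild finite_Rst_cyclotomic[OF T_in ev])
  have sub: "\<L> n \<subseteq> A" "cyc N \<subseteq> A" "FF m \<subseteq> A" using gen_incl[of "\<L> n \<union> cyc N \<union> FF m"] unfolding A by auto
  define D where "D = Dec \<kk> (\<O> \<inter> A)"
  have DA: "D \<subseteq> Aut \<kk>" unfolding D_def using Dec_Aut by auto
  obtain c a \<alpha> where c: "c > 0" "coprime a (int c)" "coprime c CARD('a)" and al: "\<alpha> \<in> cyc N" "\<alpha> \<noteq> 0" "val \<alpha> = of_int a / real c"
    and cD: "\<And>A. subfld A ==> cyc N \<subseteq> A ==> card (Rst (Dec \<kk> (\<O> \<inter> A)) (cyc N)) \<le> c"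
  proof (rule cyc_inertia[OF N])
  qed (rule that)
  obtain \<beta> where b: "\<beta> \<in> \<L> n" "\<beta> \<noteq> 0" "val \<beta> = 1 / real CARD('a) ^ n"
  proof (rule wild_uniformizer[of n])
  qed (rule that)
  define Q where "Q = CARD('a) ^ n"
  have Q: "Q > 0" "coprime c Q" "val \<beta> = 1 / real Q" using c(3) b(3) by (auto simp: Q_def)
  have "coprime (a * int Q) (int c)" using c Q by (simp add: coprime_commute)
  \<comment> \<open>As c and q^n are coprime, Bezout exponents produce an element of value 1 / (c
    q^n) from \<open>\<alpha>\<close> and \<open>\<beta>\<close>.\<close>
  then obtain h l where xy: "h * (a * int Q) + l * int c = 1" using bezout_int[of "a * int Q" "int c"] by (auto simp: coprime_iff_gcd_eq_1)
  define \<gamma> where "\<gamma> = \<alpha> powi h * \<beta> powi l"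
  have "val \<gamma> = of_int h * (of_int a / real c) + of_int l * (1 / real Q)"
    unfolding \<gamma>_def using al b(2) Q(3) by (subst val_mult) (simp_all add: val_powi)
  hence "real (c * Q) * val \<gamma> = of_int (h * (a * int Q) + l * int c)" using Q(1) c(1) by (simp add: field_simps)
  hence g: "\<gamma> \<in> A" "\<gamma> \<noteq> 0" "of_nat (c * Q) * val \<gamma> = 1"
    unfolding xy using al b sub Gal_D(1)[OF G] by (auto simp: \<gamma>_def intro!: subfld_mult subfld_powi)
  \<comment> \<open>Kept general in the residue family: it is used for a basis of
    \<open>FF m\<close>, and again with one more residue to exclude residues outside
    \<open>FF m\<close>.\<close>
  have low: "c * Q * card J \<le> card (Rst D A)" if "finite J" and u: "\<And>j. j \<in> J ==> u j \<in> \<O> \<inter> A" 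
    and res: "\<And>b. (\<Sum>j\<in>J. const_emb (b j) * u j) \<in> mx \<O> ==> (\<forall>j\<in>J. b j = 0)" for J :: "nat set" and u
    unfolding D_def
  proof (rule Dec_ef_le[OF algcl_ratfun order.refl G fin Gal_D(1)[OF G] order.refl _ _ _ g \<open>finite J\<close> u])
    show "\<sigma> ` A \<subseteq> A" if "\<sigma> \<in> Aut \<kk>" for \<sigma> using Gal_image[OF G that] by simp
    show "\<exists>i::int. val x = of_int i * 1" if "x \<in> \<kk> - {0}" for x using val_k that by simp
    fix b assume b: "\<And>j. j \<in> J ==> b j \<in> \<kk> \<inter> \<O>" and s: "(\<Sum>j\<in>J. b j * u j) \<in> mx \<O>"
    have "\<forall>j\<in>J. \<exists>b'. b j - const_emb b' \<in> mx \<O>" using const_residue b by blast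
    then obtain b' where b': "\<And>j. j \<in> J ==> b j - const_emb (b' j) \<in> mx \<O>" by metis
    have "(\<Sum>j\<in>J. u j * (b j - const_emb (b' j))) \<in> mx \<O>" by (rule m_sum, rule m_mult) (use b' u in auto)
    from m_diff[OF s this] have "(\<Sum>j\<in>J. const_emb (b' j) * u j) \<in> mx \<O>" by (simp add: algebra_simps flip: sum_subtractf)
    hence "b' j = 0" if "j \<in> J" for j using res that by blast
    thus "\<forall>j\<in>J. b j \<in> mx \<O>" using b' by fastforce
  qed simp_all
  define S where "S = Rst D (cyc N) \<times> Rst (Aut \<kk>) (\<L> n :: 'a rat_closure set) \<times> Rst (Aut \<kk>) (FF m :: 'a rat_closure set)"
  define g where "g = (\<lambda>\<sigma> :: 'a rat_closure \<Rightarrow> 'a rat_closure. (restrict \<sigma> (cyc N), restrict \<sigma> (\<L> n :: 'a rat_closure set), restrict \<sigma> (FF m :: 'a rat_closure set)))"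
  have finS: "finite S" unfolding S_def
    by (intro finite_cartesian_product finite_Rst_wild Rst_FF(1)[OF m] finite_Rst_mono[OF finite_Rst_cyclotomic[OF T_in ev] DA])
  have gS: "g ` D \<subseteq> S" unfolding g_def S_def Rst_def using DA by auto
  have cS: "card S \<le> c * Q * m"
    unfolding S_def card_cartesian_product card_Rst_wild Rst_FF(2)[OF m] using cD[OF Gal_D(1)[OF G] sub(2)] by (simp add: D_def Q_def)
  have up: "card (Rst D A) \<le> card (g ` D)" unfolding Rst_def
  proof (rule finite_image_kernel(2))
    show "finite (g ` D)" by (rule finite_subset[OF gS finS])
    fix \<sigma> \<tau> assume s: "\<sigma> \<in> D" "\<tau> \<in> D" "g \<sigma> = g \<tau>"
    have "\<sigma> x = \<tau> x" if "x \<in> A" for x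
      by (rule aut_agree_gen[OF Aut_fhom Aut_fhom, of _ \<kk> _ \<kk>, OF _ _ _ \<open>x \<in> A\<close>[unfolded A]]) (use s DA in \<open>auto simp: g_def restrict_eq_iff\<close>)
    thus "restrict \<sigma> A = restrict \<tau> A" by (simp add: restrict_eq_iff)
  qed
  obtain u :: "nat \<Rightarrow> 'a rat_closure" where u: "indep FFq {..<m} u" "FF m = {\<Sum>i<m. e i * u i | e. \<forall>i<m. e i \<in> FFq}" using dimn_basis[OF Rst_FF(3)[OF m] subfld_FFq] by blast
  have uF: "u i \<in> FF m" if "i < m" for i unfolding u(2) by (rule basis_mem[OF subfld_FFq that])
  have cu: "(\<Sum>j<m. const_emb (e j) * u j) \<in> FF m" for e
    by (intro subfld_sum[OF subfld_FF] subfld_mult[OF subfld_FF]) (use uF FFq_FF[of m] in auto)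
  have ru: "\<forall>j<m. e j = 0" if "(\<Sum>j<m. const_emb (e j) * u j) \<in> mx \<O>" for e
  proof -
    have "(\<Sum>j<m. const_emb (e j) * u j) = 0" by (rule FF_O(2)[OF m cu that])
    hence "\<forall>j\<in>{..<m}. const_emb (e j) = (0 :: 'a rat_closure)"
      by (rule u(1)[unfolded indep_def, THEN spec[of _ "\<lambda>j. const_emb (e j)"], THEN mp, THEN mp, rotated]) simp
    thus ?thesis by simp
  qed
  have "c * Q * m \<le> card (Rst D A)" 
  proof -
    have "c * Q * card {..<m} \<le> card (Rst D A)"
    proof (rule low)
      show "u j \<in> \<O> \<inter> A" if "j \<in> {..<m}" for j using uF[of j] that FF_O(1)[OF m] sub(3) by blast
      show "\<forall>j\<in>{..<m}. e j = 0" if "(\<Sum>j<m. const_emb (e j) * u j) \<in> mx \<O>" for e using ru[OF that] by blast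
    qed simp
    thus ?thesis by simp
  qed
  hence eq: "g ` D = S" and cD: "card (Rst D A) = c * Q * m" using up cS card_mono[OF finS gS] by (intro card_seteq[OF finS gS], linarith, linarith)
  show "\<exists>E \<gamma>. E > 0 \<and> \<gamma> \<in> A \<and> \<gamma> \<noteq> 0 \<and> of_nat E * val \<gamma> = 1 \<and> card (Rst (Dec \<kk> (\<O> \<inter> A)) A) = E * m"
    using g cD c(1) Q(1) unfolding D_def by (intro exI[of _ "c * Q"] exI[of _ \<gamma>]) simp
  show "\<exists>\<sigma>\<in>Dec \<kk> (\<O> \<inter> A). (\<forall>x\<in>cyc N. \<sigma> x = x) \<and> (\<forall>x\<in>\<L> n. \<sigma> x = \<tau> x) \<and> (\<forall>x\<in>FF m. \<sigma> x = \<rho> x)"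
    if t: "\<tau> \<in> Aut \<kk>" "\<rho> \<in> Aut \<kk>" for \<tau> \<rho>
  proof -
    have "id \<in> D" unfolding D_def by (rule autgrpD(4)[OF autgrp_Dec])
    hence "(restrict id (cyc N), restrict \<tau> (\<L> n), restrict \<rho> (FF m)) \<in> S" using t by (auto simp: S_def Rst_def)
    hence "(restrict id (cyc N), restrict \<tau> (\<L> n), restrict \<rho> (FF m)) \<in> g ` D" unfolding eq .
    then obtain \<sigma> where "\<sigma> \<in> D" "(restrict id (cyc N), restrict \<tau> (\<L> n), restrict \<rho> (FF m)) = g \<sigma>" by (rule_tac imageE)
    thus ?thesis unfolding D_def[symmetric] by (intro bexI[of _ \<sigma>]) (auto simp: g_def restrict_eq_iff)
  qed
  show "\<exists>x\<in>FF m. y - x \<in> mx \<O>" if y: "y \<in> \<O> \<inter> A"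
  proof (rule ccontr)
    assume no: "\<not> ?thesis"
    \<comment> \<open>The basis of \<open>FF m\<close> extended by \<open>y\<close> at index
      \<open>m\<close>. If no constant were congruent to \<open>y\<close>, these m + 1 residues
      would be independent over F_q.\<close>
    define u' where "u' = (\<lambda>j. if j < m then u j else y)"
    have "\<forall>j\<in>{..m}. e j = 0" if e: "(\<Sum>j\<in>{..m}. const_emb (e j) * u' j) \<in> mx \<O>" for e
    proof -
      have "(\<Sum>j\<in>{..m}. const_emb (e j) * u' j) = (\<Sum>j<m. const_emb (e j) * u' j) + const_emb (e m) * u' m"
        by (simp flip: lessThan_Suc_atMost)
      also have "(\<Sum>j<m. const_emb (e j) * u' j) = (\<Sum>j<m. const_emb (e j) * u j)" by (rule sum.cong) (auto simp: u'_def)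
      finally have s: "(\<Sum>j<m. const_emb (e j) * u j) + const_emb (e m) * y \<in> mx \<O>" using e by (simp add: u'_def)
      have em: "e m = 0"
      proof (rule ccontr)
        assume e0: "e m \<noteq> 0"
        define v where "v = - ((\<Sum>j<m. const_emb (e j) * u j) * const_emb (inverse (e m)))"
        have "v \<in> FF m" unfolding v_def using cu[of e] FFq_FF[of m] by (intro subfld_uminus[OF subfld_FF] subfld_mult[OF subfld_FF]) auto
        moreover have "const_emb (inverse (e m)) * ((\<Sum>j<m. const_emb (e j) * u j) + const_emb (e m) * y) \<in> mx \<O>"
          by (rule m_mult[OF _ s]) (use FFq_O in auto)
        moreover have "const_emb (inverse (e m)) * ((\<Sum>j<m. const_emb (e j) * u j) + const_emb (e m) * y) = y - v"
          using e0 by (simp add: v_def const_emb_inverse distrib_left mult.commute)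
        ultimately show False using no by auto
      qed
      hence "\<forall>j<m. e j = 0" using s by (intro ru) simp
      thus ?thesis using em by (auto simp: le_less)
    qed
    hence "c * Q * card {..m} \<le> card (Rst D A)" using uF FF_O(1)[OF m] sub(3) y by (intro low[of _ u']) (auto simp: u'_def)
    also have "\<dots> \<le> c * Q * m" using up cS eq by simp
    finally show False using c(1) Q(1) by simp
  qed
qed

end

section \<open>Residue fields described by constants\<close>

lemma FF_dvd: assumes "m dvd k" shows "FF m \<subseteq> FF k"
proof -
  obtain i where k: "k = m * i" using assms by (rule dvdE)
  have "x ^ (CARD('a) ^ (m * i)) = x" if x: "x \<in> FF m" for x :: "'a rat_closure"
  proof (induction i)
    case (Suc i)
    have "x ^ (CARD('a) ^ (m * Suc i)) = (x ^ (CARD('a) ^ m)) ^ (CARD('a) ^ (m * i))" by (simp add: power_add flip: power_mult)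
    thus ?case using Suc x by (simp add: FF_def)
  qed simp
  thus ?thesis unfolding k by (auto simp: FF_def)
qed

lemma FF_le: assumes "FF m \<subseteq> (FF k :: 'a::{finite,field} rat_closure set)" "m > 0" "k > 0" shows "m \<le> k"
proof -
  have "CARD('a) ^ m \<le> CARD('a) ^ k" using card_mono[OF FF_card(1)[OF assms(3)] assms(1)] by (simp add: FF_card(2) assms)
  thus ?thesis using card_ge_2[where 'a = 'a] by (subst (asm) power_increasing_iff) auto
qed

context inf_place
begin

lemma rcard_O:
  assumes B: "subfld B" shows "rcard (\<O> \<inter> B) = card (rclass \<O> ` (\<O> \<inter> B))"
  unfolding rcard_def
proof (rule card_image_kernel)
  fix x y assume xy: "x \<in> \<O> \<inter> B" "y \<in> \<O> \<inter> B"
  have "x - y \<in> B" using xy subfld_diff[OF B] by blast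
  thus "rclass (\<O> \<inter> B) x = rclass (\<O> \<inter> B) y \<longleftrightarrow> rclass \<O> x = rclass \<O> y"
    using rclass_eq_iff[OF B vring_O_Int[OF B] xy] rclass_eq_iff[OF subfld_UNIV vO, of x y] xy mx_Int[OF B, of \<O>] by auto
qed

lemma rcard_eq:
  assumes B: "subfld B" and C: "subfld C" "B \<subseteq> C" and r: "\<And>y. y \<in> \<O> \<inter> C ==> \<exists>x\<in>\<O> \<inter> B. y - x \<in> mx \<O>"
  shows "rcard (\<O> \<inter> C) = rcard (\<O> \<inter> B)"
proof -
  have "rclass \<O> y \<in> rclass \<O> ` (\<O> \<inter> B)" if y: "y \<in> \<O> \<inter> C" for y
  proof -
    obtain x where x: "x \<in> \<O> \<inter> B" "y - x \<in> mx \<O>" using r[OF y] by blast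
    hence "rclass \<O> y = rclass \<O> x" using rclass_eq_iff[OF subfld_UNIV vO, of y x] y by blast
    thus ?thesis using x(1) by blast
  qed
  hence "rclass \<O> ` (\<O> \<inter> C) = rclass \<O> ` (\<O> \<inter> B)" using C(2) by blast
  thus ?thesis unfolding rcard_O[OF B] rcard_O[OF C(1)] by simp
qed

lemma rcard_level:
  assumes j: "j > 0" and B: "subfld B" and r: "\<And>y. y \<in> \<O> \<inter> B ==> \<exists>x\<in>FF j. y - x \<in> mx \<O>"
    and r': "\<And>x. x \<in> FF j ==> \<exists>y\<in>\<O> \<inter> B. y - x \<in> mx \<O>"
  shows "rcard (\<O> \<inter> B) = CARD('a) ^ j"
proof -
  have eq: "rclass \<O> y = rclass \<O> x \<longleftrightarrow> y - x \<in> mx \<O>" if "y \<in> \<O>" "x \<in> FF j" for x y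
    using rclass_eq_iff[OF subfld_UNIV vO] FF_O(1)[OF j] that by blast
  have "rclass \<O> ` (\<O> \<inter> B) = rclass \<O> ` FF j"
  proof (intro equalityI image_subsetI)
    fix y assume y: "y \<in> \<O> \<inter> B"
    obtain x :: "'a rat_closure" where "x \<in> FF j" "y - x \<in> mx \<O>" using r[OF y] by blast
    thus "rclass \<O> y \<in> rclass \<O> ` FF j" using eq[of y x] y by auto
  next
    fix x :: "'a rat_closure" assume x: "x \<in> FF j"
    obtain y where "y \<in> \<O> \<inter> B" "y - x \<in> mx \<O>" using r'[OF x] by blast
    thus "rclass \<O> x \<in> rclass \<O> ` (\<O> \<inter> B)" using eq[of y x] x by (intro image_eqI[where x = y]) auto
  qed
  moreover have "inj_on (rclass \<O>) (FF j)"
  proof (rule inj_onI)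
    fix x y :: "'a rat_closure" assume xy: "x \<in> FF j" "y \<in> FF j" "rclass \<O> x = rclass \<O> y"
    hence "x - y \<in> mx \<O>" using eq[of x y] FF_O(1)[OF j] by blast
    thus "x = y" using FF_O(2)[OF j subfld_diff[OF subfld_FF xy(1,2)]] by simp
  qed
  ultimately show ?thesis unfolding rcard_O[OF B] by (simp add: card_image FF_card(2)[OF j])
qed

text \<open>The constants congruent to elements of \<open>B\<close> form a finite field, hence some
  \<open>FF j\<close>. As a residue class contains at most one constant, this is a copy of the
  residue field of \<open>B\<close>.\<close>

lemma residue_subfield:
  assumes m: "m > 0" and B: "subfld B" "\<kk> \<subseteq> B" and r: "\<And>y. y \<in> \<O> \<inter> B ==> \<exists>x\<in>FF m. y - x \<in> mx \<O>"
  obtains j where "j > 0" "FF j \<subseteq> (FF m :: 'a rat_closure set)" "rcard (\<O> \<inter> B) = CARD('a) ^ j"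
    "\<And>y. y \<in> \<O> \<inter> B ==> \<exists>x\<in>FF j. y - x \<in> mx \<O>" "\<And>x. x \<in> FF j ==> \<exists>y\<in>\<O> \<inter> B. y - x \<in> mx \<O>"
proof -
  define R where "R = {x \<in> FF m. \<exists>y\<in>\<O> \<inter> B. y - x \<in> mx \<O>}"
  have FO: "x \<in> \<O>" if "x \<in> R" for x using that FF_O(1)[OF m] by (auto simp: R_def)
  have "subfld R" unfolding subfld_def
  proof (intro conjI ballI)
    show "0 \<in> R" unfolding R_def using subfld_0[OF B(1)] subrng_0[OF sO] m_0 subfld_0[OF subfld_FF]
      by (intro CollectI conjI bexI[of _ 0]) auto
    show "1 \<in> R" unfolding R_def using subfld_1[OF B(1)] subrng_1[OF sO] m_0 subfld_1[OF subfld_FF]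
      by (intro CollectI conjI bexI[of _ 1]) auto
    fix x assume x: "x \<in> R"
    then obtain y where y: "y \<in> \<O>" "y \<in> B" "y - x \<in> mx \<O>" by (auto simp: R_def)
    have xF: "x \<in> FF m" using x by (simp add: R_def)
    show "inverse x \<in> R"
    proof (cases "x = 0")
      case False
      have xm: "x \<notin> mx \<O>" using FF_O(2)[OF m xF] False by blast
      hence ym: "y \<notin> mx \<O>" using m_diff[OF _ y(3), of y] by auto
      have i: "inverse x \<in> \<O>" "inverse y \<in> \<O>" "y \<noteq> 0" using xm ym FO[OF x] y(1) m_0 by (auto simp: mx_def)
      have "- (inverse x * inverse y) * (y - x) \<in> mx \<O>" by (intro m_mult y(3) subrng_uminus[OF sO] subrng_mult[OF sO] i)
      moreover have "- (inverse x * inverse y) * (y - x) = inverse y - inverse x" using False i(3) by (simp add: field_simps)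
      ultimately have "inverse y - inverse x \<in> mx \<O>" by simp
      thus ?thesis unfolding R_def using subfld_inverse[OF subfld_FF xF] subfld_inverse[OF B(1) y(2)] i(2) by blast
    qed (use \<open>0 \<in> R\<close> in simp)
    fix x' assume x': "x' \<in> R"
    then obtain y' where y': "y' \<in> \<O>" "y' \<in> B" "y' - x' \<in> mx \<O>" by (auto simp: R_def)
    have xF': "x' \<in> FF m" using x' by (simp add: R_def)
    have "(y - x) - (y' - x') \<in> mx \<O>" by (rule m_diff[OF y(3) y'(3)])
    hence "(y - y') - (x - x') \<in> mx \<O>" by (simp add: algebra_simps)
    thus "x - x' \<in> R" unfolding R_def using subfld_diff[OF subfld_FF xF xF'] subfld_diff[OF B(1) y(2) y'(2)] subrng_diff[OF sO y(1) y'(1)] by blast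
    have "y * (y' - x') + x' * (y - x) \<in> mx \<O>" by (intro m_add m_mult y y' FO[OF x'])
    hence "y * y' - x * x' \<in> mx \<O>" by (simp add: algebra_simps)
    thus "x * x' \<in> R" unfolding R_def using subfld_mult[OF subfld_FF xF xF'] subfld_mult[OF B(1) y(2) y'(2)] subrng_mult[OF sO y(1) y'(1)] by blast
  qed
  moreover have "finite R" by (rule finite_subset[OF _ FF_card(1)[OF m]]) (auto simp: R_def)
  moreover have "FFq \<subseteq> R"
  proof
    fix x :: "'a rat_closure" assume x: "x \<in> FFq"
    hence "x \<in> FF m" "x \<in> \<O>" "x \<in> B" using FFq_FF[of m] FFq_O FFq_le B(2) by auto
    thus "x \<in> R" unfolding R_def using m_0 by (intro CollectI conjI bexI[of _ x]) auto
  qed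
  ultimately obtain j where j: "j > 0" "R = FF j" using finite_subfld_FF by blast
  have r1: "\<exists>x\<in>FF j. y - x \<in> mx \<O>" if "y \<in> \<O> \<inter> B" for y
    using r[OF that] that unfolding j(2)[symmetric] R_def by blast
  have r2: "\<exists>y\<in>\<O> \<inter> B. y - x \<in> mx \<O>" if "x \<in> FF j" for x using that unfolding j(2)[symmetric] R_def by blast
  have "FF j \<subseteq> (FF m :: 'a rat_closure set)" unfolding j(2)[symmetric] R_def by blast
  thus ?thesis using that[OF j(1) _ rcard_level[OF j(1) B(1) r1 r2] r1 r2] by blast
qed

text \<open>The case m = 1 of \<open>decomposition\<close>: adjoining \<open>FF 1\<close> = F_q
  changes nothing.\<close>

lemma ncyc_residue:
  assumes N: "N \<noteq> 0" and y: "y \<in> \<O>" "y \<in> ncyc n N" shows "\<exists>a. y - const_emb a \<in> mx \<O>"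
proof -
  have "y \<in> \<O> \<inter> const_ext (ncyc n N) 1" using y gen_incl unfolding const_ext_gen by blast
  from decomposition(2)[OF N _ this] obtain x where "x \<in> FF 1" "y - x \<in> mx \<O>" by auto
  thus ?thesis unfolding FF_1 by blast
qed

lemma FF_Int_ncyc: assumes N: "N \<noteq> 0" and m: "m > 0" shows "FF m \<inter> ncyc n N \<subseteq> (FFq :: 'a rat_closure set)"
proof
  fix x :: "'a rat_closure" assume x: "x \<in> FF m \<inter> ncyc n N"
  obtain a where a: "x - const_emb a \<in> mx \<O>" using ncyc_residue[OF N, of x] x FF_O(1)[OF m] by blast
  have "x - const_emb a \<in> FF m" using x FFq_FF[of m] by (intro subfld_diff[OF subfld_FF]) auto
  from FF_O(2)[OF m this a] show "x \<in> FFq" by simp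
qed

lemma rcard_inject: assumes "CARD('a) ^ i = CARD('a) ^ j" shows "i = j"
  using assms card_ge_2[where 'a = 'a] by (intro power_inject_exp[THEN iffD1]) auto

text \<open>A basis of \<open>FF j\<close> over \<open>FF i\<close> is lifted to \<open>K\<close>. A
  combination in the maximal ideal is congruent to one of constants, which must vanish.\<close>

lemma Dec_ef_le_FF:
  fixes g :: real
  assumes B: "subfld B" "\<kk> \<subseteq> B" and G: "Gal B A" "finite (Rst (Aut B) A)"
    and K: "subfld K" "K \<subseteq> A" and st: "\<And>\<sigma>. \<sigma> \<in> Aut B ==> \<sigma> ` K \<subseteq> K"
    and vB: "\<And>x. x \<in> B - {0} ==> \<exists>i::int. val x = of_int i * g" and g: "g > 0"
    and \<gamma>: "\<gamma> \<in> K" "\<gamma> \<noteq> 0" "of_nat e * val \<gamma> = g"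
    and j: "i > 0" "j > 0" "FF i \<subseteq> (FF j :: 'a rat_closure set)" "dimn d (FF i) (FF j :: 'a rat_closure set)"
    and r1: "\<And>y. y \<in> \<O> \<inter> B ==> \<exists>x\<in>FF i. y - x \<in> mx \<O>" and r2: "\<And>x. x \<in> FF j ==> \<exists>y\<in>\<O> \<inter> K. y - x \<in> mx \<O>"
  shows "e * d \<le> card (Rst (Dec B (\<O> \<inter> A)) K)"
proof -
  obtain w :: "nat \<Rightarrow> 'a rat_closure" where w: "indep (FF i) {..<d} w" "FF j = {\<Sum>l<d. c l * w l | c. \<forall>l<d. c l \<in> FF i}"
    using dimn_basis[OF j(4) subfld_FF] by blast
  have wF: "w l \<in> FF j" if "l < d" for l unfolding w(2) by (rule basis_mem[OF subfld_FF that])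
  have "\<forall>l. \<exists>y. l < d \<longrightarrow> y \<in> \<O> \<inter> K \<and> y - w l \<in> mx \<O>" using r2 wF by blast
  from choice[OF this] obtain u where u: "\<And>l. l < d ==> u l \<in> \<O> \<inter> K" "\<And>l. l < d ==> u l - w l \<in> mx \<O>" by blast
  have "e * card {..<d} \<le> card (Rst (Dec B (\<O> \<inter> A)) K)"
  proof (rule Dec_ef_le[OF algcl_mono[OF algcl_ratfun B] B(2) G K st vB g \<gamma>])
    fix c assume c: "\<And>l. l \<in> {..<d} ==> c l \<in> B \<inter> \<O>" and s: "(\<Sum>l<d. c l * u l) \<in> mx \<O>"
    have "\<forall>l. \<exists>x. l < d \<longrightarrow> x \<in> FF i \<and> c l - x \<in> mx \<O>" using r1 c by blast
    from choice[OF this] obtain b where b: "\<And>l. l < d ==> b l \<in> FF i" "\<And>l. l < d ==> c l - b l \<in> mx \<O>" by blast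
    have "(\<Sum>l<d. c l * (u l - w l) + w l * (c l - b l)) \<in> mx \<O>"
      using wF FF_O(1)[OF j(2)] c by (intro m_sum m_add m_mult b(2) u(2)) auto
    from m_diff[OF s this] have "(\<Sum>l<d. b l * w l) \<in> mx \<O>" by (simp add: algebra_simps flip: sum_subtractf)
    moreover have "(\<Sum>l<d. b l * w l) \<in> FF j" unfolding w(2) using b(1) by blast
    ultimately have "(\<Sum>l<d. b l * w l) = 0" using FF_O(2)[OF j(2)] by blast
    hence "\<forall>l\<in>{..<d}. b l = 0" using w(1) b(1) unfolding indep_def by blast
    thus "\<forall>l\<in>{..<d}. c l \<in> mx \<O>" using b(2) by fastforce
  qed (use u in auto)
  thus ?thesis by simp
qed

text \<open>The bounds \<open>e f \<le> |D|\<close> for \<open>K\<close> over \<open>k\<close> and \<open>A\<close> over \<open>K\<close> multiply to the equality for \<open>A\<close> over \<open>k\<close>.\<close>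

lemma card_Rst_Dec:
  assumes A: "Gal \<kk> A" "finite (Rst (Aut \<kk>) A)" and m: "m > 0" "FF m \<subseteq> A"
    and \<gamma>: "\<gamma> \<in> A" "\<gamma> \<noteq> 0" "of_nat E * val \<gamma> = 1" "card (Rst (Dec \<kk> (\<O> \<inter> A)) A) = E * m"
    and K: "Gal \<kk> K" "K \<subseteq> A" and j: "j > 0" "FF j \<subseteq> (FF m :: 'a rat_closure set)"
    and r1: "\<And>y. y \<in> \<O> \<inter> K ==> \<exists>x\<in>FF j. y - x \<in> mx \<O>" and r2: "\<And>x. x \<in> FF j ==> \<exists>y\<in>\<O> \<inter> K. y - x \<in> mx \<O>"
    and pK: "piK \<in> K" "piK \<noteq> 0" "val piK > 0" "\<And>x. x \<in> K - {0} ==> \<exists>i::int. val x = of_int i * val piK" and e: "of_nat e * val piK = 1"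
  shows "card (Rst (Dec \<kk> (\<O> \<inter> A)) K) = e * j"
proof -
  note sA = Gal_D(1)[OF A(1)] and sK = Gal_D(1)[OF K(1)] and kK = Gal_D(2)[OF K(1)]
  obtain piA e' where pA: "piA \<in> A" "piA \<noteq> 0" "val piA > 0" "\<And>x. x \<in> A - {0} ==> \<exists>i::int. val x = of_int i * val piA"
    and e': "e' > 0" "of_nat e' * val piA = 1"
    by (rule discrete_index[OF sA Gal_D(2)[OF A(1)] Gal_dimn[OF algcl_ratfun A]]) (rule that; assumption)
  \<comment> \<open>A value 1/l is a multiple of the least value 1/e', so \<open>l\<close> divides
    \<open>e'\<close>.\<close>
  have mult: "\<exists>i::nat. val x = of_nat i * val piA \<and> e' = l * i" if x: "x \<in> A" "x \<noteq> 0" and l: "of_nat l * val x = 1" for x l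
  proof -
    obtain i :: int where i: "val x = of_int i * val piA" using pA(4)[of x] x by blast
    have "val x > 0" using l by (metis of_nat_0_le_iff not_less zero_less_mult_iff zero_less_one)
    hence "i > 0" using i pA(3) by (simp add: zero_less_mult_iff)
    moreover have "real e' * val piA = (real l * of_int i) * val piA" using e'(2) l i by simp
    hence "real e' = real (l * nat i)" using pA(3) \<open>i > 0\<close> by simp
    hence "e' = l * nat i" by (simp only: of_nat_eq_iff)
    ultimately show ?thesis using i by (intro exI[of _ "nat i"]) simp
  qed
  obtain l where "e' = E * l" using mult[OF \<gamma>(1-3)] by blast
  hence Ee: "E \<le> e'" using e'(1) by (cases l) auto
  obtain e1 where e1: "of_nat e1 * val piA = val piK" "e' = e * e1" using mult[OF _ pK(2) e] pK(1) K(2) by (metis subsetD)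
  obtain d where d: "dimn d (FF j) (FF m :: 'a rat_closure set)"
    using finite_subfld_card[OF subfld_FF subfld_FF j(2) FF_card(1)[OF m(1)]] by blast
  have md: "m = j * d" by (rule dim_FF[OF m(1) j(1,2) d])
  have l1: "e1 * d \<le> card (Rst (Dec K (\<O> \<inter> A)) A)"
    by (rule Dec_ef_le_FF[OF sK kK Gal_top[OF A(1) kK K(2)] finite_Rst_mono[OF A(2) Aut_mono[OF kK]] sA order.refl _ pK(4,3) pA(1,2) e1(1) j(1) m(1) j(2) d r1])
      (use Gal_image[OF A(1)] Aut_mono[OF kK] FF_O(1)[OF m(1)] m m_0 in \<open>auto intro!: bexI[of _ x for x]\<close>)
  have l2: "e * j \<le> card (Rst (Dec \<kk> (\<O> \<inter> A)) K)"
  proof (rule Dec_ef_le_FF[OF subfld_ratfun order.refl A sK K(2) _ _ _ pK(1,2) e, of 1 j])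
    show "dimn j (FF 1) (FF j :: 'a rat_closure set)" "FF 1 \<subseteq> (FF j :: 'a rat_closure set)" unfolding FF_1 by (rule Rst_FF(3)[OF j(1)], rule FFq_FF)
    show "\<exists>i::int. val x = of_int i * 1" if "x \<in> \<kk> - {0}" for x using val_k that by simp
    show "\<exists>x\<in>FF 1. y - x \<in> mx \<O>" if "y \<in> \<O> \<inter> \<kk>" for y using const_residue[of y] that unfolding FF_1 by blast
  qed (use Gal_image[OF K(1)] r2 j in auto)
  have "Dec K (\<O> \<inter> A) = {\<sigma> \<in> Dec \<kk> (\<O> \<inter> A). \<forall>x\<in>K. \<sigma> x = x}" unfolding Dec_def Aut_def using kK by blast
  hence "E * m = card (Rst (Dec \<kk> (\<O> \<inter> A)) K) * card (Rst (Dec K (\<O> \<inter> A)) A)"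
    using card_Rst_tower[OF autgrp_Dec K(2) finite_Rst_mono[OF A(2)], of \<kk> "\<O> \<inter> A"] Dec_Aut \<gamma>(4) by (metis subsetI)
  \<comment> \<open>The two orders are bounded below by \<open>e * j\<close> and
    \<open>e1 * d\<close>, while their product is at most the product of these bounds; so neither
    bound can be strict.\<close>
  moreover have "E * m \<le> (e * j) * (e1 * d)" using Ee unfolding e1(2) md by (simp add: mult_ac)
  moreover have "e1 * d > 0" using e'(1) m(1) unfolding e1(2) md by simp
  ultimately show ?thesis using l1 l2 mult_less_le_imp_less[of "e * j" "card (Rst (Dec \<kk> (\<O> \<inter> A)) K)" "e1 * d"]
    by (metis le_neq_implies_less not_le zero_le)
qed

lemma Dec_mx:
  assumes A: "subfld A" "\<kk> \<subseteq> A" and s: "\<sigma> \<in> Dec \<kk> (\<O> \<inter> A)" and x: "x \<in> A" "x \<in> mx \<O>"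
  shows "\<sigma> x \<in> mx \<O>"
proof (cases "x = 0")
  case True thus ?thesis using x(2) hom_0[OF Aut_fhom[OF Dec_Aut[OF s]]] by simp
next
  case False
  thus ?thesis using m_val[of x] m_val[of "\<sigma> x"] x Dec_val[OF A s x(1)] hom_nonzero[OF Aut_fhom[OF Dec_Aut[OF s]], of x] by simp
qed

text \<open>Each automorphism over \<open>B\<close> is realised on the constants by an element of
  the decomposition group that fixes \<open>y\<close>. It preserves congruences, so the constant
  congruent to \<open>y\<close> goes to a congruent constant, which is itself.\<close>

lemma residue_in:
  assumes A: "subfld A" "\<kk> \<subseteq> A" "FF m \<subseteq> A" and m: "m > 0" and B: "subfld B" "\<kk> \<subseteq> B" "B \<subseteq> A"
    and D: "\<And>\<rho>. \<rho> \<in> Aut B ==> \<exists>\<sigma>\<in>Dec \<kk> (\<O> \<inter> A). (\<forall>x\<in>B. \<sigma> x = x) \<and> (\<forall>x\<in>FF m. \<sigma> x = \<rho> x)"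
    and x: "x \<in> FF m" and y: "y \<in> B" "y - x \<in> mx \<O>"
  shows "x \<in> B"
proof (rule Sep_fixed[OF algcl_mono[OF algcl_ratfun B(1,2)]])
  show "x \<in> Sep B" using FF_Sep[OF m _ B(1)] FFq_le B(2) x by blast
  fix \<rho> assume r: "\<rho> \<in> Aut B"
  obtain \<sigma> where s: "\<sigma> \<in> Dec \<kk> (\<O> \<inter> A)" "\<forall>x\<in>B. \<sigma> x = x" "\<forall>x\<in>FF m. \<sigma> x = \<rho> x" using D[OF r] by (elim bexE conjE)
  have "\<sigma> (y - x) \<in> mx \<O>" using Dec_mx[OF A(1,2) s(1) _ y(2)] subfld_diff[OF A(1)] y(1) x A(3) B(3) by blast
  moreover have "\<sigma> (y - x) = y - \<rho> x"
    using hom_diff[OF Aut_fhom[OF Dec_Aut[OF s(1)]], of y x] bspec[OF s(2) y(1)] bspec[OF s(3) x] by simp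
  ultimately have "\<rho> x - x \<in> mx \<O>" using m_diff[OF y(2), of "y - \<rho> x"] by simp
  moreover have "\<rho> x - x \<in> FF m" using FF_stable[OF Aut_fhom[OF r], of m] x by (intro subfld_diff[OF subfld_FF]) auto
  ultimately show "\<rho> x = x" using FF_O(2)[OF m] by fastforce
qed

section \<open>Completely split places, Hilbert class fields and genus fields\<close>

lemma split_Dec_trivial:
  assumes ab: "finite_abelian_ext A E" and kE: "\<kk> \<subseteq> E" and sp: "inf_splits A E" and s: "\<sigma> \<in> Dec E (\<O> \<inter> A)" and x: "x \<in> A"
  shows "\<sigma> x = x"
proof -
  note A = finite_abelian_Gal(1)[OF ab kE] and E = finite_abelian_Gal(2)[OF ab kE] and G = finite_abelian_Gal(3)[OF ab kE]
    and fin = finite_abelian_Gal(4)[OF ab kE]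
  have EA: "E \<subseteq> A" by (rule Gal_D(2)[OF G])
  have aE: "algcl E" by (rule algcl_mono[OF algcl_ratfun E kE])
  have kA: "\<kk> \<subseteq> A" using kE EA by blast
  have "inf_prime E (\<O> \<inter> E)" using inf_prime_iff_place[OF E kE] inf_place_axioms by blast
  hence c: "card {V. field_prime A V \<and> V \<inter> E = \<O> \<inter> E} = ext_degree A E" using sp by (simp add: inf_splits_def)
  have "ext_degree A E = card (Rst (Aut E) A)" unfolding ext_degree_def
    using dim_eqI[OF E] artin[OF autgrp_Aut A _ fin] Gal_image[OF G] unfolding fixed_in_Gal[OF aE G] by blast
  moreover have ri: "restrict \<sigma> A ` (\<O> \<inter> A) = \<sigma> ` (\<O> \<inter> A)" for \<sigma> by (rule image_cong) auto
  moreover have "{V. field_prime A V \<and> V \<inter> E = \<O> \<inter> E} \<subseteq> (\<lambda>\<sigma>. \<sigma> ` (\<O> \<inter> A)) ` Aut E"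
  proof
    fix V assume "V \<in> {V. field_prime A V \<and> V \<inter> E = \<O> \<inter> E}"
    hence V: "field_prime A V" "V \<inter> E = \<O> \<inter> E" by auto
    have "V \<inter> \<kk> = inf_ring" using V(2) kE inf by blast
    hence "inf_prime A V" using V(1) by (simp add: inf_prime_def)
    then obtain \<O>' where O': "inf_place \<O>'" "V = \<O>' \<inter> A" using inf_prime_iff_place[OF A kA] by blast
    interpret O': inf_place \<O>' by (rule O'(1))
    have eq: "(\<O> \<inter> A) \<inter> E = (\<O>' \<inter> A) \<inter> E" using V(2) O'(2) EA by blast
    obtain \<tau> where "\<tau> \<in> Aut E" "\<tau> ` (\<O> \<inter> A) = \<O>' \<inter> A"
      by (rule vrings_conjugate[OF aE G fin vring_O_Int[OF A] tors_O_Int[OF A] O'.vring_O_Int[OF A] O'.tors_O_Int[OF A] eq])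
    thus "V \<in> (\<lambda>\<sigma>. \<sigma> ` (\<O> \<inter> A)) ` Aut E" using O'(2) by (intro image_eqI[where x = \<tau>]) auto
  qed
  moreover have "(\<lambda>\<sigma>. \<sigma> ` (\<O> \<inter> A)) ` Aut E = (\<lambda>\<rho>. \<rho> ` (\<O> \<inter> A)) ` Rst (Aut E) A"
    by (simp only: Rst_def image_image ri)
  ultimately have "{V. field_prime A V \<and> V \<inter> E = \<O> \<inter> E} \<subseteq> (\<lambda>\<rho>. \<rho> ` (\<O> \<inter> A)) ` Rst (Aut E) A"
    and e: "ext_degree A E = card (Rst (Aut E) A)" by simp_all
  hence "card (Rst (Aut E) A) \<le> card ((\<lambda>\<rho>. \<rho> ` (\<O> \<inter> A)) ` Rst (Aut E) A)"
    using card_mono[OF finite_imageI[OF fin]] unfolding c[unfolded e, symmetric] by blast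
  \<comment> \<open>The primes above that of E are the images under the group. As there are as many
    primes as restrictions, only the identity restriction can stabilise the given prime.\<close>
  hence inj: "inj_on (\<lambda>\<rho>. \<rho> ` (\<O> \<inter> A)) (Rst (Aut E) A)" using card_image_le[OF fin] fin by (intro eq_card_imp_inj_on) (auto intro: antisym)
  have "restrict \<sigma> A = restrict id A"
  proof (rule inj_onD[OF inj])
    show "restrict \<sigma> A ` (\<O> \<inter> A) = restrict id A ` (\<O> \<inter> A)" using s by (simp add: ri Dec_def)
    show "restrict \<sigma> A \<in> Rst (Aut E) A" "restrict id A \<in> Rst (Aut E) A" unfolding Rst_def
      by (rule imageI, rule Dec_Aut[OF s], rule imageI, rule autgrpD(4)[OF autgrp_Aut])
  qed
  thus ?thesis using x by (simp add: restrict_eq_iff)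
qed

text \<open>The element lies in a composite of \<open>K\<close> with finitely many extensions of E
  that split at infinity. The decomposition group over E K acts trivially on each of them, so it
  fixes \<open>y\<close>, and the decomposition field is immediate.\<close>

lemma hilbert_residue:
  assumes E: "subfld E" "\<kk> \<subseteq> E" and K: "subfld K" and y: "y \<in> \<O>" "y \<in> gen (hilbert_class_field E \<union> K)"
  shows "\<exists>x\<in>\<O> \<inter> gen (E \<union> K). y - x \<in> mx \<O>"
proof (cases "y = 0")
  case True thus ?thesis using m_0 subrng_0[OF sO] subfld_0[OF subfld_gen] by (intro bexI[of _ 0]) auto
next
  case y0: False
  define \<A> where "\<A> = {A. finite_abelian_ext A E \<and> unramified_ext A E \<and> inf_splits A E}"
  define B where "B = gen (E \<union> K)"
  have B: "subfld B" "E \<subseteq> B" "K \<subseteq> B" unfolding B_def using subfld_gen gen_incl[of "E \<union> K"] by auto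
  have kB: "\<kk> \<subseteq> B" using E(2) B(2) by blast
  have aB: "algcl B" by (rule algcl_mono[OF algcl_ratfun B(1) kB])
  have aE: "algcl E" by (rule algcl_mono[OF algcl_ratfun E])
  have "y \<in> gen (\<Union>\<A> \<union> K)" using y(2) unfolding hilbert_class_field_def generate_field_eq_gen \<A>_def gen_Un_gen .
  then obtain T where T: "finite T" "T \<subseteq> \<Union>\<A> \<union> K" "y \<in> gen T" by (rule gen_finite_subset)
  have "\<forall>z\<in>T - K. \<exists>A. A \<in> \<A> \<and> z \<in> A" using T(2) by blast
  then obtain h where h: "\<And>z. z \<in> T - K ==> h z \<in> \<A> \<and> z \<in> h z" by metis
  define C where "C = gen (B \<union> \<Union>((\<lambda>z. gen (B \<union> h z)) ` (T - K)))"
  have GA: "Gal B (gen (B \<union> h z)) \<and> finite (Rst (Aut B) (gen (B \<union> h z)))" if z: "z \<in> T - K" for z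
  proof -
    have ab: "finite_abelian_ext (h z) E" using h[OF z] by (simp add: \<A>_def)
    have "finite (Rst (Aut B) (gen (B \<union> h z)))"
    proof (rule finite_Rst_comp)
      show "finite (Rst (Aut B) B)"
        by (rule finite_subset[of _ "{restrict id B}"]) (auto simp: Rst_def restrict_eq_iff Aut_fix)
      show "finite (Rst (Aut B) (h z))" by (rule finite_Rst_mono[OF finite_abelian_Gal(4)[OF ab E(2)] Aut_mono[OF B(2)]])
    qed
    thus ?thesis using Gal_lift[OF aE finite_abelian_Gal(3)[OF ab E(2)] B(2,1)] by blast
  qed
  have GC: "Gal B C" unfolding C_def by (rule Gal_Union[OF aB]) (use GA in blast)
  have finC: "finite (Rst (Aut B) C)"
  proof -
    have "finite S ==> S \<subseteq> T - K ==> finite (Rst (Aut B) (gen (B \<union> \<Union>((\<lambda>z. gen (B \<union> h z)) ` S))))" for S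
    proof (induction S rule: finite_induct)
      case empty
      show ?case by (rule finite_subset[of _ "{restrict id (gen (B \<union> \<Union>((\<lambda>z. gen (B \<union> h z)) ` {})))}"])
          (auto simp: Rst_def restrict_eq_iff Aut_fix gen_subfld[OF B(1)])
    next
      case (insert z S)
      have e: "gen (B \<union> \<Union>((\<lambda>z. gen (B \<union> h z)) ` insert z S)) = gen (gen (B \<union> \<Union>((\<lambda>z. gen (B \<union> h z)) ` S)) \<union> gen (B \<union> h z))"
        unfolding gen_Un_gen[of "B \<union> \<Union>((\<lambda>z. gen (B \<union> h z)) ` S)"] by (intro arg_cong[where f = gen]) auto
      show ?case unfolding e by (rule finite_Rst_comp) (use insert GA in auto)
    qed
    from this[of "T - K"] show ?thesis using T(1) unfolding C_def by simp
  qed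
  have hC: "h z \<subseteq> C" if "z \<in> T - K" for z
    using gen_incl[of "B \<union> h z"] gen_incl[of "B \<union> \<Union>((\<lambda>z. gen (B \<union> h z)) ` (T - K))"] that unfolding C_def by blast
  have TC: "T \<subseteq> C"
  proof
    fix z assume z: "z \<in> T"
    show "z \<in> C"
    proof (cases "z \<in> K")
      case True thus ?thesis using B(3) Gal_D(2)[OF GC] by blast
    next
      case False thus ?thesis using hC[of z] h[of z] z by blast
    qed
  qed
  have yC: "y \<in> C" using T(3) gen_least[OF Gal_D(1)[OF GC] TC] by blast
  have "\<exists>x\<in>B. x \<noteq> 0 \<and> x / y - 1 \<in> mx \<O>"
  proof (rule decomposition_field_immediate[OF aB kB GC finC yC y0])
    fix \<sigma> assume s: "\<sigma> \<in> Dec B (\<O> \<inter> C)"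
    have sB: "\<sigma> \<in> Aut B" by (rule Dec_Aut[OF s])
    have "\<sigma> y = id y"
    proof (rule aut_agree_gen[OF Aut_fhom[OF sB] fhom_id _ T(3)])
      fix z assume z: "z \<in> T"
      show "\<sigma> z = id z"
      proof (cases "z \<in> K")
        case True thus ?thesis using Aut_fix[OF sB] B(3) by auto
      next
        case False
        hence zT: "z \<in> T - K" using z by blast
        have ab: "finite_abelian_ext (h z) E" "inf_splits (h z) E" using h[OF zT] by (auto simp: \<A>_def)
        have sE: "\<sigma> \<in> Aut E" using Aut_mono[OF B(2)] sB by blast
        have im: "\<sigma> ` h z = h z" by (rule Gal_image[OF finite_abelian_Gal(3)[OF ab(1) E(2)] sE])
        have "\<sigma> ` (\<O> \<inter> h z) = \<sigma> ` ((\<O> \<inter> C) \<inter> h z)" using hC[OF zT] by (intro arg_cong[where f = "\<lambda>S. \<sigma> ` S"]) blast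
        also have "\<dots> = \<sigma> ` (\<O> \<inter> C) \<inter> \<sigma> ` h z" by (rule image_Int[OF bij_is_inj[OF Aut_bij[OF sB]]])
        also have "\<dots> = \<O> \<inter> h z" using s im hC[OF zT] by (auto simp: Dec_def)
        finally have "\<sigma> \<in> Dec E (\<O> \<inter> h z)" using sE by (simp add: Dec_def)
        from split_Dec_trivial[OF ab(1) E(2) ab(2) this] h[OF zT] show ?thesis by simp
      qed
    qed
    thus "\<sigma> y = y" by simp
  qed
  then obtain x where x: "x \<in> B" "x \<noteq> 0" "x / y - 1 \<in> mx \<O>" by blast
  thus ?thesis using cong1_val(2,3)[OF x(3,2) y0 y(1)] m_uminus[of "x - y"] unfolding B_def by (intro bexI[of _ x]) auto
qed

end

lemma finite_abelian_ext_refl: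
  assumes "subfld K" "\<kk> \<subseteq> K" shows "finite_abelian_ext K K"
proof (rule finite_abelian_extI[OF assms])
  show "Gal K K" using assms(1) Sep_base[OF assms(1)] by (auto simp: Gal_def Aut_fix)
  show "finite (Rst (Aut K) K)"
    by (rule finite_subset[of _ "{restrict id K}"]) (auto simp: Rst_def restrict_eq_iff Aut_fix)
qed (auto simp: Aut_fix)

text \<open>Places K in the family that defines its own Hilbert class field. All primes count here,
  so each is extended to a place with a uniformizer of the prime of k below; that prime is
  nontrivial because K is integral over k.\<close>

lemma unramified_refl:
  assumes K: "finite_abelian_ext K \<kk>" shows "unramified_ext K K"
  unfolding unramified_ext_def
proof (intro allI impI)
  fix V assume V: "field_prime K V"
  note sK = finite_abelian_Gal(1)[OF K order.refl] and G = finite_abelian_Gal(3)[OF K order.refl] and fin = finite_abelian_Gal(4)[OF K order.refl]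
  have kK: "\<kk> \<subseteq> K" by (rule Gal_D(2)[OF G])
  have v: "vring K V" "FFq \<subseteq> V" "V \<noteq> K" using V by (auto simp: field_prime_iff)
  have "\<not> \<kk> \<subseteq> V"
  proof
    assume kV: "\<kk> \<subseteq> V"
    have "x \<in> V" if x: "x \<in> K" for x
    proof -
      obtain p where p: "minpol \<kk> x p" using minpol_exists[OF algcl_ratfun] by blast
      show ?thesis by (rule vring_int_closed[OF sK v(1) x, of p]) (use p kV in \<open>auto simp: minpol_def intro: pover_mono\<close>)
    qed
    thus False using v(3) vringD(2)[OF v(1)] by blast
  qed
  hence vk: "vring \<kk> (V \<inter> \<kk>)" "FFq \<subseteq> V \<inter> \<kk>" "V \<inter> \<kk> \<noteq> \<kk>" using vring_Int[OF v(1) subfld_ratfun kK] v(2) FFq_le by auto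
  obtain \<pi> where p: "\<pi> \<in> mx (V \<inter> \<kk>)" "\<pi> \<noteq> 0" "\<And>x. x \<in> \<kk> ==> x \<noteq> 0 ==> \<exists>i::int. x * \<pi> powi i \<in> (V \<inter> \<kk>) - mx (V \<inter> \<kk>)"
    using base_uniformizer[OF vk] by blast
  obtain W where W: "vring UNIV W" "W \<inter> K = V" using chevalley[OF sK v(1)] by blast
  have Wk: "V \<inter> \<kk> = W \<inter> \<kk>" using W(2) kK by blast
  have mk: "mx (V \<inter> \<kk>) = mx W \<inter> \<kk>" unfolding Wk by (rule mx_Int[OF subfld_ratfun])
  have pl: "place W \<kk> \<pi>"
  proof
    show "\<exists>i::int. x * \<pi> powi i \<in> W - mx W" if "x \<in> \<kk>" "x \<noteq> 0" for x using p(3)[OF that] mk Wk by blast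
  qed (use W(1) algcl_ratfun p(1,2) mk in auto)
  have "dimn (card (Rst (Aut \<kk>) K)) \<kk> K"
    using artin[OF autgrp_Aut sK _ fin] Gal_image[OF G] unfolding fixed_in_Gal[OF algcl_ratfun G] by blast
  then obtain piK where pK: "piK \<in> K" "piK \<noteq> 0" "place.val W \<pi> piK > 0" "\<And>x. x \<in> K - {0} ==> \<exists>i::int. place.val W \<pi> x = of_int i * place.val W \<pi> piK"
    using place.discrete[OF pl sK kK] by blast
  have "place.val W \<pi> piK = of_nat 1 * place.val W \<pi> piK" by simp
  from ram_index_O[OF pl sK order.refl sK kK pK pK this] show "ram_index K V = 1" unfolding W(2) .
qed

lemma splits_refl:
  assumes K: "subfld K" "\<kk> \<subseteq> K" shows "inf_splits K K"
  unfolding inf_splits_def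
proof (intro allI impI)
  fix W assume W: "inf_prime K W"
  note G = finite_abelian_Gal(3,4)[OF finite_abelian_ext_refl[OF K] K(2)]
  have "{V. field_prime K V \<and> V \<inter> K = W} = {W}" using W by (auto simp: inf_prime_def field_prime_def)
  moreover have "Rst (Aut K) K = {restrict id K}"
    using autgrpD(4)[OF autgrp_Aut[of K]] by (auto simp: Rst_def restrict_eq_iff Aut_fix image_iff intro!: bexI[of _ id])
  hence "ext_degree K K = 1" unfolding ext_degree_def
    using dim_eqI[OF K(1)] artin[OF autgrp_Aut K(1) _ G(2)] Gal_image[OF G(1)]
    unfolding fixed_in_Gal[OF algcl_mono[OF algcl_ratfun K] G(1)] by fastforce
  ultimately show "card {V. field_prime K V \<and> V \<inter> K = W} = ext_degree K K" by simp
qed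

lemma genus_field_bounds:
  assumes K: "finite_abelian_ext K \<kk>"
  shows "K \<subseteq> genus_field K" "genus_field K \<subseteq> hilbert_class_field K" "subfld (genus_field K)"
proof -
  have sK: "subfld K" "\<kk> \<subseteq> K" using finite_abelian_Gal(1)[OF K order.refl] Gal_D(2)[OF finite_abelian_Gal(3)[OF K order.refl]] by auto
  have hK: "K \<subseteq> hilbert_class_field K" unfolding hilbert_class_field_def generate_field_eq_gen
    using finite_abelian_ext_refl[OF sK] unramified_refl[OF K] splits_refl[OF sK] by (intro order.trans[OF _ gen_incl] Union_upper) auto
  show "K \<subseteq> genus_field K" unfolding genus_field_def generate_field_eq_gen
    using K hK by (intro order.trans[OF _ gen_incl] Union_upper) auto
  show "genus_field K \<subseteq> hilbert_class_field K" unfolding genus_field_def generate_field_eq_gen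
    by (rule gen_least) (auto simp: hilbert_class_field_def generate_field_eq_gen subfld_gen)
  show "subfld (genus_field K)" by (simp add: genus_field_def generate_field_eq_gen subfld_gen)
qed

lemma composite_gen: "A \<squnion>\<^sub>F B = gen (A \<union> B)"
  by (simp add: composite_def generate_field_eq_gen)

section \<open>Degrees as numbers of restrictions, and constants in composites\<close>

lemma card_Rst_gen: "card (Rst (Aut B) (gen (B \<union> Z))) = card (Rst (Aut B) Z)"
  unfolding Rst_def
proof (rule card_image_kernel)
  fix \<sigma> \<tau> assume s: "\<sigma> \<in> Aut B" "\<tau> \<in> Aut B"
  show "restrict \<sigma> (gen (B \<union> Z)) = restrict \<tau> (gen (B \<union> Z)) \<longleftrightarrow> restrict \<sigma> Z = restrict \<tau> Z"
    unfolding restrict_eq_iff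
  proof
    assume e: "\<forall>x\<in>Z. \<sigma> x = \<tau> x"
    show "\<forall>x\<in>gen (B \<union> Z). \<sigma> x = \<tau> x"
    proof
      show "\<sigma> x = \<tau> x" if "x \<in> gen (B \<union> Z)" for x
        by (rule aut_agree_gen[OF Aut_fhom[OF s(1)] Aut_fhom[OF s(2)] _ that]) (use e Aut_fix[OF s(1)] Aut_fix[OF s(2)] in auto)
    qed
  qed (use gen_incl[of "B \<union> Z"] in blast)
qed

lemma Rst_dvd:
  fixes B :: "'w::alg_closed_field set"
  assumes B: "algcl B" and A: "Gal B A" "finite (Rst (Aut B) A)" and C: "Gal B C" "C \<subseteq> A"
  shows "card (Rst (Aut B) C) dvd card (Rst (Aut B) A)"
proof -
  note sC = Gal_D(1)[OF C(1)] and BC = Gal_D(2)[OF C(1)] and sB = algcl_subfld[OF B]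
  have d1: "dimn (card (Rst (Aut B) C)) B C" by (rule Gal_dimn[OF B C(1) finite_Rst_subset[OF A(2) C(2)]])
  have "dimn (card (Rst (Aut C) A)) C A"
    by (rule Gal_dimn[OF algcl_mono[OF B sC BC] Gal_top[OF A(1) BC C(2)] finite_Rst_mono[OF A(2) Aut_mono[OF BC]]])
  from ring.telescopic_base[OF ring_Om _ _ d1 this] have "dimn (card (Rst (Aut B) C) * card (Rst (Aut C) A)) B A"
    using sB sC by (simp add: subfield_iff_subfld)
  from dimn_unique[OF sB this Gal_dimn[OF B A]] show ?thesis by (metis dvd_triv_left)
qed

text \<open>The group of \<open>Aut C\<close> on \<open>A\<close> has fixed field A \<inter> C, so
  its order is the degree [A : A \<inter> C].\<close>

lemma Rst_restrict_dvd:
  fixes B :: "'w::alg_closed_field set"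
  assumes B: "algcl B" and A: "Gal B A" "finite (Rst (Aut B) A)" and C: "Gal B C"
  shows "card (Rst (Aut C) A) dvd card (Rst (Aut B) A)"
proof -
  note sC = Gal_D(1)[OF C(1)] and BC = Gal_D(2)[OF C(1)] and sB = algcl_subfld[OF B] and sA = Gal_D(1)[OF A(1)]
  have aC: "algcl C" by (rule algcl_mono[OF B sC BC])
  have st: "\<sigma> ` A \<subseteq> A" if "\<sigma> \<in> Aut C" for \<sigma> using Gal_image[OF A(1)] Aut_mono[OF BC] that by blast
  have fx: "fixed_in (Aut C) A = A \<inter> C"
    using Sep_fixed[OF aC] Gal_D(3)[OF A(1)] Sep_mono[OF BC] Aut_fix[of _ C] unfolding fixed_in_def by blast
  have d1: "dimn (card (Rst (Aut B) (A \<inter> C))) B (A \<inter> C)"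
    by (rule Gal_dimn[OF B Gal_Int[OF A(1) C] finite_Rst_subset[OF A(2)]]) blast
  have "dimn (card (Rst (Aut C) A)) (A \<inter> C) A"
    using artin[OF autgrp_Aut sA st finite_Rst_mono[OF A(2) Aut_mono[OF BC]]] unfolding fx .
  from ring.telescopic_base[OF ring_Om _ _ d1 this] have "dimn (card (Rst (Aut B) (A \<inter> C)) * card (Rst (Aut C) A)) B A"
    using sB subfld_Int[OF sA sC] by (simp add: subfield_iff_subfld)
  from dimn_unique[OF sB this Gal_dimn[OF B A]] show ?thesis by (metis dvd_triv_right)
qed

text \<open>Artin's theorem on \<open>FF m\<close>, where \<open>Aut B\<close> has fixed field FF m
  \<inter> B; degrees of finite fields follow from cardinalities.\<close>

lemma FF_degree:
  fixes B :: "'a::{finite,field} rat_closure set"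
  assumes B: "subfld B" "\<kk> \<subseteq> B" and m: "m > 0" "f > 0" and f: "FF m \<inter> B = FF f"
  shows "m = f * card (Rst (Aut B) (FF m))"
proof -
  have aB: "algcl B" by (rule algcl_mono[OF algcl_ratfun B])
  have "fixed_in (Aut B) (FF m) = FF f" unfolding f[symmetric]
    using Sep_fixed[OF aB] FF_Sep[OF m(1) _ B(1)] FFq_le B(2) Aut_fix[of _ B] unfolding fixed_in_def by blast
  moreover have "dimn (card (Rst (Aut B) (FF m))) (fixed_in (Aut B) (FF m)) (FF m)"
    by (rule artin[OF autgrp_Aut subfld_FF FF_stable[OF Aut_fhom] finite_Rst_mono[OF Rst_FF(1)[OF m(1)] Aut_mono[OF B(2)]]])
  ultimately show ?thesis using dim_FF[OF m] f by fastforce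
qed

text \<open>By natural irrationalities the composite of \<open>B\<close> and \<open>Z\<close> is
  generated over \<open>B\<close> by the constants \<open>FF j\<close> of \<open>FF m\<close> that
  it contains. Leastness of m gives j \<ge> m, so \<open>FF j\<close> is all of
  \<open>FF m\<close>.\<close>

lemma FF_in_composite:
  fixes B :: "'a::{finite,field} rat_closure set"
  assumes B: "subfld B" "\<kk> \<subseteq> B" and m: "m > 0" and Z: "Z \<subseteq> gen (B \<union> FF m)"
    and least: "\<And>j. j > 0 ==> Z \<subseteq> gen (B \<union> FF j) ==> m \<le> j"
  shows "FF m \<subseteq> gen (B \<union> Z)"
proof -
  define C where "C = gen (B \<union> Z)"
  have C: "subfld C" "B \<subseteq> C" "Z \<subseteq> C" "C \<subseteq> gen (B \<union> FF m)"
    unfolding C_def using subfld_gen gen_incl[of "B \<union> Z"] gen_incl[of "B \<union> FF m"] Z gen_least[OF subfld_gen, of "B \<union> Z"] by auto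
  have FB: "FFq \<subseteq> B" using FFq_le B(2) by blast
  have CB: "C = gen (B \<union> (C \<inter> FF m))"
    by (rule natural_irrationality[OF algcl_mono[OF algcl_ratfun B] C(1,2,4) subfld_FF FF_Sep[OF m FB B(1)] FF_stable[OF Aut_fhom]
          finite_Rst_mono[OF Rst_FF(1)[OF m] Aut_mono[OF B(2)]]])
  obtain j where j: "j > 0" "C \<inter> FF m = FF j"
  proof (rule finite_subfld_FF[OF subfld_Int[OF C(1) subfld_FF] finite_Int[OF disjI2[OF FF_card(1)[OF m]]]])
    show "FFq \<subseteq> C \<inter> FF m" using FB C(2) FFq_FF[of m] by blast
  qed (rule that)
  have "m \<le> j" using least[OF j(1)] C(3) CB unfolding j(2) by blast
  hence "CARD('a) ^ m \<le> CARD('a) ^ j" using card_ge_2[where 'a = 'a] by (intro power_increasing) auto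
  hence "card (FF m :: 'a rat_closure set) \<le> card (FF j :: 'a rat_closure set)" by (simp add: FF_card m j(1))
  moreover have "FF j \<subseteq> (FF m :: 'a rat_closure set)" using j(2) by blast
  ultimately have "FF j = (FF m :: 'a rat_closure set)" by (intro card_seteq FF_card m)
  thus ?thesis using j(2) unfolding C_def by blast
qed

lemma (in inf_place) rcard_base: "rcard (\<O> \<inter> \<kk>) = CARD('a) ^ 1"
proof (rule rcard_level[OF _ subfld_ratfun])
  show "\<exists>x\<in>FF 1. y - x \<in> mx \<O>" if "y \<in> \<O> \<inter> \<kk>" for y using const_residue[of y] that unfolding FF_1 by blast
  show "\<exists>y\<in>\<O> \<inter> \<kk>. y - x \<in> mx \<O>" if "x \<in> FF 1" for x
    using that FFq_O FFq_le m_0 unfolding FF_1 by (intro bexI[of _ x]) auto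
qed simp

section \<open>The minimal constant degree of K\<close>

locale min_const =
  fixes K :: "'a::{finite,field} rat_closure set" and N :: "'a poly" and n m :: nat
  assumes K: "finite_abelian_ext K \<kk>" and N: "N \<noteq> 0" and min: "min_const_degree K n N m"
begin

lemma m: "m > 0" and K_in: "K \<subseteq> gen (ncyc n N \<union> FF m)" and least: "j > 0 ==> K \<subseteq> gen (ncyc n N \<union> FF j) ==> m \<le> j"
  using min by (auto simp: min_const_degree_def const_ext_gen)

lemmas sK = finite_abelian_Gal(1)[OF K order.refl] and GK = finite_abelian_Gal(3)[OF K order.refl] and fK = finite_abelian_Gal(4)[OF K order.refl]
lemmas kK = Gal_D(2)[OF GK]

lemma evN: "ev ratfun_T N \<noteq> (0 :: 'a rat_closure)"
  using N by (simp add: ev_T_eq_0)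

lemmas Gcyc = Gal_cyclotomic[OF T_in evN] and fcyc = finite_Rst_cyclotomic[OF T_in evN]

abbreviation Y where "Y \<equiv> ncyc n N :: 'a rat_closure set"
abbreviation A where "A \<equiv> const_ext Y m"

lemma GY: "Gal \<kk> Y" and fY: "finite (Rst (Aut \<kk>) Y)"
  unfolding ncyc_gen by (intro Gal_comp[OF algcl_ratfun] Gal_wild Gcyc, intro finite_Rst_comp finite_Rst_wild fcyc)

lemmas GA = Gal_const_ext(1)[OF algcl_ratfun FFq_le GY m] and fA = Gal_const_ext(2)[OF algcl_ratfun FFq_le GY m fY]
lemmas sY = Gal_D(1)[OF GY] and kY = Gal_D(2)[OF GY]
lemmas aY = algcl_mono[OF algcl_ratfun sY kY]

lemma A_gen: "A = gen (\<L> n \<union> cyc N \<union> FF m)"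
  unfolding const_ext_gen ncyc_gen gen_Un_gen ..

lemma subs: "\<L> n \<subseteq> Y" "cyc N \<subseteq> Y" "Y \<subseteq> A" "FF m \<subseteq> A" "K \<subseteq> A" "\<kk> \<subseteq> A"
  using gen_incl[of "\<L> n \<union> cyc N"] gen_incl[of "Y \<union> FF m"] K_in Gal_D(2)[OF GA] unfolding ncyc_gen const_ext_gen by auto

lemma FF_in_YK: "FF m \<subseteq> gen (Y \<union> K)"
  by (rule FF_in_composite[OF sY kY m K_in least])

lemma YK: "gen (Y \<union> K) = A"
proof
  show "gen (Y \<union> K) \<subseteq> A" by (rule gen_least[OF Gal_D(1)[OF GA]]) (use subs in auto)
  show "A \<subseteq> gen (Y \<union> K)" unfolding const_ext_gen by (rule gen_least[OF subfld_gen]) (use FF_in_YK gen_incl[of "Y \<union> K"] in auto)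
qed

text \<open>Both choices embed into the field with the larger index and modulus
  \<open>N * N'\<close>. There \<open>FF m\<close> lies in the extension by \<open>FF m'\<close>,
  whose residues all come from \<open>FF m'\<close>; so \<open>FF m\<close> is contained in
  \<open>FF m'\<close>.\<close>

lemma m_le:
  assumes N': "N' \<noteq> 0" and min': "min_const_degree K n' N' m'" shows "m \<le> m'"
proof -
  have m': "m' > 0" and K': "K \<subseteq> gen (ncyc n' N' \<union> FF m')" using min' by (auto simp: min_const_degree_def const_ext_gen)
  define B where "B = (ncyc (max n n') (N * N') :: 'a rat_closure set)"
  have NN: "N * N' \<noteq> 0" using N N' by simp
  have cyc: "cyc M \<subseteq> (cyc (N * N') :: 'a rat_closure set)" if "M dvd N * N'" "M \<noteq> 0" for M
    using torsion_dvd[OF that(1), of ratfun_T] cyclotomic_gen[OF T_in, of M] cyclotomic_gen[OF T_in, of "N * N'"] that(2) NN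
    by (simp add: ev_T_eq_0 del: ev_mult) (intro gen_mono, blast)
  have YB: "Y \<subseteq> B" unfolding B_def ncyc_gen by (intro gen_mono Un_mono wild_mono cyc) (use N in auto)
  have YB': "ncyc n' N' \<subseteq> B" unfolding B_def ncyc_gen by (intro gen_mono Un_mono wild_mono cyc) (use N' in auto)
  have "K \<subseteq> const_ext B m'" using K' gen_mono[OF Un_mono[OF YB' order.refl], of "FF m'"] unfolding const_ext_gen by blast
  hence sub: "FF m \<subseteq> const_ext B m'" using FF_in_YK YB gen_least[of "const_ext B m'" "Y \<union> K"] gen_incl[of "B \<union> FF m'"]
    unfolding const_ext_gen using subfld_gen by blast
  obtain \<O> :: "'a rat_closure set" where "inf_place \<O>" using inf_place_exists by blast
  then interpret inf_place \<O> .
  have mm: "m * m' > 0" using m m' by simp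
  have "FF m \<subseteq> (FF m' :: 'a rat_closure set)"
  proof
    fix x :: "'a rat_closure" assume x: "x \<in> FF m"
    hence "x \<in> \<O> \<inter> const_ext (ncyc (max n n') (N * N')) m'" using sub FF_O(1)[OF m] unfolding B_def by blast
    from decomposition(2)[OF NN m' this] obtain x' where x': "x' \<in> FF m'" "x - x' \<in> mx \<O>" by blast
    \<comment> \<open>Both constants lie in a common finite field, where congruent elements are
      equal.\<close>
    have "x - x' \<in> FF (m * m')" using x x'(1) FF_dvd[of m "m * m'"] FF_dvd[of m' "m * m'"] by (intro subfld_diff[OF subfld_FF]) auto
    from FF_O(2)[OF mm this x'(2)] show "x \<in> FF m'" using x'(1) by simp
  qed
  thus ?thesis by (rule FF_le[OF _ m m'])
qed

definition F where "F = K \<inter> Y"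

lemma GF: "Gal \<kk> F" and fF: "finite (Rst (Aut \<kk>) F)" and F_fixed: "F = fixed_in (Aut Y) K"
proof -
  show "Gal \<kk> F" unfolding F_def by (rule Gal_Int[OF GK GY])
  show "finite (Rst (Aut \<kk>) F)" unfolding F_def by (rule finite_Rst_subset[OF fK]) blast
  show "F = fixed_in (Aut Y) K" unfolding F_def fixed_in_def
    using Sep_fixed[OF aY] Gal_D(3)[OF GK] Sep_mono[OF kY] Aut_fix[of _ Y] by blast
qed

text \<open>K and \<open>FF m\<close> generate the same field over Y, so they have equally many
  restrictions. For \<open>FF m\<close> the number is m because Y has no constants beyond
  F_q.\<close>

lemma card_K: "card (Rst (Aut Y) K) = m"
proof -
  obtain \<O> :: "'a rat_closure set" where "inf_place \<O>" using inf_place_exists by blast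
  then interpret inf_place \<O> .
  have "FF m \<inter> Y = FF 1" using FF_Int_ncyc[OF N m] FFq_FF[of m] FFq_le kY unfolding FF_1 by blast
  from FF_degree[OF sY kY m _ this] have "m = card (Rst (Aut Y) (FF m))" by simp
  also have "\<dots> = card (Rst (Aut Y) (gen (Y \<union> FF m)))" by (rule card_Rst_gen[symmetric])
  also have "gen (Y \<union> FF m) = gen (Y \<union> K)" unfolding YK by (simp add: const_ext_gen)
  also have "card (Rst (Aut Y) (gen (Y \<union> K))) = card (Rst (Aut Y) K)" by (rule card_Rst_gen)
  finally show ?thesis by simp
qed

lemma Aut_Y_stable: "\<sigma> \<in> Aut Y ==> \<sigma> ` K \<subseteq> K" and fYK: "finite (Rst (Aut Y) K)"
  using Gal_image[OF GK] Aut_mono[OF kY] finite_Rst_mono[OF fK Aut_mono[OF kY]] by blast+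

lemma dimn_K: "dimn m F K"
  using artin[OF autgrp_Aut sK Aut_Y_stable fYK] unfolding F_fixed[symmetric] card_K .

lemma degree_K: "ext_degree K F = m"
  using dim_eqI[OF Gal_D(1)[OF GF]] artin[OF autgrp_Aut sK Aut_Y_stable fYK] unfolding ext_degree_def F_fixed[symmetric] card_K by blast

definition M :: "'a rat_closure set" where "M = gen (\<L> n \<union> FF m)"
definition E where "E = gen (K \<union> M) \<inter> cyc N"
definition EK where "EK = gen (E \<union> K)"

lemma GM: "Gal \<kk> M"
proof -
  have "M = const_ext (\<L> n) m" by (simp add: M_def const_ext_gen)
  thus ?thesis using Gal_const_ext(1)[OF algcl_ratfun FFq_le Gal_wild[of n] m] by simp
qed

lemma GE: "Gal \<kk> E" and fE: "finite (Rst (Aut \<kk>) E)"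
  unfolding E_def by (intro Gal_Int Gal_comp[OF algcl_ratfun] GK GM Gcyc, rule finite_Rst_subset[OF fcyc], blast)

lemma E_abelian: "finite_abelian_ext E \<kk>"
  by (rule finite_abelian_extI[OF subfld_ratfun order.refl GE fE], rule cyc_commute[OF N]) (auto simp: E_def)

lemma GEK: "Gal \<kk> EK" and fEK: "finite (Rst (Aut \<kk>) EK)"
  unfolding EK_def by (rule Gal_comp[OF algcl_ratfun GE GK], rule finite_Rst_comp[OF fE fK])

lemmas sEK = Gal_D(1)[OF GEK] and kEK = Gal_D(2)[OF GEK]

lemma EK_subs: "E \<subseteq> EK" "K \<subseteq> EK" "E \<subseteq> cyc N" "EK \<subseteq> A"
proof -
  show "E \<subseteq> EK" "K \<subseteq> EK" using gen_incl[of "E \<union> K"] by (auto simp: EK_def)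
  show "E \<subseteq> cyc N" by (auto simp: E_def)
  thus "EK \<subseteq> A" unfolding EK_def by (intro gen_least Gal_D(1)[OF GA]) (use subs in auto)
qed

text \<open>Natural irrationalities over \<open>M\<close>: K M lies in the composite of
  \<open>M\<close> and \<open>cyc N\<close>, so it is generated over \<open>M\<close> by its
  intersection with \<open>cyc N\<close>, which is E.\<close>

lemma KM: "gen (K \<union> M) = gen (M \<union> E)"
proof -
  note sM = Gal_D(1)[OF GM] and kM = Gal_D(2)[OF GM]
  have "M \<subseteq> gen (K \<union> M)" using gen_incl[of "K \<union> M"] by blast
  moreover have "A \<subseteq> gen (M \<union> cyc N)" unfolding A_gen M_def gen_Un_gen by (rule gen_mono) blast
  hence "gen (K \<union> M) \<subseteq> gen (M \<union> cyc N)" using subs(5) gen_incl[of "M \<union> cyc N"] by (intro gen_least subfld_gen) auto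
  moreover have "\<sigma> ` cyc N \<subseteq> cyc N" if "\<sigma> \<in> Aut M" for \<sigma> using Gal_image[OF Gcyc] Aut_mono[OF kM] that by blast
  ultimately show ?thesis unfolding E_def
    by (rule natural_irrationality[OF algcl_mono[OF algcl_ratfun sM kM] subfld_gen _ _ Gal_D(1)[OF Gcyc]
        order.trans[OF Gal_D(3)[OF Gcyc] Sep_mono[OF kM]] _ finite_Rst_mono[OF fcyc Aut_mono[OF kM]]])
qed

lemma K_in_ELF: "K \<subseteq> gen (E \<union> \<L> n \<union> FF m)"
proof -
  have "K \<subseteq> gen (M \<union> E)" using gen_incl[of "K \<union> M"] unfolding KM[symmetric] by blast
  thus ?thesis unfolding M_def gen_Un_gen by (simp add: Un_ac)
qed

text \<open>E L_n is contained in Y, so a constant extension of it containing K gives one of Y of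
  the same level; the leastness of m therefore passes to E L_n.\<close>

lemma FF_in_EKL: "FF m \<subseteq> gen (EK \<union> \<L> n)"
proof -
  define B where "B = gen (E \<union> \<L> n)"
  have B: "subfld B" "\<kk> \<subseteq> B" unfolding B_def using Gal_D(2)[OF GE] gen_incl[of "E \<union> \<L> n"] subfld_gen by auto
  have BY: "B \<subseteq> Y" unfolding B_def by (rule gen_least[OF sY]) (use EK_subs(3) subs in auto)
  have "FF m \<subseteq> gen (B \<union> K)"
  proof (rule FF_in_composite[OF B m])
    show "K \<subseteq> gen (B \<union> FF m)" using K_in_ELF unfolding B_def gen_Un_gen .
    show "m \<le> j" if "j > 0" "K \<subseteq> gen (B \<union> FF j)" for j
      using least[OF that(1)] that(2) gen_mono[OF Un_mono[OF BY order.refl], of "FF j"] by blast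
  qed
  also have "gen (B \<union> K) = gen (EK \<union> \<L> n)" unfolding B_def EK_def gen_Un_gen by (simp add: Un_ac)
  finally show ?thesis .
qed

lemma residue_degree:
  assumes Z: "Gal \<kk> Z" "finite (Rst (Aut \<kk>) Z)" "Z \<subseteq> A"
  obtains j where "j > 0" "\<And>\<O>. inf_place \<O> ==> rcard (\<O> \<inter> Z) = CARD('a) ^ j"
proof -
  obtain \<O> :: "'a rat_closure set" where O: "inf_place \<O>" using inf_place_exists by blast
  then interpret inf_place \<O> .
  have res: "\<exists>x\<in>FF m. y - x \<in> mx \<O>" if "y \<in> \<O> \<inter> Z" for y using decomposition(2)[OF N m, of y n] that Z(3) by blast
  obtain j where j: "j > 0" "rcard (\<O> \<inter> Z) = CARD('a) ^ j" 
    by (rule residue_subfield[OF m Gal_D(1,2)[OF Z(1)] res], assumption) (rule that; assumption)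
  show ?thesis by (rule that[OF j(1)]) (use rcard_conj[OF Z(1,2) _ O] j(2) in simp)
qed

lemma residue_FF:
  assumes O: "inf_place \<O>" and Z: "Gal \<kk> Z" "Z \<subseteq> A" and c: "rcard (\<O> \<inter> Z) = CARD('a) ^ j"
  shows "j > 0" "FF j \<subseteq> (FF m :: 'a rat_closure set)"
    "\<And>y. y \<in> \<O> \<inter> Z ==> \<exists>x\<in>FF j. y - x \<in> mx \<O>" "\<And>x. x \<in> FF j ==> \<exists>y\<in>\<O> \<inter> Z. y - x \<in> mx \<O>"
proof -
  interpret inf_place \<O> by fact
  have res: "\<exists>x\<in>FF m. y - x \<in> mx \<O>" if "y \<in> \<O> \<inter> Z" for y using decomposition(2)[OF N m, of y n] that Z(2) by blast
  obtain i where i: "i > 0" "FF i \<subseteq> (FF m :: 'a rat_closure set)" "rcard (\<O> \<inter> Z) = CARD('a) ^ i"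
    "\<And>y. y \<in> \<O> \<inter> Z ==> \<exists>x\<in>FF i. y - x \<in> mx \<O>" "\<And>x. x \<in> FF i ==> \<exists>y\<in>\<O> \<inter> Z. y - x \<in> mx \<O>"
    by (rule residue_subfield[OF m Gal_D(1,2)[OF Z(1)] res], assumption) (rule that; assumption)
  have "i = j" by (rule rcard_inject) (use c i(3) in simp)
  thus "j > 0" "FF j \<subseteq> (FF m :: 'a rat_closure set)"
    "\<And>y. y \<in> \<O> \<inter> Z ==> \<exists>x\<in>FF j. y - x \<in> mx \<O>" "\<And>x. x \<in> FF j ==> \<exists>y\<in>\<O> \<inter> Z. y - x \<in> mx \<O>" using i by auto
qed

lemma rcard_mult:
  fixes Z C :: "'a rat_closure set"
  assumes Z: "Gal \<kk> Z" "finite (Rst (Aut \<kk>) Z)" and C: "subfld C" "C \<subseteq> Z"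
    and a: "\<And>\<O>. inf_place \<O> ==> rcard (\<O> \<inter> Z) = CARD('a) ^ a"
    and b: "\<And>\<O>. inf_place \<O> ==> rcard (\<O> \<inter> C) = CARD('a) ^ b" "b > 0"
  shows "a = b * f_inf Z C"
proof -
  obtain \<O> :: "'a rat_closure set" where O: "inf_place \<O>" using inf_place_exists by blast
  then interpret inf_place \<O> .
  note sZ = Gal_D(1)[OF Z(1)]
  have e: "\<O>' \<inter> Z \<inter> C = \<O>' \<inter> C" for \<O>' using C(2) by auto
  have "rcard (\<O> \<inter> Z) > 0" using a[OF O] by simp
  hence "finite (rclass (\<O> \<inter> Z) ` (\<O> \<inter> Z))" unfolding rcard_def by (rule card_ge_0_finite)
  from inertia_card[OF sZ vring_O_Int[OF sZ] C(1) this]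
  have "CARD('a) ^ a = CARD('a) ^ (b * inertia_degree C (\<O> \<inter> Z))" unfolding e a[OF O] b(1)[OF O] by (simp add: power_mult)
  moreover have "CARD('a) > 1" using card_ge_2[where 'a = 'a] by simp
  ultimately have ab: "a = b * inertia_degree C (\<O> \<inter> Z)" by (simp only: power_inject_exp)
  have "f_inf Z C = inertia_degree C (\<O> \<inter> Z)"
    by (rule f_inf_eqI[OF sZ Gal_D(2)[OF Z(1)] C(1) a _ ab b(2)]) (simp_all add: e b(1))
  thus ?thesis using ab by simp
qed

text \<open>K F_(q^m) has residue field F_(q^m), since it contains these constants and lies in A.
  Comparing exponents of q gives the factorisations.\<close>

lemma residues:
  obtains t f where "t > 0" "t = f_inf K \<kk>" "f = f_inf EK \<kk>" "f = t * f_inf EK K" "m = t * f_inf (gen (K \<union> FF m)) K"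
    "\<And>\<O>. inf_place \<O> ==> rcard (\<O> \<inter> K) = CARD('a) ^ t" "\<And>\<O>. inf_place \<O> ==> rcard (\<O> \<inter> EK) = CARD('a) ^ f"
proof -
  obtain t where t: "t > 0" "\<And>\<O>. inf_place \<O> ==> rcard (\<O> \<inter> K) = CARD('a) ^ t"
    by (rule residue_degree[OF GK fK subs(5)]) (rule that; assumption)
  obtain f where f: "f > 0" "\<And>\<O>. inf_place \<O> ==> rcard (\<O> \<inter> EK) = CARD('a) ^ f"
    by (rule residue_degree[OF GEK fEK EK_subs(4)]) (rule that; assumption)
  have k: "rcard (\<O> \<inter> \<kk>) = CARD('a) ^ 1" if "inf_place \<O>" for \<O> :: "'a rat_closure set" by (rule inf_place.rcard_base[OF that])
  note Km = Gal_const_ext[OF algcl_ratfun FFq_le GK m, unfolded const_ext_gen]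
  have KmA: "gen (K \<union> FF m) \<subseteq> A" "K \<subseteq> gen (K \<union> FF m)" "FF m \<subseteq> gen (K \<union> FF m)"
    using gen_least[OF Gal_D(1)[OF GA], of "K \<union> FF m"] subs gen_incl[of "K \<union> FF m"] by auto
  have mm: "rcard (\<O> \<inter> gen (K \<union> FF m)) = CARD('a) ^ m" if "inf_place \<O>" for \<O> :: "'a rat_closure set"
  proof -
    interpret inf_place \<O> by fact
    show ?thesis
    proof (rule rcard_level[OF m subfld_gen])
      show "\<exists>x\<in>FF m. y - x \<in> mx \<O>" if "y \<in> \<O> \<inter> gen (K \<union> FF m)" for y using decomposition(2)[OF N m, of y n] that KmA(1) by blast
      show "\<exists>y\<in>\<O> \<inter> gen (K \<union> FF m). y - x \<in> mx \<O>" if "x \<in> FF m" for x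
        using that FF_O(1)[OF m] KmA(3) m_0 by (intro bexI[of _ x]) auto
    qed
  qed
  show ?thesis
  proof (rule that[OF t(1) _ _ _ _ t(2) f(2)])
    show "t = f_inf K \<kk>" using rcard_mult[OF GK fK subfld_ratfun kK t(2) k] by simp
    show "f = f_inf EK \<kk>" using rcard_mult[OF GEK fEK subfld_ratfun kEK f(2) k] by simp
    show "f = t * f_inf EK K" by (rule rcard_mult[OF GEK fEK sK EK_subs(2) f(2) t(2,1)])
    show "m = t * f_inf (gen (K \<union> FF m)) K" by (rule rcard_mult[OF Km(1) Km(2)[OF fK] sK KmA(2) mm t(2,1)])
  qed
qed

text \<open>By \<open>hilbert_residue\<close> no residues are added from EK to the composite of the
  genus field of E with K, nor from K to its own genus field. As \<open>inertia_degree\<close> uses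
  the residues of the intersection with the base, those of B \<inter> \<open>genus_field K\<close>
  are compared.\<close>

lemma f_inf_genus: "f_inf (gen (genus_field E \<union> K)) (genus_field K) = f_inf EK K"
proof -
  obtain t f where t: "t > 0" "f = t * f_inf EK K"
    "\<And>\<O>. inf_place \<O> ==> rcard (\<O> \<inter> K) = CARD('a) ^ t" "\<And>\<O>. inf_place \<O> ==> rcard (\<O> \<inter> EK) = CARD('a) ^ f" by (rule residues) (rule that; assumption)
  note gE = genus_field_bounds[OF E_abelian] and gK = genus_field_bounds[OF K]
  note sE = Gal_D(1)[OF GE] and kE = Gal_D(2)[OF GE]
  define B where "B = gen (genus_field E \<union> K)"
  have B: "subfld B" "EK \<subseteq> B" "B \<subseteq> gen (hilbert_class_field E \<union> K)" "K \<subseteq> B"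
    unfolding B_def EK_def using gen_mono[of "E \<union> K" "genus_field E \<union> K"] gen_mono[of "genus_field E \<union> K" "hilbert_class_field E \<union> K"]
      gE subfld_gen gen_incl[of "genus_field E \<union> K"] by auto
  show ?thesis unfolding B_def[symmetric]
  proof (rule f_inf_eqI[OF B(1) _ gK(3) _ _ t(2,1)])
    show "\<kk> \<subseteq> B" using kEK B(2) by blast
    fix \<O> :: "'a rat_closure set" assume O: "inf_place \<O>"
    interpret inf_place \<O> by fact
    have "\<exists>x\<in>\<O> \<inter> EK. y - x \<in> mx \<O>" if "y \<in> \<O> \<inter> B" for y
      using hilbert_residue[OF sE kE sK, of y] that B(3) unfolding EK_def by blast
    from rcard_eq[OF sEK B(1,2) this] show "rcard (\<O> \<inter> B) = CARD('a) ^ f" using t(4)[OF O] by simp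
    have "\<exists>x\<in>\<O> \<inter> K. y - x \<in> mx \<O>" if "y \<in> \<O> \<inter> (B \<inter> genus_field K)" for y
      using hilbert_residue[OF sK kK sK, of y] that gK(2) gen_incl[of "hilbert_class_field K \<union> K"] gen_subfld[OF sK] by auto
    from rcard_eq[OF sK subfld_Int[OF B(1) gK(3)] _ this] show "rcard (\<O> \<inter> B \<inter> genus_field K) = CARD('a) ^ t"
      using t(3)[OF O] B(4) gK(1) by (simp add: Int_assoc)
  qed
qed

text \<open>The constants of \<open>FF m\<close> inside EK are exactly the residue field
  \<open>FF f\<close>, so adjoining \<open>FF m\<close> to EK has degree m/f. This degree divides
  that of EK L_n over EK, hence q^n.\<close>

lemma p_power: obtains s where "m = f_inf EK \<kk> * CHAR('a) ^ s"
proof -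
  obtain t f where t: "t > 0" "f = f_inf EK \<kk>" "f = t * f_inf EK K"
    "\<And>\<O>. inf_place \<O> ==> rcard (\<O> \<inter> EK) = CARD('a) ^ f" by (rule residues) (rule that; assumption)
  obtain \<O> :: "'a rat_closure set" where O: "inf_place \<O>" using inf_place_exists by blast
  then interpret inf_place \<O> .
  note j = residue_FF[OF O GEK EK_subs(4) t(4)[OF O]]
  note r1 = j(3) and r2 = j(4)
  have FEK: "FF m \<inter> EK = FF f"
  proof (intro equalityI subsetI IntI)
    fix x :: "'a rat_closure" assume x: "x \<in> FF m \<inter> EK"
    then obtain z where z: "z \<in> FF f" "x - z \<in> mx \<O>" using r1[of x] FF_O(1)[OF m] by blast
    have "x - z \<in> FF m" using x z j(2) by (intro subfld_diff[OF subfld_FF]) auto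
    from FF_O(2)[OF m this z(2)] show "x \<in> FF f" using z by simp
  next
    fix x :: "'a rat_closure" assume x: "x \<in> FF f"
    show xm: "x \<in> FF m" using x j(2) by blast
    obtain y where y: "y \<in> EK" "y - x \<in> mx \<O>" using r2[OF x] by blast
    show "x \<in> EK"
    proof (rule residue_in[OF Gal_D(1)[OF GA] subs(6,4) m sEK kEK EK_subs(4) _ xm y])
      fix \<rho> assume r: "\<rho> \<in> Aut EK"
      have rk: "\<rho> \<in> Aut \<kk>" using r Aut_mono[OF kEK] by blast
      \<comment> \<open>Trivial on \<open>cyc N\<close>, hence on E, where \<rho> is trivial as
        well; so it agrees with \<rho> on the generators E, L_n and \<open>FF m\<close> of a field
        containing K.\<close>
      obtain \<sigma> where s: "\<sigma> \<in> Dec \<kk> (\<O> \<inter> A)" "\<And>x. x \<in> cyc N ==> \<sigma> x = x" "\<And>x. x \<in> \<L> n ==> \<sigma> x = \<rho> x" "\<And>x. x \<in> FF m ==> \<sigma> x = \<rho> x"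
        using decomposition(1)[OF N m rk rk, where n = n] by blast
      note h = Aut_fhom[OF Dec_Aut[OF s(1)]]
      have ELF: "\<sigma> x = \<rho> x" if "x \<in> E \<union> \<L> n \<union> FF m" for x
        using that s Aut_fix[OF r] EK_subs(1,3) by fastforce
      have "\<sigma> x = \<rho> x" if "x \<in> E \<union> K" for x
        using aut_agree_gen[OF h Aut_fhom[OF r] ELF] ELF that K_in_ELF by blast
      hence "\<sigma> x = \<rho> x" if "x \<in> EK" for x using aut_agree_gen[OF h Aut_fhom[OF r], of "E \<union> K"] that unfolding EK_def by blast
      thus "\<exists>\<sigma>\<in>Dec \<kk> (\<O> \<inter> A). (\<forall>x\<in>EK. \<sigma> x = x) \<and> (\<forall>x\<in>FF m. \<sigma> x = \<rho> x)"
        using s(1,4) Aut_fix[OF r] by (intro bexI[of _ \<sigma>]) auto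
    qed
  qed
  define c where "c = card (Rst (Aut EK) (FF m :: 'a rat_closure set))"
  have mc: "m = f * c" using FF_degree[OF sEK kEK m j(1) FEK] by (simp add: c_def)
  have aEK: "algcl EK" by (rule algcl_mono[OF algcl_ratfun sEK kEK])
  have "c dvd card (Rst (Aut EK) (gen (EK \<union> \<L> n)))" unfolding c_def card_Rst_gen[of EK "FF m", symmetric]
  proof (rule Rst_dvd[OF aEK Gal_lift[OF algcl_ratfun Gal_wild kEK sEK]])
    have "finite (Rst (Aut EK) EK)" by (rule finite_subset[of _ "{restrict id EK}"]) (auto simp: Rst_def restrict_eq_iff Aut_fix)
    thus "finite (Rst (Aut EK) (gen (EK \<union> \<L> n)))" by (rule finite_Rst_comp) (rule finite_Rst_mono[OF finite_Rst_wild Aut_mono[OF kEK]])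
    show "Gal EK (gen (EK \<union> FF m))"
      by (rule Gal_gen[OF aEK]) (use FF_Sep[OF m _ sEK] FFq_le kEK FF_stable[OF Aut_fhom, of _ EK m] gen_incl[of "EK \<union> FF m"] in blast)+
    show "gen (EK \<union> FF m) \<subseteq> gen (EK \<union> \<L> n)" by (rule gen_least[OF subfld_gen]) (use FF_in_EKL gen_incl[of "EK \<union> \<L> n"] in auto)
  qed
  also have "card (Rst (Aut EK) (gen (EK \<union> \<L> n))) = card (Rst (Aut EK) (\<L> n))" by (rule card_Rst_gen)
  also have "\<dots> dvd card (Rst (Aut \<kk>) (\<L> n :: 'a rat_closure set))" by (rule Rst_restrict_dvd[OF algcl_ratfun Gal_wild finite_Rst_wild GEK])
  also have "\<dots> = CARD('a) ^ n" by (rule card_Rst_wild)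
  finally have "c dvd CARD('a) ^ n" .
  moreover obtain r where "CARD('a) = CHAR('a) ^ r" using card_finite_field by blast
  ultimately have "c dvd CHAR('a) ^ (r * n)" by (simp add: power_mult)
  moreover have "prime CHAR('a)" by (rule prime_CHAR_semidom) (rule finite_imp_CHAR_pos, simp)
  ultimately obtain s where s: "c = CHAR('a) ^ s" using divides_primepow_nat by blast
  show ?thesis by (rule that[OF mc[unfolded t(2) s]])
qed

text \<open>The decomposition group has a t restrictions to K and b to F, with a and b the absolute
  ramification indices. Its elements trivial on F induce the whole group of K/F, of order m, so a t
  = b m, and a/b is the ramification index.\<close>

lemma e_inf_K: "m = f_inf K \<kk> * e_inf K F"
proof -
  obtain t where t: "t > 0" "t = f_inf K \<kk>" "\<And>\<O>. inf_place \<O> ==> rcard (\<O> \<inter> K) = CARD('a) ^ t" by (rule residues) (rule that; assumption)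
  note sF = Gal_D(1)[OF GF] and kF = Gal_D(2)[OF GF]
  have FK: "F \<subseteq> K" "F \<subseteq> Y" by (auto simp: F_def)
  have "m = ram_index F (\<O> \<inter> K) * t" if O: "inf_place \<O>" for \<O> :: "'a rat_closure set"
  proof -
    interpret inf_place \<O> by fact
    define D where "D = Dec \<kk> (\<O> \<inter> A)"
    have D: "autgrp D" "D \<subseteq> Aut \<kk>" unfolding D_def using autgrp_Dec Dec_Aut by auto
    obtain piK a where pK: "piK \<in> K" "piK \<noteq> 0" "val piK > 0" "\<And>x. x \<in> K - {0} ==> \<exists>i::int. val x = of_int i * val piK"
      and a: "a > 0" "of_nat a * val piK = 1" by (rule discrete_index[OF sK kK Gal_dimn[OF algcl_ratfun GK fK]]) (rule that; assumption)
    obtain piF b where pF: "piF \<in> F" "piF \<noteq> 0" "val piF > 0" "\<And>x. x \<in> F - {0} ==> \<exists>i::int. val x = of_int i * val piF"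
      and b: "b > 0" "of_nat b * val piF = 1" by (rule discrete_index[OF sF kF Gal_dimn[OF algcl_ratfun GF fF]]) (rule that; assumption)
    obtain i :: int where i: "val piF = of_int i * val piK" using pK(4)[of piF] pF(1,2) FK by blast
    have "i > 0" using i pF(3) pK(3) by (simp add: zero_less_mult_iff)
    hence e: "val piF = of_nat (nat i) * val piK" using i by simp
    have "real a * val piK = real (b * nat i) * val piK" using a(2) b(2)[unfolded e] by (simp only: of_nat_mult mult.assoc)
    hence ab: "a = b * nat i" using pK(3) by (simp only: mult_cancel_right of_nat_eq_iff) simp
    obtain E \<gamma> where \<gamma>: "\<gamma> \<in> A" "\<gamma> \<noteq> 0" "of_nat E * val \<gamma> = 1" "card (Rst (Dec \<kk> (\<O> \<inter> A)) A) = E * m"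
      using decomposition(3)[OF N m, of n] by blast
    note c = card_Rst_Dec[OF GA fA m subs(4) \<gamma>]
    have cK: "card (Rst D K) = a * t" unfolding D_def
      by (rule c[OF GK subs(5) residue_FF[OF O GK subs(5) t(3)[OF O]] pK a(2)])
    have cF: "card (Rst D F) = b * 1" unfolding D_def
    proof (rule c[OF GF _ _ _ _ _ pF b(2)])
      show "F \<subseteq> A" using FK(1) subs(5) by blast
      show "FF 1 \<subseteq> (FF m :: 'a rat_closure set)" unfolding FF_1 by (rule FFq_FF)
      show "\<exists>x\<in>FF 1. y - x \<in> mx \<O>" if "y \<in> \<O> \<inter> F" for y using ncyc_residue[OF N, of y n] that FK(2) unfolding FF_1 by blast
      show "\<exists>y\<in>\<O> \<inter> F. y - x \<in> mx \<O>" if "x \<in> FF 1" for x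
        using that FFq_O FFq_le kF m_0 unfolding FF_1 by (intro bexI[of _ x]) auto
    qed simp
    define DF where "DF = {\<sigma> \<in> D. \<forall>x\<in>F. \<sigma> x = x}"
    have "Rst (Aut Y) K \<subseteq> Rst DF K"
    proof
      fix \<rho> assume "\<rho> \<in> Rst (Aut Y) K"
      then obtain \<sigma> where s: "\<sigma> \<in> Aut Y" "\<rho> = restrict \<sigma> K" by (auto simp: Rst_def)
      have sk: "\<sigma> \<in> Aut \<kk>" using s(1) Aut_mono[OF kY] by blast
      \<comment> \<open>\<open>\<sigma>\<close> is trivial on Y, so this element of the
        decomposition group agrees with it on all generators of A and thus on K.\<close>
      obtain \<tau> where h: "\<tau> \<in> Dec \<kk> (\<O> \<inter> A)" "\<And>x. x \<in> cyc N ==> \<tau> x = x" "\<And>x. x \<in> \<L> n ==> \<tau> x = \<sigma> x" "\<And>x. x \<in> FF m ==> \<tau> x = \<sigma> x"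
        using decomposition(1)[OF N m sk sk, where n = n] by blast
      have g: "\<sigma> x = \<tau> x" if "x \<in> \<L> n \<union> cyc N \<union> FF m" for x using that h Aut_fix[OF s(1)] subs(2) by fastforce
      have K: "\<forall>x\<in>K. \<sigma> x = \<tau> x"
        using aut_agree_gen[OF Aut_fhom[OF s(1)] Aut_fhom[OF Dec_Aut[OF h(1)]] g] subs(5) unfolding A_gen by blast
      hence "\<tau> \<in> DF" using h(1) FK Aut_fix[OF s(1)] unfolding DF_def D_def by fastforce
      moreover have "\<rho> = restrict \<tau> K" unfolding s(2) restrict_eq_iff by (rule K)
      ultimately show "\<rho> \<in> Rst DF K" by (simp add: Rst_def)
    qed
    moreover have "Rst DF K \<subseteq> Rst (Aut F) K" unfolding Rst_def DF_def D_def Dec_def Aut_def by blast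
    moreover have fFK: "finite (Rst (Aut F) K)" by (rule finite_Rst_mono[OF fK Aut_mono[OF kF]])
    moreover have "card (Rst (Aut F) K) = m"
      using dimn_unique[OF sF Gal_dimn[OF algcl_mono[OF algcl_ratfun sF kF] Gal_top[OF GK kF FK(1)] fFK]] dimn_K by simp
    ultimately have "card (Rst DF K) = m" using card_K card_mono[of "Rst (Aut F) K" "Rst DF K"] card_mono[of "Rst DF K" "Rst (Aut Y) K"] finite_subset by fastforce
    hence "a * t = b * m"
      using card_Rst_tower[OF D(1) FK(1) finite_Rst_mono[OF fK D(2)]] cK cF unfolding DF_def by simp
    hence "m = nat i * t" using b(1) unfolding ab by simp
    moreover have "ram_index F (\<O> \<inter> K) = nat i"
      by (rule ram_index_O[OF place_axioms sK FK(1) sF kF pK pF e])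
    ultimately show ?thesis by simp
  qed
  hence r: "ram_index F V * t = m" if "inf_prime K V" for V
    using that inf_prime_iff_place[OF sK kK, of V] by (auto simp: mult.commute)
  obtain \<O> :: "'a rat_closure set" where "inf_place \<O>" using inf_place_exists by blast
  hence V: "inf_prime K (\<O> \<inter> K)" using inf_prime_iff_place[OF sK kK] by blast
  have "ram_index F V = ram_index F (\<O> \<inter> K)" if "inf_prime K V" for V
    using trans[OF r[OF that] r[OF V, symmetric]] t(1) by simp
  hence e: "e_inf K F = ram_index F (\<O> \<inter> K)" unfolding e_inf_def using V by - (rule the_equality, blast+)
  show ?thesis unfolding t(2)[symmetric] e by (rule trans[OF r[OF V, symmetric] mult.commute])
qed

end

theorem theorem3p1:
  fixes K M E F :: "'a::{finite,field} rat_closure set"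
    and N :: "'a poly" and n m t d :: nat
  assumes K: "finite_abelian_ext K \<kk>"
    and N: "N \<noteq> 0"
    and m: "min_const_degree K n N m"
    and t: "t = f_inf K \<kk>"
    and M: "M = \<L> n \<squnion>\<^sub>F const_ext \<kk> m"
    and E: "E = (K \<squnion>\<^sub>F M) \<inter> cyc N"
    and F: "F = K \<inter> ncyc n N"
    and d: "d = f_inf (E \<squnion>\<^sub>F K) K"
  shows "(\<forall>n' N' m'. N' \<noteq> 0 \<and> min_const_degree K n' N' m' \<longrightarrow> m' = m) \<and>
    d = f_inf (genus_field E \<squnion>\<^sub>F K) (genus_field K) \<and>
    ncyc n N \<squnion>\<^sub>F K = const_ext (ncyc n N) m \<and>
    (\<exists>s::nat.
      m = ext_degree K F \<and>
      m = t * e_inf K F \<and>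
      m = t * d * CHAR('a) ^ s \<and>
      m = f_inf (E \<squnion>\<^sub>F K) \<kk> * CHAR('a) ^ s \<and>
      e_inf K F = d * CHAR('a) ^ s \<and>
      e_inf K F = f_inf (const_ext K m) K)"
proof -
  interpret min_const K N n m by unfold_locales fact+
  have uniq: "m' = m" if "N' \<noteq> 0" "min_const_degree K n' N' m'" for n' N' m'
  proof -
    interpret c: min_const K N' n' m' by unfold_locales (use K that in auto)
    show ?thesis using m_le[OF that] c.m_le[OF N min] by simp
  qed
  \<comment> \<open>The two composites differ only by k, which \<open>\<L> n\<close> already
    contains.\<close>
  have M': "M = min_const.M n m"
    unfolding M min_const.M_def[OF min_const_axioms] composite_gen const_ext_gen gen_Un_gen' 
    using Gal_D(2)[OF Gal_wild[of n, where 'a = 'a]] by (simp add: Un_absorb2 flip: Un_assoc)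
  have E': "E = min_const.E K N n m" unfolding E M' E_def composite_gen ..
  have F': "F = min_const.F K N n" unfolding F F_def ..
  have EK': "E \<squnion>\<^sub>F K = EK" unfolding E' EK_def composite_gen ..
  obtain s where s: "m = f_inf EK \<kk> * CHAR('a) ^ s" by (rule p_power)
  obtain f where f: "t > 0" "f = f_inf EK \<kk>" "f = t * d" "m = t * f_inf (gen (K \<union> FF m)) K"
    unfolding t d EK' by (rule residues) blast
  have e: "m = t * e_inf K F" using e_inf_K unfolding t F' .
  have td: "m = t * d * CHAR('a) ^ s" using s unfolding f(2,3)[symmetric] .
  have "t * e_inf K F = t * (d * CHAR('a) ^ s)" using trans[OF e[symmetric] td] by (simp add: mult.assoc)
  hence ed: "e_inf K F = d * CHAR('a) ^ s" using f(1) by simp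
  have "t * e_inf K F = t * f_inf (gen (K \<union> FF m)) K" by (rule trans[OF e[symmetric] f(4)])
  hence ef: "e_inf K F = f_inf (const_ext K m) K" unfolding const_ext_gen using f(1) by simp
  have g: "d = f_inf (genus_field E \<squnion>\<^sub>F K) (genus_field K)"
    unfolding d EK' unfolding E' composite_gen by (rule f_inf_genus[symmetric])
  have y: "ncyc n N \<squnion>\<^sub>F K = const_ext (ncyc n N) m" unfolding composite_gen by (rule YK)
  have "m = ext_degree K F" unfolding F' by (rule degree_K[symmetric])
  thus ?thesis using uniq g y e td s[folded EK'] ed ef by blast
qed

end
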